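(* Let $\chi$ be a bi-homomorphism on $\Pi$, write $q_{ij}=\chi(\alpha_i,\alpha_j)$, and let $\Lambda\in\mathrm{Ch}(U^0(\chi))$. For $i\in I$ say that $\Lambda\in\mathbb{S}_i(\chi)$ if $\Lambda(K_{\alpha_i}L_{-\alpha_i})=q_{ii}^{r}$ for some integer $r\ge0$. (1) (Type $A(m-1,N-m)$.) Assume $N\ge2$ and $m\in I$, and that there is $\hat q\in\mathbb{K}^\times_\infty$ such that $q_{ii}=\hat q^{2}$ for $i<m$, $q_{mm}=-1$, $q_{ii}=\hat q^{-2}$ for $i>m$; $q_{i,i+1}q_{i+1,i}=\hat q^{-2}$ if $i+1\le m$ and $q_{i,i+1}q_{i+1,i}=\hat q^{2}$ if $i+1>m$ (for $1\le i\le N-1$); and $q_{ij}q_{ji}=1$ if $|i-j|\ge2$. Then $\dim\mathcal{L}_\chi(\Lambda)<\infty$ if and only if $\Lambda\in\mathbb{S}_i(\chi)$ for all $i\in I\setminus\{m\}$. (2) (Type $C(N)$.) Assume $N\ge3$ and that there is $\hat q\in\mathbb{K}^\times_\infty$ such that $q_{11}=-1$, $q_{ii}=\hat q^2$ for $2\le i\le N-1$, $q_{NN}=\hat q^4$; $q_{i,i+1}q_{i+1,i}=\hat q^{-2}$ for $1\le i\le N-2$, $q_{N-1,N}q_{N,N-1}=\hat q^{-4}$; and $q_{ij}q_{ji}=1$ if $|i-j|\ge2$. Then $\dim\mathcal{L}_\chi(\Lambda)<\infty$ if and only if $\Lambda\in\mathbb{S}_i(\chi)$ for all $i\in I\setm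inus\{1\}$.
   Context: $\mathbb{K}$ is a field of characteristic $0$, $\mathbb{K}^\times=\mathbb{K}\setminus\{0\}$, and $\mathbb{K}^\times_\infty$ is the set of elements of $\mathbb{K}^\times$ that are not roots of unity. $N\ge1$ is an integer, $I=\{1,\dots,N\}$, $\Pi=\{\alpha_i\mid i\in I\}$, $\mathbb{Z}\Pi=\bigoplus_{i\in I}\mathbb{Z}\alpha_i$ (free $\mathbb{Z}$-module), $\mathbb{Z}_{\ge0}\Pi=\bigoplus_{i\in I}\mathbb{Z}_{\ge0}\alpha_i$. A bi-homomorphism on $\Pi$ is a map $\chi:\mathbb{Z}\Pi\times\mathbb{Z}\Pi\to\mathbb{K}^\times$ with $\chi(\alpha,\beta+\gamma)=\chi(\alpha,\beta)\chi(\alpha,\gamma)$ and $\chi(\alpha+\beta,\gamma)=\chi(\alpha,\gamma)\chi(\beta,\gamma)$. Generalized quantum group $U(\chi)$: $\tilde U=\tilde U(\chi)$ is the unital associative $\mathbb{K}$-algebra with generators $\tilde K_\alpha,\tilde L_\alpha$ ($\alpha\in\mathbb{Z}\Pi$), $\tilde E_i,\tilde F_i$ ($i\in I$) and relations $\tilde K_0=\tilde L_0=1$, $\tilde K_\alpha\tilde K_\beta=\tilde K_{\alpha+\beta}$, $\tilde L_\alpha\tilde L_\beta=\tilde L_{\alpha+\beta}$, $\tilde K_\alpha\tilde L_\beta=\tilde L_\beta\tilde K_\alpha$, $\tilde K_\alpha\tilde E_i=\chi(\alpha,\alpha_i)\tilde E_i\tilde K_\alpha$, $\tilde L_\alpha\tilde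 E_i=\chi(-\alpha_i,\alpha)\tilde E_i\tilde L_\alpha$, $\tilde K_\alpha\tilde F_i=\chi(\alpha,-\alpha_i)\tilde F_i\tilde K_\alpha$, $\tilde L_\alpha\tilde F_i=\chi(\alpha_i,\alpha)\tilde F_i\tilde L_\alpha$, $\tilde E_i\tilde F_j-\tilde F_j\tilde E_i=\delta_{ij}(-\tilde K_{\alpha_i}+\tilde L_{\alpha_i})$. It is $\mathbb{Z}\Pi$-graded with $\tilde K_\alpha,\tilde L_\alpha$ in degree $0$, $\tilde E_i$ in degree $\alpha_i$, $\tilde F_i$ in degree $-\alpha_i$. $\tilde U^0,\tilde U^+,\tilde U^-$ are the unital subalgebras generated by the $\tilde K_\alpha,\tilde L_\alpha$, by the $\tilde E_i$, and by the $\tilde F_i$. Define subspaces $\tilde{\mathcal I}^-_{-\alpha}\subseteq\tilde U^-_{-\alpha}$ ($\alpha\in\mathbb{Z}_{\ge0}\Pi$) inductively: $\tilde{\mathcal I}^-_0=0$ and, for $\alpha\ne0$, $\tilde{\mathcal I}^-_{-\alpha}$ is the set of $Y\in\tilde U^-_{-\alpha}$ with $[\tilde E_i,Y]\in\tilde{\mathcal I}^-_{-\alpha+\alpha_i}\tilde K_{\alpha_i}+\tilde{\mathcal I}^-_{-\alpha+\alpha_i}\tilde L_{\alpha_i}$ for all $i$ with $\alpha-\alpha_i\in\mathbb{Z}_{\ge0}\Pi$. Put $\tilde{\mathcal I}^-=\bigoplus_\alpha\tilde{\mathcal I}^-_{-\alpha}$ and $\tilde{\mathcal J}^-=\mathrm{Span}_{\mathbb{K}}(\tilde{\mathcal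 I}^-\tilde U^0\tilde U^+)$ (an ideal). Let $\tilde\Omega$ be the algebra automorphism of $\tilde U$ with $\tilde K_\alpha\mapsto\tilde K_{-\alpha}$, $\tilde L_\alpha\mapsto\tilde L_{-\alpha}$, $\tilde E_i\mapsto\tilde F_i\tilde L_{-\alpha_i}$, $\tilde F_i\mapsto\tilde K_{-\alpha_i}\tilde E_i$. Then $U(\chi)=\tilde U/(\tilde{\mathcal J}^-+\tilde\Omega(\tilde{\mathcal J}^-))$. Images of generators are written $K_\alpha,L_\alpha,E_i,F_i$; $U^0(\chi),U^\pm(\chi)$ are the images of $\tilde U^0,\tilde U^\pm$. Multiplication $U^-\otimes U^0\otimes U^+\to U$ is a linear isomorphism and the $K_\alpha L_\beta$ form a basis of $U^0$. Highest weight modules: $\mathrm{Ch}(U^0(\chi))$ is the set of unital $\mathbb{K}$-algebra homomorphisms $U^0(\chi)\to\mathbb{K}$. For $\Lambda\in\mathrm{Ch}(U^0(\chi))$, $\mathcal{M}_\chi(\Lambda)$ is the Verma module: generated by $\tilde v_\Lambda\neq0$ with $Z\tilde v_\Lambda=\Lambda(Z)\tilde v_\Lambda$ ($Z\in U^0$), $E_i\tilde v_\Lambda=0$ ($i\in I$), and $U^-\to\mathcal{M}_\chi(\Lambda)$, $Y\mapsto Y\tilde v_\Lambda$ bijective; it is graded by $\mathcal{M}_\chi(\Lambda)_\alpha=U^-_\alpha\tilde v_\Lambda$. $\mathcal{L}_\chi(\Lambda)$ is the quotient of $\mathcal{M}_\chi(\Lambda)$ by its maximal proper $\mathbb{Z}\Pi$-graded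 submodule. *)

theory Defs
  imports
    "HOL-Library.Poly_Mapping"
    "HOL-Algebra.QuotRing"
    "HOL-Algebra.Subrings"
    "HOL-Algebra.Module"
    "HOL-Algebra.Free_Abelian_Groups"
    "HOL-Algebra.Algebraic_Closure_Type"
begin

section \<open>Algebras and modules as records\<close>

text \<open>
  A \<open>\<bbbK>\<close>-algebra, as well as a left module over a not necessarily commutative ring, is an element
  of the record type \<^typ>\<open>('c, 'a) module\<close>.  In the case of a module the fields \<open>mult\<close> and \<open>one\<close>
  carry no meaning.  The locale \<^locale>\<open>submodule\<close> only asks for an additive subgroup
  that is closed under the action, so it applies to left modules and in particular to left ideals.
  The field \<open>\<bbbK>\<close> is the type \<open>'k\<close>, turned into a record by \<^const>\<open>ring_of_type_algebra\<close>.
\<close>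

definition quot :: "('c, 'a) module \<Rightarrow> 'a set \<Rightarrow> ('c, 'a set) module" where
  "quot M N =
     \<lparr>carrier = a_rcosets\<^bsub>M\<^esub> N, monoid.mult = rcoset_mult M N, one = N +>\<^bsub>M\<^esub> \<one>\<^bsub>M\<^esub>,
      zero = N, add = set_add M, module.smult = (\<lambda>c C. \<Union>x\<in>C. N +>\<^bsub>M\<^esub> (c \<odot>\<^bsub>M\<^esub> x))\<rparr>"

definition lin_span :: "('k::field, 'a) module \<Rightarrow> 'a set \<Rightarrow> 'a set" where
  "lin_span V S = \<Inter>{W. submodule W (ring_of_type_algebra :: 'k ring) V \<and> S \<subseteq> W}"

definition fin_dim :: "('k::field, 'a) module \<Rightarrow> bool" where
  "fin_dim V \<longleftrightarrow> (\<exists>B. finite B \<and> B \<subseteq> carrier V \<and> lin_span V B = carrier V)"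

definition subalg_gen :: "('k::field, 'a) module \<Rightarrow> 'a set \<Rightarrow> 'a set" where
  "subalg_gen A S =
     \<Inter>{B. subring B A \<and> submodule B (ring_of_type_algebra :: 'k ring) A \<and> S \<subseteq> B}"

definition regular_module :: "('k, 'a) module \<Rightarrow> ('a, 'a) module" where
  "regular_module A =
     \<lparr>carrier = carrier A, monoid.mult = monoid.mult A, one = one A, zero = zero A, add = add A,
      module.smult = monoid.mult A\<rparr>"

definition left_ideal_gen :: "('k, 'a) module \<Rightarrow> 'a set \<Rightarrow> 'a set" where
  "left_ideal_gen A S = \<Inter>{H. submodule H A (regular_module A) \<and> S \<subseteq> H}"

text \<open>A module over the \<open>\<bbbK>\<close>-algebra \<open>A\<close> as a vector space over \<open>\<bbbK>\<close>.\<close>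

definition scalars :: "('k, 'a) module \<Rightarrow> ('a, 'm) module \<Rightarrow> ('k, 'm) module" where
  "scalars A M =
     \<lparr>carrier = carrier M, monoid.mult = monoid.mult M, one = one M, zero = zero M, add = add M,
      module.smult = (\<lambda>c x. (c \<odot>\<^bsub>A\<^esub> \<one>\<^bsub>A\<^esub>) \<odot>\<^bsub>M\<^esub> x)\<rparr>"


section \<open>Free algebras\<close>

text \<open>
  With concatenation of words as addition on lists, the multiplication of
  \<^typ>\<open>'g list \<Rightarrow>\<^sub>0 'k\<close> is the one of the free algebra on \<open>'g\<close>.
\<close>

instantiation list :: (type) monoid_add
begin
definition zero_list :: "'a list" where "zero_list = []"
definition plus_list :: "'a list \<Rightarrow> 'a list \<Rightarrow> 'a list" where "plus_list = (@)"
instance by standard (simp_all add: zero_list_def plus_list_def)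
end

abbreviation fconst :: "'k::zero \<Rightarrow> 'g list \<Rightarrow>\<^sub>0 'k" where
  "fconst c \<equiv> Poly_Mapping.single [] c"

abbreviation letter :: "'g \<Rightarrow> 'g list \<Rightarrow>\<^sub>0 'k::zero_neq_one" where
  "letter g \<equiv> Poly_Mapping.single [g] 1"

definition free_algebra :: "'g set \<Rightarrow> ('k::field, 'g list \<Rightarrow>\<^sub>0 'k) module" where
  "free_algebra G =
     \<lparr>carrier = {p. Poly_Mapping.keys p \<subseteq> lists G}, monoid.mult = (*), one = 1, zero = 0, add = (+),
      module.smult = (\<lambda>c p. fconst c * p)\<rparr>"

lemma ring_free_algebra: "ring (free_algebra G :: ('k::field, 'g list \<Rightarrow>\<^sub>0 'k) module)"
proof (intro ringI abelian_groupI monoidI)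
  fix x :: "'g list \<Rightarrow>\<^sub>0 'k" assume x: "x \<in> carrier (free_algebra G)"
  show "\<exists>y\<in>carrier (free_algebra G). y \<oplus>\<^bsub>free_algebra G\<^esub> x = \<zero>\<^bsub>free_algebra G\<^esub>"
    by (rule bexI[of _ "- x"]) (use x in \<open>auto simp: free_algebra_def\<close>)
next
  fix x y :: "'g list \<Rightarrow>\<^sub>0 'k"
  assume "x \<in> carrier (free_algebra G)" "y \<in> carrier (free_algebra G)"
  then show "x \<oplus>\<^bsub>free_algebra G\<^esub> y \<in> carrier (free_algebra G)"
    using keys_add[of x y] by (auto simp: free_algebra_def)
next
  fix x y :: "'g list \<Rightarrow>\<^sub>0 'k"
  assume "x \<in> carrier (free_algebra G)" "y \<in> carrier (free_algebra G)"
  then show "x \<otimes>\<^bsub>free_algebra G\<^esub> y \<in> carrier (free_algebra G)"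
    using keys_mult[of x y] by (fastforce simp: free_algebra_def plus_list_def)
qed (auto simp: free_algebra_def algebra_simps zero_list_def)

definition free_subst :: "('g \<Rightarrow> ('h list \<Rightarrow>\<^sub>0 'k)) \<Rightarrow> ('g list \<Rightarrow>\<^sub>0 'k) \<Rightarrow> ('h list \<Rightarrow>\<^sub>0 'k::field)" where
  "free_subst h p =
     (\<Sum>w\<in>Poly_Mapping.keys p. fconst (Poly_Mapping.lookup p w) * prod_list (map h w))"


section \<open>Lattice and bi-homomorphisms\<close>

text \<open>\<open>\<int>\<Pi>\<close> is the free abelian group on \<open>I = {1..N}\<close>, with \<open>\<alpha>\<^sub>i = frag_of i\<close>.\<close>

type_synonym lattice = "nat \<Rightarrow>\<^sub>0 int"

abbreviation ZPi :: "nat \<Rightarrow> lattice set" where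
  "ZPi N \<equiv> carrier (free_Abelian_group {1..N})"

definition ZPi_pos :: "nat \<Rightarrow> lattice set" where
  "ZPi_pos N = {\<alpha> \<in> ZPi N. \<forall>i. 0 \<le> Poly_Mapping.lookup \<alpha> i}"

definition bihom :: "nat \<Rightarrow> (lattice \<Rightarrow> lattice \<Rightarrow> 'k::field) \<Rightarrow> bool" where
  "bihom N \<chi> \<longleftrightarrow>
     (\<forall>\<alpha>\<in>ZPi N. \<forall>\<beta>\<in>ZPi N. \<chi> \<alpha> \<beta> \<noteq> 0) \<and>
     (\<forall>\<alpha>\<in>ZPi N. \<forall>\<beta>\<in>ZPi N. \<forall>\<gamma>\<in>ZPi N.
        \<chi> \<alpha> (\<beta> + \<gamma>) = \<chi> \<alpha> \<beta> * \<chi> \<alpha> \<gamma> \<and> \<chi> (\<alpha> + \<beta>) \<gamma> = \<chi> \<alpha> \<gamma> * \<chi> \<beta> \<gamma>)"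

definition not_root_of_unity :: "'k::field \<Rightarrow> bool" where
  "not_root_of_unity q \<longleftrightarrow> q \<noteq> 0 \<and> (\<forall>n::nat. n \<ge> 1 \<longrightarrow> q ^ n \<noteq> 1)"


section \<open>The algebra before taking the quotient\<close>

datatype gen = GK lattice | GL lattice | GE nat | GF nat

abbreviation kk :: "lattice \<Rightarrow> gen list \<Rightarrow>\<^sub>0 'k::field" where "kk \<alpha> \<equiv> letter (GK \<alpha>)"
abbreviation ll :: "lattice \<Rightarrow> gen list \<Rightarrow>\<^sub>0 'k::field" where "ll \<alpha> \<equiv> letter (GL \<alpha>)"
abbreviation ee :: "nat \<Rightarrow> gen list \<Rightarrow>\<^sub>0 'k::field" where "ee i \<equiv> letter (GE i)"
abbreviation ff :: "nat \<Rightarrow> gen list \<Rightarrow>\<^sub>0 'k::field" where "ff i \<equiv> letter (GF i)"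

definition gens :: "nat \<Rightarrow> gen set" where
  "gens N = GK ` ZPi N \<union> GL ` ZPi N \<union> GE ` {1..N} \<union> GF ` {1..N}"

primrec gen_deg :: "gen \<Rightarrow> lattice" where
  "gen_deg (GK \<alpha>) = 0"
| "gen_deg (GL \<alpha>) = 0"
| "gen_deg (GE i) = frag_of i"
| "gen_deg (GF i) = - frag_of i"

primrec Omega_gen :: "gen \<Rightarrow> gen list \<Rightarrow>\<^sub>0 'k::field" where
  "Omega_gen (GK \<alpha>) = kk (- \<alpha>)"
| "Omega_gen (GL \<alpha>) = ll (- \<alpha>)"
| "Omega_gen (GE i) = ff i * ll (- frag_of i)"
| "Omega_gen (GF i) = kk (- frag_of i) * ee i"

text \<open>A suffix \<open>t\<close> marks the objects that the paper decorates with a tilde.\<close>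

context
  fixes N :: nat and \<chi> :: "lattice \<Rightarrow> lattice \<Rightarrow> 'k::field_char_0"
begin

abbreviation FA :: "('k, gen list \<Rightarrow>\<^sub>0 'k) module" where
  "FA \<equiv> free_algebra (gens N)"

text \<open>Each defining relation \<open>x = y\<close> is listed as \<open>x - y\<close>.\<close>

definition relators :: "(gen list \<Rightarrow>\<^sub>0 'k) set" where
  "relators =
     {kk 0 - 1, ll 0 - 1}
     \<union> {kk \<alpha> * kk \<beta> - kk (\<alpha> + \<beta>) | \<alpha> \<beta>. \<alpha> \<in> ZPi N \<and> \<beta> \<in> ZPi N}
     \<union> {ll \<alpha> * ll \<beta> - ll (\<alpha> + \<beta>) | \<alpha> \<beta>. \<alpha> \<in> ZPi N \<and> \<beta> \<in> ZPi N}
     \<union> {kk \<alpha> * ll \<beta> - ll \<beta> * kk \<alpha> | \<alpha> \<beta>. \<alpha> \<in> ZPi N \<and> \<beta> \<in> ZPi N}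
     \<union> {kk \<alpha> * ee i - fconst (\<chi> \<alpha> (frag_of i)) * ee i * kk \<alpha> | \<alpha> i. \<alpha> \<in> ZPi N \<and> i \<in> {1..N}}
     \<union> {ll \<alpha> * ee i - fconst (\<chi> (- frag_of i) \<alpha>) * ee i * ll \<alpha> | \<alpha> i. \<alpha> \<in> ZPi N \<and> i \<in> {1..N}}
     \<union> {kk \<alpha> * ff i - fconst (\<chi> \<alpha> (- frag_of i)) * ff i * kk \<alpha> | \<alpha> i. \<alpha> \<in> ZPi N \<and> i \<in> {1..N}}
     \<union> {ll \<alpha> * ff i - fconst (\<chi> (frag_of i) \<alpha>) * ff i * ll \<alpha> | \<alpha> i. \<alpha> \<in> ZPi N \<and> i \<in> {1..N}}
     \<union> {ee i * ff j - ff j * ee i - (if i = j then - kk (frag_of i) + ll (frag_of i) else 0)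
          | i j. i \<in> {1..N} \<and> j \<in> {1..N}}"

definition rel_ideal :: "(gen list \<Rightarrow>\<^sub>0 'k) set" where
  "rel_ideal = Idl\<^bsub>FA\<^esub> relators"

definition Ut :: "('k, (gen list \<Rightarrow>\<^sub>0 'k) set) module" where
  "Ut = quot FA rel_ideal"

definition projt :: "(gen list \<Rightarrow>\<^sub>0 'k) \<Rightarrow> (gen list \<Rightarrow>\<^sub>0 'k) set" where
  "projt p = rel_ideal +>\<^bsub>FA\<^esub> p"

definition Ut_deg :: "lattice \<Rightarrow> (gen list \<Rightarrow>\<^sub>0 'k) set set" where
  "Ut_deg \<beta> =
     projt ` {p \<in> carrier FA. \<forall>w\<in>Poly_Mapping.keys p. sum_list (map gen_deg w) = \<beta>}"

definition Ut_zero :: "(gen list \<Rightarrow>\<^sub>0 'k) set set" where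
  "Ut_zero = subalg_gen Ut ((\<lambda>\<alpha>. projt (kk \<alpha>)) ` ZPi N \<union> (\<lambda>\<alpha>. projt (ll \<alpha>)) ` ZPi N)"

definition Ut_plus :: "(gen list \<Rightarrow>\<^sub>0 'k) set set" where
  "Ut_plus = subalg_gen Ut ((\<lambda>i. projt (ee i)) ` {1..N})"

definition Ut_minus :: "(gen list \<Rightarrow>\<^sub>0 'k) set set" where
  "Ut_minus = subalg_gen Ut ((\<lambda>i. projt (ff i)) ` {1..N})"

text \<open>
  \<open>It \<alpha> Y\<close> means that \<open>Y\<close> lies in the subspace indexed by \<open>-\<alpha>\<close>.  Membership in degree \<open>-\<alpha>\<close> only
  refers to the indices \<open>\<alpha> - \<alpha>\<^sub>i\<close>, which have smaller height, so that the least fixed point is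
  the family given by recursion on the height of \<open>\<alpha>\<close>.
\<close>

inductive It :: "lattice \<Rightarrow> (gen list \<Rightarrow>\<^sub>0 'k) set \<Rightarrow> bool" where
  zero: "It 0 \<zero>\<^bsub>Ut\<^esub>"
| step: "It \<alpha> Y"
    if "\<alpha> \<in> ZPi_pos N" "\<alpha> \<noteq> 0" "Y \<in> Ut_minus \<inter> Ut_deg (- \<alpha>)"
      "\<forall>i\<in>{1..N}. \<alpha> - frag_of i \<in> ZPi_pos N \<longrightarrow>
         (\<exists>A B. It (\<alpha> - frag_of i) A \<and> It (\<alpha> - frag_of i) B \<and>
            projt (ee i) \<otimes>\<^bsub>Ut\<^esub> Y \<ominus>\<^bsub>Ut\<^esub> Y \<otimes>\<^bsub>Ut\<^esub> projt (ee i) =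
            A \<otimes>\<^bsub>Ut\<^esub> projt (kk (frag_of i)) \<oplus>\<^bsub>Ut\<^esub> B \<otimes>\<^bsub>Ut\<^esub> projt (ll (frag_of i)))"

definition It_minus :: "(gen list \<Rightarrow>\<^sub>0 'k) set set" where
  "It_minus = lin_span Ut {Y. \<exists>\<alpha>\<in>ZPi_pos N. It \<alpha> Y}"

definition Jt_minus :: "(gen list \<Rightarrow>\<^sub>0 'k) set set" where
  "Jt_minus = lin_span Ut
     {Y \<otimes>\<^bsub>Ut\<^esub> Z \<otimes>\<^bsub>Ut\<^esub> W | Y Z W. Y \<in> It_minus \<and> Z \<in> Ut_zero \<and> W \<in> Ut_plus}"

text \<open>
  \<open>free_subst Omega_gen\<close> maps the ideal of relations to itself; \<open>Omegat\<close> is the induced map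
  on cosets.
\<close>

definition Omegat :: "(gen list \<Rightarrow>\<^sub>0 'k) set \<Rightarrow> (gen list \<Rightarrow>\<^sub>0 'k) set" where
  "Omegat C = (\<Union>p\<in>C. projt (free_subst Omega_gen p))"


section \<open>The generalized quantum group\<close>

definition U_ideal :: "(gen list \<Rightarrow>\<^sub>0 'k) set set" where
  "U_ideal = Jt_minus <+>\<^bsub>Ut\<^esub> Omegat ` Jt_minus"

definition Uq :: "('k, (gen list \<Rightarrow>\<^sub>0 'k) set set) module" where
  "Uq = quot Ut U_ideal"

definition proj :: "(gen list \<Rightarrow>\<^sub>0 'k) set \<Rightarrow> (gen list \<Rightarrow>\<^sub>0 'k) set set" where
  "proj C = U_ideal +>\<^bsub>Ut\<^esub> C"

definition Kgen :: "lattice \<Rightarrow> (gen list \<Rightarrow>\<^sub>0 'k) set set" where "Kgen \<alpha> = proj (projt (kk \<alpha>))"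
definition Lgen :: "lattice \<Rightarrow> (gen list \<Rightarrow>\<^sub>0 'k) set set" where "Lgen \<alpha> = proj (projt (ll \<alpha>))"
definition Egen :: "nat \<Rightarrow> (gen list \<Rightarrow>\<^sub>0 'k) set set" where "Egen i = proj (projt (ee i))"

definition U_zero :: "(gen list \<Rightarrow>\<^sub>0 'k) set set set" where "U_zero = proj ` Ut_zero"
definition U_minus :: "(gen list \<Rightarrow>\<^sub>0 'k) set set set" where "U_minus = proj ` Ut_minus"

definition U_deg :: "lattice \<Rightarrow> (gen list \<Rightarrow>\<^sub>0 'k) set set set" where
  "U_deg \<beta> = proj ` Ut_deg \<beta>"

text \<open>
  \<open>Ch(U\<^sup>0)\<close>.  Functions are not required to be extensional: the values outside of \<open>U\<^sup>0\<close>
  are irrelevant.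
\<close>

definition characters :: "((gen list \<Rightarrow>\<^sub>0 'k) set set \<Rightarrow> 'k) set" where
  "characters = {\<Lambda>. \<Lambda> \<one>\<^bsub>Uq\<^esub> = 1 \<and>
     (\<forall>x\<in>U_zero. \<forall>y\<in>U_zero. \<Lambda> (x \<otimes>\<^bsub>Uq\<^esub> y) = \<Lambda> x * \<Lambda> y \<and> \<Lambda> (x \<oplus>\<^bsub>Uq\<^esub> y) = \<Lambda> x + \<Lambda> y) \<and>
     (\<forall>c. \<forall>x\<in>U_zero. \<Lambda> (c \<odot>\<^bsub>Uq\<^esub> x) = c * \<Lambda> x)}"


section \<open>Highest weight modules\<close>

context
  fixes \<Lambda> :: "(gen list \<Rightarrow>\<^sub>0 'k) set set \<Rightarrow> 'k"
begin

definition verma_ideal :: "(gen list \<Rightarrow>\<^sub>0 'k) set set set" where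
  "verma_ideal =
     left_ideal_gen Uq ({Z \<ominus>\<^bsub>Uq\<^esub> (\<Lambda> Z \<odot>\<^bsub>Uq\<^esub> \<one>\<^bsub>Uq\<^esub>) | Z. Z \<in> U_zero} \<union> Egen ` {1..N})"

text \<open>
  The Verma module is presented by its generator \<open>v\<close> and the relations \<open>Z v = \<Lambda>(Z) v\<close>,
  \<open>E\<^sub>i v = 0\<close>.  By the triangular decomposition of \<open>U\<close> the map \<open>Y \<mapsto> Y v\<close> from \<open>U\<^sup>-\<close> is bijective.
\<close>

definition verma :: "((gen list \<Rightarrow>\<^sub>0 'k) set set, (gen list \<Rightarrow>\<^sub>0 'k) set set set) module" where
  "verma = quot (regular_module Uq) verma_ideal"

definition verma_vec :: "(gen list \<Rightarrow>\<^sub>0 'k) set set set" where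
  "verma_vec = verma_ideal +>\<^bsub>regular_module Uq\<^esub> \<one>\<^bsub>Uq\<^esub>"

definition verma_deg :: "lattice \<Rightarrow> (gen list \<Rightarrow>\<^sub>0 'k) set set set set" where
  "verma_deg \<alpha> = (\<lambda>Y. Y \<odot>\<^bsub>verma\<^esub> verma_vec) ` (U_minus \<inter> U_deg \<alpha>)"

definition graded_submodule :: "(gen list \<Rightarrow>\<^sub>0 'k) set set set set \<Rightarrow> bool" where
  "graded_submodule H \<longleftrightarrow> submodule H Uq verma \<and>
     H = lin_span (scalars Uq verma) (\<Union>\<alpha>\<in>ZPi N. H \<inter> verma_deg \<alpha>)"

text \<open>The greatest element is taken with respect to inclusion.\<close>

definition max_graded_submodule :: "(gen list \<Rightarrow>\<^sub>0 'k) set set set set" where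
  "max_graded_submodule = (GREATEST H. graded_submodule H \<and> H \<noteq> carrier verma)"

definition simple_module ::
    "((gen list \<Rightarrow>\<^sub>0 'k) set set, (gen list \<Rightarrow>\<^sub>0 'k) set set set set) module" where
  "simple_module = quot verma max_graded_submodule"

definition simple_fin_dim :: bool where
  "simple_fin_dim \<longleftrightarrow> fin_dim (scalars Uq simple_module)"

text \<open>The condition \<open>\<Lambda> \<in> \<S>\<^sub>i(\<chi>)\<close>.\<close>

definition in_S :: "nat \<Rightarrow> bool" where
  "in_S i \<longleftrightarrow>
     (\<exists>r::nat. \<Lambda> (Kgen (frag_of i) \<otimes>\<^bsub>Uq\<^esub> Lgen (- frag_of i)) = \<chi> (frag_of i) (frag_of i) ^ r)"

end

end

end

theory Submission
  imports Defs
begin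

text \<open>The simple module is realised concretely, and its set of weights is then bounded.

  A vector f of a highest weight module is recorded by the numbers "vacuum coefficient of E_{i_n}
  ... E_{i_1} f". This makes f a function on words: E_i strips the first letter, every K and L is
  diagonal, and F_j is forced by E_i F_j - F_j E_i = \<delta>_ij (L_i - K_i). Let \<open>vac\<close>
  be the indicator of the empty word and \<open>Lspan\<close> the span of all F-words applied to
  \<open>vac\<close>. A nonzero function has a nonzero coefficient, so some E-word takes it to a
  vector with nonzero vacuum coefficient. Hence the annihilator of \<open>vac\<close> gives exactly
  the maximal graded submodule of the Verma module (\<open>max_graded_eq\<close>), and the question
  becomes whether \<open>Lspan\<close> has finite dimension (\<open>simple_fin_dim_iff\<close>). For
  this the action must respect the ideal that defines U(\<chi>), which is \<open>J2_J4\<close>.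

  The same encoding proves identities between F's: an operator that commutes with all E_i and
  produces no constant coefficient is zero (\<open>op_zeroI\<close>). This yields the Serre
  relations (\<open>serre\<close>), F_j^2 = 0 at an odd node (\<open>Fop_square_zero\<close>) and
  the quartic super relation (\<open>quartic\<close>). Up to a diagonal rescaling of words only q_ii
  and q_ij q_ji matter (\<open>normalized_Fword\<close>), so q may be taken to be 1 above the
  diagonal.

  Necessity: if \<Lambda>(K_i L_i^{-1}) is not a nonnegative power of q_ii, then no F_i^n vac
  vanishes, and these vectors have different weights (\<open>finite_dim_dominant\<close>).

  Sufficiency: at an even node the condition makes F_i locally nilpotent, and the rank one string
  argument makes the set of weights stable under the reflection at i
  (\<open>weights_reflect\<close>). The even reflections do not control the odd direction by
  themselves. There the odd root vectors x_0, ..., x_n along a row of the diagram starting at the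
  odd node s square to zero and anticommute, and a relation with one further node z moves all but
  one of them to the right of F_z. Hence every weight \<Lambda> - sum b_i \<alpha>_i satisfies b_s -
  b_z \<le> n + 1 (\<open>weights_lead\<close>).

  In type A, the shifted differences b_i - b_{i-1} are permuted by the even reflections in two
  blocks. Each difference of the first block can be moved to position m, where
  \<open>weights_lead\<close> bounds it, and each of the second block to position N + 1, where
  nonnegativity of b_N does (\<open>type_A_finite\<close>). In type C, the reflections act by signed
  permutations. A weight of least height with given b_1 satisfies dominance inequalities which,
  against \<open>weights_lead\<close>, bound b_1, and then everything else
  (\<open>type_C_finite\<close>).

  On the algebraic side each object is a quotient of the one space \<open>Fr\<close> of
  noncommutative polynomials, by the subspaces \<open>rr\<close> \<subseteq> \<open>J2\<close>
  \<subseteq> \<open>J3\<close> \<subseteq> \<open>J4\<close> for U-tilde, U(\<chi>), the Verma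
  module and the simple module.\<close>

section \<open>Functions on words, the operators E_i and the vacuum\<close>

datatype 'k vec = Vec (coef: "nat list \<Rightarrow> 'k")

lemma vec_eqI: "(\<And>u. coef f u = coef g u) \<Longrightarrow> f = g"
  by (cases f; cases g) auto

instantiation vec :: (ab_group_add) ab_group_add
begin
definition "0 = Vec (\<lambda>u. 0)"
definition "f + g = Vec (\<lambda>u. coef f u + coef g u)"
definition "f - g = Vec (\<lambda>u. coef f u - coef g u)"
definition "- f = Vec (\<lambda>u. - coef f u)" for f :: "'a vec"
instance
  by standard (simp_all add: zero_vec_def plus_vec_def minus_vec_def uminus_vec_def algebra_simps)
end

definition scl :: "'k::field \<Rightarrow> 'k vec \<Rightarrow> 'k vec" where "scl c f = Vec (\<lambda>u. c * coef f u)"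

lemma coef_simps [simp]:
  "coef 0 u = 0" "coef (f + g) u = coef f u + coef g u" "coef (f - g) u = coef f u - coef g u"
  "coef (- f) u = - coef f u" "coef (scl c h) u = c * coef h u"
  by (simp_all add: zero_vec_def plus_vec_def minus_vec_def uminus_vec_def scl_def)

interpretation vec: vector_space "scl :: 'k::field \<Rightarrow> _"
  by unfold_locales (auto intro!: vec_eqI simp: algebra_simps)

definition Eop :: "nat \<Rightarrow> 'k vec \<Rightarrow> 'k vec" where "Eop i f = Vec (\<lambda>u. coef f (i # u))"

lemma coef_Eop: "coef (Eop i f) u = coef f (i # u)" by (simp add: Eop_def)

lemma Eop_linear [simp]:
  "Eop i (f + g) = Eop i f + Eop i (g :: 'k::field vec)" "Eop i (f - g) = Eop i f - Eop i g"
  "Eop i (- f) = - Eop i f" "Eop i (scl c f) = scl c (Eop i f)" "Eop i 0 = 0"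
  by (auto intro!: vec_eqI simp: coef_Eop)

definition vac :: "'k::field vec" where "vac = Vec (\<lambda>u. if u = [] then 1 else 0)"

lemma Eop_vac [simp]: "Eop i vac = 0"
  by (rule vec_eqI) (simp add: coef_Eop vac_def)

text \<open>There are no singular vectors besides the multiples of \<open>vac\<close>: a coefficient
  at a nonempty word is a coefficient of some E-image.\<close>

lemma vec_zeroI: "f = 0" if "coef f [] = 0" "\<And>i. Eop i f = 0" for f :: "'k::field vec"
proof (rule vec_eqI)
  fix u show "coef f u = coef 0 u" using that(1) coef_Eop[of _ f] that(2) by (cases u) (simp, metis coef_simps(1))
qed

text \<open>The coefficient of a vector at a word is the constant coefficient after stripping the
  word by E's. If Y commutes with the E's they can be applied before Y, where the first assumption
  gives 0.\<close>

lemma op_zeroI: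
  fixes Y :: "'k::field vec \<Rightarrow> 'k vec"
  assumes "\<And>f. coef (Y f) [] = 0" "\<And>f i. Eop i (Y f) = Y (Eop i f)"
  shows "Y f = 0"
proof (rule vec_eqI)
  fix u show "coef (Y f) u = coef 0 u"
  proof (induction u arbitrary: f)
    case (Cons i u)
    have "coef (Y f) (i # u) = coef (Eop i (Y f)) u" by (simp add: coef_Eop)
    with Cons assms show ?case by simp
  qed (simp add: assms)
qed

section \<open>The operators K, L and F\<close>

locale shuffle =
  fixes q :: "nat \<Rightarrow> nat \<Rightarrow> 'k::field" and k l :: "nat \<Rightarrow> 'k"
begin

text \<open>A word of content \<beta> carries the weight \<Lambda> - \<beta>, on which K_j acts by
  k_j \<chi>(\<alpha>_j, \<beta>)^{-1} and L_j, in \<open>Lop\<close>, by l_j \<chi>(\<beta>,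
  \<alpha>_j).\<close>

definition Kop :: "nat \<Rightarrow> 'k vec \<Rightarrow> 'k vec" where
  "Kop j f = Vec (\<lambda>u. k j * (\<Prod>x\<leftarrow>u. inverse (q j x)) * coef f u)"

definition Lop :: "nat \<Rightarrow> 'k vec \<Rightarrow> 'k vec" where
  "Lop j f = Vec (\<lambda>u. l j * (\<Prod>x\<leftarrow>u. q x j) * coef f u)"

text \<open>The commutation relation with E_i, read as a recursion: the value of F_j f at
  \<open>i # u\<close> is the value of E_i F_j f at \<open>u\<close>. Nothing in the image of F_j
  has a constant coefficient.\<close>

primrec Fop_at :: "nat \<Rightarrow> nat list \<Rightarrow> 'k vec \<Rightarrow> 'k" where
  "Fop_at j [] f = 0"
| "Fop_at j (i # u) f = Fop_at j u (Eop i f) + (if i = j then coef (Lop j f) u - coef (Kop j f) u else 0)"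

definition Fop :: "nat \<Rightarrow> 'k vec \<Rightarrow> 'k vec" where "Fop j f = Vec (\<lambda>u. Fop_at j u f)"

abbreviation Fword :: "nat list \<Rightarrow> 'k vec \<Rightarrow> 'k vec" where "Fword w \<equiv> foldr Fop w"

lemma Fop_Nil [simp]: "coef (Fop j f) [] = 0" by (simp add: Fop_def)

lemma Eop_Fop: "Eop i (Fop j f) = Fop j (Eop i f) + (if i = j then Lop j f - Kop j f else 0)"
  by (auto intro!: vec_eqI simp: coef_Eop Fop_def)

lemma Kop_linear [simp]:
  "Kop i (f + g) = Kop i f + Kop i g" "Kop i (f - g) = Kop i f - Kop i g"
  "Kop i (- f) = - Kop i f" "Kop i (scl c f) = scl c (Kop i f)" "Kop i 0 = 0"
  by (auto intro!: vec_eqI simp: Kop_def algebra_simps)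

lemma Lop_linear [simp]:
  "Lop i (f + g) = Lop i f + Lop i g" "Lop i (f - g) = Lop i f - Lop i g"
  "Lop i (- f) = - Lop i f" "Lop i (scl c f) = scl c (Lop i f)" "Lop i 0 = 0"
  by (auto intro!: vec_eqI simp: Lop_def algebra_simps)

lemma Fop_add [simp]: "Fop j (f + g) = Fop j f + Fop j g"
proof (rule vec_eqI)
  fix u show "coef (Fop j (f + g)) u = coef (Fop j f + Fop j g) u"
    by (induction u arbitrary: f g) (auto simp: Fop_def)
qed

lemma Fop_scl [simp]: "Fop j (scl c f) = scl c (Fop j f)"
proof (rule vec_eqI)
  fix u show "coef (Fop j (scl c f)) u = coef (scl c (Fop j f)) u"
    by (induction u arbitrary: f) (auto simp: Fop_def algebra_simps)
qed

lemma Fop_uminus [simp]: "Fop j (- f) = - Fop j f"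
  using Fop_scl[of j "- 1" f] by (simp add: vec.scale_minus_left)

lemma Fop_zero [simp]: "Fop j 0 = 0"
  using Fop_scl[of j 0 0] by simp

lemma Fop_diff [simp]: "Fop j (f - g) = Fop j f - Fop j g"
  using Fop_add[of j f "- g"] by simp

lemma Eop_Kop: "q j i \<noteq> 0 \<Longrightarrow> Eop i (Kop j f) = scl (inverse (q j i)) (Kop j (Eop i f))"
  by (auto intro!: vec_eqI simp: coef_Eop Kop_def algebra_simps)

lemma Eop_Lop: "Eop i (Lop j f) = scl (q i j) (Lop j (Eop i f))"
  by (auto intro!: vec_eqI simp: coef_Eop Lop_def algebra_simps)

lemma Kop_Fop:
  assumes "\<And>i j. q i j \<noteq> 0"
  shows "Kop j (Fop i f) = scl (inverse (q j i)) (Fop i (Kop j f))"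
proof (rule vec_eqI)
  fix u show "coef (Kop j (Fop i f)) u = coef (scl (inverse (q j i)) (Fop i (Kop j f))) u"
  proof (induction u arbitrary: f)
    case (Cons n u)
    have "coef (Kop j (Fop i f)) (n # u) = inverse (q j n) * coef (Kop j (Eop n (Fop i f))) u"
      by (simp add: Kop_def coef_Eop)
    also have "\<dots> = inverse (q j n) * (coef (Kop j (Fop i (Eop n f))) u + (if n = i then coef (Kop j (Lop i f - Kop i f)) u else 0))"
      by (simp add: Eop_Fop)
    also have "\<dots> = coef (scl (inverse (q j i)) (Eop n (Fop i (Kop j f)))) u"
      using assms by (simp add: Cons Eop_Fop Eop_Kop) (auto simp: Kop_def Lop_def field_simps)
    finally show ?case by (simp add: coef_Eop)
  qed (simp add: Kop_def)
qed

lemma Lop_Fop: "Lop j (Fop i f) = scl (q i j) (Fop i (Lop j f))"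
proof (rule vec_eqI)
  fix u show "coef (Lop j (Fop i f)) u = coef (scl (q i j) (Fop i (Lop j f))) u"
  proof (induction u arbitrary: f)
    case (Cons n u)
    have "coef (Lop j (Fop i f)) (n # u) = q n j * coef (Lop j (Eop n (Fop i f))) u"
      by (simp add: Lop_def coef_Eop)
    also have "\<dots> = q n j * (coef (Lop j (Fop i (Eop n f))) u + (if n = i then coef (Lop j (Lop i f - Kop i f)) u else 0))"
      by (simp add: Eop_Fop)
    also have "\<dots> = coef (scl (q i j) (Eop n (Fop i (Lop j f)))) u"
      by (simp add: Cons Eop_Fop Eop_Lop) (auto simp: Kop_def Lop_def field_simps)
    finally show ?case by (simp add: coef_Eop)
  qed (simp add: Lop_def)
qed

section \<open>Iterated q-commutators and the Serre relations\<close>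

text \<open>The n-fold q-adjoint action of F_i on F_j. The twist at each step is the scalar by which
  L_i passes \<open>adF i j n\<close>, so that the L_i-terms cancel in the commutator with
  E_i.\<close>

primrec adF :: "nat \<Rightarrow> nat \<Rightarrow> nat \<Rightarrow> 'k vec \<Rightarrow> 'k vec" where
  "adF i j 0 f = Fop j f"
| "adF i j (Suc n) f = Fop i (adF i j n f) - scl (q i i ^ n * q j i) (adF i j n (Fop i f))"

lemma adF_linear [simp]:
  "adF i j n (f + g) = adF i j n f + adF i j n g" "adF i j n (f - g) = adF i j n f - adF i j n g"
  "adF i j n (scl c f) = scl c (adF i j n f)" "adF i j n 0 = 0"
  by (induction n arbitrary: f g) (simp_all, (rule vec_eqI, simp add: algebra_simps)+)

end

locale shuffle_nz = shuffle q k l for q :: "nat \<Rightarrow> nat \<Rightarrow> 'k::field" and k l +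
  assumes nz: "q i j \<noteq> 0"
begin

lemma Kop_adF: "Kop i (adF i j n f) = scl (inverse (q i i) ^ n * inverse (q i j)) (adF i j n (Kop i f))"
proof (induction n arbitrary: f)
  case (Suc n)
  show ?case
    by (simp add: Suc Kop_Fop nz, rule vec_eqI, simp add: algebra_simps)
qed (simp add: Kop_Fop nz)

lemma Lop_adF: "Lop i (adF i j n f) = scl (q i i ^ n * q j i) (adF i j n (Lop i f))"
proof (induction n arbitrary: f)
  case (Suc n)
  show ?case
    by (simp add: Suc Lop_Fop, rule vec_eqI, simp add: algebra_simps)
qed (simp add: Lop_Fop)

lemma Eop_adF_other: "m \<noteq> i \<Longrightarrow> m \<noteq> j \<Longrightarrow> Eop m (adF i j n f) = adF i j n (Eop m f)"
  by (induction n arbitrary: f) (auto simp: Eop_Fop)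

lemma adF_Nil: "coef (adF i j n f) [] = 0"
  by (induction n arbitrary: f) auto

text \<open>The scalar of the K_i-term that remains when E_i is commuted past
  \<open>adF i j n\<close>.\<close>

definition sB :: "nat \<Rightarrow> nat \<Rightarrow> nat \<Rightarrow> 'k" where
  "sB i j n = (\<Sum>t<n. q i i ^ t * q j i - inverse (q i i) ^ t * inverse (q i j))"

lemma Eop_adF_self:
  assumes "i \<noteq> j"
  shows "Eop i (adF i j n f) =
    adF i j n (Eop i f) + (if n = 0 then 0 else scl (sB i j n) (adF i j (n - 1) (Kop i f)))"
proof (induction n arbitrary: f)
  case 0
  then show ?case using assms by (simp add: Eop_Fop)
next
  case (Suc n)
  show ?case
  proof (cases n)
    case 0
    then show ?thesis using assms
      apply (simp add: Eop_Fop Kop_Fop Lop_Fop nz sB_def)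
      apply (rule vec_eqI) apply (simp add: algebra_simps) done
  next
    case (Suc m)
    have e: "Eop i (adF i j n g) = adF i j n (Eop i g) + scl (sB i j n) (adF i j m (Kop i g))" for g
      using Suc.IH[of g] unfolding Suc by simp
    have r: "Fop i (adF i j m g) = adF i j n g + scl (q i i ^ m * q j i) (adF i j m (Fop i g))" for g
      unfolding Suc by simp
    have p: "q i i ^ n = q i i * q i i ^ m" unfolding Suc by simp
    have s: "sB i j (Suc n) = sB i j n + (q i i ^ n * q j i - inverse (q i i) ^ n * inverse (q i j))"
      by (simp add: sB_def)
    show ?thesis
      using assms
      apply (simp add: Eop_Fop e r s Kop_adF Lop_adF Kop_Fop nz)
      apply (rule vec_eqI)
      apply (simp add: p field_simps nz)
      done
  qed
qed

text \<open>Each step moves L_j or K_j past one more F_i. Compared with the twist this gives the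
  factor 1 - q_ii^t q_ij q_ji for L_j and 1 - q_ii^t for K_j.\<close>

lemma Eop_adF_j:
  assumes "i \<noteq> j"
  shows "Eop j (adF i j n f) = adF i j n (Eop j f)
     + scl (\<Prod>t<n. 1 - q i i ^ t * q i j * q j i) ((Fop i ^^ n) (Lop j f))
     - scl (\<Prod>t<n. 1 - q i i ^ t) ((Fop i ^^ n) (Kop j f))"
proof (induction n arbitrary: f)
  case 0
  then show ?case by (simp add: Eop_Fop algebra_simps)
next
  case (Suc n)
  have 1: "(Fop i ^^ n) (scl c f) = scl c ((Fop i ^^ n) f)" for c f
    by (induction n) simp_all
  have 2: "(Fop i ^^ n) (Fop i f) = Fop i ((Fop i ^^ n) f)" for f
    by (simp add: funpow_swap1)
  show ?case using assms
    apply (simp add: Eop_Fop Suc.IH Lop_Fop Kop_Fop nz 1 2)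
    apply (rule vec_eqI)
    apply (simp add: field_simps nz)
    done
qed

text \<open>By \<open>op_zeroI\<close> it suffices that E_i and E_j commute with the operator. For
  E_i, the two halves of \<open>sB\<close> agree under t \<mapsto> s - t. For E_j, the L-product
  contains a zero factor at t = s and the K-product one at t = 0.\<close>

theorem serre:
  assumes "i \<noteq> j" "q i j * q j i * q i i ^ s = 1"
  shows "adF i j (Suc s) f = 0"
proof (rule op_zeroI[where Y = "adF i j (Suc s)"])
  show "coef (adF i j (Suc s) f) [] = 0" for f by (rule adF_Nil)
  have p: "inverse (q i j) = q j i * q i i ^ s" "q i i ^ s * q i j * q j i = 1"
    "q i j * (q j i * q i i ^ s) = 1"
    using assms(2) nz by (auto simp: field_simps)
  have "(\<Sum>t<Suc s. inverse (q i i) ^ t * inverse (q i j)) = (\<Sum>t<Suc s. q i i ^ (s - t) * q j i)"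
    by (rule sum.cong) (auto simp: p nz power_diff field_simps power_inverse)
  also have "\<dots> = (\<Sum>t<Suc s. q i i ^ t * q j i)"
    using sum.nat_diff_reindex[of "\<lambda>t. q i i ^ t * q j i" "Suc s"] by simp
  finally have b: "sB i j (Suc s) = 0" by (simp add: sB_def sum_subtractf)
  have P1: "(\<Prod>t<Suc s. 1 - q i i ^ t * q i j * q j i) = 0"
    by (rule prod_zero) (use p(2) in \<open>auto intro!: bexI[of _ s]\<close>)
  have P2: "(\<Prod>t<Suc s. 1 - q i i ^ t) = 0"
    by (rule prod_zero) (auto intro!: bexI[of _ 0])
  have "Eop j (adF i j (Suc s) f) = adF i j (Suc s) (Eop j f)" for f
    unfolding Eop_adF_j[OF assms(1), of "Suc s" f] P1 P2 by simp
  then show "Eop m (adF i j (Suc s) f) = adF i j (Suc s) (Eop m f)" for m f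
    using Eop_adF_other[of m i j "Suc s" f] Eop_adF_self[OF assms(1), of "Suc s" f] b
    by (cases "m = i"; cases "m = j") (simp_all del: adF.simps)
qed

lemma Fop_comm:
  assumes "i \<noteq> j" "q i j * q j i = 1"
  shows "Fop i (Fop j f) = scl (q j i) (Fop j (Fop i f))"
  using serre[OF assms(1), of 0 f] assms(2) by simp

text \<open>Commuting E_j past F_j^2 produces L_j - K_j twice; for q_jj = -1 the two contributions
  are opposite.\<close>

lemma Fop_square_zero:
  assumes "q j j = - 1"
  shows "Fop j (Fop j f) = 0"
  by (rule op_zeroI[where Y = "\<lambda>f. Fop j (Fop j f)"]) (auto simp: Eop_Fop Lop_Fop Kop_Fop nz assms)

section \<open>Local nilpotency of F_i\<close>

text \<open>One application of F_i turns \<open>adF i j d f\<close> into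
  \<open>adF i j (Suc d) f\<close> plus a multiple of \<open>adF i j d (Fop i f)\<close>: either the
  q-commutator gets longer, until the Serre relation kills it, or a power of F_i reaches f. The case
  e = s + 1 speaks of F_j f itself.\<close>

lemma Fop_nilpotent_step:
  assumes "i \<noteq> j" "q i j * q j i * q i i ^ s = 1"
  shows "(Fop i ^^ n) f = 0 \<Longrightarrow> e \<le> Suc s \<Longrightarrow> (Fop i ^^ (n + e)) (adF i j (Suc s - e) f) = 0"
proof (induction "n + e" arbitrary: n e f)
  case 0
  then show ?case by simp
next
  case (Suc x)
  have lin: "(Fop i ^^ n) (f - scl c g) = (Fop i ^^ n) f - scl c ((Fop i ^^ n) g)" for n f g c
    by (induction n) simp_all
  have z: "(Fop i ^^ n) 0 = 0" for n by (induction n) simp_all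
  show ?case
  proof (cases "n = 0 \<or> e = 0")
    case True
    then show ?thesis using Suc.prems serre[OF assms] z by (elim disjE) (simp_all del: adF.simps)
  next
    case False
    then obtain n' e' where ne: "n = Suc n'" "e = Suc e'" by (metis not0_implies_Suc)
    define d where "d = Suc s - e"
    have d: "Suc s - e' = Suc d" using Suc.prems ne by (simp add: d_def)
    have "Fop i (adF i j d f) = adF i j (Suc d) f + scl (q i i ^ d * q j i) (adF i j d (Fop i f))"
      by simp
    moreover have "(Fop i ^^ (n + e')) (adF i j (Suc d) f) = 0"
      using Suc.hyps(1)[of n e' f] Suc.hyps(2) Suc.prems ne d by (simp del: adF.simps)
    moreover have "(Fop i ^^ (n' + e)) (adF i j d (Fop i f)) = 0"
      using Suc.hyps(1)[of n' e "Fop i f"] Suc.hyps(2) Suc.prems ne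
      by (simp add: d_def funpow_swap1 del: adF.simps)
    ultimately have "(Fop i ^^ (n + e')) (Fop i (adF i j d f)) = 0"
      using lin[of "n + e'" "adF i j (Suc d) f" "- (q i i ^ d * q j i)"] ne
      by (simp del: adF.simps add: vec.scale_minus_left)
    then show ?thesis using ne by (simp add: d_def funpow_swap1 del: adF.simps)
  qed
qed

lemma Fop_locally_nilpotent:
  assumes "\<And>j. j \<noteq> i \<Longrightarrow> \<exists>s. q i j * q j i * q i i ^ s = 1" "(Fop i ^^ r) vac = 0"
  shows "\<exists>n. (Fop i ^^ n) (Fword w vac) = 0"
proof (induction w)
  case (Cons j w)
  then obtain n where n: "(Fop i ^^ n) (Fword w vac) = 0" by blast
  show ?case
  proof (cases "j = i")
    case True
    have "(Fop i ^^ Suc n) (Fword w vac) = 0" using n by simp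
    then have "(Fop i ^^ n) (Fword (j # w) vac) = 0" using True by (simp add: funpow_swap1)
    then show ?thesis by blast
  next
    case False
    then obtain s where "q i j * q j i * q i i ^ s = 1" using assms(1) by blast
    from Fop_nilpotent_step[OF False[symmetric] this n, of "Suc s"]
    have "(Fop i ^^ (n + Suc s)) (Fword (j # w) vac) = 0" by simp
    then show ?thesis by blast
  qed
qed (use assms(2) in auto)

end

section \<open>Weights and the span of the F-words\<close>

text \<open>Integer valued, because reflections and differences of weights may be negative on the
  way.\<close>

definition cnt :: "nat list \<Rightarrow> nat \<Rightarrow> int" where "cnt u = (\<lambda>j. int (count_list u j))"

lemma cnt_simps: "cnt [] = (\<lambda>_. 0)" "cnt (i # u) = (cnt u)(i := cnt u i + 1)"
  by (auto simp: cnt_def fun_eq_iff)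

lemma cnt_nonneg: "0 \<le> cnt u j" by (simp add: cnt_def)

lemma cnt_eq_mset: "cnt u = cnt v \<Longrightarrow> mset u = mset v"
  by (rule multiset_eqI) (simp add: cnt_def fun_eq_iff count_mset)

text \<open>The function b stands for the weight \<Lambda> - sum b_i \<alpha>_i.\<close>

definition has_wt :: "'k::field vec \<Rightarrow> (nat \<Rightarrow> int) \<Rightarrow> bool" where
  "has_wt f b \<longleftrightarrow> (\<forall>u. coef f u \<noteq> 0 \<longrightarrow> cnt u = b)"

lemma has_wt_add: "has_wt f b \<Longrightarrow> has_wt g b \<Longrightarrow> has_wt (f + g) b"
  unfolding has_wt_def by (intro allI impI) (metis add_0 coef_simps(2))

lemma has_wt_diff: "has_wt f b \<Longrightarrow> has_wt g b \<Longrightarrow> has_wt (f - g) b"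
  unfolding has_wt_def by (intro allI impI) (metis diff_0_right coef_simps(3))

lemma has_wt_scl: "has_wt f b \<Longrightarrow> has_wt (scl c f) b"
  by (auto simp: has_wt_def)

lemma has_wt_zero [simp]: "has_wt 0 b" by (simp add: has_wt_def)

lemma has_wt_vac: "has_wt vac (\<lambda>_. 0)"
  by (auto simp: has_wt_def vac_def cnt_simps)

lemma has_wt_Eop: "has_wt f b \<Longrightarrow> has_wt (Eop i f) (b(i := b i - 1))"
  by (auto simp: has_wt_def coef_Eop cnt_simps)

lemma nonzero_coef: "f \<noteq> 0 \<Longrightarrow> \<exists>u. coef f u \<noteq> 0"
  by (metis coef_simps(1) vec_eqI)

lemma powi_eq_one:
  fixes Q :: "'k::field" assumes "not_root_of_unity Q" "Q powi a = 1" shows "a = 0"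
proof (rule ccontr)
  assume "a \<noteq> 0"
  have "Q ^ nat \<bar>a\<bar> = 1"
    using assms(2) by (cases "a \<ge> 0") (auto simp: power_int_def power_inverse)
  with \<open>a \<noteq> 0\<close> assms(1) show False by (auto simp: not_root_of_unity_def)
qed

lemma geometric_nonzero:
  fixes Q :: "'k::field" assumes "not_root_of_unity Q" shows "(\<Sum>t<Suc n. Q ^ t) \<noteq> 0"
proof
  assume "(\<Sum>t<Suc n. Q ^ t) = 0"
  then have "Q ^ Suc n = 1" using power_diff_1_eq[of Q "Suc n"] by simp
  with assms show False by (auto simp: not_root_of_unity_def simp del: power_Suc)
qed

context shuffle
begin

lemma Fop_at_nz: "coef (Fop i f) u \<noteq> 0 \<Longrightarrow> has_wt f b \<Longrightarrow> cnt u = b(i := b i + 1)"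
proof (induction u arbitrary: f b)
  case (Cons j u)
  have "coef (Fop i f) (j # u) = coef (Eop j (Fop i f)) u" by (simp add: coef_Eop)
  then have "coef (Fop i (Eop j f)) u \<noteq> 0 \<or> j = i \<and> coef f u \<noteq> 0"
    using Cons.prems(1) by (auto simp: Eop_Fop Lop_def Kop_def split: if_splits)
  then show ?case
  proof
    assume "coef (Fop i (Eop j f)) u \<noteq> 0"
    from Cons.IH[OF this has_wt_Eop[OF Cons.prems(2)]] show ?thesis
      by (auto simp: cnt_simps fun_eq_iff)
  next
    assume "j = i \<and> coef f u \<noteq> 0"
    then show ?thesis using Cons.prems(2) by (auto simp: has_wt_def cnt_simps)
  qed
qed simp

lemma has_wt_Fop: "has_wt f b \<Longrightarrow> has_wt (Fop i f) (b(i := b i + 1))"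
  using Fop_at_nz by (auto simp: has_wt_def)

lemma has_wt_Fword: "has_wt (Fword w vac) (cnt w)"
proof (induction w)
  case (Cons i w)
  then show ?case using has_wt_Fop[of "Fword w vac" "cnt w" i] by (simp only: cnt_simps foldr.simps o_apply)
qed (simp add: has_wt_vac cnt_simps)

lemma has_wt_Fpow: "has_wt f b \<Longrightarrow> has_wt ((Fop i ^^ n) f) (b(i := b i + int n))"
proof (induction n)
  case (Suc n)
  have e: "(b(i := b i + int n))(i := (b(i := b i + int n)) i + 1) = b(i := b i + int (Suc n))"
    by (rule ext) simp
  from has_wt_Fop[OF Suc.IH[OF Suc.prems], of i] show ?case unfolding e funpow.simps o_apply .
qed simp

lemma has_wt_Epow: "has_wt f b \<Longrightarrow> has_wt ((Eop i ^^ n) f) (b(i := b i - int n))"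
proof (induction n)
  case (Suc n)
  have e: "(b(i := b i - int n))(i := (b(i := b i - int n)) i - 1) = b(i := b i - int (Suc n))"
    by (rule ext) simp
  from has_wt_Eop[OF Suc.IH[OF Suc.prems], of i] show ?case unfolding e funpow.simps o_apply .
qed simp

lemma prod_list_mset_cong:
  assumes "mset u = mset v" shows "(\<Prod>x\<leftarrow>u. g x) = (\<Prod>x\<leftarrow>v. g x :: 'k)"
proof -
  have "prod_mset (mset (map g u)) = prod_mset (mset (map g v))" by (simp only: mset_map assms)
  then show ?thesis by (simp only: prod_mset_prod_list)
qed

lemma KL_weight:
  assumes "has_wt f (cnt v)"
  shows "Kop i f = scl (k i * (\<Prod>x\<leftarrow>v. inverse (q i x))) f"
    and "Lop i f = scl (l i * (\<Prod>x\<leftarrow>v. q x i)) f"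
proof -
  have "mset u = mset v" if "coef f u \<noteq> 0" for u
    using that assms cnt_eq_mset[of u v] unfolding has_wt_def by blast
  then have *: "coef f u \<noteq> 0 \<Longrightarrow> (\<Prod>x\<leftarrow>u. g x) = (\<Prod>x\<leftarrow>v. g x :: 'k)" for u g
    using prod_list_mset_cong by blast
  show "Kop i f = scl (k i * (\<Prod>x\<leftarrow>v. inverse (q i x))) f"
  proof (rule vec_eqI)
    fix u show "coef (Kop i f) u = coef (scl (k i * (\<Prod>x\<leftarrow>v. inverse (q i x))) f) u"
      using *[of u "\<lambda>x. inverse (q i x)"] by (cases "coef f u = 0") (simp_all add: Kop_def)
  qed
  show "Lop i f = scl (l i * (\<Prod>x\<leftarrow>v. q x i)) f"
  proof (rule vec_eqI)
    fix u show "coef (Lop i f) u = coef (scl (l i * (\<Prod>x\<leftarrow>v. q x i)) f) u"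
      using *[of u "\<lambda>x. q x i"] by (cases "coef f u = 0") (simp_all add: Lop_def)
  qed
qed

text \<open>The submodule generated by \<open>vac\<close>, a model of the simple module.\<close>

definition Lspan :: "nat \<Rightarrow> 'k vec set" where
  "Lspan N = vec.span ((\<lambda>w. Fword w vac) ` lists {1..N})"

lemma Fword_in_Lspan: "w \<in> lists {1..N} \<Longrightarrow> Fword w vac \<in> Lspan N"
  unfolding Lspan_def by (rule vec.span_base) blast

lemma Lspan_Fop: "f \<in> Lspan N \<Longrightarrow> i \<in> {1..N} \<Longrightarrow> Fop i f \<in> Lspan N"
  unfolding Lspan_def
proof (induction rule: vec.span_induct_alt)
  case (step c x y)
  then obtain w where w: "w \<in> lists {1..N}" "x = Fword w vac" by auto
  have "Fop i x \<in> Lspan N" using Fword_in_Lspan[of "i # w" N] w step.prems by simp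
  then show ?case using step unfolding Lspan_def by (simp add: vec.span_add vec.span_scale)
qed (simp add: vec.span_zero)

lemma Eop_Fword_in_Lspan: "w \<in> lists {1..N} \<Longrightarrow> Eop i (Fword w vac) \<in> Lspan N"
proof (induction w)
  case Nil
  then show ?case by (simp add: Lspan_def vec.span_zero)
next
  case (Cons j w)
  then have *: "Fop j (Eop i (Fword w vac)) \<in> Lspan N" "Fword w vac \<in> Lspan N"
    by (auto intro!: Lspan_Fop Fword_in_Lspan)
  then show ?case
    using KL_weight[OF has_wt_Fword[of w], of j]
    by (auto simp: Eop_Fop Lspan_def intro!: vec.span_add vec.span_diff vec.span_scale)
qed

lemma Lspan_Eop: "f \<in> Lspan N \<Longrightarrow> Eop i f \<in> Lspan N"
  unfolding Lspan_def
proof (induction rule: vec.span_induct_alt)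
  case (step c x y)
  then have "Eop i x \<in> Lspan N" using Eop_Fword_in_Lspan by auto
  then show ?case using step unfolding Lspan_def by (simp add: vec.span_add vec.span_scale)
qed (simp add: vec.span_zero)

lemma Lspan_Fpow: "f \<in> Lspan N \<Longrightarrow> i \<in> {1..N} \<Longrightarrow> (Fop i ^^ n) f \<in> Lspan N"
  by (induction n) (auto intro: Lspan_Fop)

lemma Lspan_Epow: "f \<in> Lspan N \<Longrightarrow> (Eop i ^^ n) f \<in> Lspan N"
  by (induction n) (auto intro: Lspan_Eop)

definition weights :: "nat \<Rightarrow> (nat \<Rightarrow> int) set" where
  "weights N = {cnt w | w. w \<in> lists {1..N} \<and> Fword w vac \<noteq> 0}"

lemma Lspan_weights: "f \<in> Lspan N \<Longrightarrow> coef f u \<noteq> 0 \<Longrightarrow> cnt u \<in> weights N \<and> u \<in> lists {1..N}"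
  unfolding Lspan_def
proof (induction rule: vec.span_induct_alt)
  case (step c x y)
  show ?case
  proof (cases "coef y u = 0")
    case True
    with step obtain w where w: "w \<in> lists {1..N}" "x = Fword w vac" "coef x u \<noteq> 0" by auto
    then have c: "cnt u = cnt w" using has_wt_Fword by (auto simp: has_wt_def)
    then have "set u = set w" using cnt_eq_mset by (metis set_mset_mset)
    then have "u \<in> lists {1..N}" using w(1) by (auto simp: lists_eq_set)
    moreover have "x \<noteq> 0" using w(3) by auto
    ultimately show ?thesis using w c unfolding weights_def by auto
  qed (use step in auto)
qed simp

lemma weights_I: "f \<in> Lspan N \<Longrightarrow> f \<noteq> 0 \<Longrightarrow> has_wt f b \<Longrightarrow> b \<in> weights N"
  using nonzero_coef[of f] Lspan_weights[of f N] by (auto simp: has_wt_def)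

end

section \<open>Rank one strings\<close>

context shuffle_nz
begin

lemma Lop_Fpow: "Lop i y = scl \<mu> y \<Longrightarrow> Lop i ((Fop i ^^ n) y) = scl (q i i ^ n * \<mu>) ((Fop i ^^ n) y)"
  by (induction n) (simp_all add: Lop_Fop mult.assoc)

lemma Kop_Fpow: "Kop i y = scl \<kappa> y \<Longrightarrow> Kop i ((Fop i ^^ n) y) = scl (inverse (q i i) ^ n * \<kappa>) ((Fop i ^^ n) y)"
  by (induction n) (simp_all add: Kop_Fop nz mult.assoc)

lemma Lop_Eop: "Lop j (Eop i f) = scl (inverse (q i j)) (Eop i (Lop j f))"
  by (simp add: Eop_Lop nz)

lemma Kop_Eop: "Kop j (Eop i f) = scl (q j i) (Eop i (Kop j f))"
  by (simp add: Eop_Kop nz)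

lemma Lop_Epow: "Lop i y = scl \<mu> y \<Longrightarrow> Lop i ((Eop i ^^ n) y) = scl (inverse (q i i) ^ n * \<mu>) ((Eop i ^^ n) y)"
  by (induction n) (simp_all add: Lop_Eop mult.assoc)

lemma Kop_Epow: "Kop i y = scl \<kappa> y \<Longrightarrow> Kop i ((Eop i ^^ n) y) = scl (q i i ^ n * \<kappa>) ((Eop i ^^ n) y)"
  by (induction n) (simp_all add: Kop_Eop mult.assoc)

lemma Eop_Fpow:
  assumes "Eop i y = 0" "Kop i y = scl \<kappa> y" "Lop i y = scl \<mu> y"
  shows "Eop i ((Fop i ^^ Suc n) y) =
    scl (\<Sum>t<Suc n. q i i ^ t * \<mu> - inverse (q i i) ^ t * \<kappa>) ((Fop i ^^ n) y)"
proof (induction n)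
  case 0
  then show ?case using assms by (simp add: Eop_Fop vec.scale_left_diff_distrib)
next
  case (Suc n)
  have "Eop i ((Fop i ^^ Suc (Suc n)) y) = Fop i (Eop i ((Fop i ^^ Suc n) y))
     + (Lop i ((Fop i ^^ Suc n) y) - Kop i ((Fop i ^^ Suc n) y))"
    by (simp add: Eop_Fop)
  also have "\<dots> = scl (\<Sum>t<Suc n. q i i ^ t * \<mu> - inverse (q i i) ^ t * \<kappa>) ((Fop i ^^ Suc n) y)
     + scl (q i i ^ Suc n * \<mu> - inverse (q i i) ^ Suc n * \<kappa>) ((Fop i ^^ Suc n) y)"
    unfolding Suc Lop_Fpow[OF assms(3)] Kop_Fpow[OF assms(2)]
    by (simp add: vec.scale_left_diff_distrib)
  finally show ?case by (simp add: vec.scale_left_distrib[symmetric])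
qed

lemma Fop_Epow:
  assumes "Fop i y = 0" "Kop i y = scl \<kappa> y" "Lop i y = scl \<mu> y"
  shows "Fop i ((Eop i ^^ Suc n) y) =
    - scl (\<Sum>t<Suc n. inverse (q i i) ^ t * \<mu> - q i i ^ t * \<kappa>) ((Eop i ^^ n) y)"
proof (induction n)
  case 0
  have "Eop i (Fop i y) = Fop i (Eop i y) + (Lop i y - Kop i y)" by (simp add: Eop_Fop)
  then have "Fop i (Eop i y) = - scl (\<mu> - \<kappa>) y"
    using assms by (simp add: vec.scale_left_diff_distrib algebra_simps eq_neg_iff_add_eq_0)
  then show ?case by simp
next
  case (Suc n)
  define z where "z = (Eop i ^^ Suc n) y"
  have "Fop i ((Eop i ^^ Suc (Suc n)) y) = Eop i (Fop i z) - (Lop i z - Kop i z)"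
    by (simp add: Eop_Fop z_def)
  also have "\<dots> = - scl (\<Sum>t<Suc n. inverse (q i i) ^ t * \<mu> - q i i ^ t * \<kappa>) z
     - scl (inverse (q i i) ^ Suc n * \<mu> - q i i ^ Suc n * \<kappa>) z"
    unfolding z_def Suc Lop_Epow[OF assms(3)] Kop_Epow[OF assms(2)]
    by (simp add: vec.scale_left_diff_distrib)
  finally show ?case unfolding z_def[symmetric]
    by (simp add: vec.scale_left_distrib algebra_simps)
qed

text \<open>Reversing the order of the K-part extracts a common quantum integer. The other factor
  vanishes exactly when \<kappa> = q_ii^n \<mu>, that is, when the string ends at n.\<close>

lemma string_sum:
  "(\<Sum>t<Suc n. q i i ^ t * \<mu> - inverse (q i i) ^ t * \<kappa>) = (\<Sum>t<Suc n. q i i ^ t) * (\<mu> - inverse (q i i) ^ n * \<kappa>)"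
proof -
  have "(\<Sum>t<Suc n. inverse (q i i) ^ t) = (\<Sum>t<Suc n. inverse (q i i) ^ n * q i i ^ (n - t))"
    by (rule sum.cong) (auto simp: power_diff nz field_simps power_inverse)
  also have "\<dots> = inverse (q i i) ^ n * (\<Sum>t<Suc n. q i i ^ t)"
    using sum.nat_diff_reindex[of "\<lambda>t. q i i ^ t" "Suc n"] by (simp add: sum_distrib_left[symmetric] del: sum.lessThan_Suc)
  finally have *: "(\<Sum>t<Suc n. inverse (q i i) ^ t) = inverse (q i i) ^ n * (\<Sum>t<Suc n. q i i ^ t)" .
  show ?thesis
    unfolding sum_subtractf sum_distrib_right[symmetric] * by (simp only: algebra_simps)
qed

lemma string_sum':
  "(\<Sum>t<Suc n. inverse (q i i) ^ t * \<mu> - q i i ^ t * \<kappa>) = (\<Sum>t<Suc n. q i i ^ t) * (inverse (q i i) ^ n * \<mu> - \<kappa>)"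
proof -
  have "(\<Sum>t<Suc n. inverse (q i i) ^ t * \<mu> - q i i ^ t * \<kappa>) = - (\<Sum>t<Suc n. q i i ^ t * \<kappa> - inverse (q i i) ^ t * \<mu>)"
    by (simp add: sum_subtractf del: sum.lessThan_Suc)
  then show ?thesis unfolding string_sum by (simp add: algebra_simps)
qed

end

section \<open>Reflections of the weight set at even nodes\<close>

text \<open>\<open>c\<close> supplies the rows of a Cartan matrix that belong to the nodes in
  \<open>Ev\<close>, and \<open>kl\<close> is the condition \<Lambda> \<in> S_i written without
  inverses.\<close>

locale even_nodes = shuffle_nz q k l for q :: "nat \<Rightarrow> nat \<Rightarrow> 'k::field" and k l +
  fixes N :: nat and Ev :: "nat set" and r :: "nat \<Rightarrow> nat" and c :: "nat \<Rightarrow> nat \<Rightarrow> int"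
  assumes lnz: "l i \<noteq> 0"
    and Ev: "i \<in> Ev \<Longrightarrow> i \<in> {1..N}"
    and nru: "i \<in> Ev \<Longrightarrow> not_root_of_unity (q i i)"
    and cartan: "i \<in> Ev \<Longrightarrow> q i x * q x i = q i i powi c i x"
    and c_diag: "i \<in> Ev \<Longrightarrow> c i i = 2"
    and c_neg: "i \<in> Ev \<Longrightarrow> x \<noteq> i \<Longrightarrow> c i x \<le> 0"
    and kl: "i \<in> Ev \<Longrightarrow> k i = l i * q i i ^ r i"
begin

lemma even_serre:
  assumes "i \<in> Ev" "x \<noteq> i"
  shows "q i x * q x i * q i i ^ nat (- c i x) = 1"
  using cartan[OF assms(1), of x] c_neg[OF assms] nz[of i i]
  by (cases "c i x = 0") (auto simp: power_int_def power_inverse)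

text \<open>In the Verma module this vector would merely be singular; here a vector that all E's
  kill and that has no constant coefficient is zero.\<close>

lemma Fop_vac_nilpotent:
  assumes "i \<in> Ev" shows "(Fop i ^^ Suc (r i)) vac = 0"
proof (rule vec_zeroI)
  show "coef ((Fop i ^^ Suc (r i)) vac) [] = 0" by simp
  fix j
  have 1: "Kop i vac = scl (k i) vac" "Lop i vac = scl (l i) vac"
    by (auto intro!: vec_eqI simp: vac_def Kop_def Lop_def)
  show "Eop j ((Fop i ^^ Suc (r i)) vac) = 0"
  proof (cases "j = i")
    case True
    show ?thesis unfolding True Eop_Fpow[OF Eop_vac 1] string_sum
      using kl[OF assms] nz[of i i] by (simp add: power_inverse)
  next
    case False
    have "Eop j ((Fop i ^^ n) vac) = 0" for n
      using False by (induction n) (simp_all add: Eop_Fop)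
    then show ?thesis by blast
  qed
qed

lemma even_nilpotent: "i \<in> Ev \<Longrightarrow> \<exists>n. (Fop i ^^ n) (Fword w vac) = 0"
  using Fop_locally_nilpotent[OF _ Fop_vac_nilpotent, of i w] even_serre by blast

text \<open>The pairing of the weight b with the coroot of i: K_i and L_i differ on it by the factor
  q_ii to this power (see \<open>eigen\<close>).\<close>

definition kf :: "nat \<Rightarrow> (nat \<Rightarrow> int) \<Rightarrow> int" where
  "kf i b = int (r i) - (\<Sum>x\<in>{1..N}. c i x * b x)"

lemma kf_upd: "i \<in> Ev \<Longrightarrow> kf i (b(i := b i + d)) = kf i b - 2 * d"
proof -
  assume i: "i \<in> Ev"
  have "(\<Sum>x\<in>{1..N}. c i x * (b(i := b i + d)) x) = (\<Sum>x\<in>{1..N}. c i x * b x + (if x = i then c i i * d else 0))"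
    by (rule sum.cong) (auto simp: algebra_simps)
  also have "\<dots> = (\<Sum>x\<in>{1..N}. c i x * b x) + 2 * d"
    using Ev[OF i] c_diag[OF i] by (simp add: sum.distrib)
  finally show ?thesis by (simp add: kf_def)
qed

lemma KL_ratio:
  assumes "i \<in> Ev"
  shows "k i * (\<Prod>x\<leftarrow>v. inverse (q i x)) = l i * (\<Prod>x\<leftarrow>v. q x i) * q i i powi (int (r i) - (\<Sum>x\<leftarrow>v. c i x))"
proof (induction v)
  case (Cons x v)
  have "q i i powi (int (r i) - (\<Sum>x\<leftarrow>x # v. c i x)) = q i i powi (int (r i) - (\<Sum>x\<leftarrow>v. c i x)) * inverse (q i i powi c i x)"
    using nz[of i i] by (simp add: power_int_minus[symmetric] power_int_add[symmetric] algebra_simps)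
  then show ?case using Cons nz cartan[OF assms, of x, symmetric] by (simp add: field_simps)
qed (use kl[OF assms] in simp)

lemma sum_list_cnt:
  "v \<in> lists {1..N} \<Longrightarrow> (\<Sum>x\<leftarrow>v. c i x) = (\<Sum>x\<in>{1..N}. c i x * cnt v x)"
proof (induction v)
  case (Cons y v)
  have "(\<Sum>x\<in>{1..N}. c i x * cnt (y # v) x) = (\<Sum>x\<in>{1..N}. c i x * cnt v x + (if x = y then c i y else 0))"
    by (rule sum.cong) (auto simp: cnt_simps algebra_simps)
  also have "\<dots> = (\<Sum>x\<in>{1..N}. c i x * cnt v x) + c i y"
    using Cons.prems by (simp add: sum.distrib)
  finally show ?case using Cons by simp
qed (simp add: cnt_simps)

lemma eigen:
  assumes "i \<in> Ev" "f \<in> Lspan N" "f \<noteq> 0" "has_wt f b"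
  obtains \<mu> where "\<mu> \<noteq> 0" "Lop i f = scl \<mu> f" "Kop i f = scl (\<mu> * q i i powi kf i b) f"
proof -
  obtain v where v: "coef f v \<noteq> 0" using nonzero_coef[OF assms(3)] by blast
  then have b: "b = cnt v" "v \<in> lists {1..N}"
    using assms Lspan_weights by (auto simp: has_wt_def)
  have *: "l i * (\<Prod>x\<leftarrow>v. q x i) \<noteq> 0" using lnz nz by (auto simp: prod_list_zero_iff)
  show ?thesis
    using that[OF *] KL_weight[OF assms(4)[unfolded b(1)]] KL_ratio[OF assms(1), of v]
      sum_list_cnt[OF b(2), of i] b(1) by (simp add: kf_def)
qed

text \<open>Go to an end of the i-string through a weight vector and come back beyond it. The string
  cannot break off before the mirror image, since q_ii is not a root of unity.\<close>

lemma weights_reflect: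
  assumes i: "i \<in> Ev" and b: "b \<in> weights N"
  shows "b(i := b i + kf i b) \<in> weights N"
proof -
  obtain w where w: "w \<in> lists {1..N}" "b = cnt w" "Fword w vac \<noteq> 0"
    using b by (auto simp: weights_def)
  define f where "f = Fword w vac"
  have f: "f \<in> Lspan N" "f \<noteq> 0" "has_wt f b"
    using w has_wt_Fword Fword_in_Lspan by (auto simp: f_def)
  have bn: "(b(i := b i + d)) = (b(i := b i + e)) \<longleftrightarrow> d = e" for d e
    by (auto simp: fun_eq_iff split: if_splits)
  have Qnz: "(1 :: 'k) \<noteq> q i i powi a" if "a \<noteq> 0" for a
    using powi_eq_one[OF nru[OF i]] that by metis
  show ?thesis
  proof (cases "kf i b \<ge> 0")
    case True
    \<comment> \<open>No more than b_i letters i can be stripped, because letter counts are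
      nonnegative.\<close>
    have "(Eop i ^^ Suc (nat (b i))) f = 0"
    proof (rule ccontr)
      assume n: "(Eop i ^^ Suc (nat (b i))) f \<noteq> 0"
      obtain u where "coef ((Eop i ^^ Suc (nat (b i))) f) u \<noteq> 0" using nonzero_coef[OF n] by blast
      then have "cnt u = b(i := b i - int (Suc (nat (b i))))"
        using has_wt_Epow[OF f(3)] by (auto simp: has_wt_def simp del: funpow.simps)
      then have "cnt u i < 0" by (auto split: if_splits)
      then show False using cnt_nonneg[of u i] by simp
    qed
    then obtain p where p: "(Eop i ^^ p) f \<noteq> 0" "(Eop i ^^ Suc p) f = 0"
      using f(2) ex_least_nat_less[of "\<lambda>n. (Eop i ^^ n) f = 0" "Suc (nat (b i))"]
      by (auto simp del: funpow.simps(2))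
    define y where "y = (Eop i ^^ p) f"
    have y: "y \<in> Lspan N" "y \<noteq> 0" "has_wt y (b(i := b i + (- int p)))" "Eop i y = 0"
      using p f Lspan_Epow has_wt_Epow[OF f(3), where i = i and n = p] by (auto simp: y_def)
    obtain \<mu> where \<mu>: "\<mu> \<noteq> 0" "Lop i y = scl \<mu> y" "Kop i y = scl (\<mu> * q i i powi (kf i b + 2 * int p)) y"
      by (rule eigen[OF i y(1-3)]) (use kf_upd[OF i, of b "- int p"] in simp)
    \<comment> \<open>From the top y of the string, the scalar of E_i F_i^{n+1} y has the factor 1 -
      q_ii^(kf + 2p - n), which is nonzero before the end of the string.\<close>
    have F: "(Fop i ^^ n) y \<noteq> 0" if "int n \<le> kf i b + 2 * int p" for n
      using that
    proof (induction n)
      case (Suc n)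
      have "\<mu> - inverse (q i i) ^ n * (\<mu> * q i i powi (kf i b + 2 * int p)) = \<mu> * (1 - q i i powi (kf i b + 2 * int p - int n))"
        using power_int_diff[of "q i i" "kf i b + 2 * int p" "int n"] nz[of i i]
        by (simp add: algebra_simps divide_inverse power_inverse)
      also have "\<dots> \<noteq> 0" using \<mu>(1) Qnz[of "kf i b + 2 * int p - int n"] Suc.prems by simp
      finally have "Eop i ((Fop i ^^ Suc n) y) \<noteq> 0"
        unfolding Eop_Fpow[OF y(4) \<mu>(3,2)] string_sum
        using geometric_nonzero[OF nru[OF i], of n] Suc by (simp del: sum.lessThan_Suc)
      then show ?case by (auto simp del: funpow.simps)
    qed (use y in simp)
    \<comment> \<open>The first p steps undo the E's, and the other \<open>kf i b\<close> steps lead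
      to the mirror image.\<close>
    have "(Fop i ^^ (p + nat (kf i b))) y \<noteq> 0" using F True by simp
    moreover have "has_wt ((Fop i ^^ (p + nat (kf i b))) y) (b(i := b i + kf i b))"
      using has_wt_Fpow[OF y(3), where i = i and n = "p + nat (kf i b)"] True by simp
    ultimately show ?thesis using weights_I Lspan_Fpow[OF y(1) Ev[OF i]] by blast
  next
    case False
    \<comment> \<open>For a negative pairing the string is entered from its lower end, whose
      existence is local nilpotency.\<close>
    obtain m where m: "(Fop i ^^ m) f = 0" using even_nilpotent[OF i] f_def by blast
    then obtain p where p: "(Fop i ^^ p) f \<noteq> 0" "(Fop i ^^ Suc p) f = 0"
      using f(2) ex_least_nat_less[of "\<lambda>n. (Fop i ^^ n) f = 0" m]
      by (auto simp del: funpow.simps(2))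
    define y where "y = (Fop i ^^ p) f"
    have y: "y \<in> Lspan N" "y \<noteq> 0" "has_wt y (b(i := b i + int p))" "Fop i y = 0"
      using p f Lspan_Fpow[OF f(1) Ev[OF i]] has_wt_Fpow[OF f(3), where i = i and n = p] by (auto simp: y_def)
    obtain \<mu> where \<mu>: "\<mu> \<noteq> 0" "Lop i y = scl \<mu> y" "Kop i y = scl (\<mu> * q i i powi (kf i b - 2 * int p)) y"
      by (rule eigen[OF i y(1-3)]) (use kf_upd[OF i, of b "int p"] in simp)
    have E: "(Eop i ^^ n) y \<noteq> 0" if "int n \<le> - (kf i b - 2 * int p)" for n
      using that
    proof (induction n)
      case (Suc n)
      have ab: "inverse (q i i) ^ n * (q i i ^ n * z) = z" for z by (simp add: nz power_inverse)
      have "inverse (q i i) ^ n * \<mu> - \<mu> * q i i powi (kf i b - 2 * int p) = \<mu> * inverse (q i i) ^ n * (1 - q i i powi (kf i b - 2 * int p + int n))"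
        using ab power_int_add[of "q i i" "kf i b - 2 * int p" "int n"] nz[of i i]
        by (simp add: algebra_simps)
      also have "\<dots> \<noteq> 0" using \<mu>(1) nz[of i i] Qnz[of "kf i b - 2 * int p + int n"] Suc.prems by simp
      finally have "Fop i ((Eop i ^^ Suc n) y) \<noteq> 0"
        unfolding Fop_Epow[OF y(4) \<mu>(3,2)] string_sum'
        using geometric_nonzero[OF nru[OF i], of n] Suc by (simp del: sum.lessThan_Suc)
      then show ?case by (auto simp del: funpow.simps)
    qed (use y in simp)
    have "(Eop i ^^ (p + nat (- kf i b))) y \<noteq> 0" using E False by simp
    moreover have "has_wt ((Eop i ^^ (p + nat (- kf i b))) y) (b(i := b i + kf i b))"
      using has_wt_Epow[OF y(3), where i = i and n = "p + nat (- kf i b)"] False by simp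
    ultimately show ?thesis using weights_I Lspan_Epow[OF y(1)] by blast
  qed
qed

end

section \<open>Odd root vectors along a row of type A\<close>

context shuffle
begin

text \<open>A root vector x_a for \<alpha>_s + ... + \<alpha>_{s+a}. Plain commutators are the right
  ones when q is 1 above the diagonal: the twist of F_{s+a+1} against smaller indices is then
  1.\<close>

primrec xop :: "nat \<Rightarrow> nat \<Rightarrow> 'k vec \<Rightarrow> 'k vec" where
  "xop s 0 f = Fop s f"
| "xop s (Suc a) f = Fop (s + Suc a) (xop s a f) - xop s a (Fop (s + Suc a) f)"

lemma xop_linear [simp]:
  "xop s a (f + g) = xop s a f + xop s a g" "xop s a (scl t f) = scl t (xop s a f)"
  by (induction a arbitrary: f g) (simp_all, (rule vec_eqI, simp add: algebra_simps)+)

lemma xop_zero [simp]: "xop s a 0 = 0" using xop_linear(2)[of s a 0 0] by simp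

lemma xop_uminus [simp]: "xop s a (- f) = - xop s a f"
  using xop_linear(2)[of s a "- 1" f] by (simp add: vec.scale_minus_left)

lemma xop_diff [simp]: "xop s a (f - g) = xop s a f - xop s a g"
  using xop_linear(1)[of s a f "- g"] by simp

lemma Fop_xop_Suc: "Fop (s + Suc a) (xop s a f) = xop s (Suc a) f + xop s a (Fop (s + Suc a) f)"
  by simp

lemma xop_in:
  assumes "vec.subspace W" "\<And>j g. j \<in> {s..s + a} \<Longrightarrow> g \<in> W \<Longrightarrow> Fop j g \<in> W"
  shows "g \<in> W \<Longrightarrow> xop s a g \<in> W"
  using assms(2)
  by (induction a arbitrary: g) (auto intro!: vec.subspace_diff[OF assms(1)])

end

lemma scl_double_zero: "scl (1 + t) f = 0 \<Longrightarrow> t \<noteq> - 1 \<Longrightarrow> f = 0"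
  by (simp add: add_eq_0_iff)

text \<open>Brings the quadratic Serre relation into a form in which p, the inverse of Q, no longer
  occurs.\<close>

lemma serre_coefficients:
  fixes A B C Q p :: "'k::field"
  assumes "A - p * B - Q * p * (B - p * C) = 0" "p * Q = 1"
  shows "Q * A = (1 + Q) * B - C"
proof -
  have "Q \<noteq> 0" "p = inverse Q" using assms(2) inverse_unique[of Q p] by (auto simp: mult.commute)
  with assms(1) have "Q * (C + A * Q) = Q * (B + B * Q)" by (simp add: field_simps)
  then have "C + A * Q = B + B * Q" using \<open>Q \<noteq> 0\<close> by (metis mult_left_cancel)
  then show ?thesis by (simp add: algebra_simps)
qed

text \<open>The p's will be eight words in F_{s+a}, F_{s+a+1} and x_{a-1}. The alternating sum in
  the conclusion is the commutator of F_{s+a} with x_{a+1}, and the four assumptions are Serre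
  relations in which the other words are eliminated.\<close>

lemma serre_elimination:
  fixes Q :: "'k::field"
  assumes "p1 = (1 + Q) * p3 - Q * p2" "Q * p1 = (1 + Q) * p5 - p4"
    "p4 = (1 + Q) * p7 - Q * p6" "Q * p2 = (1 + Q) * p8 - p6"
  shows "(1 + Q) * (p5 + p3 + p6 - (p1 + p7 + p8)) = 0"
proof -
  have "(1 + Q) * (p5 + p3 + p6 - (p1 + p7 + p8)) =
      ((1 + Q) * p3 - Q * p2 - p1) + ((1 + Q) * p5 - p4 - Q * p1)
      - ((1 + Q) * p7 - Q * p6 - p4) - ((1 + Q) * p8 - p6 - Q * p2)"
    by (simp add: algebra_simps)
  also have "\<dots> = 0" using assms by simp
  finally show ?thesis .
qed

text \<open>The row s, ..., s + n starts at the odd node s and goes on with even nodes;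
  \<open>left\<close> and \<open>right\<close> make the Serre exponent of neighbours equal to 1. The
  node z lies outside the row and may interact with it, and all remaining nodes are disconnected
  from the row.\<close>

locale pre_odd_row = shuffle_nz q k l for q :: "nat \<Rightarrow> nat \<Rightarrow> 'k::field" and k l +
  fixes N s n z :: nat
  assumes norm: "i < j \<Longrightarrow> q i j = 1"
    and row: "1 \<le> s" "s + n \<le> N" "z \<notin> {s..s + n}"
    and odd: "q s s = - 1"
    and far: "a + 2 \<le> b \<Longrightarrow> b \<le> n \<Longrightarrow> q (s + b) (s + a) = 1"
    and even_nz: "1 \<le> a \<Longrightarrow> a \<le> n \<Longrightarrow> q (s + a) (s + a) \<noteq> - 1"
    and left: "Suc a \<le> n \<Longrightarrow> q (s + Suc a) (s + a) * q (s + Suc a) (s + Suc a) = 1"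
    and right: "1 \<le> a \<Longrightarrow> Suc a \<le> n \<Longrightarrow> q (s + Suc a) (s + a) * q (s + a) (s + a) = 1"
    and others: "j \<in> {1..N} - {s..s + n} - {z} \<Longrightarrow> a \<le> n \<Longrightarrow> q j (s + a) = 1 \<and> q (s + a) j = 1"
begin

abbreviation "go a \<equiv> Fop (s + a)"
abbreviation "xo \<equiv> xop s"

lemma go_comm: assumes "a + 2 \<le> b" "b \<le> n" shows "go b (go a f) = go a (go b f)"
proof -
  have "q (s + a) (s + b) * q (s + b) (s + a) = 1" "s + b \<noteq> s + a"
    using far[OF assms] norm[of "s + a" "s + b"] assms by auto
  from Fop_comm[OF this(2)] this(1) norm[of "s + a" "s + b"] assms show ?thesis
    by (simp add: mult.commute)
qed

lemma serre_left:
  assumes "Suc a \<le> n"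
  shows "go (Suc a) (go (Suc a) (go a f)) = scl (1 + q (s + Suc a) (s + Suc a)) (go (Suc a) (go a (go (Suc a) f)))
    - scl (q (s + Suc a) (s + Suc a)) (go a (go (Suc a) (go (Suc a) f)))"
proof -
  have "q (s + Suc a) (s + a) * q (s + a) (s + Suc a) * q (s + Suc a) (s + Suc a) ^ 1 = 1"
    using left[OF assms] norm[of "s + a" "s + Suc a"] by simp
  from serre[OF _ this, of f] norm[of "s + a" "s + Suc a"]
  have *: "adF (s + Suc a) (s + a) 2 f = 0" by (simp add: numeral_2_eq_2 del: adF.simps add: adF.simps)
  show ?thesis
  proof (rule vec_eqI)
    fix u show "coef (go (Suc a) (go (Suc a) (go a f))) u = coef (scl (1 + q (s + Suc a) (s + Suc a)) (go (Suc a) (go a (go (Suc a) f)))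
    - scl (q (s + Suc a) (s + Suc a)) (go a (go (Suc a) (go (Suc a) f)))) u"
      using arg_cong[OF *, of "\<lambda>f. coef f u"] norm[of "s + a" "s + Suc a"]
      by (simp add: numeral_2_eq_2 algebra_simps)
  qed
qed

lemma serre_right:
  assumes "1 \<le> a" "Suc a \<le> n"
  shows "scl (q (s + a) (s + a)) (go a (go a (go (Suc a) f))) = scl (1 + q (s + a) (s + a)) (go a (go (Suc a) (go a f)))
    - go (Suc a) (go a (go a f))"
proof -
  have r: "q (s + Suc a) (s + a) * q (s + a) (s + a) = 1" using right[OF assms] .
  then have "q (s + a) (s + Suc a) * q (s + Suc a) (s + a) * q (s + a) (s + a) ^ 1 = 1"
    using norm[of "s + a" "s + Suc a"] by simp
  from serre[OF _ this, of f]
  have *: "adF (s + a) (s + Suc a) 2 f = 0" by (simp add: numeral_2_eq_2 del: adF.simps add: adF.simps)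
  show ?thesis
  proof (rule vec_eqI)
    fix u
    have "coef (adF (s + a) (s + Suc a) 2 f) u = 0" using * by simp
    then show "coef (scl (q (s + a) (s + a)) (go a (go a (go (Suc a) f)))) u = coef (scl (1 + q (s + a) (s + a)) (go a (go (Suc a) (go a f)))
    - go (Suc a) (go a (go a f))) u"
      using serre_coefficients[OF _ r, of "coef (go a (go a (go (Suc a) f))) u"
        "coef (go a (go (Suc a) (go a f))) u" "coef (go (Suc a) (go a (go a f))) u"]
      by (simp add: numeral_2_eq_2 del: add_Suc_right)
  qed
qed

lemma go_xo_far: "a + 2 \<le> b \<Longrightarrow> b \<le> n \<Longrightarrow> go b (xo a f) = xo a (go b f)"
proof (induction a arbitrary: f)
  case 0
  then show ?case using go_comm[of 0 b f] by simp
next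
  case (Suc a)
  have "go b (go (Suc a) h) = go (Suc a) (go b h)" for h using go_comm[of "Suc a" b] Suc.prems by simp
  then show ?case using Suc by simp
qed

text \<open>This is the Serre relation for the last two letters of x_a; the earlier letters commute
  with F_{s+a}.\<close>

lemma go_xo_self:
  assumes "1 \<le> a" "a \<le> n"
  shows "go a (xo a f) = scl (q (s + a) (s + a)) (xo a (go a f))"
proof -
  obtain b where a: "a = Suc b" using assms by (cases a) auto
  define Z where "Z f = go a (go b f) - go b (go a f)" for f
  have Z: "go a (Z f) = scl (q (s + a) (s + a)) (Z (go a f))" for f
    using serre_left[of b f] assms unfolding a Z_def
    by (simp, intro vec_eqI, simp add: algebra_simps)
  show ?thesis
  proof (cases b)
    case 0
    then show ?thesis using Z[of f] unfolding Z_def a by simp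
  next
    case (Suc d)
    have c: "go a (xo d h) = xo d (go a h)" for h
      using go_xo_far[of d a h] assms a Suc by simp
    have x: "xo a f = Z (xo d f) - xo d (Z f)" for f
      using c unfolding Z_def a Suc by simp
    show ?thesis unfolding x
      by (simp add: c Z vec.scale_right_diff_distrib)
  qed
qed

text \<open>The rank three computation: \<alpha>_{s+a} sits inside the root of x_{a+1}, so Serre
  relations with both neighbours enter. They give 1 + Q times the claim, and Q is not -1 at an even
  node.\<close>

lemma go_xo_pred:
  assumes "1 \<le> a" "Suc a \<le> n"
  shows "go a (xo (Suc a) f) = xo (Suc a) (go a f)"
proof -
  obtain b where a: "a = Suc b" using assms by (cases a) auto
  define Q where "Q = q (s + a) (s + a)"
  have Q: "Q \<noteq> - 1" using even_nz[of a] assms by (simp add: Q_def)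
  have c: "go (Suc a) (xo b h) = xo b (go (Suc a) h)" for h using go_xo_far[of b "Suc a"] assms a by simp
  have xo: "xo a h = go a (xo b h) - xo b (go a h)" for h unfolding a by simp
  have e1: "go a (go a (xo b h)) = scl (1 + Q) (go a (xo b (go a h))) - scl Q (xo b (go a (go a h)))" for h
    using go_xo_self[of a h] assms unfolding xo Q_def[symmetric]
    by (simp, intro vec_eqI, drule_tac arg_cong[where f = "\<lambda>f. coef f _"], simp add: algebra_simps)
  have e2: "scl Q (go a (go a (go (Suc a) h))) = scl (1 + Q) (go a (go (Suc a) (go a h))) - go (Suc a) (go a (go a h))" for h
    using serre_right[OF assms, of h] unfolding Q_def .
  show ?thesis
  proof (rule vec_eqI)
    fix u
    have 1: "coef (go a (go a (xo b (go (Suc a) f)))) u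
        = (1 + Q) * coef (go a (xo b (go a (go (Suc a) f)))) u - Q * coef (xo b (go a (go a (go (Suc a) f)))) u"
      using arg_cong[OF e1[of "go (Suc a) f"], of "\<lambda>f. coef f u"] by simp
    have 2: "Q * coef (go a (go a (xo b (go (Suc a) f)))) u
        = (1 + Q) * coef (go a (go (Suc a) (go a (xo b f)))) u - coef (go (Suc a) (go a (go a (xo b f)))) u"
      using arg_cong[OF e2[of "xo b f"], of "\<lambda>f. coef f u"] by (simp add: c del: add_Suc_right)
    have 3: "coef (go (Suc a) (go a (go a (xo b f)))) u
        = (1 + Q) * coef (go (Suc a) (go a (xo b (go a f)))) u - Q * coef (xo b (go (Suc a) (go a (go a f)))) u"
      using arg_cong[OF e1[of f], of "\<lambda>f. coef (go (Suc a) f) u"] by (simp add: c del: add_Suc_right)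
    have 4: "Q * coef (xo b (go a (go a (go (Suc a) f)))) u
        = (1 + Q) * coef (xo b (go a (go (Suc a) (go a f)))) u - coef (xo b (go (Suc a) (go a (go a f)))) u"
      using arg_cong[OF e2[of f], of "\<lambda>f. coef (xo b f) u"] by simp
    have "(1 + Q) * (coef (go a (xo (Suc a) f)) u - coef (xo (Suc a) (go a f)) u) = 0"
      using serre_elimination[OF 1 2 3 4] by (simp add: xo c algebra_simps del: add_Suc_right)
    moreover have "1 + Q \<noteq> 0" using Q by (simp add: add_eq_0_iff)
    ultimately show "coef (go a (xo (Suc a) f)) u = coef (xo (Suc a) (go a f)) u" by simp
  qed
qed

lemma go_xo_below:
  assumes "1 \<le> a" "a < b" "b \<le> n"
  shows "go a (xo b f) = xo b (go a f)"
  using assms(2,3)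
proof (induction b arbitrary: f)
  case (Suc b)
  show ?case
  proof (cases "b = a")
    case True
    then show ?thesis using go_xo_pred[of a f] assms(1) Suc.prems by (simp del: xop.simps)
  next
    case False
    then have "go a (go (Suc b) h) = go (Suc b) (go a h)" for h
      using go_comm[of a "Suc b"] Suc.prems by simp
    then show ?thesis using Suc False by simp
  qed
qed simp

text \<open>Commutators with F_{s+a+1} propagate F_s^2 = 0 along the row: one commutator with x_a^2
  = 0 gives the anticommutation of x_a and x_{a+1}, and a second one gives (1 + Q) x_{a+1}^2 =
  0.\<close>

lemma xo_square_and_step:
  "a \<le> n \<Longrightarrow> xo a (xo a f) = 0"
  "Suc a \<le> n \<Longrightarrow> xo (Suc a) (xo a f) + xo a (xo (Suc a) f) = 0"
proof -
  have step: "xo (Suc a) (xo a f) + xo a (xo (Suc a) f) = 0"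
    if "\<And>f. xo a (xo a f) = 0" for a f
    using that[of f] that[of "go (Suc a) f"] by (simp add: that)
  have sq: "xo a (xo a f) = 0" if "a \<le> n" for a f
    using that
  proof (induction a arbitrary: f)
    case 0
    then show ?case using Fop_square_zero[OF odd] by simp
  next
    case (Suc a)
    define Q where "Q = q (s + Suc a) (s + Suc a)"
    have A: "xo (Suc a) (xo a f) + xo a (xo (Suc a) f) = 0" for f using step Suc by auto
    have GX: "go (Suc a) (xo (Suc a) h) = scl Q (xo (Suc a) (go (Suc a) h))" for h
      using go_xo_self[of "Suc a" h] Suc.prems unfolding Q_def by (simp del: xop.simps)
    \<comment> \<open>Once F_{s+a+1} has been moved to the right, everything except the squares is
      again an anticommutator, hence zero.\<close>
    have "0 = go (Suc a) (xo (Suc a) (xo a f) + xo a (xo (Suc a) f))" by (simp only: A Fop_zero)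
    also have "\<dots> = scl Q (xo (Suc a) (go (Suc a) (xo a f))) + go (Suc a) (xo a (xo (Suc a) f))"
      by (simp only: Fop_add GX)
    also have "\<dots> = scl (1 + Q) (xo (Suc a) (xo (Suc a) f)) + scl Q (xo (Suc a) (xo a (go (Suc a) f)) + xo a (xo (Suc a) (go (Suc a) f)))"
      unfolding Fop_xop_Suc GX xop_linear by (intro vec_eqI) (simp add: algebra_simps del: xop.simps)
    also have "\<dots> = scl (1 + Q) (xo (Suc a) (xo (Suc a) f))" by (simp only: A vec.scale_zero_right add_0_right)
    finally have "scl (1 + Q) (xo (Suc a) (xo (Suc a) f)) = 0" by simp
    moreover have "Q \<noteq> - 1" using even_nz[of "Suc a"] Suc.prems by (simp add: Q_def)
    ultimately show ?case by (rule scl_double_zero)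
  qed
  then show "a \<le> n \<Longrightarrow> xo a (xo a f) = 0" .
  show "Suc a \<le> n \<Longrightarrow> xo (Suc a) (xo a f) + xo a (xo (Suc a) f) = 0" using step sq by auto
qed

lemma xo_anticomm_less:
  assumes "a < b" "b \<le> n" shows "xo b (xo a f) = - xo a (xo b f)"
  using assms
proof (induction b arbitrary: f)
  case (Suc b)
  show ?case
  proof (cases "b = a")
    case True
    then show ?thesis using xo_square_and_step(2)[of a f] Suc.prems by (simp add: eq_neg_iff_add_eq_0 del: xop.simps)
  next
    case False
    then have "go (Suc b) (xo a h) = xo a (go (Suc b) h)" for h
      using go_xo_far[of a "Suc b"] Suc.prems by simp
    then show ?thesis using Suc False by simp
  qed
qed simp

lemma xo_anticomm:
  assumes "a \<noteq> b" "a \<le> n" "b \<le> n" shows "xo a (xo b f) = - xo b (xo a f)"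
  using xo_anticomm_less[of a b f] xo_anticomm_less[of b a f] assms by (cases "a < b") auto

text \<open>A relation between x_0, x_1 and F_z spreads to all pairs a < b, since commuting with the
  even F's of the row raises the indices and these F's commute with F_z.\<close>

lemma special_extend:
  fixes c1 c2 c3 :: 'k
  assumes base: "\<And>f. xo 0 (xo 1 (Fop z f)) = scl c1 (xo 0 (Fop z (xo 1 f)))
        + scl c2 (xo 1 (Fop z (xo 0 f))) + scl c3 (Fop z (xo 0 (xo 1 f)))"
    and comm: "\<And>a f. 1 \<le> a \<Longrightarrow> a \<le> n \<Longrightarrow> go a (Fop z f) = Fop z (go a f)"
    and ab: "a < b" "b \<le> n"
  shows "xo a (xo b (Fop z f)) = scl c1 (xo a (Fop z (xo b f)))
        + scl c2 (xo b (Fop z (xo a f))) + scl c3 (Fop z (xo a (xo b f)))"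
proof -
  define R where "R a b f \<longleftrightarrow> xo a (xo b (Fop z f)) = scl c1 (xo a (Fop z (xo b f)))
        + scl c2 (xo b (Fop z (xo a f))) + scl c3 (Fop z (xo a (xo b f)))" for a b f
  \<comment> \<open>The larger index is raised first, with 0 kept fixed; then the smaller one is
    raised below b, where its generator commutes with x_b.\<close>
  have first: "Suc b \<le> n \<Longrightarrow> R 0 (Suc b) f" for b f
  proof (induction b arbitrary: f)
    case 0
    then show ?case using base by (simp add: R_def)
  next
    case (Suc b f)
    define g where "g = go (Suc (Suc b))"
    have c: "g (Fop z f) = Fop z (g f)" "g (xo 0 f) = xo 0 (g f)" for f
      using comm[of "Suc (Suc b)" f] go_xo_far[of 0 "Suc (Suc b)" f] Suc.prems by (simp_all add: g_def)
    have x: "xo (Suc (Suc b)) h = g (xo (Suc b) h) - xo (Suc b) (g h)" for h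
      by (simp add: g_def)
    have lin: "g (f + h) = g f + g h" "g (scl t f) = scl t (g f)" for f h t by (simp_all add: g_def)
    have "xo 0 (xo (Suc (Suc b)) (Fop z f)) = g (xo 0 (xo (Suc b) (Fop z f))) - xo 0 (xo (Suc b) (Fop z (g f)))"
      unfolding x by (simp add: c del: xop.simps)
    also have "\<dots> = g (scl c1 (xo 0 (Fop z (xo (Suc b) f)))
        + scl c2 (xo (Suc b) (Fop z (xo 0 f))) + scl c3 (Fop z (xo 0 (xo (Suc b) f))))
      - (scl c1 (xo 0 (Fop z (xo (Suc b) (g f))))
        + scl c2 (xo (Suc b) (Fop z (xo 0 (g f)))) + scl c3 (Fop z (xo 0 (xo (Suc b) (g f)))))"
      using Suc unfolding R_def by (simp del: xop.simps)
    also have "\<dots> = scl c1 (xo 0 (Fop z (xo (Suc (Suc b)) f)))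
        + scl c2 (xo (Suc (Suc b)) (Fop z (xo 0 f))) + scl c3 (Fop z (xo 0 (xo (Suc (Suc b)) f)))"
      unfolding x lin by (simp add: c vec.scale_right_diff_distrib del: xop.simps)
    finally show ?case unfolding R_def .
  qed
  have "a < b \<Longrightarrow> R a b f" for a f
  proof (induction a arbitrary: f)
    case 0
    then show ?case using first[of "b - 1"] ab by simp
  next
    case (Suc a f)
    define g where "g = go (Suc a)"
    have c: "g (Fop z f) = Fop z (g f)" "g (xo b f) = xo b (g f)" for f
      using comm[of "Suc a" f] go_xo_below[of "Suc a" b f] Suc.prems ab by (simp_all add: g_def)
    have x: "xo (Suc a) h = g (xo a h) - xo a (g h)" for h
      by (simp add: g_def)
    have lin: "g (f + h) = g f + g h" "g (scl t f) = scl t (g f)" for f h t by (simp_all add: g_def)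
    have "xo (Suc a) (xo b (Fop z f)) = g (xo a (xo b (Fop z f))) - xo a (xo b (Fop z (g f)))"
      unfolding x by (simp add: c del: xop.simps)
    also have "\<dots> = g (scl c1 (xo a (Fop z (xo b f)))
        + scl c2 (xo b (Fop z (xo a f))) + scl c3 (Fop z (xo a (xo b f))))
      - (scl c1 (xo a (Fop z (xo b (g f))))
        + scl c2 (xo b (Fop z (xo a (g f)))) + scl c3 (Fop z (xo a (xo b (g f)))))"
      using Suc unfolding R_def by (simp del: xop.simps)
    also have "\<dots> = scl c1 (xo (Suc a) (Fop z (xo b f)))
        + scl c2 (xo b (Fop z (xo (Suc a) f))) + scl c3 (Fop z (xo (Suc a) (xo b f)))"
      unfolding x lin by (simp add: c vec.scale_right_diff_distrib del: xop.simps)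
    finally show ?case unfolding R_def .
  qed
  then show ?thesis using ab by (simp add: R_def)
qed

end

section \<open>The bound in the odd direction\<close>

text \<open>The relation \<open>special\<close> replaces two odd root vectors to the left of F_z by
  terms in which at least one of them stands to the right of F_z.\<close>

locale odd_row = pre_odd_row q k l N s n z for q :: "nat \<Rightarrow> nat \<Rightarrow> 'k::field" and k l N s n z +
  fixes c1 c2 c3 :: 'k
  assumes special: "z \<in> {1..N} \<Longrightarrow> a < b \<Longrightarrow> b \<le> n \<Longrightarrow>
      xop s a (xop s b (Fop z f)) = scl c1 (xop s a (Fop z (xop s b f)))
        + scl c2 (xop s b (Fop z (xop s a f))) + scl c3 (Fop z (xop s a (xop s b f)))"
begin

text \<open>Each x_a contains F_s exactly once, so this filtration counts odd root vectors minus
  letters F_z.\<close>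

definition lead :: "int \<Rightarrow> 'k vec set" where
  "lead t = {f. \<forall>u. coef f u \<noteq> 0 \<longrightarrow> cnt u s - cnt u z \<le> t}"

lemma lead_subspace: "vec.subspace (lead t)"
  unfolding lead_def
proof (rule vec.subspaceI)
  fix x y :: "'k vec"
  assume "x \<in> {f. \<forall>u. coef f u \<noteq> 0 \<longrightarrow> cnt u s - cnt u z \<le> t}" "y \<in> {f. \<forall>u. coef f u \<noteq> 0 \<longrightarrow> cnt u s - cnt u z \<le> t}"
  then show "x + y \<in> {f. \<forall>u. coef f u \<noteq> 0 \<longrightarrow> cnt u s - cnt u z \<le> t}"
    by simp (metis add_0)
qed auto

lemma Fop_support: "coef (Fop i f) u \<noteq> 0 \<Longrightarrow> \<exists>v. coef f v \<noteq> 0 \<and> cnt u = (cnt v)(i := cnt v i + 1)"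
proof (induction u arbitrary: f)
  case (Cons j u)
  have "coef (Fop i f) (j # u) = coef (Eop j (Fop i f)) u" by (simp add: coef_Eop)
  then have "coef (Fop i (Eop j f)) u \<noteq> 0 \<or> j = i \<and> coef f u \<noteq> 0"
    using Cons.prems(1) by (auto simp: Eop_Fop Lop_def Kop_def split: if_splits)
  then show ?case
  proof
    assume "coef (Fop i (Eop j f)) u \<noteq> 0"
    from Cons.IH[OF this] obtain v where v: "coef f (j # v) \<noteq> 0" "cnt u = (cnt v)(i := cnt v i + 1)"
      unfolding coef_Eop by blast
    then have "cnt (j # u) = (cnt (j # v))(i := cnt (j # v) i + 1)"
      by (simp add: cnt_simps fun_eq_iff)
    with v(1) show ?thesis by blast
  next
    assume "j = i \<and> coef f u \<noteq> 0"
    then show ?thesis by (intro exI[of _ u]) (simp add: cnt_simps)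
  qed
qed simp

lemma lead_Fop:
  assumes "f \<in> lead t"
  shows "Fop j f \<in> lead (t + (if j = s then 1 else 0) - (if j = z then 1 else 0))"
  unfolding lead_def
proof (intro CollectI allI impI)
  fix u assume "coef (Fop j f) u \<noteq> 0"
  then obtain v where "coef f v \<noteq> 0" "cnt u = (cnt v)(j := cnt v j + 1)" using Fop_support by blast
  moreover from this assms have "cnt v s - cnt v z \<le> t" by (auto simp: lead_def)
  moreover have "s \<noteq> z" using row by auto
  ultimately show "cnt u s - cnt u z \<le> t + (if j = s then 1 else 0) - (if j = z then 1 else 0)"
    by auto
qed

lemma lead_xo: "a \<le> n \<Longrightarrow> f \<in> lead t \<Longrightarrow> xo a f \<in> lead (t + 1)"
proof (induction a arbitrary: f)
  case 0
  then show ?case using lead_Fop[of f t s] row by (auto split: if_splits)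
next
  case (Suc a)
  have j: "s + Suc a \<noteq> s" "s + Suc a \<noteq> z" using row Suc.prems by auto
  have F: "g \<in> lead t' \<Longrightarrow> go (Suc a) g \<in> lead t'" for g t' using lead_Fop[of g t' "s + Suc a"] j by simp
  show ?case using Suc F[of "xo a f" "t + 1"] F[of f t]
    by (auto intro!: vec.subspace_diff[OF lead_subspace])
qed

definition "rest = {1..N} - {s, z}"

lemma lead_Fword_rest: "u \<in> lists rest \<Longrightarrow> f \<in> lead t \<Longrightarrow> Fword u f \<in> lead t"
proof (induction u)
  case (Cons j u)
  then have "Fword u f \<in> lead t" "j \<noteq> s" "j \<noteq> z" by (auto simp: rest_def)
  then show ?case using lead_Fop[of "Fword u f" t j] by simp
qed simp

text \<open>Ordered products in the manner of a PBW spanning set: the letters other than s and z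
  stand on the left and do not change the \<open>lead\<close> degree.\<close>

definition rest_span :: "'k vec set \<Rightarrow> 'k vec set" where
  "rest_span B = vec.span {Fword u h | u h. u \<in> lists rest \<and> h \<in> B}"

lemma rest_span_subspace: "vec.subspace (rest_span B)"
  unfolding rest_span_def by (rule vec.subspace_span)

lemma rest_span_base: "u \<in> lists rest \<Longrightarrow> h \<in> B \<Longrightarrow> Fword u h \<in> rest_span B"
  unfolding rest_span_def by (rule vec.span_base) blast

lemma rest_span_Fop:
  assumes "f \<in> rest_span B" "j \<in> rest" shows "Fop j f \<in> rest_span B"
  using assms(1) unfolding rest_span_def
proof (induction rule: vec.span_induct_alt)
  case (step c x y)
  then obtain u h where u: "u \<in> lists rest" "h \<in> B" "x = Fword u h" by auto
  have "Fop j x \<in> rest_span B" using rest_span_base[of "j # u" h B] u assms(2) by simp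
  then show ?case using step unfolding rest_span_def by (simp add: vec.span_add vec.span_scale)
qed (simp add: vec.span_zero)

lemma rest_span_lead:
  assumes "B \<subseteq> lead t" shows "rest_span B \<subseteq> lead t"
  unfolding rest_span_def
  using assms lead_Fword_rest by (intro vec.span_minimal lead_subspace) auto

lemma other_xo:
  assumes "j \<in> rest" "j \<notin> {s..s + n}" "a \<le> n"
  shows "Fop j (xo a f) = xo a (Fop j f)"
  using assms(3)
proof (induction a arbitrary: f)
  case 0
  have "q j (s + 0) = 1 \<and> q (s + 0) j = 1" using assms by (intro others) (auto simp: rest_def)
  then show ?case using Fop_comm[of j s f] assms(1) by (auto simp: rest_def)
next
  case (Suc a)
  have "q j (s + Suc a) = 1 \<and> q (s + Suc a) j = 1"
    using assms Suc.prems by (intro others) (auto simp: rest_def)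
  moreover have "j \<noteq> s + Suc a" using assms(2) Suc.prems by auto
  ultimately have "Fop j (go (Suc a) h) = go (Suc a) (Fop j h)" for h
    using Fop_comm[of j "s + Suc a" h] by simp
  then show ?case using Suc by simp
qed

text \<open>An x_a can be moved to the right through letters of \<open>rest\<close>, at worst
  turning into x_{a+1}; so stability under the x's has to be checked on B alone.\<close>

lemma rest_span_xo:
  assumes B: "\<And>h a. h \<in> B \<Longrightarrow> a \<le> n \<Longrightarrow> xo a h \<in> rest_span B"
    and f: "f \<in> rest_span B" and "a \<le> n"
  shows "xo a f \<in> rest_span B"
proof -
  note sub = rest_span_subspace[of B]
  have word: "u \<in> lists rest \<Longrightarrow> h \<in> B \<Longrightarrow> a \<le> n \<Longrightarrow> xo a (Fword u h) \<in> rest_span B" for u h a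
  proof (induction u arbitrary: a)
    case (Cons j u)
    define y where "y = Fword u h"
    have j: "j \<in> rest" using Cons.prems by auto
    have F: "Fop j (xo a y) \<in> rest_span B" if "a \<le> n" for a
      using Cons.IH[of a] Cons.prems that rest_span_Fop j by (simp add: y_def)
    have "xo a (Fop j y) \<in> rest_span B"
    proof (cases "j \<in> {s..s + n}")
      case False
      with other_xo[OF j False, of a y] F[of a] Cons.prems show ?thesis by simp
    next
      case True
      then obtain d where d: "j = s + d" "d \<le> n" by (auto simp: le_iff_add)
      have d1: "1 \<le> d" using j d by (cases d) (auto simp: rest_def)
      \<comment> \<open>Only d = a + 1 creates a new root vector; in the other cases x_a and F_j
        commute up to a scalar.\<close>
      consider "d = Suc a" | "d = a" | "d < a" | "a + 2 \<le> d" by linarith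
      then show ?thesis
      proof cases
        case 1
        have "xo a (Fop j y) = Fop j (xo a y) - xo d y" unfolding d 1 by simp
        moreover have "xo d y \<in> rest_span B" using Cons.IH[of d] Cons.prems d by (simp add: y_def)
        ultimately show ?thesis using F[of a] Cons.prems vec.subspace_diff[OF sub] by simp
      next
        case 2
        have "xo a (Fop j y) = scl (inverse (q j j)) (Fop j (xo a y))"
          using go_xo_self[OF d1 d(2), of y] nz[of j j] unfolding d 2[symmetric] by simp
        then show ?thesis using F[of a] Cons.prems vec.subspace_scale[OF sub] by simp
      next
        case 3
        then show ?thesis using go_xo_below[OF d1 3, of y] F[of a] Cons.prems d by simp
      next
        case 4
        then show ?thesis using go_xo_far[OF 4 d(2), of y] F[of a] Cons.prems d by simp
      qed
    qed
    then show ?case by (simp add: y_def)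
  qed (use B in simp)
  show ?thesis using f unfolding rest_span_def
  proof (induction rule: vec.span_induct_alt)
    case (step c x y)
    then have "xo a x \<in> rest_span B" using word \<open>a \<le> n\<close> by auto
    then show ?case using step unfolding rest_span_def by (simp add: vec.span_add vec.span_scale)
  qed (simp add: vec.span_zero)
qed

definition good :: "'k vec set \<Rightarrow> bool" where
  "good W \<longleftrightarrow> vec.subspace W \<and> (\<forall>j\<in>{1..N} - {z}. \<forall>g\<in>W. Fop j g \<in> W) \<and> W \<subseteq> lead (int n + 1)"

lemma good_rest_span:
  assumes "\<And>h a. h \<in> B \<Longrightarrow> a \<le> n \<Longrightarrow> xo a h \<in> rest_span B" "B \<subseteq> lead (int n + 1)"
  shows "good (rest_span B)"
proof -
  have "Fop j g \<in> rest_span B" if "j \<in> {1..N} - {z}" "g \<in> rest_span B" for j g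
  proof (cases "j = s")
    case True
    then show ?thesis using rest_span_xo[of B g 0] assms(1) that by simp
  next
    case False
    then show ?thesis using rest_span_Fop[of g B j] that by (auto simp: rest_def)
  qed
  then show ?thesis using assms(2) rest_span_lead rest_span_subspace by (auto simp: good_def)
qed

lemma good_xo: "good W \<Longrightarrow> g \<in> W \<Longrightarrow> a \<le> n \<Longrightarrow> xo a g \<in> W"
  using row by (intro xop_in[of W s a g]) (auto simp: good_def)

text \<open>The exterior algebra on x_0, ..., x_n applied to \<open>vac\<close>. It has at most n +
  1 factors, which is where the bound n + 1 comes from.\<close>

definition base0 :: "'k vec set" where
  "base0 = {foldr xo as vac | as. distinct as \<and> set as \<subseteq> {..n}}"

lemma xo_word_repeated: "a \<in> set as \<Longrightarrow> set as \<subseteq> {..n} \<Longrightarrow> xo a (foldr xo as f) = 0"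
proof (induction as)
  case (Cons b as)
  show ?case
  proof (cases "a = b")
    case True
    then show ?thesis using xo_square_and_step(1) Cons.prems by simp
  next
    case False
    then show ?thesis using xo_anticomm[of a b "foldr xo as f"] Cons by auto
  qed
qed simp

lemma foldr_xo_lead: "set as \<subseteq> {..n} \<Longrightarrow> foldr xo as vac \<in> lead (int (length as))"
proof (induction as)
  case Nil
  show ?case using has_wt_vac by (auto simp: lead_def has_wt_def cnt_simps)
next
  case (Cons a as)
  then show ?case using lead_xo[of a "foldr xo as vac" "int (length as)"] by (simp add: add.commute)
qed

lemma good_base0: "good (rest_span base0)"
proof (rule good_rest_span)
  fix h a assume "h \<in> base0" "a \<le> n"
  then obtain as where as: "h = foldr xo as vac" "distinct as" "set as \<subseteq> {..n}" by (auto simp: base0_def)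
  show "xo a h \<in> rest_span base0"
  proof (cases "a \<in> set as")
    case True
    then show ?thesis using xo_word_repeated as vec.subspace_0[OF rest_span_subspace] by simp
  next
    case False
    then have "foldr xo (a # as) vac \<in> base0" unfolding base0_def using as \<open>a \<le> n\<close> by (intro CollectI exI[of _ "a # as"]) auto
    then show ?thesis using rest_span_base[of "[]" "xo a h" base0] as by simp
  qed
next
  show "base0 \<subseteq> lead (int n + 1)"
  proof
    fix h assume "h \<in> base0"
    then obtain as where as: "h = foldr xo as vac" "distinct as" "set as \<subseteq> {..n}" by (auto simp: base0_def)
    have "length as \<le> n + 1" using card_mono[OF _ as(3)] distinct_card[OF as(2)] by simp
    then show "h \<in> lead (int n + 1)" using foldr_xo_lead[OF as(3)] as(1) by (fastforce simp: lead_def)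
  qed
qed

text \<open>After a further F_z, at most one odd root vector has to be kept on its left.\<close>

definition next_base :: "'k vec set \<Rightarrow> 'k vec set" where
  "next_base W = {Fop z g | g. g \<in> W} \<union> {xo a (Fop z g) | a g. a \<le> n \<and> g \<in> W}"

text \<open>F_z lowers the \<open>lead\<close> degree from n + 1 to n, and the single x_a in front
  restores n + 1: the bound does not grow with the number of F_z.\<close>

lemma good_next:
  assumes W: "good W" and z: "z \<in> {1..N}"
  shows "good (rest_span (next_base W))"
proof (rule good_rest_span)
  note sub = rest_span_subspace[of "next_base W"]
  have b: "h \<in> next_base W \<Longrightarrow> h \<in> rest_span (next_base W)" for h
    using rest_span_base[of "[]" h "next_base W"] by simp
  have g1: "Fop z g \<in> rest_span (next_base W)" if "g \<in> W" for g
    using that by (intro b) (auto simp: next_base_def)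
  have g2: "xo a (Fop z g) \<in> rest_span (next_base W)" if "g \<in> W" "a \<le> n" for g a
    using that by (intro b) (auto simp: next_base_def)
  \<comment> \<open>The x's that \<open>special\<close> leaves to the right of F_z are absorbed by
    W, which is stable under all of them.\<close>
  have two: "xo a (xo b (Fop z g)) \<in> rest_span (next_base W)" if "a < b" "b \<le> n" "g \<in> W" for a b g
    unfolding special[OF z that(1,2)] using good_xo[OF W] that g1 g2
    by (intro vec.subspace_add[OF sub] vec.subspace_scale[OF sub]) auto
  fix h a assume "h \<in> next_base W" and a: "a \<le> n"
  then consider g where "h = Fop z g" "g \<in> W" | b g where "h = xo b (Fop z g)" "b \<le> n" "g \<in> W"
    by (auto simp: next_base_def)
  then show "xo a h \<in> rest_span (next_base W)"
  proof cases
    case 1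
    then show ?thesis using g2 a by simp
  next
    case 2
    consider "a = b" | "a < b" | "b < a" by linarith
    then show ?thesis
    proof cases
      case 1
      then show ?thesis using 2 xo_square_and_step(1) vec.subspace_0[OF sub] by simp
    next
      case 3
      then show ?thesis using 2 a xo_anticomm[of a b] vec.subspace_neg[OF sub two[of b a g]] by simp
    qed (use two 2 in auto)
  qed
next
  have "Fop z g \<in> lead (int n)" if "g \<in> W" for g
  proof -
    have "g \<in> lead (int n + 1)" using that W by (auto simp: good_def)
    from lead_Fop[OF this, of z] row show ?thesis by (auto split: if_splits)
  qed
  moreover have "lead (int n) \<subseteq> lead (int n + 1)" by (fastforce simp: lead_def)
  ultimately show "next_base W \<subseteq> lead (int n + 1)"
    using lead_xo[of _ _ "int n"] by (auto simp: next_base_def)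
qed

text \<open>By induction on the number d of letters z: \<open>base0\<close> serves d = 0, and each
  further z replaces W by the span of \<open>next_base W\<close>.\<close>

lemma words_good:
  "\<exists>W. good W \<and> (\<forall>w\<in>lists {1..N}. count_list w z = d \<longrightarrow> Fword w vac \<in> W)"
proof (induction d)
  case 0
  have "w \<in> lists {1..N} \<Longrightarrow> count_list w z = 0 \<Longrightarrow> Fword w vac \<in> rest_span base0" for w
  proof (induction w)
    case Nil
    have "vac \<in> base0" unfolding base0_def by (intro CollectI exI[of _ "[]"]) simp
    then show ?case using rest_span_base[of "[]" vac base0] by simp
  next
    case (Cons j w)
    then show ?case using good_base0 by (auto simp: good_def split: if_splits)
  qed
  then show ?case using good_base0 by blast
next
  case (Suc d)
  then obtain W where W: "good W" "\<And>w. w \<in> lists {1..N} \<Longrightarrow> count_list w z = d \<Longrightarrow> Fword w vac \<in> W" by blast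
  show ?case
  proof (cases "z \<in> {1..N}")
    case False
    have "w \<in> lists {1..N} \<Longrightarrow> count_list w z = 0" for w
      using False by (induction w) auto
    then show ?thesis using W(1) by auto
  next
    case z: True
    note G = good_next[OF W(1) z]
    have "w \<in> lists {1..N} \<Longrightarrow> count_list w z = Suc d \<Longrightarrow> Fword w vac \<in> rest_span (next_base W)" for w
    proof (induction w)
      case (Cons j w)
      show ?case
      proof (cases "j = z")
        case True
        then have "Fword w vac \<in> W" using W(2)[of w] Cons.prems by simp
        then have "Fop z (Fword w vac) \<in> next_base W" unfolding next_base_def by blast
        then show ?thesis using rest_span_base[of "[]" _ "next_base W"] True by simp
      next
        case False
        then show ?thesis using Cons G by (auto simp: good_def)
      qed
    qed simp
    then show ?thesis using G by blast
  qed
qed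

text \<open>The only information used about the odd direction. The even reflections extend it to a
  bound on all weights.\<close>

theorem weights_lead:
  assumes "b \<in> weights N" shows "b s - b z \<le> int n + 1"
proof -
  obtain w where w: "w \<in> lists {1..N}" "b = cnt w" "Fword w vac \<noteq> 0" using assms by (auto simp: weights_def)
  obtain u where u: "coef (Fword w vac) u \<noteq> 0" using nonzero_coef[OF w(3)] by blast
  then have "cnt u = b" using has_wt_Fword[of w] w(2) by (auto simp: has_wt_def)
  moreover have "Fword w vac \<in> lead (int n + 1)" using words_good[of "count_list w z"] w(1) by (auto simp: good_def)
  ultimately show ?thesis using u by (auto simp: lead_def)
qed

end

section \<open>From bounded weights to vanishing of long words\<close>

context even_nodes
begin

lemma reflect: "i \<in> Ev \<Longrightarrow> b \<in> weights N \<Longrightarrow> b(i := int (r i) - (\<Sum>x\<in>{1..N} - {i}. c i x * b x) - b i) \<in> weights N"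
proof -
  assume i: "i \<in> Ev" and b: "b \<in> weights N"
  have "(\<Sum>x\<in>{1..N}. c i x * b x) = 2 * b i + (\<Sum>x\<in>{1..N} - {i}. c i x * b x)"
    using Ev[OF i] c_diag[OF i] by (simp add: sum.remove)
  then have "b i + kf i b = int (r i) - (\<Sum>x\<in>{1..N} - {i}. c i x * b x) - b i"
    by (simp add: kf_def)
  then show ?thesis using weights_reflect[OF i b] by (simp only:)
qed

end

lemma (in shuffle) weights_bounds:
  "b \<in> weights N \<Longrightarrow> 0 \<le> b i" "b \<in> weights N \<Longrightarrow> i \<notin> {1..N} \<Longrightarrow> b i = 0"
proof -
  show "b \<in> weights N \<Longrightarrow> 0 \<le> b i" by (auto simp: weights_def cnt_nonneg)
  show "b \<in> weights N \<Longrightarrow> i \<notin> {1..N} \<Longrightarrow> b i = 0"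
    by (auto simp: weights_def cnt_def count_list_0_iff lists_eq_set subset_iff)
qed

lemma (in shuffle) weights_bounded_finite:
  assumes "\<And>b i. b \<in> weights N \<Longrightarrow> i \<in> {1..N} \<Longrightarrow> b i \<le> C"
  shows "\<exists>n. \<forall>w\<in>lists {1..N}. length w \<ge> n \<longrightarrow> Fword w vac = 0"
proof -
  have "Fword w vac = 0" if w: "w \<in> lists {1..N}" "length w \<ge> Suc (N * nat C)" for w
  proof (rule ccontr)
    assume "Fword w vac \<noteq> 0"
    then have "cnt w \<in> weights N" using w by (auto simp: weights_def)
    then have "count_list w i \<le> nat C" if "i \<in> {1..N}" for i
      using assms that by (fastforce simp: cnt_def)
    moreover have "length w = (\<Sum>i\<in>set w. count_list w i)" by (simp add: sum_count_set)
    moreover have "\<dots> \<le> (\<Sum>i\<in>{1..N}. count_list w i)"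
      using w by (intro sum_mono2) (auto simp: lists_eq_set)
    ultimately have "length w \<le> N * nat C"
      using sum_bounded_above[of "{1..N}" "count_list w" "nat C"] by simp
    with w show False by simp
  qed
  then show ?thesis by blast
qed

text \<open>The relation between two odd simple root vectors that share an even neighbour on either side
  of the odd node.\<close>

lemma (in shuffle_nz) quartic:
  assumes q: "q a s = 1" "q s a = inverse P" "q e s = P" "q s e = 1" "q a e = 1" "q e a = 1" "q s s = - 1"
    and P: "P \<noteq> 0" and d: "a \<noteq> s" "a \<noteq> e" "e \<noteq> s"
  shows "Fop s (Fop a (Fop s (Fop e f))) + Fop s (Fop e (Fop s (Fop a f)))
    + scl P (Fop a (Fop s (Fop e (Fop s f)))) + scl P (Fop e (Fop s (Fop a (Fop s f))))
    - scl (1 + P) (Fop s (Fop a (Fop e (Fop s f)))) = 0"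
proof (rule op_zeroI[where Y = "\<lambda>f. Fop s (Fop a (Fop s (Fop e f))) + Fop s (Fop e (Fop s (Fop a f)))
    + scl P (Fop a (Fop s (Fop e (Fop s f)))) + scl P (Fop e (Fop s (Fop a (Fop s f))))
    - scl (1 + P) (Fop s (Fop a (Fop e (Fop s f))))"])
  have sq: "Fop s (Fop s f) = 0" for f by (rule Fop_square_zero) (rule q)
  have cm: "Fop e (Fop a f) = Fop a (Fop e f)" for f using Fop_comm[of e a f] q d by simp
  fix f m
  show "Eop m (Fop s (Fop a (Fop s (Fop e f))) + Fop s (Fop e (Fop s (Fop a f)))
    + scl P (Fop a (Fop s (Fop e (Fop s f)))) + scl P (Fop e (Fop s (Fop a (Fop s f))))
    - scl (1 + P) (Fop s (Fop a (Fop e (Fop s f))))) =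
   Fop s (Fop a (Fop s (Fop e (Eop m f)))) + Fop s (Fop e (Fop s (Fop a (Eop m f))))
    + scl P (Fop a (Fop s (Fop e (Fop s (Eop m f))))) + scl P (Fop e (Fop s (Fop a (Fop s (Eop m f)))))
    - scl (1 + P) (Fop s (Fop a (Fop e (Fop s (Eop m f)))))"
  proof -
    \<comment> \<open>For each of the three letters, the terms left by the commutator with E_m are
      normally ordered by F_s^2 = 0 and by the commutation of F_a and F_e, after which they
      cancel.\<close>
    consider "m = a" | "m = s" | "m = e" | "m \<noteq> a" "m \<noteq> s" "m \<noteq> e" by blast
    then show ?thesis
    proof cases
      case 1
      show ?thesis using d P unfolding 1
        apply (simp add: Eop_Fop Lop_Fop Kop_Fop nz q sq cm)
        apply (rule vec_eqI)
        apply (simp add: field_simps)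
        done
    next
      case 2
      show ?thesis using d P unfolding 2
        apply (simp add: Eop_Fop Lop_Fop Kop_Fop nz q sq cm)
        apply (rule vec_eqI)
        apply (simp add: field_simps)
        done
    next
      case 3
      show ?thesis using d P unfolding 3
        apply (simp add: Eop_Fop Lop_Fop Kop_Fop nz q sq cm)
        apply (rule vec_eqI)
        apply (simp add: field_simps)
        done
    next
      case 4
      then show ?thesis by (simp add: Eop_Fop)
    qed
  qed
qed simp

section \<open>Moving coordinates of weights by adjacent swaps\<close>

text \<open>Lets a value of one coordinate on S be studied at another coordinate, where a bound is
  available.\<close>

lemma bubble_up:
  assumes "\<And>b i. b \<in> S \<Longrightarrow> lo \<le> i \<Longrightarrow> i < hi \<Longrightarrow> \<exists>b'\<in>S. t (Suc i) b' = t i b"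
  shows "b \<in> S \<Longrightarrow> lo \<le> i \<Longrightarrow> i \<le> j \<Longrightarrow> j \<le> hi \<Longrightarrow> \<exists>b'\<in>S. t j b' = (t i b :: int)"
proof (induction "j - i" arbitrary: i b)
  case (Suc x)
  then have "i < hi" "Suc i \<le> j" "x = j - Suc i" "lo \<le> Suc i" by auto
  moreover obtain b' where "b' \<in> S" "t (Suc i) b' = t i b" using assms[OF Suc.prems(1,2) \<open>i < hi\<close>] by blast
  ultimately show ?case using Suc.hyps(1)[of "Suc i" b'] Suc.prems by auto
qed auto

lemma bubble_down:
  assumes "\<And>b i. b \<in> S \<Longrightarrow> lo \<le> i \<Longrightarrow> i < hi \<Longrightarrow> \<exists>b'\<in>S. t i b' = t (Suc i) b"
  shows "b \<in> S \<Longrightarrow> lo \<le> i \<Longrightarrow> i \<le> j \<Longrightarrow> j \<le> hi \<Longrightarrow> \<exists>b'\<in>S. t i b' = (t j b :: int)"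
proof (induction "j - i" arbitrary: j b)
  case (Suc x)
  then obtain j' where j: "j = Suc j'" by (cases j) auto
  with Suc have "j' < hi" "i \<le> j'" "x = j' - i" "lo \<le> j'" by auto
  moreover obtain b' where "b' \<in> S" "t j' b' = t j b" using assms[OF Suc.prems(1) \<open>lo \<le> j'\<close> \<open>j' < hi\<close>] j by blast
  ultimately show ?case using Suc.hyps(1)[of j' b'] Suc.prems by auto
qed auto

lemma two_neighbours_sum:
  fixes g :: "nat \<Rightarrow> int"
  assumes "i \<in> {1..N}" "\<And>x. x \<in> {1..N} \<Longrightarrow> x \<noteq> i \<Longrightarrow> x \<noteq> i - 1 \<Longrightarrow> x \<noteq> Suc i \<Longrightarrow> g x = 0"
    "g 0 = 0" "g (Suc N) = 0"
  shows "(\<Sum>x\<in>{1..N} - {i}. g x) = g (i - 1) + g (Suc i)"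
proof -
  have "(\<Sum>x\<in>{1..N} - {i}. g x) = (\<Sum>x\<in>{i - 1, Suc i}. g x)"
  proof (rule sum.mono_neutral_cong)
    show "g x = 0" if "x \<in> {i - 1, Suc i} - ({1..N} - {i})" for x
    proof -
      from that assms(1) have "x = 0 \<or> x = Suc N" by auto
      then show ?thesis using assms(3,4) by auto
    qed
    show "g x = 0" if "x \<in> {1..N} - {i} - {i - 1, Suc i}" for x using assms(2)[of x] that by auto
  qed auto
  then show ?thesis by simp
qed

lemma telescope_bound:
  fixes f :: "nat \<Rightarrow> int"
  assumes "f lo \<le> D" "\<And>i. lo < i \<Longrightarrow> i \<le> hi \<Longrightarrow> f i - f (i - 1) \<le> C" "0 \<le> C"
  shows "lo \<le> i \<Longrightarrow> i \<le> hi \<Longrightarrow> f i \<le> D + int i * C"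
proof (induction i)
  case (Suc i)
  show ?case
  proof (cases "lo = Suc i")
    case True
    then show ?thesis using assms(1,3) by (simp add: add_increasing2)
  next
    case False
    then show ?thesis using Suc assms(2)[of "Suc i"] by (simp add: algebra_simps)
  qed
qed (use assms in auto)

lemma not_root_of_unity_simps:
  fixes P :: "'k::field" assumes "not_root_of_unity P"
  shows "P \<noteq> 0" "not_root_of_unity (inverse P)" "not_root_of_unity (P ^ 2)" "P \<noteq> - 1" "P ^ 2 \<noteq> - 1" "inverse P \<noteq> - 1"
proof -
  show P: "P \<noteq> 0" using assms by (auto simp: not_root_of_unity_def)
  show "not_root_of_unity (inverse P)" using assms P by (auto simp: not_root_of_unity_def power_inverse)
  show "not_root_of_unity (P ^ 2)" using assms by (auto simp: not_root_of_unity_def power_mult[symmetric])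
  have 1: "P ^ 2 \<noteq> 1" and 2: "P ^ 4 \<noteq> 1" using assms by (auto simp: not_root_of_unity_def)
  show "P \<noteq> - 1" using 1 by auto
  show "P ^ 2 \<noteq> - 1" using 2 by (auto simp: power4_eq_xxxx power2_eq_square)
  show "inverse P \<noteq> - 1" using 1 by (metis inverse_inverse_eq inverse_minus_eq inverse_1 power2_minus power_one)
qed

section \<open>Boundedness in type A\<close>

text \<open>The reflections at i < m and at i > m permute shifted differences of b within the blocks
  1..m and m+1..N+1. It therefore suffices to bound the difference at m, which is
  \<open>weights_lead\<close>, and the one at N + 1, which is -b_N up to the shift.\<close>

lemma type_A_finite:
  fixes q :: "nat \<Rightarrow> nat \<Rightarrow> 'k::field" and r :: "nat \<Rightarrow> nat"
  assumes m: "m \<in> {1..N}" and P: "not_root_of_unity P"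
    and q: "\<And>i j. q i j = (if i \<in> {1..N} \<and> j \<in> {1..N} then
        if i = j then if i < m then P else if i = m then - 1 else inverse P
        else if i = Suc j then if i \<le> m then inverse P else P else 1 else 1)"
    and l: "\<And>i. l i \<noteq> 0" and kl: "\<And>i. i \<in> {1..N} - {m} \<Longrightarrow> k i = l i * q i i ^ r i"
  shows "\<exists>n. \<forall>w\<in>lists {1..N}. length w \<ge> n \<longrightarrow> foldr (shuffle.Fop q k l) w vac = 0"
proof -
  note nP = not_root_of_unity_simps[OF P]
  define c :: "nat \<Rightarrow> nat \<Rightarrow> int" where
    "c i x = (if x = i then 2 else if x \<in> {1..N} \<and> (x = Suc i \<or> i = Suc x) then - 1 else 0)" for i x
  have qnz: "q i j \<noteq> 0" for i j using nP(1) by (subst q) auto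
  have norm: "i < j \<Longrightarrow> q i j = 1" for i j by (subst q) auto
  have q_diag1: "q i i = P" if "i < m" "1 \<le> i" for i using that m by (subst q) auto
  have q_diag2: "q m m = - 1" using m by (subst q) auto
  have q_diag3: "q i i = inverse P" if "m < i" "i \<le> N" for i using that m by (subst q) auto
  have q_Suc1: "q (Suc i) i = inverse P" if "1 \<le> i" "Suc i \<le> m" for i using that m by (subst q) auto
  have q_Suc2: "q (Suc i) i = P" if "m \<le> i" "Suc i \<le> N" for i using that m by (subst q) auto
  have q_far1: "q i j = 1" if "i \<noteq> j" "i \<noteq> Suc j" for i j using that by (subst q) auto
  have q_far2: "q i j = 1" if "i \<notin> {1..N} \<or> j \<notin> {1..N}" for i j
    using that by (subst q) (rule if_not_P, blast)
  note q_diag = q_diag1 q_diag2 q_diag3 and q_Suc = q_Suc1 q_Suc2 and q_far = q_far1 q_far2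
  interpret even_nodes q k l N "{1..N} - {m}" r c
  proof
    fix i x assume i: "i \<in> {1..N} - {m}"
    then have im: "i < m \<or> m < i" by auto
    show "i \<in> {1..N}" using i by simp
    show "not_root_of_unity (q i i)" using i im nP P q_diag by auto
    show "c i i = 2" by (simp add: c_def)
    show "k i = l i * q i i ^ r i" by (rule kl[OF i])
    show "x \<noteq> i \<Longrightarrow> c i x \<le> 0" by (simp add: c_def)
    consider "x = i" | "x = Suc i" "x \<in> {1..N}" | "i = Suc x" "x \<in> {1..N}"
      | "x \<noteq> i" "x \<notin> {1..N} \<or> x \<noteq> Suc i \<and> i \<noteq> Suc x" by blast
    then show "q i x * q x i = q i i powi c i x"
    proof cases
      case 1
      then show ?thesis by (simp add: c_def power2_eq_square)
    next
      case 2
      then show ?thesis using im i q_Suc[of i] q_diag1[of i] q_diag3[of i] norm[of i x] nP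
        by (auto simp: c_def power_int_minus)
    next
      case 3
      then show ?thesis using im i q_Suc[of x] q_diag1[of i] q_diag3[of i] norm[of x i] nP
        by (auto simp: c_def power_int_minus)
    next
      case 4
      then have "c i x = 0" by (simp add: c_def)
      moreover have "q i x = 1" "q x i = 1" using 4 q_far by auto
      ultimately show ?thesis by simp
    qed
  qed (rule qnz l)+
  \<comment> \<open>The row consists of the odd node and the even nodes after it. For m = 1 the node
    z is 0, outside the diagram: \<open>special\<close> is then vacuous and b 0 = 0.\<close>
  interpret pre_odd_row q k l N m "N - m" "m - 1"
  proof
    show "1 \<le> m" "m + (N - m) \<le> N" "m - 1 \<notin> {m..m + (N - m)}" using m by auto
    fix a b :: nat
    show "a + 2 \<le> b \<Longrightarrow> b \<le> N - m \<Longrightarrow> q (m + b) (m + a) = 1" by (intro q_far1) auto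
    show "1 \<le> a \<Longrightarrow> a \<le> N - m \<Longrightarrow> q (m + a) (m + a) \<noteq> - 1" using q_diag3[of "m + a"] nP by auto
    show "Suc a \<le> N - m \<Longrightarrow> q (m + Suc a) (m + a) * q (m + Suc a) (m + Suc a) = 1"
      using q_diag3[of "m + Suc a"] q_Suc2[of "m + a"] nP by simp
    show "1 \<le> a \<Longrightarrow> Suc a \<le> N - m \<Longrightarrow> q (m + Suc a) (m + a) * q (m + a) (m + a) = 1"
      using q_diag3[of "m + a"] q_Suc2[of "m + a"] nP by simp
    fix j assume "j \<in> {1..N} - {m..m + (N - m)} - {m - 1}" "a \<le> N - m"
    then show "q j (m + a) = 1 \<and> q (m + a) j = 1" by (intro conjI q_far1) auto
  qed (rule qnz norm q_diag2 | assumption)+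
  \<comment> \<open>The three constants are read off from \<open>quartic\<close> for the nodes m -
    1, m, m + 1.\<close>
  interpret odd_row q k l N m "N - m" "m - 1" 1 "- P" "- P"
  proof
    fix a b :: nat and f :: "'k vec" assume z: "m - 1 \<in> {1..N}" and ab: "a < b" "b \<le> N - m"
    show "xo a (xo b (Fop (m - 1) f)) = scl 1 (xo a (Fop (m - 1) (xo b f)))
      + scl (- P) (xo b (Fop (m - 1) (xo a f))) + scl (- P) (Fop (m - 1) (xo a (xo b f)))"
    proof (rule special_extend[OF _ _ ab])
      have cm: "go a (Fop (m - 1) f) = Fop (m - 1) (go a f)" if "1 \<le> a" "a \<le> N - m" for a f
      proof -
        have ne: "m + a \<noteq> m - 1" "m + a \<noteq> Suc (m - 1)" "m - 1 \<noteq> m + a" "m - 1 \<noteq> Suc (m + a)"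
          using that m by auto
        show ?thesis
          using Fop_comm[OF ne(1), of f] q_far1[OF ne(1,2)] q_far1[OF ne(3,4)] by simp
      qed
      then show "1 \<le> a \<Longrightarrow> a \<le> N - m \<Longrightarrow> go a (Fop (m - 1) f) = Fop (m - 1) (go a f)" for a f .
      fix f
      have sq: "Fop m (Fop m f) = 0" for f using xo_square_and_step(1)[of 0] by simp
      have cm1: "Fop (Suc m) (Fop (m - 1) f) = Fop (m - 1) (Fop (Suc m) f)" for f using cm[of 1 f] ab by simp
      have Y: "Fop m (Fop (m - 1) (Fop m (Fop (Suc m) f))) + Fop m (Fop (Suc m) (Fop m (Fop (m - 1) f)))
        + scl P (Fop (m - 1) (Fop m (Fop (Suc m) (Fop m f)))) + scl P (Fop (Suc m) (Fop m (Fop (m - 1) (Fop m f))))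
        - scl (1 + P) (Fop m (Fop (m - 1) (Fop (Suc m) (Fop m f)))) = 0"
      proof -
        have mN: "2 \<le> m" "Suc m \<le> N" using z ab by auto
        show ?thesis
        proof (rule quartic)
          show "q (m - 1) m = 1" "q m (Suc m) = 1" "q (m - 1) (Suc m) = 1" using mN by (auto intro!: norm)
          show "q m (m - 1) = inverse P" using q_Suc1[of "m - 1"] mN by simp
          show "q (Suc m) m = P" using q_Suc2[of m] mN by simp
          show "q (Suc m) (m - 1) = 1" by (rule q_far1) (use mN in auto)
          show "q m m = - 1" "P \<noteq> 0" by (fact q_diag2 nP)+
        qed (use mN in auto)
      qed
      \<comment> \<open>With x_0 = F_m and x_1 = F_{m+1} F_m - F_m F_{m+1}, expanding and deleting
        the terms with F_m^2 turns the claim into \<open>Y\<close>.\<close>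
      show "xo 0 (xo 1 (Fop (m - 1) f)) = scl 1 (xo 0 (Fop (m - 1) (xo 1 f)))
        + scl (- P) (xo 1 (Fop (m - 1) (xo 0 f))) + scl (- P) (Fop (m - 1) (xo 0 (xo 1 f)))"
      proof (rule vec_eqI)
        fix u
        show "coef (xo 0 (xo 1 (Fop (m - 1) f))) u = coef (scl 1 (xo 0 (Fop (m - 1) (xo 1 f)))
          + scl (- P) (xo 1 (Fop (m - 1) (xo 0 f))) + scl (- P) (Fop (m - 1) (xo 0 (xo 1 f)))) u"
          using arg_cong[OF Y, of "\<lambda>f. coef f u"] by (simp add: sq cm1[unfolded One_nat_def] algebra_simps)
      qed
    qed
  qed
  \<comment> \<open>The shift by partial sums of the r_j turns the affine reflections of b into
    plain swaps of the coordinates t.\<close>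
  define R where "R i = (\<Sum>j<i. if j = m then 0 else int (r j))" for i
  have R: "0 \<le> R i" "i \<le> j \<Longrightarrow> R i \<le> R j" for i j
    unfolding R_def by (rule sum_nonneg, simp) (rule sum_mono2, simp, force, simp)
  define t where "t i b = b i - b (i - 1) + R i" for i and b :: "nat \<Rightarrow> int"
  define S where "S = weights N"
  \<comment> \<open>The reflected entry is r_i + b_{i-1} + b_{i+1} - b_i; at the two ends the
    missing neighbour contributes 0.\<close>
  have swap: "\<exists>b'\<in>S. t (Suc i) b' = t i b \<and> t i b' = t (Suc i) b" if b: "b \<in> S" and i: "i \<in> {1..N}" "i \<noteq> m" for b i
  proof -
    have z: "b 0 = 0" "b (Suc N) = 0" using weights_bounds(2)[OF b[unfolded S_def]] by auto
    have "(\<Sum>x\<in>{1..N} - {i}. c i x * b x) = c i (i - 1) * b (i - 1) + c i (Suc i) * b (Suc i)"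
      by (rule two_neighbours_sum) (use i z in \<open>auto simp: c_def\<close>)
    also have "\<dots> = - b (i - 1) - b (Suc i)"
    proof -
      have "c i (i - 1) * b (i - 1) = - b (i - 1)" using i z by (cases "i = 1") (auto simp: c_def)
      moreover have "c i (Suc i) * b (Suc i) = - b (Suc i)" using i z by (cases "i = N") (auto simp: c_def)
      ultimately show ?thesis by simp
    qed
    finally have sm: "(\<Sum>x\<in>{1..N} - {i}. c i x * b x) = - b (i - 1) - b (Suc i)" .
    have "b(i := int (r i) - (\<Sum>x\<in>{1..N} - {i}. c i x * b x) - b i) \<in> S"
      using reflect[of i b] i b by (simp add: S_def)
    then have "b(i := int (r i) - (- b (i - 1) - b (Suc i)) - b i) \<in> S" unfolding sm .
    moreover have "R (Suc i) = R i + int (r i)" using i by (simp add: R_def)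
    ultimately show ?thesis using i by (intro bexI) (auto simp: t_def)
  qed
  have up: "\<exists>b'\<in>S. t (Suc i) b' = t i b" if "b \<in> S" "i \<in> {1..N}" "i \<noteq> m" for b i
    using swap[OF that] by blast
  define C where "C = int N + 1 + R (Suc N)"
  have lead: "b m - b (m - 1) \<le> int (N - m) + 1" if "b \<in> S" for b using weights_lead that by (simp add: S_def)
  \<comment> \<open>In the first block the value is carried to position m. In the second it is
    carried to position N + 1, where b (N + 1) = 0 and b N is nonnegative.\<close>
  have step: "b i - b (i - 1) \<le> C" if b: "b \<in> S" and i: "1 \<le> i" "i \<le> N" for b i
  proof (cases "i \<le> m")
    case True
    have "\<exists>b'\<in>S. t m b' = t i b"
      by (rule bubble_up[of S 1 m], rule up) (use m b i True in auto)
    then obtain b' where "b' \<in> S" "t m b' = t i b" by blast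
    with lead[of b'] R(1)[of i] R(2)[of m "Suc N"] m show ?thesis by (simp add: t_def C_def)
  next
    case False
    have "\<exists>b'\<in>S. t (Suc N) b' = t i b"
      by (rule bubble_up[of S "Suc m" "Suc N"], rule up) (use m b i False in auto)
    then obtain b' where b': "b' \<in> S" "t (Suc N) b' = t i b" by blast
    moreover have "b' (Suc N) = 0" "0 \<le> b' N" using weights_bounds b'(1) by (auto simp: S_def)
    ultimately show ?thesis using R(1)[of i] by (simp add: t_def C_def)
  qed
  have "0 \<le> C" using R(1)[of "Suc N"] by (simp add: C_def)
  have "b i \<le> int N * C" if b: "b \<in> weights N" and i: "i \<in> {1..N}" for b i
  proof -
    have "b i \<le> 0 + int i * C"
      by (rule telescope_bound[of b 0 0 N C]) (use step b i weights_bounds(2)[OF b] \<open>0 \<le> C\<close> in \<open>auto simp: S_def\<close>)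
    also have "\<dots> \<le> int N * C" using i \<open>0 \<le> C\<close> by (simp add: mult_right_mono)
    finally show ?thesis .
  qed
  then show ?thesis by (rule weights_bounded_finite)
qed

section \<open>Boundedness in type C\<close>

text \<open>The even reflections act on the coordinates t_2, ..., t_N by signed permutations and fix
  b_1. First b_1 is bounded, by comparing \<open>weights_lead\<close> with the dominance
  inequalities of a weight of least height; then t_2 is bounded below, and by the signed
  permutations every t_j is bounded above.\<close>

lemma type_C_finite:
  fixes q :: "nat \<Rightarrow> nat \<Rightarrow> 'k::field" and r :: "nat \<Rightarrow> nat"
  assumes N: "N \<ge> 3" and P: "not_root_of_unity P"
    and q: "\<And>i j. q i j = (if i \<in> {1..N} \<and> j \<in> {1..N} then
        if i = j then if i = 1 then - 1 else if i < N then P else P ^ 2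
        else if i = Suc j then if i < N then inverse P else inverse (P ^ 2) else 1 else 1)"
    and l: "\<And>i. l i \<noteq> 0" and kl: "\<And>i. i \<in> {1..N} - {1} \<Longrightarrow> k i = l i * q i i ^ r i"
  shows "\<exists>n. \<forall>w\<in>lists {1..N}. length w \<ge> n \<longrightarrow> foldr (shuffle.Fop q k l) w vac = 0"
proof -
  note nP = not_root_of_unity_simps[OF P]
  \<comment> \<open>The entry -2 belongs to row N - 1 and column N. In row N the neighbour has entry
    -1, because q_NN is already P^2.\<close>
  define c :: "nat \<Rightarrow> nat \<Rightarrow> int" where
    "c i x = (if x = i then 2 else if x \<in> {1..N} \<and> (x = Suc i \<or> i = Suc x) then if x = N then - 2 else - 1 else 0)" for i x
  have qnz: "q i j \<noteq> 0" for i j using nP(1) by (subst q) auto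
  have norm: "i < j \<Longrightarrow> q i j = 1" for i j by (subst q) auto
  have q_one: "q 1 1 = - 1" using N by (subst q) auto
  have q_diag: "q i i = P" if "1 < i" "i < N" for i using that by (subst q) auto
  have q_NN: "q N N = P ^ 2" using N by (subst q) auto
  have q_Suc: "q (Suc i) i = inverse P" if "1 \<le> i" "Suc i < N" for i using that by (subst q) auto
  have q_N: "q N i = inverse (P ^ 2)" if "Suc i = N" for i using that N by (subst q) auto
  have q_far: "q i j = 1" if "i \<noteq> j" "i \<noteq> Suc j" for i j using that by (subst q) auto
  have q_out: "q i j = 1" if "i \<notin> {1..N} \<or> j \<notin> {1..N}" for i j
    using that by (subst q) (rule if_not_P, blast)
  interpret even_nodes q k l N "{1..N} - {1}" r c
  proof
    fix i x assume i: "i \<in> {1..N} - {1}"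
    then have iN: "1 < i \<and> i < N \<or> i = N" by auto
    show "i \<in> {1..N}" using i by simp
    show "not_root_of_unity (q i i)" using iN nP P q_diag q_NN by auto
    show "c i i = 2" by (simp add: c_def)
    show "k i = l i * q i i ^ r i" by (rule kl[OF i])
    show "x \<noteq> i \<Longrightarrow> c i x \<le> 0" by (simp add: c_def)
    consider "x = i" | "x = Suc i" "x < N" | "x = Suc i" "x = N" | "i = Suc x" "i < N" "1 \<le> x" | "i = Suc x" "i = N"
      | "x \<noteq> i" "x \<notin> {1..N} \<or> x \<noteq> Suc i \<and> i \<noteq> Suc x"
      using i by force
    then show "q i x * q x i = q i i powi c i x"
    proof cases
      case 1
      then show ?thesis by (simp add: c_def power2_eq_square)
    next
      case 2
      then show ?thesis using i q_Suc[of i] q_diag[of i] norm[of i x] nP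
        by (auto simp: c_def power_int_minus)
    next
      case 3
      then show ?thesis using i q_N[of i] q_diag[of i] norm[of i x] nP
        by (auto simp: c_def power_int_minus)
    next
      case 4
      then show ?thesis using i q_Suc[of x] q_diag[of i] norm[of x i] nP
        by (auto simp: c_def power_int_minus)
    next
      case 5
      then show ?thesis using i N q_N[of x] q_NN norm[of x i] nP
        by (auto simp: c_def power_int_minus)
    next
      case 6
      then have "\<not> (x \<in> {1..N} \<and> (x = Suc i \<or> i = Suc x))" by blast
      then have "c i x = 0" using 6(1) by (simp only: c_def if_False)
      moreover have "q i x = 1" "q x i = 1" using 6 q_far q_out by auto
      ultimately show ?thesis by simp
    qed
  qed (rule qnz l)+
  interpret pre_odd_row q k l N 1 "N - 2" N
  proof
    show "1 \<le> (1::nat)" "1 + (N - 2) \<le> N" "N \<notin> {1..1 + (N - 2)}" using N by auto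
    fix a b :: nat
    show "a + 2 \<le> b \<Longrightarrow> b \<le> N - 2 \<Longrightarrow> q (1 + b) (1 + a) = 1" by (intro q_far) auto
    show "1 \<le> a \<Longrightarrow> a \<le> N - 2 \<Longrightarrow> q (1 + a) (1 + a) \<noteq> - 1" using q_diag[of "1 + a"] nP by auto
    show "Suc a \<le> N - 2 \<Longrightarrow> q (1 + Suc a) (1 + a) * q (1 + Suc a) (1 + Suc a) = 1"
      using q_diag[of "1 + Suc a"] q_Suc[of "1 + a"] nP by simp
    show "1 \<le> a \<Longrightarrow> Suc a \<le> N - 2 \<Longrightarrow> q (1 + Suc a) (1 + a) * q (1 + a) (1 + a) = 1"
      using q_diag[of "1 + a"] q_Suc[of "1 + a"] nP by simp
    fix j assume "j \<in> {1..N} - {1..1 + (N - 2)} - {N}" "a \<le> N - 2"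
    then show "q j (1 + a) = 1 \<and> q (1 + a) j = 1" by auto
  qed (rule qnz norm q_one | assumption)+
  \<comment> \<open>For a < b the vector x_a does not reach node N - 1, so it commutes with F_N, and
    x_a x_b F_N = - x_b x_a F_N = - x_b F_N x_a.\<close>
  interpret odd_row q k l N 1 "N - 2" N 0 "- 1" 0
  proof
    fix a b :: nat and f :: "'k vec" assume ab: "a < b" "b \<le> N - 2"
    have "Fop N (xo a f) = xo a (Fop N f)" for f
      using ab(1)
    proof (induction a arbitrary: f)
      case 0
      have ne: "N \<noteq> 1" "N \<noteq> Suc 1" "1 \<noteq> N" "1 \<noteq> Suc N" using ab N by auto
      show ?case using Fop_comm[OF ne(1), of f] q_far[OF ne(1,2)] q_far[OF ne(3,4)] by simp
    next
      case (Suc a)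
      have ne: "N \<noteq> 1 + Suc a" "N \<noteq> Suc (1 + Suc a)" "1 + Suc a \<noteq> N" "1 + Suc a \<noteq> Suc N"
        using Suc.prems ab N by auto
      have "Fop N (go (Suc a) h) = go (Suc a) (Fop N h)" for h
        using Fop_comm[OF ne(1), of h] q_far[OF ne(1,2)] q_far[OF ne(3,4)] by simp
      then show ?case using Suc by simp
    qed
    then show "xo a (xo b (Fop N f)) = scl 0 (xo a (Fop N (xo b f)))
      + scl (- 1) (xo b (Fop N (xo a f))) + scl 0 (Fop N (xo a (xo b f)))"
      using xo_anticomm[of a b "Fop N f"] ab by simp
  qed
  define S where "S = weights N"
  \<comment> \<open>Doubling the coefficient of the long simple root makes the differences below
    orthogonal coordinates.\<close>
  define e where "e b i = (if i = N then 2 * b i else b i)" for b :: "nat \<Rightarrow> int" and i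
  define R where "R i = (\<Sum>j<i. int (r j))" for i
  have R: "0 \<le> R i" "i \<le> j \<Longrightarrow> R i \<le> R j" for i j
    unfolding R_def by (rule sum_nonneg, simp) (rule sum_mono2, simp, force, simp)
  have RS: "R (Suc i) = R i + int (r i)" for i by (simp add: R_def)
  \<comment> \<open>Besides the partial sums, the total is subtracted: this centres the coordinates,
    so that the reflection at N is the sign change of t_N.\<close>
  define t where "t i b = e b i - e b (i - 1) + R i - R (Suc N)" for i b
  define rf where "rf i b = b(i := (if i = N then int (r i) + b (i - 1) - b i
      else int (r i) + e b (i - 1) + e b (Suc i) - b i))" for i and b :: "nat \<Rightarrow> int"
  have rf: "rf i b \<in> S" if b: "b \<in> S" and i: "2 \<le> i" "i \<le> N" for b i
  proof -
    have z: "b 0 = 0" "b (Suc N) = 0" using weights_bounds(2)[OF b[unfolded S_def]] by auto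
    have "(\<Sum>x\<in>{1..N} - {i}. c i x * b x) = c i (i - 1) * b (i - 1) + c i (Suc i) * b (Suc i)"
      by (rule two_neighbours_sum) (use i z in \<open>auto simp: c_def\<close>)
    moreover have "c i (i - 1) * b (i - 1) = - b (i - 1)" using i by (auto simp: c_def)
    moreover have "c i (Suc i) * b (Suc i) = - e b (Suc i)" using i z by (cases "i = N") (auto simp: c_def e_def)
    moreover have "b(i := int (r i) - (\<Sum>x\<in>{1..N} - {i}. c i x * b x) - b i) \<in> S"
      using reflect[of i b] i b by (simp add: S_def)
    moreover have "e b (i - 1) = b (i - 1)" using i by (auto simp: e_def)
    moreover have "i = N \<Longrightarrow> e b (Suc i) = 0" using z by (simp add: e_def)
    ultimately show ?thesis by (auto simp: rf_def algebra_simps)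
  qed
  have rf1: "rf i b 1 = b 1" if "2 \<le> i" for i b using that by (auto simp: rf_def)
  have swap: "t (Suc i) (rf i b) = t i b \<and> t i (rf i b) = t (Suc i) b" if "2 \<le> i" "i < N" for i b
    using that by (auto simp: t_def rf_def RS e_def)
  have flip: "t N (rf N b) = - t N b" for b
    using N by (auto simp: t_def rf_def RS e_def)
  have lead: "b 1 - b N \<le> int (N - 2) + 1" if "b \<in> S" for b using weights_lead that by (simp add: S_def)
  define R0 where "R0 = R (Suc N)"
  have R0: "0 \<le> R0" "R i \<le> R0" if "i \<le> Suc N" for i using R that by (auto simp: R0_def)
  define D where "D = 2 * int N + int N * R0"
  have b1: "b 1 \<le> D" if bS: "b \<in> S" for b
  proof -
    define ht where "ht b = nat (\<Sum>i\<in>{1..N}. b i)" for b :: "nat \<Rightarrow> int"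
    \<comment> \<open>The reflections at i \<ge> 2 do not change b_1, so none of them lowers the
      height of this weight.\<close>
    obtain b' where b': "b' \<in> S" "b' 1 = b 1" and min: "\<And>y. y \<in> S \<Longrightarrow> y 1 = b 1 \<Longrightarrow> ht b' \<le> ht y"
      using ex_has_least_nat[of "\<lambda>y. y \<in> S \<and> y 1 = b 1" b ht] bS by blast
    have dom: "b' i \<le> rf i b' i" if i: "2 \<le> i" "i \<le> N" for i
    proof (rule ccontr)
      assume "\<not> b' i \<le> rf i b' i"
      then have lt: "rf i b' i < b' i" by simp
      have nn: "0 \<le> y j" if "y \<in> S" for y j using weights_bounds(1) that by (simp add: S_def)
      have "(\<Sum>j\<in>{1..N}. rf i b' j) < (\<Sum>j\<in>{1..N}. b' j)"
      proof (rule sum_strict_mono_ex1)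
        show "\<forall>j\<in>{1..N}. rf i b' j \<le> b' j" using lt by (auto simp: rf_def)
        show "\<exists>j\<in>{1..N}. rf i b' j < b' j" using lt i by (intro bexI[of _ i]) auto
      qed simp
      then have "ht (rf i b') < ht b'"
        using sum_nonneg[of "{1..N}" "rf i b'"] nn[OF rf[OF b'(1) i]] by (simp add: ht_def)
      moreover have "ht b' \<le> ht (rf i b')" using min rf[OF b'(1) i] rf1[OF i(1)] b'(2) by simp
      ultimately show False by simp
    qed
    \<comment> \<open>Minimality means t_2 \<le> ... \<le> t_N \<le> 0, a Weyl chamber.\<close>
    have tN: "t N b' \<le> 0" using dom[of N] N by (simp add: t_def rf_def RS e_def)
    have t_step: "t i b' \<le> t (Suc i) b'" if "2 \<le> i" "i < N" for i
      using dom[of i] that by (auto simp: t_def rf_def RS e_def split: if_splits)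
    have t_neg: "t i b' \<le> 0" if "2 \<le> i" "i \<le> N" for i
      using that(2,1)
    proof (induction rule: inc_induct)
      case (step i)
      then show ?case using t_step[of i] by simp
    qed (rule tN)
    have e_step: "e b' i - e b' (i - 1) \<le> R0" if "1 < i" "i \<le> N" for i
      using t_neg[of i] that R(1)[of i] by (simp add: t_def R0_def)
    have "e b' N \<le> b 1 + int N * R0"
      by (rule telescope_bound[of "e b'" 1 _ N]) (use e_step b' N R0(1)[of 0] in \<open>auto simp: e_def\<close>)
    then have "2 * b' N \<le> b 1 + int N * R0" by (simp add: e_def)
    \<comment> \<open>Together with 2 b'_N \<le> b_1 + N R0 this gives b_1 \<le> 2 N + N R0: the
      doubling at the long root lets b_1 be absorbed.\<close>
    moreover have "b 1 - b' N \<le> int N" using lead[OF b'(1)] b'(2) N by simp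
    ultimately show ?thesis by (simp add: D_def)
  qed
  have t2: "- (D + R0) \<le> t 2 b" if "b \<in> S" for b
    using b1[OF that] weights_bounds(1)[of b N 2] that N R(1)[of 2]
    by (auto simp: t_def e_def R0_def S_def)
  have down: "\<exists>b'\<in>S. t 2 b' = t j b" if "b \<in> S" "2 \<le> j" "j \<le> N" for b j
    by (rule bubble_down[of S 2 N]) (use that swap rf in \<open>force+\<close>)
  have up: "\<exists>b'\<in>S. t N b' = t j b" if "b \<in> S" "2 \<le> j" "j \<le> N" for b j
    by (rule bubble_up[of S 2 N]) (use that swap rf in \<open>force+\<close>)
  \<comment> \<open>Carry t_j to position N, change its sign by the reflection there, and carry it
    down to position 2, where a lower bound is known.\<close>
  have t_up: "t j b \<le> D + R0" if b: "b \<in> S" and j: "2 \<le> j" "j \<le> N" for b j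
  proof -
    obtain b' where b': "b' \<in> S" "t N b' = t j b" using up[OF b j] by blast
    have "rf N b' \<in> S" using rf[OF b'(1)] N by simp
    then obtain b'' where "b'' \<in> S" "t 2 b'' = t N (rf N b')" using down[of "rf N b'" N] N by auto
    with t2[of b''] flip b'(2) show ?thesis by simp
  qed
  have DR: "0 \<le> D" using R0(1)[of 0] by (simp add: D_def)
  have e_step: "e b i - e b (i - 1) \<le> D + 2 * R0" if "b \<in> S" "1 < i" "i \<le> N" for b i
    using t_up[of b i] that R(1)[of i] by (simp add: t_def R0_def)
  have "b i \<le> D + int N * (D + 2 * R0)" if b: "b \<in> weights N" and i: "i \<in> {1..N}" for b i
  proof -
    have "e b i \<le> D + int i * (D + 2 * R0)"
      by (rule telescope_bound[of "e b" 1 D N])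
        (use e_step b i b1 N DR R0(1)[of 0] in \<open>auto simp: S_def e_def\<close>)
    also have "\<dots> \<le> D + int N * (D + 2 * R0)" using i DR R0(1)[of 0] by (simp add: mult_right_mono)
    finally show ?thesis using weights_bounds(1)[OF b, of i] by (auto simp: e_def split: if_splits)
  qed
  then show ?thesis by (rule weights_bounded_finite)
qed

section \<open>Reduction to a triangular matrix q\<close>

definition normalized :: "(nat \<Rightarrow> nat \<Rightarrow> 'k::field) \<Rightarrow> nat \<Rightarrow> nat \<Rightarrow> 'k" where
  "normalized q i j = (if i < j then 1 else if i = j then q i i else q i j * q j i)"

definition dg :: "(nat \<Rightarrow> 'k::field) \<Rightarrow> 'k vec \<Rightarrow> 'k vec" where
  "dg g f = Vec (\<lambda>u. (\<Prod>x\<leftarrow>u. g x) * coef f u)"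

lemma coef_dg: "coef (dg g f) u = (\<Prod>x\<leftarrow>u. g x) * coef f u" by (simp add: dg_def)

lemma dg_linear [simp]: "dg g (f + h) = dg g f + dg g h" "dg g (f - h) = dg g f - dg g h" "dg g (scl c f) = scl c (dg g f)" "dg g 0 = 0"
  by (auto intro!: vec_eqI simp: coef_dg algebra_simps)

lemma Eop_dg: "Eop i (dg g f) = scl (g i) (dg g (Eop i f))"
  by (rule vec_eqI) (simp add: coef_Eop coef_dg)

lemma (in shuffle) dg_Fop: "dg g (Fop j f) = scl (g j) (Fop j (dg g f))"
proof (rule vec_eqI)
  fix u show "coef (dg g (Fop j f)) u = coef (scl (g j) (Fop j (dg g f))) u"
  proof (induction u arbitrary: f)
    case (Cons i u)
    have "coef (dg g (Fop j f)) (i # u) = g i * coef (dg g (Eop i (Fop j f))) u"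
      by (simp add: coef_dg coef_Eop)
    also have "\<dots> = g i * (coef (dg g (Fop j (Eop i f))) u + (if i = j then coef (dg g (Lop j f - Kop j f)) u else 0))"
      by (simp add: Eop_Fop)
    also have "\<dots> = coef (scl (g j) (Eop i (Fop j (dg g f)))) u"
      by (simp add: Cons Eop_Fop Eop_dg) (auto simp: coef_dg Kop_def Lop_def algebra_simps)
    finally show ?case by (simp add: coef_Eop)
  qed (simp add: coef_dg)
qed

lemma prod_list_mult: "(\<Prod>x\<leftarrow>u. g x * h x) = (\<Prod>x\<leftarrow>u. g x) * (\<Prod>x\<leftarrow>u. h x :: 'k::comm_monoid_mult)"
  by (induction u) (simp_all add: ac_simps)

text \<open>Only the products \<open>q i j * q j i\<close> matter: a diagonal rescaling of words intertwines the
  operators of \<open>q\<close> with those of \<open>normalized q\<close>.\<close>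

lemma normalized_Fword:
  fixes q :: "nat \<Rightarrow> nat \<Rightarrow> 'k::field"
  assumes nz: "\<And>i j. q i j \<noteq> 0"
    and zero: "foldr (shuffle.Fop (normalized q) k l) w vac = 0"
  shows "foldr (shuffle.Fop q k l) w vac = 0"
proof -
  interpret Q: shuffle q k l .
  interpret M: shuffle "normalized q" k l .
  define \<tau> where "\<tau> i j = normalized q i j / q i j" for i j
  \<comment> \<open>Any choice with \<theta> j x = \<tau> x j * \<theta> x j would do. Then
    \<open>\<sigma>\<close> is the product of \<theta> over the pairs of positions of a word in
    their order, and \<open>H\<close> is the diagonal intertwiner.\<close>
  define \<theta> where "\<theta> i j = (if j < i then \<tau> j i else 1)" for i j
  define \<sigma> where "\<sigma> = rec_list 1 (\<lambda>i u s. (\<Prod>x\<leftarrow>u. \<theta> i x) * s)"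
  define H where "H f = Vec (\<lambda>u. \<sigma> u * coef f u)" for f
  have \<tau>_nz: "\<tau> i j \<noteq> 0" for i j using nz by (simp add: \<tau>_def normalized_def)
  have \<tau>_inv: "inverse (\<tau> j x) = \<tau> x j" for j x
    using nz by (cases "j = x") (auto simp: \<tau>_def normalized_def field_simps)
  have \<theta>_nz: "\<theta> i j \<noteq> 0" for i j using \<tau>_nz by (simp add: \<theta>_def)
  have \<theta>: "\<theta> j x = \<tau> x j * \<theta> x j" for j x
  proof (cases x j rule: linorder_cases)
    case equal
    have "\<tau> j j = 1" using nz[of j j] by (simp add: \<tau>_def normalized_def)
    then show ?thesis using equal by simp
  next
    case greater
    have "\<tau> x j * \<tau> j x = 1" unfolding \<tau>_inv[of j x, symmetric] using \<tau>_nz[of j x] by simp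
    then show ?thesis using greater by (simp add: \<theta>_def)
  qed (simp add: \<theta>_def)
  have \<sigma>: "\<sigma> [] = 1" "\<sigma> (i # u) = (\<Prod>x\<leftarrow>u. \<theta> i x) * \<sigma> u" for i u by (simp_all add: \<sigma>_def)
  have \<sigma>_nz: "\<sigma> u \<noteq> 0" for u using \<theta>_nz by (induction u) (auto simp: \<sigma> prod_list_zero_iff)
  have qM: "normalized q i j = q i j * \<tau> i j" for i j using nz by (simp add: \<tau>_def)
  have c: "coef (M.Lop j g) u - coef (M.Kop j g) u
      = (\<Prod>x\<leftarrow>u. \<tau> x j) * (coef (Q.Lop j g) u - coef (Q.Kop j g) u)" for j g u
    by (simp add: Q.Lop_def Q.Kop_def M.Lop_def M.Kop_def qM prod_list_mult \<tau>_inv algebra_simps)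
  have H: "coef (H f) u = \<sigma> u * coef f u" for f u by (simp add: H_def)
  have E: "Eop i (H (dg (\<lambda>x. \<theta> x j) f)) = scl (\<theta> i j) (dg (\<theta> i) (H (dg (\<lambda>x. \<theta> x j) (Eop i f))))" for i j f
    by (rule vec_eqI) (simp add: coef_Eop H coef_dg \<sigma>)
  \<comment> \<open>Inserting a letter j in front of another letter rather than behind it changes
    \<open>\<sigma>\<close> by a ratio of \<theta>'s, which is exactly the ratio \<tau> by which the
    operators K and L of the two matrices differ.\<close>
  have inter: "coef (M.Fop j (H (dg (\<lambda>x. \<theta> x j) f))) u = coef (H (Q.Fop j f)) u" for j f u
  proof (induction u arbitrary: f)
    case (Cons i u)
    define h where "h = H (dg (\<lambda>x. \<theta> x j) (Eop i f))"
    have "scl (\<theta> i j) (M.Fop j (dg (\<theta> i) h)) = dg (\<theta> i) (M.Fop j h)"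
      by (simp add: M.dg_Fop)
    then have 1: "\<theta> i j * coef (M.Fop j (dg (\<theta> i) h)) u = (\<Prod>x\<leftarrow>u. \<theta> i x) * coef (M.Fop j h) u"
      by (metis coef_dg coef_simps(5))
    have 2: "(\<Prod>x\<leftarrow>u. \<theta> j x) = (\<Prod>x\<leftarrow>u. \<tau> x j) * (\<Prod>x\<leftarrow>u. \<theta> x j)"
      unfolding prod_list_mult[symmetric] by (intro arg_cong[where f = prod_list] map_cong refl \<theta>)
    have 3: "coef (M.Lop j (H (dg (\<lambda>x. \<theta> x j) f))) u - coef (M.Kop j (H (dg (\<lambda>x. \<theta> x j) f))) u
      = \<sigma> u * (\<Prod>x\<leftarrow>u. \<theta> j x) * (coef (Q.Lop j f) u - coef (Q.Kop j f) u)"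
      unfolding c 2 by (simp add: Q.Lop_def Q.Kop_def H coef_dg algebra_simps)
    have "coef (M.Fop j (H (dg (\<lambda>x. \<theta> x j) f))) (i # u) = coef (Eop i (M.Fop j (H (dg (\<lambda>x. \<theta> x j) f)))) u"
      by (simp add: coef_Eop)
    also have "\<dots> = \<theta> i j * coef (M.Fop j (dg (\<theta> i) h)) u + (if i = j then coef (M.Lop j (H (dg (\<lambda>x. \<theta> x j) f))) u - coef (M.Kop j (H (dg (\<lambda>x. \<theta> x j) f))) u else 0)"
      by (simp add: M.Eop_Fop E h_def)
    also have "\<dots> = (\<Prod>x\<leftarrow>u. \<theta> i x) * coef (H (Q.Fop j (Eop i f))) u + (if i = j then \<sigma> u * (\<Prod>x\<leftarrow>u. \<theta> j x) * (coef (Q.Lop j f) u - coef (Q.Kop j f) u) else 0)"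
      by (simp only: 1 3 Cons[of "Eop i f", folded h_def])
    also have "\<dots> = \<sigma> (i # u) * coef (Eop i (Q.Fop j f)) u"
      by (simp add: H \<sigma> Q.Eop_Fop algebra_simps)
    finally show ?case by (simp add: H coef_Eop)
  qed (simp add: H)
  have "\<exists>s. s \<noteq> 0 \<and> H (Q.Fword w vac) = scl s (M.Fword w vac)"
  proof (induction w)
    case Nil
    have "H (Q.Fword [] vac) = scl 1 (M.Fword [] vac)" by (rule vec_eqI) (auto simp: H vac_def \<sigma>)
    then show ?case by (intro exI[of _ 1]) simp
  next
    case (Cons j w)
    then obtain s where s: "s \<noteq> 0" "H (Q.Fword w vac) = scl s (M.Fword w vac)" by blast
    define d where "d = (\<Prod>x\<leftarrow>w. \<theta> x j)"
    have d: "d \<noteq> 0" using \<theta>_nz by (auto simp: d_def prod_list_zero_iff)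
    \<comment> \<open>On a weight vector the diagonal correction is a nonzero scalar, so
      \<open>H\<close> sends F-words to nonzero multiples of F-words.\<close>
    have "dg (\<lambda>x. \<theta> x j) (Q.Fword w vac) = scl d (Q.Fword w vac)"
    proof (rule vec_eqI)
      fix u
      show "coef (dg (\<lambda>x. \<theta> x j) (Q.Fword w vac)) u = coef (scl d (Q.Fword w vac)) u"
      proof (cases "coef (Q.Fword w vac) u = 0")
        case False
        then have "mset u = mset w" using Q.has_wt_Fword[of w] cnt_eq_mset[of u w] by (auto simp: has_wt_def)
        then show ?thesis using Q.prod_list_mset_cong[of u w "\<lambda>x. \<theta> x j"] by (simp add: coef_dg d_def)
      qed (simp add: coef_dg)
    qed
    then have "H (dg (\<lambda>x. \<theta> x j) (Q.Fword w vac)) = scl d (H (Q.Fword w vac))"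
      by (intro vec_eqI) (simp add: H)
    then have "H (Q.Fop j (Q.Fword w vac)) = scl (d * s) (M.Fop j (M.Fword w vac))"
      using inter[of j "Q.Fword w vac"] by (intro vec_eqI) (simp add: s)
    then show ?case using d s(1) by (intro exI[of _ "d * s"]) simp
  qed
  then have "H (Q.Fword w vac) = 0" using zero by auto
  then have "\<sigma> u * coef (Q.Fword w vac) u = 0" for u using H[of "Q.Fword w vac" u] by simp
  then show ?thesis using \<sigma>_nz by (intro vec_eqI) simp
qed

section \<open>Necessity, and the criterion for the span of the F-words\<close>

context shuffle
begin

lemma Lspan_finite_dim:
  assumes "\<forall>w\<in>lists {1..N}. length w \<ge> n \<longrightarrow> Fword w vac = 0"
  shows "\<exists>B. finite B \<and> B \<subseteq> Lspan N \<and> Lspan N \<subseteq> vec.span B"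
proof -
  define B where "B = (\<lambda>w. Fword w vac) ` {w. set w \<subseteq> {1..N} \<and> length w \<le> n}"
  have "finite B" unfolding B_def by (intro finite_imageI finite_lists_length_le) simp
  moreover have "B \<subseteq> Lspan N" using Fword_in_Lspan by (auto simp: B_def lists_eq_set)
  moreover have "Lspan N \<subseteq> vec.span B"
    unfolding Lspan_def
  proof (intro vec.span_minimal vec.subspace_span image_subsetI)
    fix w assume w: "w \<in> lists {1..N}"
    show "Fword w vac \<in> vec.span B"
    proof (cases "length w \<le> n")
      case True
      then show ?thesis using w by (intro vec.span_base) (auto simp: B_def lists_eq_set)
    next
      case False
      then show ?thesis using assms w vec.span_zero by auto
    qed
  qed
  ultimately show ?thesis by blast
qed

end

text \<open>If no r works, the factor in \<open>string_sum\<close> never vanishes, so every F_i^n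
  vac is nonzero; lying in different weights, these vectors are independent.\<close>

lemma (in shuffle_nz) finite_dim_dominant:
  assumes fin: "finite B" "Lspan N \<subseteq> vec.span B" and i: "i \<in> {1..N}" "not_root_of_unity (q i i)"
    and l: "l i \<noteq> 0"
  shows "\<exists>r. k i = l i * q i i ^ r"
proof (rule ccontr)
  assume no: "\<nexists>r. k i = l i * q i i ^ r"
  define f where "f n = (Fop i ^^ n) vac" for n
  have KL: "Kop i vac = scl (k i) vac" "Lop i vac = scl (l i) vac"
    by (auto intro!: vec_eqI simp: vac_def Kop_def Lop_def)
  have f_nz: "f n \<noteq> 0" for n
  proof (induction n)
    case 0
    have "coef vac [] \<noteq> (0::'k)" by (simp add: vac_def)
    then show ?case by (auto simp: f_def)
  next
    case (Suc n)
    have "l i - inverse (q i i) ^ n * k i \<noteq> 0"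
    proof
      assume "l i - inverse (q i i) ^ n * k i = 0"
      then have "k i = l i * q i i ^ n" using nz[of i i] by (simp add: field_simps power_inverse)
      with no show False by blast
    qed
    then have "Eop i (f (Suc n)) \<noteq> 0"
      unfolding f_def Eop_Fpow[OF Eop_vac KL] string_sum
      using geometric_nonzero[OF i(2), of n] Suc by (simp add: f_def del: sum.lessThan_Suc)
    then show ?case by auto
  qed
  have wt: "has_wt (f n) ((\<lambda>_. 0)(i := int n))" for n
    using has_wt_Fpow[OF has_wt_vac, where i = i and n = n] by (simp add: f_def)
  have distinct: "n = n'" if "coef (f n) u \<noteq> 0" "coef (f n') u \<noteq> 0" for n n' u
  proof -
    note a = wt[unfolded has_wt_def, rule_format]
    from fun_cong[OF a[OF that(1)], of i] fun_cong[OF a[OF that(2)], of i] show ?thesis by simp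
  qed
  have inj: "inj f"
  proof (rule injI)
    fix n n' assume "f n = f n'"
    moreover obtain u where "coef (f n) u \<noteq> 0" using nonzero_coef[OF f_nz[of n]] by blast
    ultimately show "n = n'" using distinct[of n u n'] by simp
  qed
  \<comment> \<open>The supports of the vectors f n are nonempty and pairwise disjoint, so a
    relation can be tested at one word.\<close>
  have "vec.independent (range f)"
  proof
    assume "vec.dependent (range f)"
    then obtain T c v where T: "finite T" "T \<subseteq> range f" "(\<Sum>v\<in>T. scl (c v) v) = 0" "v \<in> T" "c v \<noteq> 0"
      by (auto simp: vec.dependent_explicit)
    then obtain n u where n: "v = f n" "coef v u \<noteq> 0" using f_nz nonzero_coef by blast
    have coef_sum: "coef (\<Sum>v\<in>T. scl (c v) v) u = (\<Sum>v\<in>T. c v * coef v u)" for T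
      by (induction T rule: infinite_finite_induct) auto
    have "c v' * coef v' u = 0" if v': "v' \<in> T - {v}" for v'
    proof -
      obtain n' where "v' = f n'" using v' T(2) by blast
      then have "coef v' u = 0" using v' n distinct[of n u n'] by blast
      then show ?thesis by simp
    qed
    then have "(\<Sum>v\<in>T - {v}. c v * coef v u) = 0" by (rule sum.neutral[OF ballI])
    then have "(\<Sum>v\<in>T. c v * coef v u) = c v * coef v u"
      using sum.remove[OF T(1,4), of "\<lambda>v. c v * coef v u"] by simp
    then have "c v * coef v u = 0" using coef_sum[of T] T(3) by simp
    with T(5) n(2) show False by simp
  qed
  moreover have "range f \<subseteq> vec.span B"
    using Lspan_Fpow[OF Fword_in_Lspan[of "[]"] i(1)] fin(2) by (auto simp: f_def)
  ultimately have "finite (range f)" using vec.independent_span_bound[OF fin(1)] by blast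
  then show False using inj by (simp add: finite_image_iff)
qed

lemma not_root_of_unity_power: "not_root_of_unity (Q :: 'k::field) \<Longrightarrow> n \<ge> 1 \<Longrightarrow> not_root_of_unity (Q ^ n)"
  by (auto simp: not_root_of_unity_def power_mult[symmetric])

locale shuffle_on = shuffle_nz q k l for q :: "nat \<Rightarrow> nat \<Rightarrow> 'k::field" and k l +
  fixes N :: nat
  assumes out: "i \<notin> {1..N} \<or> j \<notin> {1..N} \<Longrightarrow> q i j = 1"
    and lnz: "l i \<noteq> 0"
begin

definition fin_dim_Lspan :: bool where
  "fin_dim_Lspan \<longleftrightarrow> (\<exists>B. finite B \<and> B \<subseteq> Lspan N \<and> Lspan N \<subseteq> vec.span B)"

lemma fin_dim_dominant:
  "fin_dim_Lspan \<Longrightarrow> i \<in> {1..N} \<Longrightarrow> not_root_of_unity (q i i) \<Longrightarrow> \<exists>r. k i = l i * q i i ^ r"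
  using finite_dim_dominant[of _ N i] lnz by (auto simp: fin_dim_Lspan_def)

lemma fin_dim_normalized:
  assumes "\<exists>n. \<forall>w\<in>lists {1..N}. length w \<ge> n \<longrightarrow> foldr (shuffle.Fop (normalized q) k l) w vac = 0"
  shows fin_dim_Lspan
proof -
  obtain n where n: "\<And>w. w \<in> lists {1..N} \<Longrightarrow> length w \<ge> n \<Longrightarrow> foldr (shuffle.Fop (normalized q) k l) w vac = 0"
    using assms by blast
  have "\<forall>w\<in>lists {1..N}. length w \<ge> n \<longrightarrow> Fword w vac = 0"
  proof (intro ballI impI)
    fix w assume "w \<in> lists {1..N}" "n \<le> length w"
    from normalized_Fword[OF nz n[OF this]] show "Fword w vac = 0" .
  qed
  then show ?thesis unfolding fin_dim_Lspan_def by (rule Lspan_finite_dim)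
qed

lemma normalized_out: "i \<notin> {1..N} \<or> j \<notin> {1..N} \<Longrightarrow> normalized q i j = 1"
  using out[of i j] out[of j i] unfolding normalized_def by (metis mult_1)

theorem type_A_iff:
  assumes m: "m \<in> {1..N}" and Q: "not_root_of_unity Q"
    and d: "\<And>i. i \<in> {1..N} \<Longrightarrow> i < m \<Longrightarrow> q i i = Q powi 2" "q m m = - 1"
      "\<And>i. i \<in> {1..N} \<Longrightarrow> m < i \<Longrightarrow> q i i = Q powi (- 2)"
    and n: "\<And>i. i \<in> {1..N-1} \<Longrightarrow> q i (i + 1) * q (i + 1) i = (if i + 1 \<le> m then Q powi (- 2) else Q powi 2)"
    and f: "\<And>i j. i \<in> {1..N} \<Longrightarrow> j \<in> {1..N} \<Longrightarrow> \<bar>int i - int j\<bar> \<ge> 2 \<Longrightarrow> q i j * q j i = 1"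
  shows "fin_dim_Lspan \<longleftrightarrow> (\<forall>i\<in>{1..N} - {m}. \<exists>r. k i = l i * q i i ^ r)"
proof
  define P where "P = Q ^ 2"
  have P: "not_root_of_unity P" unfolding P_def by (rule not_root_of_unity_power[OF Q]) simp
  have pw: "Q powi 2 = P" "Q powi (- 2) = inverse P" by (simp_all add: P_def power_int_minus)
  have nru: "not_root_of_unity (q i i)" if "i \<in> {1..N} - {m}" for i
    using that d(1,3)[of i] pw P not_root_of_unity_simps(2)[OF P] by (cases "i < m") auto
  show "\<forall>i\<in>{1..N} - {m}. \<exists>r. k i = l i * q i i ^ r" if fin_dim_Lspan
    using fin_dim_dominant[OF that] nru by blast
  assume "\<forall>i\<in>{1..N} - {m}. \<exists>r. k i = l i * q i i ^ r"
  then obtain r where r: "\<And>i. i \<in> {1..N} - {m} \<Longrightarrow> k i = l i * q i i ^ r i" by metis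
  show fin_dim_Lspan
  proof (rule fin_dim_normalized, rule type_A_finite[OF m P])
    show "l i \<noteq> 0" for i by (rule lnz)
    show "k i = l i * normalized q i i ^ r i" if "i \<in> {1..N} - {m}" for i
      using r[OF that] by (simp add: normalized_def)
    fix i j
    show "normalized q i j = (if i \<in> {1..N} \<and> j \<in> {1..N} then
        if i = j then if i < m then P else if i = m then - 1 else inverse P
        else if i = Suc j then if i \<le> m then inverse P else P else 1 else 1)"
    proof (cases "i \<in> {1..N} \<and> j \<in> {1..N}")
      case False
      then show ?thesis using normalized_out[of i j] by (simp only: if_False) blast
    next
      case True
      consider "i < j" | "i = j" | "i = Suc j" | "i > Suc j" by linarith
      then show ?thesis
      proof cases
        case 1
        then show ?thesis by (simp add: normalized_def)
      next
        case 2
        then show ?thesis using d(1,3)[of i] d(2) True pw by (cases i m rule: linorder_cases) (auto simp: normalized_def)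
      next
        case 3
        then show ?thesis using n[of j] True pw by (auto simp: normalized_def mult.commute)
      next
        case 4
        then show ?thesis using f[of i j] True by (auto simp: normalized_def)
      qed
    qed
  qed
qed

theorem type_C_iff:
  assumes N: "N \<ge> 3" and Q: "not_root_of_unity Q"
    and d: "q 1 1 = - 1" "\<And>i. i \<in> {2..N-1} \<Longrightarrow> q i i = Q powi 2" "q N N = Q powi 4"
    and n: "\<And>i. i \<in> {1..N-2} \<Longrightarrow> q i (i + 1) * q (i + 1) i = Q powi (- 2)"
      "q (N-1) N * q N (N-1) = Q powi (- 4)"
    and f: "\<And>i j. i \<in> {1..N} \<Longrightarrow> j \<in> {1..N} \<Longrightarrow> \<bar>int i - int j\<bar> \<ge> 2 \<Longrightarrow> q i j * q j i = 1"
  shows "fin_dim_Lspan \<longleftrightarrow> (\<forall>i\<in>{1..N} - {1}. \<exists>r. k i = l i * q i i ^ r)"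
proof
  define P where "P = Q ^ 2"
  have P: "not_root_of_unity P" unfolding P_def by (rule not_root_of_unity_power[OF Q]) simp
  have pw: "Q powi 2 = P" "Q powi (- 2) = inverse P" "Q powi 4 = P ^ 2" "Q powi (- 4) = inverse (P ^ 2)"
    by (simp_all add: P_def power_int_minus)
  have di: "q i i = P" if "1 < i" "i < N" for i
    using d(2)[of i] that pw by auto
  have nru: "not_root_of_unity (q i i)" if "i \<in> {1..N} - {1}" for i
    using that di[of i] d(3) pw P not_root_of_unity_power[OF P, of 2] by (cases "i = N") auto
  show "\<forall>i\<in>{1..N} - {1}. \<exists>r. k i = l i * q i i ^ r" if fin_dim_Lspan
    using fin_dim_dominant[OF that] nru by blast
  assume "\<forall>i\<in>{1..N} - {1}. \<exists>r. k i = l i * q i i ^ r"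
  then obtain r where r: "\<And>i. i \<in> {1..N} - {1} \<Longrightarrow> k i = l i * q i i ^ r i" by metis
  show fin_dim_Lspan
  proof (rule fin_dim_normalized, rule type_C_finite[OF N P])
    show "l i \<noteq> 0" for i by (rule lnz)
    show "k i = l i * normalized q i i ^ r i" if "i \<in> {1..N} - {1}" for i
      using r[OF that] by (simp add: normalized_def)
    fix i j
    show "normalized q i j = (if i \<in> {1..N} \<and> j \<in> {1..N} then
        if i = j then if i = 1 then - 1 else if i < N then P else P ^ 2
        else if i = Suc j then if i < N then inverse P else inverse (P ^ 2) else 1 else 1)"
    proof (cases "i \<in> {1..N} \<and> j \<in> {1..N}")
      case False
      then show ?thesis using normalized_out[of i j] by (simp only: if_False) blast
    next
      case True
      consider "i < j" | "i = j" | "i = Suc j" "i < N" | "i = Suc j" "i = N" | "i > Suc j" using True by force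
      then show ?thesis
      proof cases
        case 1
        then show ?thesis by (simp add: normalized_def)
      next
        case 2
        then show ?thesis using di[of i] d True pw by (cases "i = 1"; cases "i = N") (auto simp: normalized_def)
      next
        case 3
        then show ?thesis using n(1)[of j] True pw by (auto simp: normalized_def mult.commute)
      next
        case 4
        then have "N - 1 = j" "j < N" by simp_all
        then have "q j N * q N j = inverse (P ^ 2)" using n(2) pw by simp
        then show ?thesis using 4 True by (simp add: normalized_def mult.commute)
      next
        case 5
        then show ?thesis using f[of i j] True by (auto simp: normalized_def)
      qed
    qed
  qed
qed

end

section \<open>Linear algebra in the free algebra\<close>

text \<open>Linear extension from a basis of words: the common form of substitutions, of homogeneous
  components and of the action on functions on words.\<close>

definition lext :: "('k::field \<Rightarrow> 'v \<Rightarrow> 'v) \<Rightarrow> ('w \<Rightarrow> 'v) \<Rightarrow> ('w \<Rightarrow>\<^sub>0 'k) \<Rightarrow> 'v::ab_group_add" where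
  "lext sc h p = (\<Sum>w\<in>Poly_Mapping.keys p. sc (Poly_Mapping.lookup p w) (h w))"

lemma lext_zero [simp]: "lext sc h 0 = 0" by (simp add: lext_def)

lemma lext_superset:
  assumes "vector_space sc" "finite K" "Poly_Mapping.keys p \<subseteq> K"
  shows "lext sc h p = (\<Sum>w\<in>K. sc (Poly_Mapping.lookup p w) (h w))"
proof -
  interpret V: vector_space sc by fact
  show ?thesis unfolding lext_def using assms(2,3)
    by (intro sum.mono_neutral_left) (auto simp: in_keys_iff)
qed

lemma lext_add: assumes "vector_space sc" shows "lext sc h (p + q) = lext sc h p + lext sc h q"
proof -
  interpret V: vector_space sc by fact
  define K where "K = Poly_Mapping.keys p \<union> Poly_Mapping.keys q"
  have K: "finite K" "Poly_Mapping.keys p \<subseteq> K" "Poly_Mapping.keys q \<subseteq> K" "Poly_Mapping.keys (p + q) \<subseteq> K"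
    using keys_add[of p q] by (auto simp: K_def)
  show ?thesis
    unfolding lext_superset[OF assms K(1,2)] lext_superset[OF assms K(1,3)] lext_superset[OF assms K(1,4)]
    by (simp add: lookup_add V.scale_left_distrib sum.distrib)
qed

lemma lext_single: assumes "vector_space sc" shows "lext sc h (Poly_Mapping.single w c) = sc c (h w)"
proof -
  interpret V: vector_space sc by fact
  show ?thesis by (cases "c = 0") (simp_all add: lext_def)
qed

definition scp :: "'k::field \<Rightarrow> ('g list \<Rightarrow>\<^sub>0 'k) \<Rightarrow> ('g list \<Rightarrow>\<^sub>0 'k)" where
  "scp c p = fconst c * p"

definition mon :: "'g list \<Rightarrow> ('g list \<Rightarrow>\<^sub>0 'k::field)" where
  "mon w = Poly_Mapping.single w 1"

lemma list_add_simps: "[] + w = w" "w + [] = w" "(u + v) = u @ (v :: 'g list)"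
  by (simp_all add: plus_list_def)

lemma fconst_mult: "fconst c * fconst d = fconst (c * d)"
  by (simp add: mult_single list_add_simps)

lemma fconst_one: "fconst 1 = (1 :: 'g list \<Rightarrow>\<^sub>0 'k::field)"
  by (metis single_one zero_list_def)

interpretation fa: vector_space "scp :: 'k::field \<Rightarrow> ('g list \<Rightarrow>\<^sub>0 'k) \<Rightarrow> _"
  by unfold_locales (simp_all add: scp_def algebra_simps single_add fconst_mult[symmetric] fconst_one)

lemma scp_mon: "scp c (mon w) = Poly_Mapping.single w c"
  by (simp add: scp_def mon_def mult_single list_add_simps)

lemma mon_mult: "mon u * mon v = mon (u @ v)"
  by (simp add: mon_def mult_single plus_list_def)

lemma mon_Nil: "mon [] = 1" by (simp add: mon_def fconst_one)

lemma letter_mon: "letter g = mon [g]" by (simp add: mon_def)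

lemma mon_Cons: "mon (g # w) = letter g * mon w" by (simp add: letter_mon mon_mult)

definition Wd :: "'g set \<Rightarrow> ('g list \<Rightarrow>\<^sub>0 'k::field) set" where
  "Wd G = {p. Poly_Mapping.keys p \<subseteq> lists G}"

lemma carrier_free_algebra: "carrier (free_algebra G) = Wd G"
  by (simp add: free_algebra_def Wd_def)

lemma keys_span:
  fixes A :: "'g list set"
  shows "{p :: 'g list \<Rightarrow>\<^sub>0 'k::field. Poly_Mapping.keys p \<subseteq> A} = fa.span (mon ` A)"
proof
  show "fa.span (mon ` A) \<subseteq> {p :: 'g list \<Rightarrow>\<^sub>0 'k. Poly_Mapping.keys p \<subseteq> A}"
  proof (rule fa.span_minimal)
    show "fa.subspace {p :: 'g list \<Rightarrow>\<^sub>0 'k. Poly_Mapping.keys p \<subseteq> A}"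
    proof (rule fa.subspaceI)
      fix x y :: "'g list \<Rightarrow>\<^sub>0 'k" and c
      assume x: "x \<in> {p. Poly_Mapping.keys p \<subseteq> A}"
      show "y \<in> {p. Poly_Mapping.keys p \<subseteq> A} \<Longrightarrow> x + y \<in> {p. Poly_Mapping.keys p \<subseteq> A}"
        using keys_add[of x y] x by auto
      show "scp c x \<in> {p. Poly_Mapping.keys p \<subseteq> A}" using keys_mult[of "fconst c" x] x
        by (fastforce simp: scp_def list_add_simps split: if_splits)
    qed simp
  qed (auto simp: mon_def)
next
  show "{p :: 'g list \<Rightarrow>\<^sub>0 'k. Poly_Mapping.keys p \<subseteq> A} \<subseteq> fa.span (mon ` A)"
  proof
    fix p :: "'g list \<Rightarrow>\<^sub>0 'k" assume p: "p \<in> {p. Poly_Mapping.keys p \<subseteq> A}"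
    have "p = (\<Sum>w\<in>Poly_Mapping.keys p. scp (Poly_Mapping.lookup p w) (mon w))"
    proof (rule poly_mapping_eqI)
      fix v
      have "Poly_Mapping.lookup (\<Sum>w\<in>K. scp (Poly_Mapping.lookup p w) (mon w)) v = (if v \<in> K then Poly_Mapping.lookup p v else 0)"
        if "finite K" for K
        using that by (induction K) (auto simp: lookup_add scp_mon lookup_single when_def)
      then show "Poly_Mapping.lookup p v = Poly_Mapping.lookup (\<Sum>w\<in>Poly_Mapping.keys p. scp (Poly_Mapping.lookup p w) (mon w)) v"
        by (simp add: in_keys_iff)
    qed
    moreover have "\<dots> \<in> fa.span (mon ` A)"
      using p by (intro fa.span_sum fa.span_scale fa.span_base) auto
    ultimately show "p \<in> fa.span (mon ` A)" by simp
  qed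
qed

lemma Wd_span: "Wd G = fa.span (mon ` lists G)"
  unfolding Wd_def by (rule keys_span)

lemma Wd_subspace: "fa.subspace (Wd G)" unfolding Wd_span by (rule fa.subspace_span)

lemma Wd_mon: "w \<in> lists G \<Longrightarrow> mon w \<in> Wd G" by (auto simp: Wd_def mon_def)

lemma Wd_letter: "g \<in> G \<Longrightarrow> letter g \<in> Wd G" by (auto simp: Wd_def)

lemma Wd_one: "1 \<in> Wd G" using Wd_mon[of "[]" G] by (simp add: mon_Nil)

lemma Wd_fconst: "fconst c \<in> Wd G" by (auto simp: Wd_def)

lemma Wd_UNIV: "Wd UNIV = UNIV" by (auto simp: Wd_def)

lemma Wd_mult: "p \<in> Wd G \<Longrightarrow> q \<in> Wd G \<Longrightarrow> p * q \<in> Wd G"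
  using keys_mult[of p q] by (fastforce simp: Wd_def plus_list_def)

lemma Wd_mono: "G \<subseteq> H \<Longrightarrow> Wd G \<subseteq> Wd H"
  unfolding Wd_def using lists_mono[of G H] by blast

lemmas Wd_closed = Wd_letter Wd_one Wd_fconst Wd_mult fa.subspace_add[OF Wd_subspace]
  fa.subspace_diff[OF Wd_subspace] fa.subspace_neg[OF Wd_subspace] fa.subspace_0[OF Wd_subspace]
  fa.subspace_scale[OF Wd_subspace]

lemma Wd_induct [consumes 1, case_names zero step]:
  assumes "p \<in> Wd G" "P 0" "\<And>c w p. w \<in> lists G \<Longrightarrow> p \<in> Wd G \<Longrightarrow> P p \<Longrightarrow> P (scp c (mon w) + p)"
  shows "P p"
proof -
  have "p \<in> Wd G \<and> P p"
    using assms(1) unfolding Wd_span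
  proof (induction rule: fa.span_induct_alt)
    case (step c x y)
    then show ?case using assms(3) fa.span_base[of x "mon ` lists G"] unfolding Wd_span
      by (auto intro!: fa.span_add fa.span_scale simp: image_iff)
  qed (simp add: assms(2) fa.span_zero)
  then show ?thesis by simp
qed

lemmas poly_induct = Wd_induct[of _ UNIV, unfolded Wd_UNIV lists_UNIV, OF UNIV_I, case_names zero step]

lemma fconst_commute: "fconst c * p = p * fconst (c :: 'k::field)"
proof (induction p rule: poly_induct)
  case (step d w p)
  have "fconst c * Poly_Mapping.single w d = Poly_Mapping.single w d * fconst c"
    by (simp add: mult_single list_add_simps mult.commute)
  then show ?case using step by (simp add: scp_mon distrib_left distrib_right)
qed simp

lemma scp_mult: "scp c p * q = scp c (p * q)" "p * scp c q = scp c (p * q)"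
  by (simp_all add: scp_def mult.assoc) (metis fconst_commute mult.assoc)

lemma scp_one: "scp c 1 = fconst c" by (simp add: scp_def)

lemma free_subst_lext: "free_subst h p = lext scp (\<lambda>w. prod_list (map h w)) p"
  by (simp add: free_subst_def lext_def scp_def)

lemma free_subst_add: "free_subst h (p + q) = free_subst h p + free_subst h q"
  by (simp add: free_subst_lext lext_add[OF fa.vector_space_axioms])

lemma free_subst_mon: "free_subst h (mon w) = prod_list (map h w)"
  by (simp add: free_subst_lext mon_def lext_single[OF fa.vector_space_axioms])

lemma free_subst_zero: "free_subst h 0 = 0" by (simp add: free_subst_lext)

lemma free_subst_scp: "free_subst h (scp c p) = scp c (free_subst h p)"
proof (induction p rule: poly_induct)
  case (step d w p)
  have "free_subst h (scp c (scp d (mon w))) = scp c (free_subst h (scp d (mon w)))"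
    unfolding fa.scale_scale unfolding scp_mon free_subst_lext lext_single[OF fa.vector_space_axioms] by simp
  then show ?case using step by (simp add: fa.scale_right_distrib free_subst_add)
qed (simp add: free_subst_zero)

lemma free_subst_mult: "free_subst h (p * q) = free_subst h p * free_subst h q"
proof (induction p rule: poly_induct)
  case (step d w p)
  have "free_subst h (mon w * q) = free_subst h (mon w) * free_subst h q"
  proof (induction q rule: poly_induct)
    case (step d v q)
    then show ?case
      by (simp add: distrib_left free_subst_add scp_mult free_subst_scp mon_mult free_subst_mon)
  qed (simp add: free_subst_zero)
  then show ?case using step
    by (simp add: distrib_right free_subst_add scp_mult free_subst_scp)
qed (simp add: free_subst_zero)

lemma free_subst_letter: "free_subst h (letter g) = h g"
  by (simp add: letter_mon free_subst_mon)

lemma free_subst_Wd: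
  assumes "p \<in> Wd G" "\<And>g. g \<in> G \<Longrightarrow> h g \<in> Wd H" shows "free_subst h p \<in> Wd H"
  using assms(1)
proof (induction rule: Wd_induct)
  case (step c w p)
  have "prod_list (map h w) \<in> Wd H" using step(1) assms(2) by (induction w) (auto intro: Wd_closed)
  then show ?case using step by (auto simp: free_subst_add free_subst_scp free_subst_mon intro!: Wd_closed)
qed (simp add: free_subst_zero Wd_closed)

definition closed_by :: "'g set \<Rightarrow> ('g list \<Rightarrow>\<^sub>0 'k::field) set \<Rightarrow> bool" where
  "closed_by G J \<longleftrightarrow> fa.subspace J \<and> (\<forall>g\<in>G. \<forall>p\<in>J. letter g * p \<in> J)"

lemma closed_by_mult: "p \<in> Wd G \<Longrightarrow> closed_by G J \<Longrightarrow> j \<in> J \<Longrightarrow> p * j \<in> J"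
proof (induction p rule: Wd_induct)
  case zero
  then show ?case by (simp add: closed_by_def fa.subspace_0)
next
  case (step c w p)
  have J: "fa.subspace J" using step.prems by (simp add: closed_by_def)
  have "w \<in> lists G \<Longrightarrow> mon w * j \<in> J" for w
    using step(4,5) by (induction w) (auto simp: mon_Nil mon_Cons mult.assoc closed_by_def)
  then show ?case using step fa.subspace_add[OF J] fa.subspace_scale[OF J]
    by (simp add: distrib_right scp_mult)
qed

lemma closed_right_mult:
  assumes J: "fa.subspace J" and r: "\<And>g p. g \<in> G \<Longrightarrow> p \<in> J \<Longrightarrow> p * letter g \<in> J"
    and p: "p \<in> Wd G" and j: "j \<in> J"
  shows "j * p \<in> J"
  using p
proof (induction p rule: Wd_induct)
  case zero
  then show ?case using J by (simp add: fa.subspace_0)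
next
  case (step c w p)
  have "w \<in> lists G \<Longrightarrow> i \<in> J \<Longrightarrow> i * mon w \<in> J" for w i
  proof (induction w arbitrary: i)
    case (Cons g w)
    then show ?case using r[of g i] by (simp add: mon_Cons mult.assoc[symmetric])
  qed (simp add: mon_Nil)
  then show ?case using step j fa.subspace_add[OF J] fa.subspace_scale[OF J]
    by (simp add: distrib_left scp_mult)
qed

lemma free_algebra_simps:
  "x \<otimes>\<^bsub>free_algebra G\<^esub> y = x * y" "x \<oplus>\<^bsub>free_algebra G\<^esub> y = x + y" "\<one>\<^bsub>free_algebra G\<^esub> = 1"
  "\<zero>\<^bsub>free_algebra G\<^esub> = 0" "c \<odot>\<^bsub>free_algebra G\<^esub> x = scp c x"
  by (simp_all add: free_algebra_def scp_def)

section \<open>Quotients presented by subspaces of one polynomial space\<close>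

definition asub :: "'a::ab_group_add set \<Rightarrow> bool" where
  "asub J \<longleftrightarrow> 0 \<in> J \<and> (\<forall>x\<in>J. \<forall>y\<in>J. x + y \<in> J) \<and> (\<forall>x\<in>J. - x \<in> J)"

lemma subspace_asub: "fa.subspace J \<Longrightarrow> asub J"
  by (simp add: asub_def fa.subspace_0 fa.subspace_add fa.subspace_neg)

lemma asub_diff: "asub J \<Longrightarrow> x \<in> J \<Longrightarrow> y \<in> J \<Longrightarrow> x - y \<in> J"
  unfolding asub_def by (metis add_uminus_conv_diff)

text \<open>\<open>\<pi>\<close> identifies the additive group of \<open>M\<close> with \<open>P / J\<close>.\<close>

locale presentation =
  fixes M :: "('c, 'a) module" and \<pi> :: "'p::ab_group_add \<Rightarrow> 'a" and P J :: "'p set"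
  assumes P: "asub P" and J: "asub J" and JP: "J \<subseteq> P"
    and carr: "carrier M = \<pi> ` P"
    and add: "p \<in> P \<Longrightarrow> q \<in> P \<Longrightarrow> \<pi> p \<oplus>\<^bsub>M\<^esub> \<pi> q = \<pi> (p + q)"
    and zero: "\<zero>\<^bsub>M\<^esub> = \<pi> 0"
    and eq: "p \<in> P \<Longrightarrow> q \<in> P \<Longrightarrow> \<pi> p = \<pi> q \<longleftrightarrow> p - q \<in> J"
begin

lemma P_closed: "0 \<in> P" "x \<in> P \<Longrightarrow> y \<in> P \<Longrightarrow> x + y \<in> P" "x \<in> P \<Longrightarrow> - x \<in> P"
  "x \<in> P \<Longrightarrow> y \<in> P \<Longrightarrow> x - y \<in> P"
  using P asub_diff[OF P] by (auto simp: asub_def)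

lemma abelian: "abelian_group M"
proof (rule abelian_groupI)
  fix x assume "x \<in> carrier M"
  then obtain p where "p \<in> P" "x = \<pi> p" by (auto simp: carr)
  then show "\<exists>y\<in>carrier M. y \<oplus>\<^bsub>M\<^esub> x = \<zero>\<^bsub>M\<^esub>"
    by (intro bexI[of _ "\<pi> (- p)"]) (auto simp: add zero P_closed carr)
qed (auto simp: carr add zero P_closed ac_simps)

lemma neg: "p \<in> P \<Longrightarrow> \<ominus>\<^bsub>M\<^esub> \<pi> p = \<pi> (- p)"
proof -
  interpret abelian_group M by (rule abelian)
  assume p: "p \<in> P"
  have "\<pi> (- p) = \<ominus>\<^bsub>M\<^esub> \<pi> p"
    by (rule minus_equality[symmetric]) (use p in \<open>auto simp: carr add zero P_closed\<close>)
  then show ?thesis by simp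
qed

lemma diff: "p \<in> P \<Longrightarrow> q \<in> P \<Longrightarrow> \<pi> p \<ominus>\<^bsub>M\<^esub> \<pi> q = \<pi> (p - q)"
  by (simp add: a_minus_def neg add P_closed)

text \<open>One direction of the correspondence between subgroups of M and subgroups between J and
  P; the image under \<pi> is the other.\<close>

definition pull :: "'a set \<Rightarrow> 'p set" where "pull H = {p \<in> P. \<pi> p \<in> H}"

lemma image_pull: "H \<subseteq> carrier M \<Longrightarrow> \<pi> ` pull H = H"
  by (auto simp: pull_def carr)

lemma pull_image: "J \<subseteq> J' \<Longrightarrow> J' \<subseteq> P \<Longrightarrow> asub J' \<Longrightarrow> pull (\<pi> ` J') = J'"
proof (intro equalityI subsetI)
  fix p assume *: "J \<subseteq> J'" "J' \<subseteq> P" "asub J'" "p \<in> pull (\<pi> ` J')"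
  then obtain j where j: "j \<in> J'" "\<pi> p = \<pi> j" "p \<in> P" by (auto simp: pull_def)
  then have "p - j \<in> J'" using eq[of p j] * by auto
  then have "(p - j) + j \<in> J'" using *(3) j(1) unfolding asub_def by blast
  then show "p \<in> J'" by simp
qed (auto simp: pull_def)

lemma subgroup_image:
  assumes "asub J'" "J' \<subseteq> P" shows "subgroup (\<pi> ` J') (add_monoid M)"
proof
  show "\<pi> ` J' \<subseteq> carrier (add_monoid M)" using assms(2) by (auto simp: carr)
  fix x assume "x \<in> \<pi> ` J'"
  then obtain j where j: "j \<in> J'" "x = \<pi> j" by auto
  then have "\<ominus>\<^bsub>M\<^esub> x = \<pi> (- j)" "- j \<in> J'" using assms neg by (auto simp: asub_def)
  then show "inv\<^bsub>add_monoid M\<^esub> x \<in> \<pi> ` J'" by (simp add: a_inv_def)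
  fix y assume "y \<in> \<pi> ` J'"
  then obtain i where i: "i \<in> J'" "y = \<pi> i" by auto
  have "x \<oplus>\<^bsub>M\<^esub> y = \<pi> (j + i)" "j + i \<in> J'" using assms i j add by (auto simp: asub_def subset_iff)
  then show "x \<otimes>\<^bsub>add_monoid M\<^esub> y \<in> \<pi> ` J'" by simp
qed (use assms in \<open>auto simp: zero asub_def\<close>)

lemma pull_subgroup:
  assumes "subgroup H (add_monoid M)" shows "asub (pull H)" "J \<subseteq> pull H" "\<pi> ` pull H = H"
proof -
  have H: "H \<subseteq> carrier M" "\<zero>\<^bsub>M\<^esub> \<in> H" "\<And>x y. x \<in> H \<Longrightarrow> y \<in> H \<Longrightarrow> x \<oplus>\<^bsub>M\<^esub> y \<in> H" "\<And>x. x \<in> H \<Longrightarrow> \<ominus>\<^bsub>M\<^esub> x \<in> H"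
    using subgroup.subset[OF assms] subgroup.one_closed[OF assms] subgroup.m_closed[OF assms] subgroup.m_inv_closed[OF assms]
    by (auto simp: a_inv_def)
  show "asub (pull H)"
    unfolding asub_def
  proof (intro conjI ballI)
    show "0 \<in> pull H" using H(2) by (simp add: pull_def P_closed zero)
    fix x assume x: "x \<in> pull H"
    then show "- x \<in> pull H" using H(4)[of "\<pi> x"] neg by (auto simp: pull_def P_closed)
    fix y assume "y \<in> pull H"
    then show "x + y \<in> pull H" using x H(3)[of "\<pi> x" "\<pi> y"] add by (auto simp: pull_def P_closed)
  qed
  show "J \<subseteq> pull H"
  proof
    fix j assume j: "j \<in> J"
    then have "\<pi> j = \<pi> 0" using eq[of j 0] JP by (auto simp: P_closed)
    then show "j \<in> pull H" using H(2) j JP by (auto simp: pull_def zero)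
  qed
  show "\<pi> ` pull H = H" by (rule image_pull[OF H(1)])
qed

end

lemma submodule_iff: "submodule H R M \<longleftrightarrow> subgroup H (add_monoid M) \<and> (\<forall>a\<in>carrier R. \<forall>x\<in>H. a \<odot>\<^bsub>M\<^esub> x \<in> H)"
  by (auto simp: submodule_def submodule_axioms_def)

text \<open>The third isomorphism theorem, (P/J)/(J'/J) = P/J': iterated quotients remain quotients
  of the same P, and nested cosets need not be handled later.\<close>

locale pres_quot = presentation M \<pi> P J for M :: "('c, 'a) module" and \<pi> :: "'p::ab_group_add \<Rightarrow> 'a" and P J :: "'p set" +
  fixes J' :: "'p set"
  assumes J': "asub J'" "J \<subseteq> J'" "J' \<subseteq> P"
begin

definition \<pi>' :: "'p \<Rightarrow> 'a set" where "\<pi>' p = \<pi> ` J' +>\<^bsub>M\<^esub> \<pi> p"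

lemma J'_closed: "0 \<in> J'" "x \<in> J' \<Longrightarrow> y \<in> J' \<Longrightarrow> x + y \<in> J'" "x \<in> J' \<Longrightarrow> - x \<in> J'"
  "x \<in> J' \<Longrightarrow> y \<in> J' \<Longrightarrow> x - y \<in> J'"
  using J'(1) asub_diff[OF J'(1)] by (auto simp: asub_def)

lemma coset: "p \<in> P \<Longrightarrow> \<pi>' p = \<pi> ` {q \<in> P. q - p \<in> J'}"
proof -
  assume p: "p \<in> P"
  have "\<pi>' p = (\<lambda>j. \<pi> (j + p)) ` J'"
    using add[OF _ p] J'(3) by (auto simp: \<pi>'_def a_r_coset_def' image_iff subset_iff)
  also have "\<dots> = \<pi> ` {q \<in> P. q - p \<in> J'}"
  proof (intro equalityI subsetI)
    fix x assume "x \<in> (\<lambda>j. \<pi> (j + p)) ` J'"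
    then show "x \<in> \<pi> ` {q \<in> P. q - p \<in> J'}" using p J'(3) P_closed by auto
  next
    fix x assume "x \<in> \<pi> ` {q \<in> P. q - p \<in> J'}"
    then obtain q where "q \<in> P" "q - p \<in> J'" "x = \<pi> ((q - p) + p)" by auto
    then show "x \<in> (\<lambda>j. \<pi> (j + p)) ` J'" by blast
  qed
  finally show ?thesis .
qed

lemma coset_eq: "p \<in> P \<Longrightarrow> q \<in> P \<Longrightarrow> \<pi>' p = \<pi>' q \<longleftrightarrow> p - q \<in> J'"
proof
  assume pq: "p \<in> P" "q \<in> P" "\<pi>' p = \<pi>' q"
  have "\<pi> p \<in> \<pi>' p" using coset[OF pq(1)] pq(1) J'_closed by auto
  then obtain x where x: "x \<in> P" "x - q \<in> J'" "\<pi> p = \<pi> x" using pq coset by auto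
  then have "p - x \<in> J'" using eq[of p x] pq J' by auto
  then have "(p - x) + (x - q) \<in> J'" using x J'_closed by blast
  then show "p - q \<in> J'" by simp
next
  assume pq: "p \<in> P" "q \<in> P" "p - q \<in> J'"
  have "x - p \<in> J' \<longleftrightarrow> x - q \<in> J'" for x
  proof
    assume "x - p \<in> J'"
    then have "(x - p) + (p - q) \<in> J'" using pq J'_closed by blast
    then show "x - q \<in> J'" by simp
  next
    assume "x - q \<in> J'"
    then have "(x - q) - (p - q) \<in> J'" using pq J'_closed by blast
    then show "x - p \<in> J'" by simp
  qed
  then show "\<pi>' p = \<pi>' q" using coset pq by simp
qed

lemma quot_carrier: "carrier (quot M (\<pi> ` J')) = \<pi>' ` P"
  by (auto simp: quot_def A_RCOSETS_def' carr \<pi>'_def)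

lemma union_const: "A \<noteq> {} \<Longrightarrow> (\<And>a. a \<in> A \<Longrightarrow> f a = c) \<Longrightarrow> (\<Union>a\<in>A. f a) = c" by auto

lemma quot_add: "p \<in> P \<Longrightarrow> q \<in> P \<Longrightarrow> \<pi>' p \<oplus>\<^bsub>quot M (\<pi> ` J')\<^esub> \<pi>' q = \<pi>' (p + q)"
proof -
  assume pq: "p \<in> P" "q \<in> P"
  have "\<pi>' p <+>\<^bsub>M\<^esub> \<pi>' q = \<pi>' (p + q)"
  proof (intro equalityI subsetI)
    fix x assume "x \<in> \<pi>' p <+>\<^bsub>M\<^esub> \<pi>' q"
    then obtain a b where ab: "a \<in> P" "a - p \<in> J'" "b \<in> P" "b - q \<in> J'" "x = \<pi> a \<oplus>\<^bsub>M\<^esub> \<pi> b"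
      by (auto simp: set_add_def' coset pq)
    then have "(a - p) + (b - q) \<in> J'" using J'_closed by blast
    then have "(a + b) - (p + q) \<in> J'" by (simp add: algebra_simps)
    then show "x \<in> \<pi>' (p + q)" using ab pq by (auto simp: coset P_closed add)
  next
    fix x assume "x \<in> \<pi>' (p + q)"
    then obtain a where a: "a \<in> P" "a - (p + q) \<in> J'" "x = \<pi> a" using pq by (auto simp: coset P_closed)
    have "x = \<pi> (a - q) \<oplus>\<^bsub>M\<^esub> \<pi> q" using a pq by (simp add: add P_closed)
    moreover have "(a - q) - p \<in> J'" using a(2) by (simp add: algebra_simps)
    then have "\<pi> (a - q) \<in> \<pi>' p" "\<pi> q \<in> \<pi>' q" using a pq J'_closed(1) by (auto simp: coset P_closed)
    ultimately show "x \<in> \<pi>' p <+>\<^bsub>M\<^esub> \<pi>' q" by (auto simp: set_add_def')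
  qed
  then show ?thesis by (simp add: quot_def)
qed

lemma quot_presentation: "presentation (quot M (\<pi> ` J')) \<pi>' P J'"
proof
  show "\<zero>\<^bsub>quot M (\<pi> ` J')\<^esub> = \<pi>' 0"
  proof -
    have "\<pi>' 0 = \<pi> ` J'" using coset[OF P_closed(1)] J'(3) by auto
    then show ?thesis by (simp add: quot_def)
  qed
qed (use P J' quot_carrier quot_add coset_eq in auto)

text \<open>The product of cosets is a union over all pairs of representatives; compatibility with
  J' makes all members of this union equal.\<close>

lemma quot_mult:
  assumes m: "\<And>p q. p \<in> P \<Longrightarrow> q \<in> P \<Longrightarrow> \<pi> p \<otimes>\<^bsub>M\<^esub> \<pi> q = \<pi> (tm p q) \<and> tm p q \<in> P"
    and tm: "\<And>a b p q. p \<in> P \<Longrightarrow> q \<in> P \<Longrightarrow> a \<in> P \<Longrightarrow> b \<in> P \<Longrightarrow> a - p \<in> J' \<Longrightarrow> b - q \<in> J' \<Longrightarrow> tm a b - tm p q \<in> J'"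
    and pq: "p \<in> P" "q \<in> P"
  shows "\<pi>' p \<otimes>\<^bsub>quot M (\<pi> ` J')\<^esub> \<pi>' q = \<pi>' (tm p q)"
proof -
  have "\<pi> ` J' +>\<^bsub>M\<^esub> (x \<otimes>\<^bsub>M\<^esub> y) = \<pi>' (tm p q)" if xy: "x \<in> \<pi>' p" "y \<in> \<pi>' q" for x y
  proof -
    obtain a b where ab: "a \<in> P" "a - p \<in> J'" "b \<in> P" "b - q \<in> J'" "x = \<pi> a" "y = \<pi> b"
      using xy pq by (auto simp: coset)
    then have "\<pi>' (tm a b) = \<pi>' (tm p q)" using coset_eq m tm pq by blast
    then show ?thesis using ab m by (simp add: \<pi>'_def)
  qed
  moreover have "\<pi>' p \<noteq> {}" "\<pi>' q \<noteq> {}" using pq J'_closed by (auto simp: coset)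
  ultimately have "(\<Union>x\<in>\<pi>' p. \<Union>y\<in>\<pi>' q. \<pi> ` J' +>\<^bsub>M\<^esub> (x \<otimes>\<^bsub>M\<^esub> y)) = \<pi>' (tm p q)"
    by (intro union_const) auto
  then show ?thesis by (simp add: quot_def rcoset_mult_def)
qed

lemma quot_smult:
  assumes m: "\<And>p. p \<in> P \<Longrightarrow> c \<odot>\<^bsub>M\<^esub> \<pi> p = \<pi> (s p) \<and> s p \<in> P"
    and s: "\<And>a p. p \<in> P \<Longrightarrow> a \<in> P \<Longrightarrow> a - p \<in> J' \<Longrightarrow> s a - s p \<in> J'"
    and p: "p \<in> P"
  shows "c \<odot>\<^bsub>quot M (\<pi> ` J')\<^esub> \<pi>' p = \<pi>' (s p)"
proof -
  have "\<pi> ` J' +>\<^bsub>M\<^esub> (c \<odot>\<^bsub>M\<^esub> x) = \<pi>' (s p)" if x: "x \<in> \<pi>' p" for x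
  proof -
    obtain a where a: "a \<in> P" "a - p \<in> J'" "x = \<pi> a" using x p by (auto simp: coset)
    then have "\<pi>' (s a) = \<pi>' (s p)" using coset_eq m s p by blast
    then show ?thesis using a m by (simp add: \<pi>'_def)
  qed
  moreover have "\<pi>' p \<noteq> {}" using p J'_closed by (auto simp: coset)
  ultimately have "(\<Union>x\<in>\<pi>' p. \<pi> ` J' +>\<^bsub>M\<^esub> (c \<odot>\<^bsub>M\<^esub> x)) = \<pi>' (s p)"
    by (intro union_const) auto
  then show ?thesis by (simp add: quot_def)
qed

lemma quot_one: "\<one>\<^bsub>M\<^esub> = \<pi> u \<Longrightarrow> \<one>\<^bsub>quot M (\<pi> ` J')\<^esub> = \<pi>' u"
  by (simp add: quot_def \<pi>'_def)

end

lemma subring_iff: "subring B A \<longleftrightarrow> subgroup B (add_monoid A) \<and> submonoid B A"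
  by (simp add: subring_def)

lemma UNIV_scalars [simp]: "carrier (ring_of_type_algebra :: 'k::field ring) = UNIV"
  by (simp add: ring_of_type_algebra_def)

lemma lin_span_image:
  fixes \<pi>f :: "('g list \<Rightarrow>\<^sub>0 'k::field) \<Rightarrow> 'a"
  assumes pi: "presentation V \<pi>f Q K" and Q: "fa.subspace Q"
    and sm: "\<And>c p. p \<in> Q \<Longrightarrow> c \<odot>\<^bsub>V\<^esub> \<pi>f p = \<pi>f (scp c p)"
    and S: "S \<subseteq> carrier V"
  shows "lin_span V S = \<pi>f ` fa.span (presentation.pull \<pi>f Q S)"
proof -
  interpret V: presentation V \<pi>f Q K by (rule pi)
  have pQ: "fa.span (V.pull S) \<subseteq> Q" by (rule fa.span_minimal) (auto simp: V.pull_def Q)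
  show ?thesis
  proof
    have "submodule (\<pi>f ` fa.span (V.pull S)) (ring_of_type_algebra :: 'k ring) V"
      unfolding submodule_iff
    proof (intro conjI ballI)
      show "subgroup (\<pi>f ` fa.span (V.pull S)) (add_monoid V)"
        by (rule V.subgroup_image[OF subspace_asub[OF fa.subspace_span] pQ])
      fix a :: 'k and x assume "x \<in> \<pi>f ` fa.span (V.pull S)"
      then show "a \<odot>\<^bsub>V\<^esub> x \<in> \<pi>f ` fa.span (V.pull S)"
        using sm pQ fa.span_scale by blast
    qed
    moreover have "S \<subseteq> \<pi>f ` fa.span (V.pull S)"
      using V.image_pull[OF S] fa.span_superset by blast
    ultimately show "lin_span V S \<subseteq> \<pi>f ` fa.span (V.pull S)" unfolding lin_span_def by blast
    show "\<pi>f ` fa.span (V.pull S) \<subseteq> lin_span V S"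
      unfolding lin_span_def
    proof (rule Inter_greatest, clarify)
      fix W p assume W: "submodule W (ring_of_type_algebra :: 'k ring) V" "S \<subseteq> W" "p \<in> fa.span (V.pull S)"
      have sub: "subgroup W (add_monoid V)" using W(1) by (simp add: submodule_iff)
      note pw = V.pull_subgroup[OF sub]
      have "fa.subspace (V.pull W)"
      proof (rule fa.subspaceI)
        fix c x assume "x \<in> V.pull W"
        then have x: "x \<in> Q" "\<pi>f x \<in> W" by (auto simp: V.pull_def)
        have "c \<odot>\<^bsub>V\<^esub> \<pi>f x \<in> W" using W(1) x(2) unfolding submodule_iff by simp
        then show "scp c x \<in> V.pull W"
          using sm[OF x(1)] x fa.subspace_scale[OF Q] by (simp add: V.pull_def)
      qed (use pw(1) in \<open>auto simp: asub_def\<close>)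
      moreover have "V.pull S \<subseteq> V.pull W" using W(2) by (auto simp: V.pull_def)
      ultimately have "p \<in> V.pull W" using fa.span_minimal W(3) by blast
      then show "\<pi>f p \<in> W" by (simp add: V.pull_def)
    qed
  qed
qed

section \<open>The lattice and the grading of polynomials\<close>

lemma ZPi_iff: "\<alpha> \<in> ZPi N \<longleftrightarrow> Poly_Mapping.keys \<alpha> \<subseteq> {1..N}"
  by (simp add: free_Abelian_group_def)

lemma ZPi_closed:
  "0 \<in> ZPi N" "\<alpha> \<in> ZPi N \<Longrightarrow> \<beta> \<in> ZPi N \<Longrightarrow> \<alpha> + \<beta> \<in> ZPi N" "\<alpha> \<in> ZPi N \<Longrightarrow> - \<alpha> \<in> ZPi N"
  "\<alpha> \<in> ZPi N \<Longrightarrow> \<beta> \<in> ZPi N \<Longrightarrow> \<alpha> - \<beta> \<in> ZPi N" "i \<in> {1..N} \<Longrightarrow> frag_of i \<in> ZPi N"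
  using keys_add[of \<alpha> \<beta>] keys_diff[of \<alpha> \<beta>] by (auto simp: ZPi_iff)

definition wdeg :: "gen list \<Rightarrow> lattice" where "wdeg w = sum_list (map gen_deg w)"

lemma wdeg_simps [simp]: "wdeg [] = 0" "wdeg (g # w) = gen_deg g + wdeg w" "wdeg (u @ w) = wdeg u + wdeg w"
  by (simp_all add: wdeg_def)

definition Hs :: "gen set \<Rightarrow> lattice \<Rightarrow> (gen list \<Rightarrow>\<^sub>0 'k::field) set" where
  "Hs S \<beta> = fa.span (mon ` {w \<in> lists S. wdeg w = \<beta>})"

lemma Hs_subspace: "fa.subspace (Hs S \<beta>)" unfolding Hs_def by (rule fa.subspace_span)

lemma Hs_mon: "w \<in> lists S \<Longrightarrow> wdeg w = \<beta> \<Longrightarrow> mon w \<in> Hs S \<beta>"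
  unfolding Hs_def by (rule fa.span_base) auto

lemma Hs_Wd: "Hs S \<beta> \<subseteq> Wd S"
  unfolding Hs_def Wd_span by (rule fa.span_mono) auto

lemma Hs_mono: "S \<subseteq> T \<Longrightarrow> Hs S \<beta> \<subseteq> Hs T \<beta>"
  unfolding Hs_def using lists_mono[of S T] by (intro fa.span_mono) auto

lemma Hs_induct [consumes 1, case_names zero step]:
  assumes "p \<in> Hs S \<beta>" "P 0"
    "\<And>c w p. w \<in> lists S \<Longrightarrow> wdeg w = \<beta> \<Longrightarrow> p \<in> Hs S \<beta> \<Longrightarrow> P p \<Longrightarrow> P (scp c (mon w) + p)"
  shows "P p"
proof -
  have "p \<in> Hs S \<beta> \<and> P p"
    using assms(1) unfolding Hs_def
  proof (induction rule: fa.span_induct_alt)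
    case (step c x y)
    then show ?case using assms(3) fa.span_base[of x "mon ` {w \<in> lists S. wdeg w = \<beta>}"] unfolding Hs_def
      by (auto intro!: fa.span_add fa.span_scale simp: image_iff)
  qed (simp add: assms(2) fa.span_zero)
  then show ?thesis by simp
qed

lemma Hs_mult: "p \<in> Hs S \<beta> \<Longrightarrow> q \<in> Hs S \<gamma> \<Longrightarrow> p * q \<in> Hs S (\<beta> + \<gamma>)"
proof (induction p rule: Hs_induct)
  case (step c w p)
  have "mon w * q \<in> Hs S (\<beta> + \<gamma>)" using step.prems step(1,2)
  proof (induction q rule: Hs_induct)
    case (step d v q)
    then show ?case
      by (simp add: distrib_left scp_mult mon_mult fa.subspace_add[OF Hs_subspace] fa.subspace_scale[OF Hs_subspace] Hs_mon)
  qed (simp add: fa.subspace_0[OF Hs_subspace])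
  then show ?case using step
    by (simp add: distrib_right scp_mult fa.subspace_add[OF Hs_subspace] fa.subspace_scale[OF Hs_subspace])
qed (simp add: fa.subspace_0[OF Hs_subspace])

definition comp :: "lattice \<Rightarrow> (gen list \<Rightarrow>\<^sub>0 'k::field) \<Rightarrow> (gen list \<Rightarrow>\<^sub>0 'k)" where
  "comp \<beta> = lext scp (\<lambda>w. if wdeg w = \<beta> then mon w else 0)"

lemma comp_add: "comp \<beta> (p + q) = comp \<beta> p + comp \<beta> q"
  by (simp add: comp_def lext_add[OF fa.vector_space_axioms])

lemma comp_zero [simp]: "comp \<beta> 0 = 0" by (simp add: comp_def)

lemma comp_scp_mon: "comp \<beta> (scp c (mon w)) = (if wdeg w = \<beta> then scp c (mon w) else 0)"
  by (simp add: comp_def scp_mon lext_single[OF fa.vector_space_axioms])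

lemma comp_scp: "comp \<beta> (scp c p) = scp c (comp \<beta> p)"
  by (induction p rule: poly_induct) (simp_all add: fa.scale_right_distrib comp_add comp_scp_mon)

lemma comp_Hs: "p \<in> Hs S \<gamma> \<Longrightarrow> comp \<beta> p = (if \<gamma> = \<beta> then p else 0)"
  by (induction p rule: Hs_induct) (auto simp: comp_add comp_scp_mon)

lemma comp_in_Hs: "p \<in> Wd S \<Longrightarrow> comp \<beta> p \<in> Hs S \<beta>"
proof (induction p rule: Wd_induct)
  case (step c w p)
  then show ?case
    by (auto simp: comp_add comp_scp_mon intro!: fa.subspace_add[OF Hs_subspace] fa.subspace_scale[OF Hs_subspace] Hs_mon)
qed (simp add: fa.subspace_0[OF Hs_subspace])

lemma comp_letter_mult: "comp \<beta> (letter g * p) = letter g * comp (\<beta> - gen_deg g) p"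
proof (induction p rule: poly_induct)
  case (step c w p)
  have "comp \<beta> (letter g * scp c (mon w)) = letter g * comp (\<beta> - gen_deg g) (scp c (mon w))"
    by (auto simp: scp_mult mon_Cons[symmetric] comp_scp_mon algebra_simps)
  then show ?case using step by (simp add: distrib_left comp_add)
qed simp

lemma comp_mult_letter: "comp \<beta> (p * letter g) = comp (\<beta> - gen_deg g) p * letter g"
proof (induction p rule: poly_induct)
  case (step c w p)
  have "comp \<beta> (scp c (mon w) * letter g) = comp (\<beta> - gen_deg g) (scp c (mon w)) * letter g"
    by (auto simp: scp_mult letter_mon mon_mult comp_scp_mon algebra_simps)
  then show ?case using step by (simp add: distrib_right comp_add)
qed simp

section \<open>The algebra U-tilde\<close>

locale gqg =
  fixes N :: nat and \<chi> :: "lattice \<Rightarrow> lattice \<Rightarrow> 'k::field_char_0"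
  assumes bh: "bihom N \<chi>"
begin

abbreviation "Fr \<equiv> (Wd (gens N) :: (gen list \<Rightarrow>\<^sub>0 'k) set)"
abbreviation "rr \<equiv> rel_ideal N \<chi>"
abbreviation "UT \<equiv> Ut N \<chi>"
abbreviation "pj \<equiv> projt N \<chi>"

lemma chi_nz: "\<alpha> \<in> ZPi N \<Longrightarrow> \<beta> \<in> ZPi N \<Longrightarrow> \<chi> \<alpha> \<beta> \<noteq> 0"
  using bh by (simp add: bihom_def)

lemma chi_add: "\<alpha> \<in> ZPi N \<Longrightarrow> \<beta> \<in> ZPi N \<Longrightarrow> \<gamma> \<in> ZPi N \<Longrightarrow> \<chi> \<alpha> (\<beta> + \<gamma>) = \<chi> \<alpha> \<beta> * \<chi> \<alpha> \<gamma>"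
  "\<alpha> \<in> ZPi N \<Longrightarrow> \<beta> \<in> ZPi N \<Longrightarrow> \<gamma> \<in> ZPi N \<Longrightarrow> \<chi> (\<alpha> + \<beta>) \<gamma> = \<chi> \<alpha> \<gamma> * \<chi> \<beta> \<gamma>"
  using bh by (simp_all add: bihom_def)

lemma chi_0: "\<alpha> \<in> ZPi N \<Longrightarrow> \<chi> \<alpha> 0 = 1" "\<alpha> \<in> ZPi N \<Longrightarrow> \<chi> 0 \<alpha> = 1"
  using chi_add[of \<alpha> 0 0] chi_add(2)[of 0 0 \<alpha>] chi_nz[of \<alpha> 0] chi_nz[of 0 \<alpha>] ZPi_closed(1)
  by auto

lemma chi_neg:
  assumes "\<alpha> \<in> ZPi N" "\<beta> \<in> ZPi N"
  shows "\<chi> \<alpha> (- \<beta>) = inverse (\<chi> \<alpha> \<beta>)" "\<chi> (- \<alpha>) \<beta> = inverse (\<chi> \<alpha> \<beta>)"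
proof -
  have a: "\<chi> \<alpha> \<beta> * \<chi> \<alpha> (- \<beta>) = 1" and b: "\<chi> \<alpha> \<beta> * \<chi> (- \<alpha>) \<beta> = 1"
    using chi_add(1)[of \<alpha> \<beta> "- \<beta>"] chi_add(2)[of \<alpha> "- \<alpha>" \<beta>] chi_0[of \<alpha>] chi_0[of \<beta>] assms ZPi_closed(3)
    by auto
  show "\<chi> \<alpha> (- \<beta>) = inverse (\<chi> \<alpha> \<beta>)" by (rule inverse_unique[OF a, symmetric])
  show "\<chi> (- \<alpha>) \<beta> = inverse (\<chi> \<alpha> \<beta>)" by (rule inverse_unique[OF b, symmetric])
qed

lemma gens_iff: "GK \<alpha> \<in> gens N \<longleftrightarrow> \<alpha> \<in> ZPi N" "GL \<alpha> \<in> gens N \<longleftrightarrow> \<alpha> \<in> ZPi N"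
  "GE i \<in> gens N \<longleftrightarrow> i \<in> {1..N}" "GF i \<in> gens N \<longleftrightarrow> i \<in> {1..N}"
  unfolding gens_def by blast+

lemma letters_Fr: "\<alpha> \<in> ZPi N \<Longrightarrow> kk \<alpha> \<in> Fr" "\<alpha> \<in> ZPi N \<Longrightarrow> ll \<alpha> \<in> Fr"
  "i \<in> {1..N} \<Longrightarrow> ee i \<in> Fr" "i \<in> {1..N} \<Longrightarrow> ff i \<in> Fr"
  by (auto intro!: Wd_letter simp only: gens_iff)

lemma gen_deg_ZPi: "g \<in> gens N \<Longrightarrow> gen_deg g \<in> ZPi N"
  using ZPi_closed(1,3,5) unfolding gens_def by auto

lemma wdeg_ZPi: "w \<in> lists (gens N) \<Longrightarrow> wdeg w \<in> ZPi N"
proof (induction w)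
  case (Cons g w)
  then show ?case using gen_deg_ZPi[of g] ZPi_closed(2)[of "gen_deg g" N "wdeg w"] by (simp del: carrier_free_Abelian_group_iff)
qed (simp add: ZPi_closed)

lemma relators_Hs:
  assumes "p \<in> relators N \<chi>" shows "\<exists>\<gamma>. p \<in> Hs (gens N) \<gamma>"
proof -
  note sub = fa.subspace_diff[OF Hs_subspace] fa.subspace_scale[OF Hs_subspace] fa.subspace_add[OF Hs_subspace]
    fa.subspace_neg[OF Hs_subspace] fa.subspace_0[OF Hs_subspace]
  have l: "letter g \<in> (Hs (gens N) (gen_deg g) :: (gen list \<Rightarrow>\<^sub>0 'k) set)" if "g \<in> gens N" for g
    unfolding letter_mon using that by (intro Hs_mon) auto
  have K: "\<alpha> \<in> ZPi N \<Longrightarrow> kk \<alpha> \<in> (Hs (gens N) 0 :: (gen list \<Rightarrow>\<^sub>0 'k) set)"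
    and L: "\<alpha> \<in> ZPi N \<Longrightarrow> ll \<alpha> \<in> (Hs (gens N) 0 :: (gen list \<Rightarrow>\<^sub>0 'k) set)" for \<alpha>
    using l[of "GK \<alpha>"] l[of "GL \<alpha>"] gens_iff by auto
  have E: "i \<in> {1..N} \<Longrightarrow> ee i \<in> (Hs (gens N) (frag_of i) :: (gen list \<Rightarrow>\<^sub>0 'k) set)"
    and F: "i \<in> {1..N} \<Longrightarrow> ff i \<in> (Hs (gens N) (- frag_of i) :: (gen list \<Rightarrow>\<^sub>0 'k) set)" for i
    using l[of "GE i"] l[of "GF i"] gens_iff by auto
  have one: "1 \<in> (Hs (gens N) 0 :: (gen list \<Rightarrow>\<^sub>0 'k) set)"
    using Hs_mon[of "[]" "gens N" 0] by (simp add: mon_Nil)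
  have KK: "a \<in> Hs (gens N) 0 \<Longrightarrow> b \<in> Hs (gens N) \<gamma> \<Longrightarrow> a * b \<in> (Hs (gens N) \<gamma> :: (gen list \<Rightarrow>\<^sub>0 'k) set)"
    "a \<in> Hs (gens N) \<gamma> \<Longrightarrow> b \<in> Hs (gens N) 0 \<Longrightarrow> a * b \<in> (Hs (gens N) \<gamma> :: (gen list \<Rightarrow>\<^sub>0 'k) set)" for a b \<gamma>
    using Hs_mult[of a "gens N" 0 b \<gamma>] Hs_mult[of a "gens N" \<gamma> b 0] by auto
  have ZK: "\<alpha> \<in> ZPi N \<Longrightarrow> \<beta> \<in> ZPi N \<Longrightarrow> \<alpha> + \<beta> \<in> ZPi N" "0 \<in> ZPi N" for \<alpha> \<beta> using ZPi_closed by blast+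
  have r1: "kk \<alpha> * ee i - fconst c * ee i * kk \<alpha> \<in> (Hs (gens N) (frag_of i) :: (gen list \<Rightarrow>\<^sub>0 'k) set)" if "\<alpha> \<in> ZPi N" "i \<in> {1..N}" for \<alpha> i c
    unfolding scp_def[symmetric] scp_mult
    by (rule sub(1)[OF KK(1)[OF K[OF that(1)] E[OF that(2)]] sub(2)[OF KK(2)[OF E[OF that(2)] K[OF that(1)]]]])
  have r2: "ll \<alpha> * ee i - fconst c * ee i * ll \<alpha> \<in> (Hs (gens N) (frag_of i) :: (gen list \<Rightarrow>\<^sub>0 'k) set)" if "\<alpha> \<in> ZPi N" "i \<in> {1..N}" for \<alpha> i c
    unfolding scp_def[symmetric] scp_mult
    by (rule sub(1)[OF KK(1)[OF L[OF that(1)] E[OF that(2)]] sub(2)[OF KK(2)[OF E[OF that(2)] L[OF that(1)]]]])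
  have r3: "kk \<alpha> * ff i - fconst c * ff i * kk \<alpha> \<in> (Hs (gens N) (- frag_of i) :: (gen list \<Rightarrow>\<^sub>0 'k) set)" if "\<alpha> \<in> ZPi N" "i \<in> {1..N}" for \<alpha> i c
    unfolding scp_def[symmetric] scp_mult
    by (rule sub(1)[OF KK(1)[OF K[OF that(1)] F[OF that(2)]] sub(2)[OF KK(2)[OF F[OF that(2)] K[OF that(1)]]]])
  have r4: "ll \<alpha> * ff i - fconst c * ff i * ll \<alpha> \<in> (Hs (gens N) (- frag_of i) :: (gen list \<Rightarrow>\<^sub>0 'k) set)" if "\<alpha> \<in> ZPi N" "i \<in> {1..N}" for \<alpha> i c
    unfolding scp_def[symmetric] scp_mult
    by (rule sub(1)[OF KK(1)[OF L[OF that(1)] F[OF that(2)]] sub(2)[OF KK(2)[OF F[OF that(2)] L[OF that(1)]]]])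
  have EF: "ee i * ff j - ff j * ee i - (if i = j then - kk (frag_of i) + ll (frag_of i) else 0)
     \<in> (Hs (gens N) (frag_of i - frag_of j) :: (gen list \<Rightarrow>\<^sub>0 'k) set)" if "i \<in> {1..N}" "j \<in> {1..N}" for i j
  proof (intro sub)
    show "ee i * ff j \<in> (Hs (gens N) (frag_of i - frag_of j) :: (gen list \<Rightarrow>\<^sub>0 'k) set)"
      using Hs_mult[OF E[OF that(1)] F[OF that(2)]] by simp
    show "ff j * ee i \<in> (Hs (gens N) (frag_of i - frag_of j) :: (gen list \<Rightarrow>\<^sub>0 'k) set)"
      using Hs_mult[OF F[OF that(2)] E[OF that(1)]] by (simp add: algebra_simps)
    show "(if i = j then - kk (frag_of i) + ll (frag_of i) else 0) \<in> (Hs (gens N) (frag_of i - frag_of j) :: (gen list \<Rightarrow>\<^sub>0 'k) set)"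
      using K L ZPi_closed(5)[OF that(1)] by (auto intro!: sub simp del: carrier_free_Abelian_group_iff)
  qed
  show ?thesis
    using assms unfolding relators_def
    apply (elim UnE insertE emptyE CollectE exE conjE; hypsubst)
    subgoal by (rule exI[of _ 0], intro sub K one ZK)
    subgoal by (rule exI[of _ 0], intro sub L one ZK)
    subgoal by (rule exI[of _ 0], intro sub KK(1) K ZK; assumption)
    subgoal by (rule exI[of _ 0], intro sub KK(1) L ZK; assumption)
    subgoal by (rule exI[of _ 0], intro sub KK(1) K L ZK; assumption)
    subgoal by (rule exI, rule r1; assumption)
    subgoal by (rule exI, rule r2; assumption)
    subgoal by (rule exI, rule r3; assumption)
    subgoal by (rule exI, rule r4; assumption)
    subgoal by (rule exI, rule EF; assumption)
    done
qed

lemma relators_Fr: "relators N \<chi> \<subseteq> Fr"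
  using relators_Hs Hs_Wd by blast

lemma rr_ideal: "ideal rr (free_algebra (gens N))"
  unfolding rel_ideal_def using ring.genideal_ideal[OF ring_free_algebra] relators_Fr
  by (simp add: carrier_free_algebra)

lemma rr_closed: "j \<in> rr \<Longrightarrow> p \<in> Fr \<Longrightarrow> p * j \<in> rr" "j \<in> rr \<Longrightarrow> p \<in> Fr \<Longrightarrow> j * p \<in> rr"
  using ideal.I_l_closed[OF rr_ideal] ideal.I_r_closed[OF rr_ideal]
  by (simp_all add: carrier_free_algebra free_algebra_simps)

lemma rr_Fr: "rr \<subseteq> Fr"
  using additive_subgroup.a_subset[OF ideal.axioms(1)[OF rr_ideal]] by (simp add: carrier_free_algebra)

lemma rr_subspace: "fa.subspace rr"
proof (rule fa.subspaceI)
  note A = ideal.axioms(1)[OF rr_ideal]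
  show "0 \<in> rr" using additive_subgroup.zero_closed[OF A] by (simp add: free_algebra_simps)
  show "x \<in> rr \<Longrightarrow> y \<in> rr \<Longrightarrow> x + y \<in> rr" for x y
    using additive_subgroup.a_closed[OF A] by (simp add: free_algebra_simps)
  show "x \<in> rr \<Longrightarrow> scp c x \<in> rr" for c x
    unfolding scp_def by (rule rr_closed(1)) (auto intro: Wd_fconst)
qed

lemma rr_relators: "relators N \<chi> \<subseteq> rr"
  unfolding rel_ideal_def genideal_def by blast

text \<open>An induction principle for the relation ideal in which stability is checked for single
  letters.\<close>

lemma rr_minimal:
  assumes J: "fa.subspace J" "J \<subseteq> Fr" "relators N \<chi> \<subseteq> J"
    and l: "\<And>g p. g \<in> gens N \<Longrightarrow> p \<in> J \<Longrightarrow> letter g * p \<in> J"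
    and r: "\<And>g p. g \<in> gens N \<Longrightarrow> p \<in> J \<Longrightarrow> p * letter g \<in> J"
  shows "rr \<subseteq> J"
proof -
  have c: "closed_by (gens N) J" using J(1) l by (simp add: closed_by_def)
  have R: "ring (free_algebra (gens N) :: ('k, gen list \<Rightarrow>\<^sub>0 'k) module)" by (rule ring_free_algebra)
  have "ideal J (free_algebra (gens N))"
  proof (rule idealI[OF R])
    have inv: "\<ominus>\<^bsub>free_algebra (gens N)\<^esub> x = - x" if "x \<in> Fr" for x :: "gen list \<Rightarrow>\<^sub>0 'k"
    proof -
      interpret ring "free_algebra (gens N) :: ('k, gen list \<Rightarrow>\<^sub>0 'k) module" by (rule R)
      show ?thesis by (rule minus_equality) (use that in \<open>auto simp: free_algebra_simps carrier_free_algebra Wd_closed\<close>)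
    qed
    show "subgroup J (add_monoid (free_algebra (gens N)))"
    proof
      show "J \<subseteq> carrier (add_monoid (free_algebra (gens N)))" using J(2) by (simp add: carrier_free_algebra)
      fix x assume x: "x \<in> J"
      then show "inv\<^bsub>add_monoid (free_algebra (gens N))\<^esub> x \<in> J"
        using inv[of x] J fa.subspace_neg[OF J(1), of x] by (auto simp: a_inv_def)
    qed (auto simp: free_algebra_simps fa.subspace_add[OF J(1)] fa.subspace_0[OF J(1)])
  qed (auto simp: free_algebra_simps carrier_free_algebra intro: closed_by_mult[OF _ c] closed_right_mult[OF J(1) r])
  then show ?thesis using J(3) unfolding rel_ideal_def genideal_def by blast
qed

text \<open>The polynomials all of whose components lie in the ideal form an ideal themselves, and
  it contains the relators because these are homogeneous.\<close>

lemma rr_graded: "p \<in> rr \<Longrightarrow> comp \<beta> p \<in> rr"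
proof -
  have "rr \<subseteq> {p \<in> Fr. \<forall>\<beta>. comp \<beta> p \<in> rr}"
  proof (rule rr_minimal)
    show "fa.subspace {p \<in> Fr. \<forall>\<beta>. comp \<beta> p \<in> rr}"
      by (rule fa.subspaceI) (auto simp: comp_add comp_scp Wd_closed fa.subspace_0[OF rr_subspace]
          fa.subspace_add[OF rr_subspace] fa.subspace_scale[OF rr_subspace])
    show "relators N \<chi> \<subseteq> {p \<in> Fr. \<forall>\<beta>. comp \<beta> p \<in> rr}"
    proof
      fix p assume p: "p \<in> relators N \<chi>"
      then obtain \<gamma> where "p \<in> Hs (gens N) \<gamma>" using relators_Hs by blast
      then show "p \<in> {p \<in> Fr. \<forall>\<beta>. comp \<beta> p \<in> rr}"
        using p relators_Fr rr_relators comp_Hs[of p "gens N" \<gamma>] fa.subspace_0[OF rr_subspace] by auto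
    qed
  qed (auto simp: comp_letter_mult comp_mult_letter Wd_closed rr_closed)
  then show "p \<in> rr \<Longrightarrow> comp \<beta> p \<in> rr" by blast
qed

text \<open>Equality in U-tilde, expressed on representatives.\<close>

definition cg :: "(gen list \<Rightarrow>\<^sub>0 'k) \<Rightarrow> (gen list \<Rightarrow>\<^sub>0 'k) \<Rightarrow> bool" where
  "cg p q \<longleftrightarrow> p \<in> Fr \<and> q \<in> Fr \<and> p - q \<in> rr"

lemma cg_Fr: "cg p q \<Longrightarrow> p \<in> Fr" "cg p q \<Longrightarrow> q \<in> Fr" by (simp_all add: cg_def)

lemma cg_refl: "p \<in> Fr \<Longrightarrow> cg p p" by (simp add: cg_def fa.subspace_0[OF rr_subspace])

lemma cg_sym: "cg p q \<Longrightarrow> cg q p"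
  using fa.subspace_neg[OF rr_subspace, of "p - q"] by (simp add: cg_def)

lemma cg_trans [trans]: "cg p q \<Longrightarrow> cg q s \<Longrightarrow> cg p s"
  using fa.subspace_add[OF rr_subspace, of "p - q" "q - s"] by (simp add: cg_def)

lemma cg_eq_trans [trans]: "cg p q \<Longrightarrow> q = s \<Longrightarrow> cg p s" "p = q \<Longrightarrow> cg q s \<Longrightarrow> cg p s" by simp_all

lemma cg_add: "cg p q \<Longrightarrow> cg p' q' \<Longrightarrow> cg (p + p') (q + q')"
  using fa.subspace_add[OF rr_subspace, of "p - q" "p' - q'"] by (simp add: cg_def Wd_closed algebra_simps)

lemma cg_scp: "cg p q \<Longrightarrow> cg (scp c p) (scp c q)"
  using fa.subspace_scale[OF rr_subspace, of "p - q" c] by (simp add: cg_def Wd_closed fa.scale_right_diff_distrib)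

lemma cg_neg: "cg p q \<Longrightarrow> cg (- p) (- q)"
  using fa.subspace_neg[OF rr_subspace, of "p - q"] by (simp add: cg_def Wd_closed algebra_simps)

lemma cg_diff: "cg p q \<Longrightarrow> cg p' q' \<Longrightarrow> cg (p - p') (q - q')"
  using cg_add[OF _ cg_neg] by simp

lemma cg_mult: "cg p q \<Longrightarrow> cg p' q' \<Longrightarrow> cg (p * p') (q * q')"
proof -
  assume a: "cg p q" "cg p' q'"
  have "p * p' - q * q' = (p - q) * p' + q * (p' - q')" by (simp add: algebra_simps)
  also have "\<dots> \<in> rr" using a by (intro fa.subspace_add[OF rr_subspace] rr_closed) (auto simp: cg_def)
  finally show ?thesis using a by (simp add: cg_def Wd_closed)
qed

lemma cg_left: "s \<in> Fr \<Longrightarrow> cg p q \<Longrightarrow> cg (s * p) (s * q)" by (rule cg_mult[OF cg_refl])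
lemma cg_right: "s \<in> Fr \<Longrightarrow> cg p q \<Longrightarrow> cg (p * s) (q * s)" by (rule cg_mult[OF _ cg_refl])

lemma cgI: "p - q \<in> relators N \<chi> \<Longrightarrow> p \<in> Fr \<Longrightarrow> q \<in> Fr \<Longrightarrow> cg p q"
  using rr_relators by (auto simp: cg_def)

lemma cg_rels:
  "cg (kk 0) 1" "cg (ll 0) 1"
  "\<alpha> \<in> ZPi N \<Longrightarrow> \<beta> \<in> ZPi N \<Longrightarrow> cg (kk \<alpha> * kk \<beta>) (kk (\<alpha> + \<beta>))"
  "\<alpha> \<in> ZPi N \<Longrightarrow> \<beta> \<in> ZPi N \<Longrightarrow> cg (ll \<alpha> * ll \<beta>) (ll (\<alpha> + \<beta>))"
  "\<alpha> \<in> ZPi N \<Longrightarrow> \<beta> \<in> ZPi N \<Longrightarrow> cg (kk \<alpha> * ll \<beta>) (ll \<beta> * kk \<alpha>)"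
  "\<alpha> \<in> ZPi N \<Longrightarrow> i \<in> {1..N} \<Longrightarrow> cg (kk \<alpha> * ee i) (scp (\<chi> \<alpha> (frag_of i)) (ee i * kk \<alpha>))"
  "\<alpha> \<in> ZPi N \<Longrightarrow> i \<in> {1..N} \<Longrightarrow> cg (ll \<alpha> * ee i) (scp (\<chi> (- frag_of i) \<alpha>) (ee i * ll \<alpha>))"
  "\<alpha> \<in> ZPi N \<Longrightarrow> i \<in> {1..N} \<Longrightarrow> cg (kk \<alpha> * ff i) (scp (\<chi> \<alpha> (- frag_of i)) (ff i * kk \<alpha>))"
  "\<alpha> \<in> ZPi N \<Longrightarrow> i \<in> {1..N} \<Longrightarrow> cg (ll \<alpha> * ff i) (scp (\<chi> (frag_of i) \<alpha>) (ff i * ll \<alpha>))"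
  "i \<in> {1..N} \<Longrightarrow> j \<in> {1..N} \<Longrightarrow>
     cg (ee i * ff j - ff j * ee i) (if i = j then - kk (frag_of i) + ll (frag_of i) else 0)"
proof -
  note Z = ZPi_closed
  note W = Wd_closed letters_Fr
  show "cg (kk 0) 1"
    by (rule cgI, unfold relators_def, rule UnI1, rule UnI1, rule UnI1, rule UnI1, rule UnI1, rule UnI1, rule UnI1, rule UnI1, simp, (intro W Z)+)
  show "cg (ll 0) 1"
    by (rule cgI, unfold relators_def, rule UnI1, rule UnI1, rule UnI1, rule UnI1, rule UnI1, rule UnI1, rule UnI1, rule UnI1, simp, (intro W Z)+)
  show "\<alpha> \<in> ZPi N \<Longrightarrow> \<beta> \<in> ZPi N \<Longrightarrow> cg (kk \<alpha> * kk \<beta>) (kk (\<alpha> + \<beta>))"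
    by (rule cgI, unfold relators_def, rule UnI1, rule UnI1, rule UnI1, rule UnI1, rule UnI1, rule UnI1, rule UnI1, rule UnI2, rule CollectI, (rule exI)+, rule conjI, rule refl, rule conjI, assumption+, (intro W Z; assumption)+)
  show "\<alpha> \<in> ZPi N \<Longrightarrow> \<beta> \<in> ZPi N \<Longrightarrow> cg (ll \<alpha> * ll \<beta>) (ll (\<alpha> + \<beta>))"
    by (rule cgI, unfold relators_def, rule UnI1, rule UnI1, rule UnI1, rule UnI1, rule UnI1, rule UnI1, rule UnI2, rule CollectI, (rule exI)+, rule conjI, rule refl, rule conjI, assumption+, (intro W Z; assumption)+)
  show "\<alpha> \<in> ZPi N \<Longrightarrow> \<beta> \<in> ZPi N \<Longrightarrow> cg (kk \<alpha> * ll \<beta>) (ll \<beta> * kk \<alpha>)"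
    by (rule cgI, unfold relators_def, rule UnI1, rule UnI1, rule UnI1, rule UnI1, rule UnI1, rule UnI2, rule CollectI, (rule exI)+, rule conjI, rule refl, rule conjI, assumption+, (intro W Z; assumption)+)
  show "\<alpha> \<in> ZPi N \<Longrightarrow> i \<in> {1..N} \<Longrightarrow> cg (kk \<alpha> * ee i) (scp (\<chi> \<alpha> (frag_of i)) (ee i * kk \<alpha>))"
    by (rule cgI, unfold relators_def scp_def mult.assoc, rule UnI1, rule UnI1, rule UnI1, rule UnI1, rule UnI2, rule CollectI, (rule exI)+, rule conjI, rule refl, rule conjI, assumption+, (intro W Z; assumption)+)
  show "\<alpha> \<in> ZPi N \<Longrightarrow> i \<in> {1..N} \<Longrightarrow> cg (ll \<alpha> * ee i) (scp (\<chi> (- frag_of i) \<alpha>) (ee i * ll \<alpha>))"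
    by (rule cgI, unfold relators_def scp_def mult.assoc, rule UnI1, rule UnI1, rule UnI1, rule UnI2, rule CollectI, (rule exI)+, rule conjI, rule refl, rule conjI, assumption+, (intro W Z; assumption)+)
  show "\<alpha> \<in> ZPi N \<Longrightarrow> i \<in> {1..N} \<Longrightarrow> cg (kk \<alpha> * ff i) (scp (\<chi> \<alpha> (- frag_of i)) (ff i * kk \<alpha>))"
    by (rule cgI, unfold relators_def scp_def mult.assoc, rule UnI1, rule UnI1, rule UnI2, rule CollectI, (rule exI)+, rule conjI, rule refl, rule conjI, assumption+, (intro W Z; assumption)+)
  show "\<alpha> \<in> ZPi N \<Longrightarrow> i \<in> {1..N} \<Longrightarrow> cg (ll \<alpha> * ff i) (scp (\<chi> (frag_of i) \<alpha>) (ff i * ll \<alpha>))"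
    by (rule cgI, unfold relators_def scp_def mult.assoc, rule UnI1, rule UnI2, rule CollectI, (rule exI)+, rule conjI, rule refl, rule conjI, assumption+, (intro W Z; assumption)+)
  show "i \<in> {1..N} \<Longrightarrow> j \<in> {1..N} \<Longrightarrow>
     cg (ee i * ff j - ff j * ee i) (if i = j then - kk (frag_of i) + ll (frag_of i) else 0)"
  proof (rule cgI)
    assume ij: "i \<in> {1..N}" "j \<in> {1..N}"
    show "ee i * ff j - ff j * ee i - (if i = j then - kk (frag_of i) + ll (frag_of i) else 0) \<in> relators N \<chi>"
      unfolding relators_def by (rule UnI2, rule CollectI, (rule exI)+, rule conjI, rule refl) (rule conjI[OF ij])
    show "ee i * ff j - ff j * ee i \<in> Fr" by (intro W ij)
    have "- kk (frag_of i) + ll (frag_of i) \<in> Fr"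
      by (intro fa.subspace_add[OF Wd_subspace] fa.subspace_neg[OF Wd_subspace] letters_Fr Z ij)
    moreover have "0 \<in> Fr" by (rule fa.subspace_0[OF Wd_subspace])
    ultimately show "(if i = j then - kk (frag_of i) + ll (frag_of i) else 0) \<in> Fr"
      by (cases "i = j") (simp_all only: simp_thms if_True if_False)
  qed
qed

interpretation FA: presentation "free_algebra (gens N) :: ('k, gen list \<Rightarrow>\<^sub>0 'k) module" "\<lambda>p. p" Fr "{0}"
  by unfold_locales (auto simp: carrier_free_algebra free_algebra_simps subspace_asub[OF Wd_subspace] asub_def Wd_closed)

interpretation FQ: pres_quot "free_algebra (gens N) :: ('k, gen list \<Rightarrow>\<^sub>0 'k) module" "\<lambda>p. p" Fr "{0}" rr
  by unfold_locales (auto simp: subspace_asub[OF rr_subspace] fa.subspace_0[OF rr_subspace] intro: subsetD[OF rr_Fr])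

lemma FQ_pi: "FQ.\<pi>' = pj" by (rule ext) (simp add: FQ.\<pi>'_def projt_def)

lemma Ut_presentation: "presentation UT pj Fr rr"
  using FQ.quot_presentation by (simp add: FQ_pi Ut_def)

lemma pj_mult: "p \<in> Fr \<Longrightarrow> q \<in> Fr \<Longrightarrow> pj p \<otimes>\<^bsub>UT\<^esub> pj q = pj (p * q)"
proof -
  assume pq: "p \<in> Fr" "q \<in> Fr"
  have "a * b - p * q \<in> rr" if "p \<in> Fr" "q \<in> Fr" "a \<in> Fr" "b \<in> Fr" "a - p \<in> rr" "b - q \<in> rr" for a b p q
    using cg_mult[of a p b q] that by (simp add: cg_def)
  from FQ.quot_mult[of "(*)", OF _ this pq] show ?thesis
    by (simp add: FQ_pi Ut_def free_algebra_simps Wd_closed)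
qed

lemma pj_smult: "p \<in> Fr \<Longrightarrow> c \<odot>\<^bsub>UT\<^esub> pj p = pj (scp c p)"
proof -
  assume p: "p \<in> Fr"
  have "scp c a - scp c p \<in> rr" if "p \<in> Fr" "a \<in> Fr" "a - p \<in> rr" for a p
    using cg_scp[of a p c] that by (simp add: cg_def)
  from FQ.quot_smult[of c "scp c", OF _ this p] show ?thesis
    by (simp add: FQ_pi Ut_def free_algebra_simps Wd_closed)
qed

lemma pj_one: "\<one>\<^bsub>UT\<^esub> = pj 1"
  using FQ.quot_one[of 1] by (simp add: FQ_pi Ut_def free_algebra_simps)

sublocale T: presentation UT pj Fr rr by (rule Ut_presentation)

lemma pj_eq: "p \<in> Fr \<Longrightarrow> q \<in> Fr \<Longrightarrow> pj p = pj q \<longleftrightarrow> cg p q"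
  by (simp add: T.eq cg_def)

lemma subalg_gen_letters:
  assumes S: "S \<subseteq> gens N"
  shows "subalg_gen UT ((\<lambda>g. pj (letter g)) ` S) = pj ` Wd S"
proof
  have WF: "Wd S \<subseteq> Fr" by (rule Wd_mono[OF S])
  have "subring (pj ` Wd S) UT"
    unfolding subring_iff
  proof
    show "subgroup (pj ` Wd S) (add_monoid UT)"
      by (rule T.subgroup_image[OF subspace_asub[OF Wd_subspace] WF])
    show "submonoid (pj ` Wd S) UT"
    proof
      show "pj ` Wd S \<subseteq> carrier UT" using WF by (auto simp: T.carr)
      show "\<one>\<^bsub>UT\<^esub> \<in> pj ` Wd S" using pj_one Wd_one by blast
      fix x y assume "x \<in> pj ` Wd S" "y \<in> pj ` Wd S"
      then obtain p q where pq: "p \<in> Wd S" "q \<in> Wd S" "x = pj p" "y = pj q" by (elim imageE)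
      have "x \<otimes>\<^bsub>UT\<^esub> y = pj (p * q)"
        unfolding pq(3,4) by (rule pj_mult[OF subsetD[OF WF pq(1)] subsetD[OF WF pq(2)]])
      then show "x \<otimes>\<^bsub>UT\<^esub> y \<in> pj ` Wd S" using Wd_mult[OF pq(1,2)] by (rule image_eqI)
    qed
  qed
  moreover have "submodule (pj ` Wd S) (ring_of_type_algebra :: 'k ring) UT"
    unfolding submodule_iff
  proof (intro conjI ballI)
    show "subgroup (pj ` Wd S) (add_monoid UT)"
      by (rule T.subgroup_image[OF subspace_asub[OF Wd_subspace] WF])
    fix a :: 'k and x assume "x \<in> pj ` Wd S"
    then obtain p where p: "p \<in> Wd S" "x = pj p" by (elim imageE)
    have "a \<odot>\<^bsub>UT\<^esub> x = pj (scp a p)" unfolding p(2) by (rule pj_smult[OF subsetD[OF WF p(1)]])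
    then show "a \<odot>\<^bsub>UT\<^esub> x \<in> pj ` Wd S" using fa.subspace_scale[OF Wd_subspace p(1)] by (rule image_eqI)
  qed
  moreover have "(\<lambda>g. pj (letter g)) ` S \<subseteq> pj ` Wd S" by (intro image_subsetI imageI Wd_letter)
  ultimately show "subalg_gen UT ((\<lambda>g. pj (letter g)) ` S) \<subseteq> pj ` Wd S" unfolding subalg_gen_def by blast
  show "pj ` Wd S \<subseteq> subalg_gen UT ((\<lambda>g. pj (letter g)) ` S)"
    unfolding subalg_gen_def
  proof (rule Inter_greatest, clarify)
    fix B and p :: "gen list \<Rightarrow>\<^sub>0 'k"
    assume B: "subring B UT" "submodule B (ring_of_type_algebra :: 'k ring) UT" "(\<lambda>g. pj (letter g)) ` S \<subseteq> B"
      and p: "p \<in> Wd S"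
    have sub: "subgroup B (add_monoid UT)" and mon: "submonoid B UT" using B(1) by (auto simp: subring_iff)
    from p show "pj p \<in> B"
    proof (induction p rule: Wd_induct)
      case zero
      then show ?case using subgroup.one_closed[OF sub] by (simp add: T.zero)
    next
      case (step c w p)
      have w: "w \<in> lists S \<Longrightarrow> pj (mon w) \<in> B \<and> mon w \<in> Fr" for w
      proof (induction w)
        case Nil
        show ?case using submonoid.one_closed[OF mon] by (simp add: pj_one mon_Nil Wd_one)
      next
        case (Cons g w)
        then have g: "g \<in> S" and IH: "pj (mon w) \<in> B" "mon w \<in> Fr" by simp_all
        have gB: "pj (letter g) \<in> B" using B(3) g by blast
        have gF: "letter g \<in> Fr" using S g by (blast intro: Wd_letter)
        have "pj (letter g * mon w) \<in> B" using submonoid.m_closed[OF mon gB IH(1)] pj_mult[OF gF IH(2)] by simp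
        then show ?case using Wd_mult[OF gF IH(2)] by (simp only: mon_Cons simp_thms)
      qed
      have "c \<odot>\<^bsub>UT\<^esub> pj (mon w) \<in> B" using w[OF step(1)] B(2) by (simp add: submodule_iff)
      then have 1: "pj (scp c (mon w)) \<in> B" using w[OF step(1)] pj_smult[of "mon w" c] by simp
      have 2: "scp c (mon w) \<in> Fr" using w[OF step(1)] fa.subspace_scale[OF Wd_subspace] by blast
      have 3: "p \<in> Fr" using step(2) WF by blast
      have "pj (scp c (mon w)) \<oplus>\<^bsub>UT\<^esub> pj p \<in> B" using subgroup.m_closed[OF sub 1 step(3)] by simp
      then show ?case by (simp only: T.add[OF 2 3])
    qed
  qed
qed

abbreviation "GFs \<equiv> GF ` {1..N}"
abbreviation "GEs \<equiv> GE ` {1..N}"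
abbreviation "GKLs \<equiv> GK ` ZPi N \<union> GL ` ZPi N"

lemma sub_gens: "GFs \<subseteq> gens N" "GEs \<subseteq> gens N" "GKLs \<subseteq> gens N" by (auto simp: gens_def)

lemma Ut_minus_eq: "Ut_minus N \<chi> = pj ` Wd GFs"
  using subalg_gen_letters[OF sub_gens(1)] by (simp add: Ut_minus_def image_image)

lemma Ut_plus_eq: "Ut_plus N \<chi> = pj ` Wd GEs"
  using subalg_gen_letters[OF sub_gens(2)] by (simp add: Ut_plus_def image_image)

lemma Ut_zero_eq: "Ut_zero N \<chi> = pj ` Wd GKLs"
  using subalg_gen_letters[OF sub_gens(3)] by (simp add: Ut_zero_def image_image image_Un)

lemma Ut_deg_eq: "Ut_deg N \<chi> \<beta> = pj ` Hs (gens N) \<beta>"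
proof -
  have "{p :: gen list \<Rightarrow>\<^sub>0 'k. p \<in> carrier (free_algebra (gens N)) \<and> (\<forall>w\<in>Poly_Mapping.keys p. sum_list (map gen_deg w) = \<beta>)}
     = {p. Poly_Mapping.keys p \<subseteq> {w \<in> lists (gens N). wdeg w = \<beta>}}"
    unfolding carrier_free_algebra Wd_def wdeg_def by blast
  then show ?thesis unfolding Ut_deg_def Hs_def keys_span by simp
qed

text \<open>Membership in U^- and in a degree come with two unrelated representatives. The component
  of the first one satisfies both conditions, because the relation ideal is graded.\<close>

lemma minus_deg_rep:
  assumes "Y \<in> Ut_minus N \<chi> \<inter> Ut_deg N \<chi> \<beta>"
  obtains p where "p \<in> Hs GFs \<beta>" "Y = pj p"
proof -
  obtain p1 p2 where p: "p1 \<in> Wd GFs" "p2 \<in> Hs (gens N) \<beta>" "Y = pj p1" "Y = pj p2"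
    using assms unfolding Ut_minus_eq Ut_deg_eq by blast
  have fr: "p1 \<in> Fr" "p2 \<in> Fr" using p Wd_mono[OF sub_gens(1)] Hs_Wd by blast+
  have "p1 - p2 \<in> rr" using p fr T.eq[of p1 p2] by simp
  then have "comp \<beta> (p1 - p2) \<in> rr" by (rule rr_graded)
  also have "comp \<beta> (p1 - p2) = comp \<beta> p1 - p2"
    using comp_add[of \<beta> "p1 - p2" p2] comp_Hs[OF p(2), of \<beta>] by (simp add: algebra_simps)
  finally have "comp \<beta> p1 - p2 \<in> rr" .
  moreover have "comp \<beta> p1 \<in> Hs GFs \<beta>" by (rule comp_in_Hs[OF p(1)])
  moreover from this have "comp \<beta> p1 \<in> Fr" using Hs_Wd Wd_mono[OF sub_gens(1)] by blast
  ultimately have "pj (comp \<beta> p1) = Y" using fr T.eq p by simp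
  then show ?thesis using that \<open>comp \<beta> p1 \<in> Hs GFs \<beta>\<close> by blast
qed

end

section \<open>Heights, and the subspaces I^-\<close>

lemma ZPi_pos_iff: "\<alpha> \<in> ZPi_pos N \<longleftrightarrow> \<alpha> \<in> ZPi N \<and> (\<forall>i. 0 \<le> Poly_Mapping.lookup \<alpha> i)"
  by (simp add: ZPi_pos_def del: carrier_free_Abelian_group_iff)

lemma lookup_frag_of: "Poly_Mapping.lookup (frag_of i) j = (if i = j then 1 else 0)"
  by (simp add: lookup_single when_def)

lemma ZPi_pos_0: "0 \<in> ZPi_pos N" using ZPi_closed(1) by (simp add: ZPi_pos_iff del: carrier_free_Abelian_group_iff)

lemma ZPi_pos_add: "\<alpha> \<in> ZPi_pos N \<Longrightarrow> j \<in> {1..N} \<Longrightarrow> \<alpha> + frag_of j \<in> ZPi_pos N"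
  using ZPi_closed(2)[of \<alpha> N "frag_of j"] ZPi_closed(5)[of j N]
  by (simp add: ZPi_pos_iff lookup_add lookup_frag_of del: carrier_free_Abelian_group_iff)

lemma ZPi_pos_minus:
  assumes "\<alpha> \<in> ZPi_pos N" "i \<in> {1..N}"
  shows "\<alpha> - frag_of i \<in> ZPi_pos N \<longleftrightarrow> 0 < Poly_Mapping.lookup \<alpha> i"
proof -
  have "\<alpha> - frag_of i \<in> ZPi N" using ZPi_closed(4,5) assms by (simp add: ZPi_pos_iff del: carrier_free_Abelian_group_iff)
  then have "\<alpha> - frag_of i \<in> ZPi_pos N \<longleftrightarrow> (\<forall>j. 0 \<le> Poly_Mapping.lookup \<alpha> j - (if i = j then 1 else 0))"
    unfolding ZPi_pos_iff lookup_minus lookup_frag_of by (simp only: simp_thms)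
  also have "\<dots> \<longleftrightarrow> 0 < Poly_Mapping.lookup \<alpha> i"
  proof
    assume "\<forall>j. 0 \<le> Poly_Mapping.lookup \<alpha> j - (if i = j then 1 else 0)"
    then have "0 \<le> Poly_Mapping.lookup \<alpha> i - 1" by (elim allE[of _ i]) simp
    then show "0 < Poly_Mapping.lookup \<alpha> i" by simp
  next
    assume "0 < Poly_Mapping.lookup \<alpha> i"
    then show "\<forall>j. 0 \<le> Poly_Mapping.lookup \<alpha> j - (if i = j then 1 else 0)"
      using assms(1) by (simp add: ZPi_pos_iff del: carrier_free_Abelian_group_iff)
  qed
  finally show ?thesis .
qed

definition ht :: "nat \<Rightarrow> lattice \<Rightarrow> nat" where "ht N \<alpha> = nat (\<Sum>i\<in>{1..N}. Poly_Mapping.lookup \<alpha> i)"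

lemma ht_minus:
  assumes "\<alpha> \<in> ZPi_pos N" "i \<in> {1..N}" "\<alpha> - frag_of i \<in> ZPi_pos N"
  shows "ht N (\<alpha> - frag_of i) < ht N \<alpha>"
proof -
  have "(\<Sum>j\<in>{1..N}. Poly_Mapping.lookup (\<alpha> - frag_of i) j) = (\<Sum>j\<in>{1..N}. Poly_Mapping.lookup \<alpha> j) - 1"
    using assms(2) by (simp add: lookup_minus lookup_frag_of sum_subtractf)
  moreover have "0 \<le> (\<Sum>j\<in>{1..N}. Poly_Mapping.lookup (\<alpha> - frag_of i) j)"
    using assms(3) by (intro sum_nonneg) (simp add: ZPi_pos_iff del: carrier_free_Abelian_group_iff)
  ultimately show ?thesis by (simp add: ht_def)
qed

lemma wdeg_F_words:
  "w \<in> lists (GF ` {1..N}) \<Longrightarrow> Poly_Mapping.lookup (wdeg w) i \<le> 0 \<and>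
    (Poly_Mapping.lookup (wdeg w) i = 0 \<longrightarrow> GF i \<notin> set w)"
proof (induction w)
  case (Cons g w)
  then obtain j where j: "g = GF j" by (auto simp only: Cons_in_lists_iff image_iff)
  have "w \<in> lists (GF ` {1..N})" using Cons.prems by simp
  note IH = Cons.IH[OF this]
  have l: "Poly_Mapping.lookup (wdeg (g # w)) i = - (if j = i then 1 else 0) + Poly_Mapping.lookup (wdeg w) i"
    unfolding wdeg_simps j gen_deg.simps lookup_add lookup_uminus lookup_frag_of ..
  show ?case
  proof (cases "j = i")
    case True
    then show ?thesis using IH l by simp
  next
    case False
    then show ?thesis using IH l j by simp
  qed
qed simp

context gqg
begin

abbreviation "al \<equiv> (frag_of :: nat \<Rightarrow> lattice)"

lemma mon_Fr: "w \<in> lists (gens N) \<Longrightarrow> mon w \<in> Fr" by (rule Wd_mon)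

lemma kk_letter:
  assumes "\<beta> \<in> ZPi N" "g \<in> gens N"
  shows "cg (kk \<beta> * letter g) (scp (\<chi> \<beta> (gen_deg g)) (letter g * kk \<beta>))"
proof (cases g)
  case (GK \<gamma>)
  then have \<gamma>: "\<gamma> \<in> ZPi N" using assms(2) gens_iff by blast
  have "cg (kk \<beta> * kk \<gamma>) (kk (\<beta> + \<gamma>))" by (rule cg_rels(3)[OF assms(1) \<gamma>])
  also have "cg (kk (\<beta> + \<gamma>)) (kk \<gamma> * kk \<beta>)"
    using cg_sym[OF cg_rels(3)[OF \<gamma> assms(1)]] by (simp only: add.commute)
  finally show ?thesis using chi_0(1)[OF assms(1)] by (simp only: GK gen_deg.simps fa.scale_one)
next
  case (GL \<gamma>)
  then have \<gamma>: "\<gamma> \<in> ZPi N" using assms(2) gens_iff by blast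
  show ?thesis using cg_rels(5)[OF assms(1) \<gamma>] chi_0(1)[OF assms(1)] by (simp only: GL gen_deg.simps fa.scale_one)
next
  case (GE i)
  then have i: "i \<in> {1..N}" using assms(2) gens_iff by blast
  show ?thesis using cg_rels(6)[OF assms(1) i] by (simp only: GE gen_deg.simps)
next
  case (GF i)
  then have i: "i \<in> {1..N}" using assms(2) gens_iff by blast
  show ?thesis using cg_rels(8)[OF assms(1) i] by (simp only: GF gen_deg.simps)
qed

lemma ll_letter:
  assumes "\<beta> \<in> ZPi N" "g \<in> gens N"
  shows "cg (ll \<beta> * letter g) (scp (\<chi> (- gen_deg g) \<beta>) (letter g * ll \<beta>))"
proof (cases g)
  case (GK \<gamma>)
  then have \<gamma>: "\<gamma> \<in> ZPi N" using assms(2) gens_iff by blast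
  show ?thesis using cg_sym[OF cg_rels(5)[OF \<gamma> assms(1)]] chi_0(2)[OF assms(1)]
    by (simp only: GK gen_deg.simps fa.scale_one minus_zero)
next
  case (GL \<gamma>)
  then have \<gamma>: "\<gamma> \<in> ZPi N" using assms(2) gens_iff by blast
  have "cg (ll \<beta> * ll \<gamma>) (ll (\<beta> + \<gamma>))" by (rule cg_rels(4)[OF assms(1) \<gamma>])
  also have "cg (ll (\<beta> + \<gamma>)) (ll \<gamma> * ll \<beta>)"
    using cg_sym[OF cg_rels(4)[OF \<gamma> assms(1)]] by (simp only: add.commute)
  finally show ?thesis using chi_0(2)[OF assms(1)] by (simp only: GL gen_deg.simps fa.scale_one minus_zero)
next
  case (GE i)
  then have i: "i \<in> {1..N}" using assms(2) gens_iff by blast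
  show ?thesis using cg_rels(7)[OF assms(1) i] by (simp only: GE gen_deg.simps)
next
  case (GF i)
  then have i: "i \<in> {1..N}" using assms(2) gens_iff by blast
  show ?thesis using cg_rels(9)[OF assms(1) i] by (simp only: GF gen_deg.simps minus_minus)
qed

text \<open>Used for x = K_\<beta> and x = L_\<beta>: the commutation scalar is a character of the
  lattice, so on a word it depends only on the degree.\<close>

lemma commute_word:
  assumes x: "x \<in> Fr" and c: "\<And>g. g \<in> gens N \<Longrightarrow> cg (x * letter g) (scp (c (gen_deg g)) (letter g * x))"
    and mult: "\<And>\<beta> \<gamma>. \<beta> \<in> ZPi N \<Longrightarrow> \<gamma> \<in> ZPi N \<Longrightarrow> c (\<beta> + \<gamma>) = c \<beta> * c \<gamma>" "c 0 = 1"
  shows "w \<in> lists (gens N) \<Longrightarrow> cg (x * mon w) (scp (c (wdeg w)) (mon w * x))"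
proof (induction w)
  case Nil
  show ?case using cg_refl[OF x] by (simp add: mon_Nil mult)
next
  case (Cons g w)
  then have g: "g \<in> gens N" and w: "w \<in> lists (gens N)" by simp_all
  note IH = Cons.IH[OF w]
  have lg: "letter g \<in> Fr" by (rule Wd_letter[OF g])
  have "cg (x * letter g * mon w) (scp (c (gen_deg g)) (letter g * x) * mon w)"
    by (rule cg_right[OF mon_Fr[OF w] c[OF g]])
  also have "\<dots> = scp (c (gen_deg g)) (letter g * (x * mon w))" by (simp only: scp_mult mult.assoc)
  also have "cg (scp (c (gen_deg g)) (letter g * (x * mon w))) (scp (c (gen_deg g)) (letter g * scp (c (wdeg w)) (mon w * x)))"
    by (rule cg_scp[OF cg_left[OF lg IH]])
  also have "\<dots> = scp (c (wdeg (g # w))) (mon (g # w) * x)"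
    unfolding wdeg_simps mult(1)[OF gen_deg_ZPi[OF g] wdeg_ZPi[OF w]] mon_Cons
    by (simp only: scp_mult mult.assoc fa.scale_scale)
  finally show ?case by (simp only: mon_Cons mult.assoc)
qed

lemma kk_word: "\<beta> \<in> ZPi N \<Longrightarrow> w \<in> lists (gens N) \<Longrightarrow> cg (kk \<beta> * mon w) (scp (\<chi> \<beta> (wdeg w)) (mon w * kk \<beta>))"
  by (rule commute_word[OF letters_Fr(1) kk_letter chi_add(1) chi_0(1)])

lemma ll_word: "\<beta> \<in> ZPi N \<Longrightarrow> w \<in> lists (gens N) \<Longrightarrow> cg (ll \<beta> * mon w) (scp (\<chi> (- wdeg w) \<beta>) (mon w * ll \<beta>))"
proof (rule commute_word[where c = "\<lambda>\<gamma>. \<chi> (- \<gamma>) \<beta>", OF letters_Fr(2) ll_letter])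
  assume b: "\<beta> \<in> ZPi N"
  show "\<chi> (- (\<gamma> + \<delta>)) \<beta> = \<chi> (- \<gamma>) \<beta> * \<chi> (- \<delta>) \<beta>" if "\<gamma> \<in> ZPi N" "\<delta> \<in> ZPi N" for \<gamma> \<delta>
    using chi_add(2)[OF ZPi_closed(3)[OF that(1)] ZPi_closed(3)[OF that(2)] b]
    by (simp only: minus_add_distrib)
  show "\<chi> (- 0) \<beta> = 1" using chi_0(2)[OF b] by (simp only: minus_zero)
qed

lemma commute_Hs:
  assumes x: "x \<in> Fr" and c: "\<And>w. w \<in> lists (gens N) \<Longrightarrow> cg (x * mon w) (scp (c (wdeg w)) (mon w * x))"
  shows "p \<in> Hs (gens N) \<gamma> \<Longrightarrow> cg (x * p) (scp (c \<gamma>) (p * x))"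
proof (induction p rule: Hs_induct)
  case zero
  show ?case using cg_refl[OF Wd_closed(8)] by simp
next
  case (step d w p)
  have "cg (scp d (x * mon w) + x * p) (scp d (scp (c \<gamma>) (mon w * x)) + scp (c \<gamma>) (p * x))"
    using c[OF step(1)] step by (intro cg_add cg_scp) auto
  then show ?case by (simp add: distrib_left distrib_right scp_mult fa.scale_right_distrib mult.commute)
qed

lemmas kk_Hs = commute_Hs[OF letters_Fr(1) kk_word]

lemma ll_Hs: "\<beta> \<in> ZPi N \<Longrightarrow> p \<in> Hs (gens N) \<gamma> \<Longrightarrow> cg (ll \<beta> * p) (scp (\<chi> (- \<gamma>) \<beta>) (p * ll \<beta>))"
  by (rule commute_Hs[OF letters_Fr(2), where c = "\<lambda>\<gamma>. \<chi> (- \<gamma>) \<beta>"]) (auto intro: ll_word simp del: carrier_free_Abelian_group_iff)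

lemma ee_F_word:
  assumes i: "i \<in> {1..N}"
  shows "w \<in> lists GFs \<Longrightarrow> GF i \<notin> set w \<Longrightarrow> cg (ee i * mon w) (mon w * ee i)"
proof (induction w)
  case Nil
  show ?case using cg_refl[OF letters_Fr(3)[OF i]] by (simp add: mon_Nil)
next
  case (Cons g w)
  then obtain j where j: "g = GF j" "j \<in> {1..N}" by (auto simp only: Cons_in_lists_iff image_iff)
  then have "j \<noteq> i" using Cons.prems(2) by auto
  note j = j this
  have w: "w \<in> lists GFs" "GF i \<notin> set w" using Cons.prems by simp_all
  have wF: "mon w \<in> Fr" using mon_Fr w(1) lists_mono[OF sub_gens(1)] by blast
  have "cg (ee i * ff j - ff j * ee i) 0" using cg_rels(10)[OF i j(2)] j(3) by simp
  then have "cg (ee i * ff j) (ff j * ee i)"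
    using letters_Fr(3)[OF i] letters_Fr(4)[OF j(2)] by (simp add: cg_def Wd_mult)
  then have "cg (ee i * ff j * mon w) (ff j * ee i * mon w)" by (rule cg_right[OF wF])
  also have "\<dots> = ff j * (ee i * mon w)" by (simp only: mult.assoc)
  also have "cg (ff j * (ee i * mon w)) (ff j * (mon w * ee i))"
    by (rule cg_left[OF letters_Fr(4)[OF j(2)] Cons.IH[OF w]])
  finally show ?case by (simp only: mon_Cons j(1) mult.assoc)
qed

lemma ee_F_Hs:
  assumes i: "i \<in> {1..N}" and z: "Poly_Mapping.lookup \<alpha> i = 0"
  shows "p \<in> Hs GFs (- \<alpha>) \<Longrightarrow> cg (ee i * p) (p * ee i)"
proof (induction p rule: Hs_induct)
  case zero
  show ?case using cg_refl[OF Wd_closed(8)] by simp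
next
  case (step d w p)
  have "GF i \<notin> set w" using wdeg_F_words[OF step(1), of i] step(2) z by (simp add: lookup_uminus)
  then have "cg (scp d (ee i * mon w) + ee i * p) (scp d (mon w * ee i) + p * ee i)"
    using ee_F_word[OF i step(1)] step by (intro cg_add cg_scp) auto
  then show ?case by (simp add: distrib_left distrib_right scp_mult)
qed

text \<open>\<open>It\<close> transported to representatives in the free algebra; \<open>AB\<close>
  is the right-hand side of its recursive condition.\<close>

definition Ip :: "lattice \<Rightarrow> (gen list \<Rightarrow>\<^sub>0 'k) \<Rightarrow> bool" where
  "Ip \<alpha> p \<longleftrightarrow> p \<in> Fr \<and> It N \<chi> \<alpha> (pj p)"

definition AB :: "lattice \<Rightarrow> nat \<Rightarrow> (gen list \<Rightarrow>\<^sub>0 'k) \<Rightarrow> bool" where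
  "AB \<beta> i x \<longleftrightarrow> (\<exists>a b. Ip \<beta> a \<and> Ip \<beta> b \<and> cg x (a * kk (al i) + b * ll (al i)))"

lemma Hs_GF_Fr: "Hs GFs \<beta> \<subseteq> Fr" "Hs GFs \<beta> \<subseteq> Hs (gens N) \<beta>"
  using Hs_Wd[of GFs \<beta>] Wd_mono[OF sub_gens(1)] Hs_mono[OF sub_gens(1)] by blast+

lemma It_rep: "It N \<chi> \<alpha> Y \<Longrightarrow> \<exists>p\<in>Hs GFs (- \<alpha>). Y = pj p"
proof (erule It.cases)
  assume "\<alpha> = 0" "Y = \<zero>\<^bsub>UT\<^esub>"
  then show ?thesis using fa.subspace_0[OF Hs_subspace] T.zero by blast
next
  fix \<alpha>' Y' assume "\<alpha> = \<alpha>'" "Y = Y'" "Y' \<in> Ut_minus N \<chi> \<inter> Ut_deg N \<chi> (- \<alpha>')"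
  then show ?thesis using minus_deg_rep[of Y "- \<alpha>"] by blast
qed

lemma It_pos: "It N \<chi> \<alpha> Y \<Longrightarrow> \<alpha> \<in> ZPi_pos N"
  by (erule It.cases) (simp_all only: ZPi_pos_0)

lemma Ip_pos: "Ip \<alpha> p \<Longrightarrow> \<alpha> \<in> ZPi_pos N" unfolding Ip_def using It_pos by blast

lemma Ip_Fr: "Ip \<alpha> p \<Longrightarrow> p \<in> Fr" by (simp add: Ip_def)

lemma Ip_rep: "Ip \<alpha> p \<Longrightarrow> \<exists>p'\<in>Hs GFs (- \<alpha>). cg p p'"
  using It_rep[of \<alpha> "pj p"] pj_eq Hs_GF_Fr(1) unfolding Ip_def by blast

lemma Ip_cong: "cg p q \<Longrightarrow> Ip \<alpha> q \<Longrightarrow> Ip \<alpha> p"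
  using pj_eq[of p q] cg_Fr[of p q] by (simp add: Ip_def)

lemma comm_E_pj:
  assumes "i \<in> {1..N}" "p \<in> Fr"
  shows "pj (ee i) \<otimes>\<^bsub>UT\<^esub> pj p \<ominus>\<^bsub>UT\<^esub> pj p \<otimes>\<^bsub>UT\<^esub> pj (ee i) = pj (ee i * p - p * ee i)"
  using assms letters_Fr(3)[OF assms(1)] by (simp add: pj_mult T.diff Wd_mult)

lemma AB_pj:
  assumes "i \<in> {1..N}" "a \<in> Fr" "b \<in> Fr"
  shows "pj a \<otimes>\<^bsub>UT\<^esub> pj (kk (al i)) \<oplus>\<^bsub>UT\<^esub> pj b \<otimes>\<^bsub>UT\<^esub> pj (ll (al i)) = pj (a * kk (al i) + b * ll (al i))"
  using assms letters_Fr(1,2)[OF ZPi_closed(5)[OF assms(1)]] by (simp add: pj_mult T.add Wd_mult)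

text \<open>The inductive predicate unfolded once. With \<open>Ip_zero_iff\<close> as base this is
  the recursion on the height that all proofs about I^- follow.\<close>

lemma Ip_iff:
  assumes \<alpha>: "\<alpha> \<noteq> 0"
  shows "Ip \<alpha> p \<longleftrightarrow> p \<in> Fr \<and> \<alpha> \<in> ZPi_pos N \<and> (\<exists>p'\<in>Hs GFs (- \<alpha>). cg p p') \<and>
    (\<forall>i\<in>{1..N}. \<alpha> - al i \<in> ZPi_pos N \<longrightarrow> AB (\<alpha> - al i) i (ee i * p - p * ee i))"
proof
  assume I: "Ip \<alpha> p"
  note F = Ip_Fr[OF I]
  have c: "\<forall>i\<in>{1..N}. \<alpha> - al i \<in> ZPi_pos N \<longrightarrow> (\<exists>A B. It N \<chi> (\<alpha> - al i) A \<and> It N \<chi> (\<alpha> - al i) B \<and>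
    pj (ee i) \<otimes>\<^bsub>UT\<^esub> pj p \<ominus>\<^bsub>UT\<^esub> pj p \<otimes>\<^bsub>UT\<^esub> pj (ee i) =
    A \<otimes>\<^bsub>UT\<^esub> pj (kk (al i)) \<oplus>\<^bsub>UT\<^esub> B \<otimes>\<^bsub>UT\<^esub> pj (ll (al i)))"
  proof -
    have "It N \<chi> \<alpha> (pj p)" using I by (simp add: Ip_def)
    then show ?thesis by (rule It.cases) (use \<alpha> in \<open>simp_all\<close>)
  qed
  have "AB (\<alpha> - al i) i (ee i * p - p * ee i)" if i: "i \<in> {1..N}" "\<alpha> - al i \<in> ZPi_pos N" for i
  proof -
    obtain A B where AB: "It N \<chi> (\<alpha> - al i) A" "It N \<chi> (\<alpha> - al i) B"
      "pj (ee i * p - p * ee i) = A \<otimes>\<^bsub>UT\<^esub> pj (kk (al i)) \<oplus>\<^bsub>UT\<^esub> B \<otimes>\<^bsub>UT\<^esub> pj (ll (al i))"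
      using c i comm_E_pj[OF i(1) F] by metis
    obtain a where a: "a \<in> Fr" "A = pj a" using It_rep[OF AB(1)] Hs_GF_Fr(1) by blast
    obtain b where b: "b \<in> Fr" "B = pj b" using It_rep[OF AB(2)] Hs_GF_Fr(1) by blast
    have e: "pj (ee i * p - p * ee i) = pj (a * kk (al i) + b * ll (al i))"
      unfolding AB(3) a(2) b(2) by (rule AB_pj[OF i(1) a(1) b(1)])
    have f1: "ee i * p - p * ee i \<in> Fr" by (intro Wd_closed letters_Fr i F)
    have f2: "a * kk (al i) + b * ll (al i) \<in> Fr" by (intro fa.subspace_add[OF Wd_subspace] Wd_mult letters_Fr ZPi_closed i a b)
    have "cg (ee i * p - p * ee i) (a * kk (al i) + b * ll (al i))" using pj_eq[OF f1 f2] e by blast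
    then show ?thesis unfolding AB_def Ip_def using AB(1,2) a b by blast
  qed
  then show "p \<in> Fr \<and> \<alpha> \<in> ZPi_pos N \<and> (\<exists>p'\<in>Hs GFs (- \<alpha>). cg p p') \<and>
    (\<forall>i\<in>{1..N}. \<alpha> - al i \<in> ZPi_pos N \<longrightarrow> AB (\<alpha> - al i) i (ee i * p - p * ee i))"
    using F Ip_pos[OF I] Ip_rep[OF I] by blast
next
  assume a: "p \<in> Fr \<and> \<alpha> \<in> ZPi_pos N \<and> (\<exists>p'\<in>Hs GFs (- \<alpha>). cg p p') \<and>
    (\<forall>i\<in>{1..N}. \<alpha> - al i \<in> ZPi_pos N \<longrightarrow> AB (\<alpha> - al i) i (ee i * p - p * ee i))"
  then obtain p' where p': "p' \<in> Hs GFs (- \<alpha>)" "cg p p'" by blast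
  then have eq: "pj p = pj p'" using pj_eq cg_Fr by blast
  have "It N \<chi> \<alpha> (pj p)"
  proof (rule It.step)
    show "\<alpha> \<in> ZPi_pos N" "\<alpha> \<noteq> 0" using a \<alpha> by blast+
    show "pj p \<in> Ut_minus N \<chi> \<inter> Ut_deg N \<chi> (- \<alpha>)"
      unfolding eq Ut_minus_eq Ut_deg_eq using p'(1) Hs_Wd[of GFs] Hs_GF_Fr(2) by blast
    show "\<forall>i\<in>{1..N}. \<alpha> - al i \<in> ZPi_pos N \<longrightarrow> (\<exists>A B. It N \<chi> (\<alpha> - al i) A \<and> It N \<chi> (\<alpha> - al i) B \<and>
      pj (ee i) \<otimes>\<^bsub>UT\<^esub> pj p \<ominus>\<^bsub>UT\<^esub> pj p \<otimes>\<^bsub>UT\<^esub> pj (ee i) =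
      A \<otimes>\<^bsub>UT\<^esub> pj (kk (al i)) \<oplus>\<^bsub>UT\<^esub> B \<otimes>\<^bsub>UT\<^esub> pj (ll (al i)))"
    proof (intro ballI impI)
      fix i assume i: "i \<in> {1..N}" "\<alpha> - al i \<in> ZPi_pos N"
      then obtain x y where xy: "Ip (\<alpha> - al i) x" "Ip (\<alpha> - al i) y"
        "cg (ee i * p - p * ee i) (x * kk (al i) + y * ll (al i))" using a unfolding AB_def by blast
      have "pj (ee i * p - p * ee i) = pj (x * kk (al i) + y * ll (al i))"
        using pj_eq[OF cg_Fr[OF xy(3)]] xy(3) by blast
      then have "pj (ee i) \<otimes>\<^bsub>UT\<^esub> pj p \<ominus>\<^bsub>UT\<^esub> pj p \<otimes>\<^bsub>UT\<^esub> pj (ee i) =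
        pj x \<otimes>\<^bsub>UT\<^esub> pj (kk (al i)) \<oplus>\<^bsub>UT\<^esub> pj y \<otimes>\<^bsub>UT\<^esub> pj (ll (al i))"
        using comm_E_pj[OF i(1), of p] a AB_pj[OF i(1) Ip_Fr[OF xy(1)] Ip_Fr[OF xy(2)]] by simp
      then show "\<exists>A B. It N \<chi> (\<alpha> - al i) A \<and> It N \<chi> (\<alpha> - al i) B \<and>
        pj (ee i) \<otimes>\<^bsub>UT\<^esub> pj p \<ominus>\<^bsub>UT\<^esub> pj p \<otimes>\<^bsub>UT\<^esub> pj (ee i) =
        A \<otimes>\<^bsub>UT\<^esub> pj (kk (al i)) \<oplus>\<^bsub>UT\<^esub> B \<otimes>\<^bsub>UT\<^esub> pj (ll (al i))"
        using xy(1,2) unfolding Ip_def by blast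
    qed
  qed
  then show "Ip \<alpha> p" using a by (simp add: Ip_def)
qed

lemma Ip_zero_iff: "Ip 0 p \<longleftrightarrow> p \<in> rr"
proof
  assume I: "Ip 0 p"
  then have "It N \<chi> 0 (pj p)" by (simp add: Ip_def)
  then have "pj p = \<zero>\<^bsub>UT\<^esub>" by (cases rule: It.cases) auto
  then show "p \<in> rr" using T.eq[OF Ip_Fr[OF I] Wd_closed(8)] T.zero by (simp only: diff_zero)
next
  assume p: "p \<in> rr"
  then have "p \<in> Fr" using rr_Fr by blast
  then have "pj p = \<zero>\<^bsub>UT\<^esub>" using T.eq[OF _ Wd_closed(8), of p] p T.zero by (simp only: diff_zero)
  then show "Ip 0 p" using \<open>p \<in> Fr\<close> It.zero by (simp add: Ip_def)
qed

text \<open>The definition yields members only; linearity in degree \<alpha> needs linearity of the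
  spaces at \<alpha> - \<alpha>_i, hence the induction on the height.\<close>

lemma Ip_subspace_aux: "\<alpha> \<in> ZPi_pos N \<Longrightarrow> fa.subspace {p. Ip \<alpha> p}"
proof (induction "ht N \<alpha>" arbitrary: \<alpha> rule: less_induct)
  case less
  show ?case
  proof (cases "\<alpha> = 0")
    case True
    then have "{p. Ip \<alpha> p} = rr" using Ip_zero_iff by blast
    then show ?thesis using rr_subspace by simp
  next
    case False
    have AB: "AB (\<alpha> - al i) i 0"
      "AB (\<alpha> - al i) i x \<Longrightarrow> AB (\<alpha> - al i) i y \<Longrightarrow> AB (\<alpha> - al i) i (x + y)"
      "AB (\<alpha> - al i) i x \<Longrightarrow> AB (\<alpha> - al i) i (scp c x)"
      if i: "i \<in> {1..N}" "\<alpha> - al i \<in> ZPi_pos N" for i x y c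
    proof -
      have S: "fa.subspace {p. Ip (\<alpha> - al i) p}" using less.hyps[OF ht_minus[OF less.prems i] i(2)] .
      have "Ip (\<alpha> - al i) 0" using fa.subspace_0[OF S] by simp
      moreover have "cg 0 (0 * kk (al i) + 0 * ll (al i))" using cg_refl[OF Wd_closed(8)] by simp
      ultimately show "AB (\<alpha> - al i) i 0" unfolding AB_def by blast
      show "AB (\<alpha> - al i) i (x + y)" if xy: "AB (\<alpha> - al i) i x" "AB (\<alpha> - al i) i y"
      proof -
        obtain a b where ab: "Ip (\<alpha> - al i) a" "Ip (\<alpha> - al i) b" "cg x (a * kk (al i) + b * ll (al i))"
          using xy(1) unfolding AB_def by blast
        obtain d e where de: "Ip (\<alpha> - al i) d" "Ip (\<alpha> - al i) e" "cg y (d * kk (al i) + e * ll (al i))"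
          using xy(2) unfolding AB_def by blast
        have "cg (x + y) ((a + d) * kk (al i) + (b + e) * ll (al i))"
          using cg_add[OF ab(3) de(3)] by (simp add: algebra_simps)
        moreover have "Ip (\<alpha> - al i) (a + d)" "Ip (\<alpha> - al i) (b + e)"
          using fa.subspace_add[OF S, of a d] fa.subspace_add[OF S, of b e] ab de by simp_all
        ultimately show ?thesis unfolding AB_def by blast
      qed
      show "AB (\<alpha> - al i) i (scp c x)" if x: "AB (\<alpha> - al i) i x"
      proof -
        obtain a b where ab: "Ip (\<alpha> - al i) a" "Ip (\<alpha> - al i) b" "cg x (a * kk (al i) + b * ll (al i))"
          using x unfolding AB_def by blast
        have "cg (scp c x) (scp c a * kk (al i) + scp c b * ll (al i))"
          using cg_scp[OF ab(3), of c] by (simp only: scp_mult fa.scale_right_distrib)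
        moreover have "Ip (\<alpha> - al i) (scp c a)" "Ip (\<alpha> - al i) (scp c b)"
          using fa.subspace_scale[OF S, of a c] fa.subspace_scale[OF S, of b c] ab by simp_all
        ultimately show ?thesis unfolding AB_def by blast
      qed
    qed
    show ?thesis
    proof (rule fa.subspaceI; unfold mem_Collect_eq Ip_iff[OF False])
      show "0 \<in> Fr \<and> \<alpha> \<in> ZPi_pos N \<and> (\<exists>p'\<in>Hs GFs (- \<alpha>). cg 0 p') \<and>
        (\<forall>i\<in>{1..N}. \<alpha> - al i \<in> ZPi_pos N \<longrightarrow> AB (\<alpha> - al i) i (ee i * 0 - 0 * ee i))"
      proof (intro conjI ballI impI)
        show "\<exists>p'\<in>Hs GFs (- \<alpha>). cg 0 p'"
          using fa.subspace_0[OF Hs_subspace] cg_refl[OF Wd_closed(8)] by (rule bexI[rotated])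
        show "AB (\<alpha> - al i) i (ee i * 0 - 0 * ee i)" if "i \<in> {1..N}" "\<alpha> - al i \<in> ZPi_pos N" for i
          using AB(1)[OF that] by simp
      qed (use less.prems in \<open>auto simp: Wd_closed\<close>)
    next
      fix p q
      assume p: "p \<in> Fr \<and> \<alpha> \<in> ZPi_pos N \<and> (\<exists>p'\<in>Hs GFs (- \<alpha>). cg p p') \<and>
        (\<forall>i\<in>{1..N}. \<alpha> - al i \<in> ZPi_pos N \<longrightarrow> AB (\<alpha> - al i) i (ee i * p - p * ee i))"
        and q: "q \<in> Fr \<and> \<alpha> \<in> ZPi_pos N \<and> (\<exists>p'\<in>Hs GFs (- \<alpha>). cg q p') \<and>
        (\<forall>i\<in>{1..N}. \<alpha> - al i \<in> ZPi_pos N \<longrightarrow> AB (\<alpha> - al i) i (ee i * q - q * ee i))"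
      have "ee i * (p + q) - (p + q) * ee i = (ee i * p - p * ee i) + (ee i * q - q * ee i)" for i
        by (simp add: algebra_simps)
      moreover have "\<exists>p'\<in>Hs GFs (- \<alpha>). cg (p + q) p'"
        using p q cg_add fa.subspace_add[OF Hs_subspace] by blast
      moreover have "p + q \<in> Fr" using p q fa.subspace_add[OF Wd_subspace] by blast
      ultimately show "p + q \<in> Fr \<and> \<alpha> \<in> ZPi_pos N \<and> (\<exists>p'\<in>Hs GFs (- \<alpha>). cg (p + q) p') \<and>
        (\<forall>i\<in>{1..N}. \<alpha> - al i \<in> ZPi_pos N \<longrightarrow> AB (\<alpha> - al i) i (ee i * (p + q) - (p + q) * ee i))"
        using AB(2) p q by (simp only:) blast
    next
      fix c p
      assume p: "p \<in> Fr \<and> \<alpha> \<in> ZPi_pos N \<and> (\<exists>p'\<in>Hs GFs (- \<alpha>). cg p p') \<and>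
        (\<forall>i\<in>{1..N}. \<alpha> - al i \<in> ZPi_pos N \<longrightarrow> AB (\<alpha> - al i) i (ee i * p - p * ee i))"
      have "ee i * scp c p - scp c p * ee i = scp c (ee i * p - p * ee i)" for i
        by (simp add: scp_mult fa.scale_right_diff_distrib)
      moreover have "\<exists>p'\<in>Hs GFs (- \<alpha>). cg (scp c p) p'"
        using p cg_scp fa.subspace_scale[OF Hs_subspace] by blast
      moreover have "scp c p \<in> Fr" using p fa.subspace_scale[OF Wd_subspace] by blast
      ultimately show "scp c p \<in> Fr \<and> \<alpha> \<in> ZPi_pos N \<and> (\<exists>p'\<in>Hs GFs (- \<alpha>). cg (scp c p) p') \<and>
        (\<forall>i\<in>{1..N}. \<alpha> - al i \<in> ZPi_pos N \<longrightarrow> AB (\<alpha> - al i) i (ee i * scp c p - scp c p * ee i))"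
        using AB(3) p by (simp only:) blast
    qed
  qed
qed

lemma Ip_zero: "\<alpha> \<in> ZPi_pos N \<Longrightarrow> Ip \<alpha> 0"
  using fa.subspace_0[OF Ip_subspace_aux] by simp

lemma Ip_add: "Ip \<alpha> p \<Longrightarrow> Ip \<alpha> q \<Longrightarrow> Ip \<alpha> (p + q)"
  using fa.subspace_add[OF Ip_subspace_aux[OF Ip_pos], of \<alpha> p p q] by simp

lemma Ip_scp: "Ip \<alpha> p \<Longrightarrow> Ip \<alpha> (scp c p)"
  using fa.subspace_scale[OF Ip_subspace_aux[OF Ip_pos], of \<alpha> p p c] by simp

lemma Ip_neg: "Ip \<alpha> p \<Longrightarrow> Ip \<alpha> (- p)"
  using fa.subspace_neg[OF Ip_subspace_aux[OF Ip_pos], of \<alpha> p p] by simp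

lemma AB_I: "Ip \<beta> a \<Longrightarrow> Ip \<beta> b \<Longrightarrow> cg x (a * kk (al i) + b * ll (al i)) \<Longrightarrow> AB \<beta> i x"
  unfolding AB_def by blast

lemma AB_cong: "cg x y \<Longrightarrow> AB \<beta> i y \<Longrightarrow> AB \<beta> i x"
  unfolding AB_def using cg_trans by blast

lemma AB_add:
  assumes "AB \<beta> i x" "AB \<beta> i y" shows "AB \<beta> i (x + y)"
proof -
  obtain a b where ab: "Ip \<beta> a" "Ip \<beta> b" "cg x (a * kk (al i) + b * ll (al i))"
    using assms(1) unfolding AB_def by blast
  obtain d e where de: "Ip \<beta> d" "Ip \<beta> e" "cg y (d * kk (al i) + e * ll (al i))"
    using assms(2) unfolding AB_def by blast
  have "cg (x + y) ((a + d) * kk (al i) + (b + e) * ll (al i))"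
    using cg_add[OF ab(3) de(3)] by (simp add: algebra_simps)
  then show ?thesis using Ip_add ab de by (intro AB_I)
qed

lemma AB_zero: "\<beta> \<in> ZPi_pos N \<Longrightarrow> AB \<beta> i 0"
  using AB_I[OF Ip_zero Ip_zero, of \<beta> 0 i] cg_refl[OF Wd_closed(8)] by simp

lemma Ip_commute_kk: "Ip \<alpha> p \<Longrightarrow> \<beta> \<in> ZPi N \<Longrightarrow> cg (kk \<beta> * p) (scp (\<chi> \<beta> (- \<alpha>)) (p * kk \<beta>))"
  and Ip_commute_ll: "Ip \<alpha> p \<Longrightarrow> \<beta> \<in> ZPi N \<Longrightarrow> cg (ll \<beta> * p) (scp (\<chi> \<alpha> \<beta>) (p * ll \<beta>))"
proof -
  assume I: "Ip \<alpha> p" and b: "\<beta> \<in> ZPi N"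
  obtain p' where p': "p' \<in> Hs GFs (- \<alpha>)" "cg p p'" using Ip_rep[OF I] by blast
  have h: "p' \<in> Hs (gens N) (- \<alpha>)" using p'(1) Hs_GF_Fr(2) by blast
  have "cg (kk \<beta> * p) (kk \<beta> * p')" by (rule cg_left[OF letters_Fr(1)[OF b] p'(2)])
  also have "cg (kk \<beta> * p') (scp (\<chi> \<beta> (- \<alpha>)) (p' * kk \<beta>))" by (rule kk_Hs[OF b b _ h])
  also have "cg (scp (\<chi> \<beta> (- \<alpha>)) (p' * kk \<beta>)) (scp (\<chi> \<beta> (- \<alpha>)) (p * kk \<beta>))"
    by (rule cg_scp[OF cg_right[OF letters_Fr(1)[OF b] cg_sym[OF p'(2)]]])
  finally show "cg (kk \<beta> * p) (scp (\<chi> \<beta> (- \<alpha>)) (p * kk \<beta>))" .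
  have "cg (ll \<beta> * p) (ll \<beta> * p')" by (rule cg_left[OF letters_Fr(2)[OF b] p'(2)])
  also have "cg (ll \<beta> * p') (scp (\<chi> (- (- \<alpha>)) \<beta>) (p' * ll \<beta>))" by (rule ll_Hs[OF b h])
  also have "cg (scp (\<chi> (- (- \<alpha>)) \<beta>) (p' * ll \<beta>)) (scp (\<chi> (- (- \<alpha>)) \<beta>) (p * ll \<beta>))"
    by (rule cg_scp[OF cg_right[OF letters_Fr(2)[OF b] cg_sym[OF p'(2)]]])
  finally show "cg (ll \<beta> * p) (scp (\<chi> \<alpha> \<beta>) (p * ll \<beta>))" by (simp only: minus_minus)
qed

end

section \<open>The ideal J^-\<close>

context gqg
begin

lemma al_ZPi: "i \<in> {1..N} \<Longrightarrow> al i \<in> ZPi N" by (rule ZPi_closed(5))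

lemma comm_AB:
  assumes I: "Ip \<alpha> p" and i: "i \<in> {1..N}" and pos: "\<alpha> - al i \<in> ZPi_pos N"
  shows "AB (\<alpha> - al i) i (ee i * p - p * ee i)"
proof -
  have "\<alpha> \<noteq> 0"
  proof
    assume "\<alpha> = 0"
    then have "0 < Poly_Mapping.lookup (0 :: lattice) i" using ZPi_pos_minus[OF ZPi_pos_0 i] pos by simp
    then show False by simp
  qed
  then show ?thesis using Ip_iff I i pos by blast
qed

text \<open>If \<alpha> does not contain \<alpha>_i, then p has a representative without F_i, and
  E_i commutes with every other F_j.\<close>

lemma comm_zero:
  assumes I: "Ip \<alpha> p" and i: "i \<in> {1..N}" and pos: "\<alpha> - al i \<notin> ZPi_pos N"
  shows "cg (ee i * p - p * ee i) 0"
proof -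
  have "0 \<le> Poly_Mapping.lookup \<alpha> i" using Ip_pos[OF I] ZPi_pos_iff by blast
  then have z: "Poly_Mapping.lookup \<alpha> i = 0" using ZPi_pos_minus[OF Ip_pos[OF I] i] pos by linarith
  obtain p' where p': "p' \<in> Hs GFs (- \<alpha>)" "cg p p'" using Ip_rep[OF I] by blast
  have "cg (ee i * p - p * ee i) (ee i * p' - p' * ee i)"
    by (rule cg_diff[OF cg_left[OF letters_Fr(3)[OF i] p'(2)] cg_right[OF letters_Fr(3)[OF i] p'(2)]])
  also have "cg (ee i * p' - p' * ee i) (p' * ee i - p' * ee i)"
    by (rule cg_diff[OF ee_F_Hs[OF i z p'(1)] cg_refl]) (intro Wd_mult letters_Fr i cg_Fr(2)[OF p'(2)])
  finally show ?thesis by simp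
qed

lemma cg_EF:
  assumes "i \<in> {1..N}" "j \<in> {1..N}"
  shows "i \<noteq> j \<Longrightarrow> cg (ee i * ff j - ff j * ee i) 0"
    "i = j \<Longrightarrow> cg (ee i * ff j - ff j * ee i) (- kk (al i) + ll (al i))"
  using cg_rels(10)[OF assms] by simp_all

lemma AB_scp: "AB \<beta> i x \<Longrightarrow> AB \<beta> i (scp c x)"
  unfolding AB_def
proof (elim exE conjE)
  fix a b assume a: "Ip \<beta> a" "Ip \<beta> b" "cg x (a * kk (al i) + b * ll (al i))"
  have "cg (scp c x) (scp c a * kk (al i) + scp c b * ll (al i))"
    using cg_scp[OF a(3), of c] by (simp only: scp_mult fa.scale_right_distrib)
  then show "\<exists>a b. Ip \<beta> a \<and> Ip \<beta> b \<and> cg (scp c x) (a * kk (al i) + b * ll (al i))"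
    using Ip_scp a by blast
qed

text \<open>The commutator of E_i with F_j p is [E_i, F_j] p + F_j [E_i, p]. The first term consists
  of K and L times p; the second is treated by induction on the height. Products on the right are
  similar, after K and L have been moved past F_j.\<close>

lemma Ip_F:
  assumes "Ip \<alpha> p" "j \<in> {1..N}"
  shows "Ip (\<alpha> + al j) (ff j * p) \<and> Ip (\<alpha> + al j) (p * ff j)"
  using assms(1)
proof (induction "ht N \<alpha>" arbitrary: \<alpha> p rule: less_induct)
  case less
  note I = less.prems
  note j = assms(2)
  define \<beta> where "\<beta> = \<alpha> + al j"
  have pF: "p \<in> Fr" by (rule Ip_Fr[OF I])
  have fF: "ff j \<in> Fr" by (rule letters_Fr(4)[OF j])
  have pos: "\<beta> \<in> ZPi_pos N" unfolding \<beta>_def by (rule ZPi_pos_add[OF Ip_pos[OF I] j])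
  have nz: "\<beta> \<noteq> 0"
  proof
    assume "\<beta> = 0"
    then have "Poly_Mapping.lookup \<alpha> j + 1 = 0"
      using arg_cong[of \<beta> 0 "\<lambda>x. Poly_Mapping.lookup x j"] unfolding \<beta>_def lookup_add lookup_frag_of by simp
    moreover have "0 \<le> Poly_Mapping.lookup \<alpha> j" using Ip_pos[OF I] ZPi_pos_iff by blast
    ultimately show False by linarith
  qed
  obtain p' where p': "p' \<in> Hs GFs (- \<alpha>)" "cg p p'" using Ip_rep[OF I] by blast
  have fH: "ff j \<in> (Hs GFs (- al j) :: (gen list \<Rightarrow>\<^sub>0 'k) set)" unfolding letter_mon using j by (intro Hs_mon) auto
  have nb: "- al j + - \<alpha> = - \<beta>" "- \<alpha> + - al j = - \<beta>" unfolding \<beta>_def by simp_all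
  have r1: "\<exists>p'\<in>Hs GFs (- \<beta>). cg (ff j * p) p'"
    using Hs_mult[OF fH p'(1)] cg_left[OF fF p'(2)] unfolding nb by blast
  have r2: "\<exists>p'\<in>Hs GFs (- \<beta>). cg (p * ff j) p'"
    using Hs_mult[OF p'(1) fH] cg_right[OF fF p'(2)] unfolding nb by blast
  have "AB (\<beta> - al i) i (ee i * (ff j * p) - (ff j * p) * ee i) \<and> AB (\<beta> - al i) i (ee i * (p * ff j) - (p * ff j) * ee i)"
    if i: "i \<in> {1..N}" and bp: "\<beta> - al i \<in> ZPi_pos N" for i
  proof -
    note Z = al_ZPi[OF i]
    have KF: "kk (al i) \<in> Fr" "ll (al i) \<in> Fr" by (rule letters_Fr(1)[OF Z], rule letters_Fr(2)[OF Z])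
    have eF: "ee i \<in> Fr" by (rule letters_Fr(3)[OF i])
    have zF: "0 \<in> Fr" by (rule Wd_closed(8))
    have s1: "AB (\<beta> - al i) i ((ee i * ff j - ff j * ee i) * p) \<and> AB (\<beta> - al i) i (p * (ee i * ff j - ff j * ee i))"
    proof (cases "i = j")
      case False
      have c1: "cg ((ee i * ff j - ff j * ee i) * p) 0" using cg_right[OF pF cg_EF(1)[OF i j False]] by simp
      have c2: "cg (p * (ee i * ff j - ff j * ee i)) 0" using cg_left[OF pF cg_EF(1)[OF i j False]] by simp
      show ?thesis using AB_cong[OF c1 AB_zero[OF bp]] AB_cong[OF c2 AB_zero[OF bp]] ..
    next
      case True
      have e: "\<beta> - al i = \<alpha>" unfolding \<beta>_def True by simp
      have "cg ((ee i * ff j - ff j * ee i) * p) ((- kk (al i) + ll (al i)) * p)"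
        by (rule cg_right[OF pF cg_EF(2)[OF i j True]])
      also have "(- kk (al i) + ll (al i)) * p = - (kk (al i) * p) + ll (al i) * p" by (simp add: algebra_simps)
      also have "cg (- (kk (al i) * p) + ll (al i) * p)
          (- scp (\<chi> (al i) (- \<alpha>)) (p * kk (al i)) + scp (\<chi> \<alpha> (al i)) (p * ll (al i)))"
        by (rule cg_add[OF cg_neg[OF Ip_commute_kk[OF I Z]] Ip_commute_ll[OF I Z]])
      also have "\<dots> = (- scp (\<chi> (al i) (- \<alpha>)) p) * kk (al i) + scp (\<chi> \<alpha> (al i)) p * ll (al i)"
        by (simp only: scp_mult minus_mult_left[symmetric])
      finally have a: "AB \<alpha> i ((ee i * ff j - ff j * ee i) * p)"
        by (rule AB_I[OF Ip_neg[OF Ip_scp[OF I]] Ip_scp[OF I]])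
      have "cg (p * (ee i * ff j - ff j * ee i)) (p * (- kk (al i) + ll (al i)))"
        by (rule cg_left[OF pF cg_EF(2)[OF i j True]])
      also have "\<dots> = (- p) * kk (al i) + p * ll (al i)" by (simp add: algebra_simps)
      finally have "AB \<alpha> i (p * (ee i * ff j - ff j * ee i))"
        by (rule AB_I[OF Ip_neg[OF I] I])
      then show ?thesis using a unfolding e by blast
    qed
    have s2: "AB (\<beta> - al i) i (ff j * (ee i * p - p * ee i)) \<and> AB (\<beta> - al i) i ((ee i * p - p * ee i) * ff j)"
    proof (cases "\<alpha> - al i \<in> ZPi_pos N")
      case False
      note c = comm_zero[OF I i False]
      have c1: "cg (ff j * (ee i * p - p * ee i)) 0" using cg_left[OF fF c] by simp
      have c2: "cg ((ee i * p - p * ee i) * ff j) 0" using cg_right[OF fF c] by simp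
      show ?thesis using AB_cong[OF c1 AB_zero[OF bp]] AB_cong[OF c2 AB_zero[OF bp]] ..
    next
      case True
      obtain a b where ab: "Ip (\<alpha> - al i) a" "Ip (\<alpha> - al i) b" "cg (ee i * p - p * ee i) (a * kk (al i) + b * ll (al i))"
        using comm_AB[OF I i True] unfolding AB_def by blast
      have h: "ht N (\<alpha> - al i) < ht N \<alpha>" by (rule ht_minus[OF Ip_pos[OF I] i True])
      have e: "\<alpha> - al i + al j = \<beta> - al i" unfolding \<beta>_def by simp
      note IHa = less.hyps[OF h ab(1), unfolded e] and IHb = less.hyps[OF h ab(2), unfolded e]
      have "cg (ff j * (ee i * p - p * ee i)) (ff j * (a * kk (al i) + b * ll (al i)))"
        by (rule cg_left[OF fF ab(3)])
      also have "\<dots> = ff j * a * kk (al i) + ff j * b * ll (al i)" by (simp add: algebra_simps)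
      finally have 1: "AB (\<beta> - al i) i (ff j * (ee i * p - p * ee i))"
        using IHa IHb AB_I by blast
      have "cg ((ee i * p - p * ee i) * ff j) ((a * kk (al i) + b * ll (al i)) * ff j)"
        by (rule cg_right[OF fF ab(3)])
      also have "\<dots> = a * (kk (al i) * ff j) + b * (ll (al i) * ff j)" by (simp add: algebra_simps)
      also have "cg (a * (kk (al i) * ff j) + b * (ll (al i) * ff j))
         (a * scp (\<chi> (al i) (- al j)) (ff j * kk (al i)) + b * scp (\<chi> (al j) (al i)) (ff j * ll (al i)))"
        by (rule cg_add[OF cg_left[OF Ip_Fr[OF ab(1)] cg_rels(8)[OF Z j]] cg_left[OF Ip_Fr[OF ab(2)] cg_rels(9)[OF Z j]]])
      also have "\<dots> = scp (\<chi> (al i) (- al j)) (a * ff j) * kk (al i) + scp (\<chi> (al j) (al i)) (b * ff j) * ll (al i)"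
        by (simp only: scp_mult mult.assoc)
      finally have "AB (\<beta> - al i) i ((ee i * p - p * ee i) * ff j)"
        using IHa IHb AB_I Ip_scp by blast
      then show ?thesis using 1 by blast
    qed
    have e1: "ee i * (ff j * p) - (ff j * p) * ee i = (ee i * ff j - ff j * ee i) * p + ff j * (ee i * p - p * ee i)"
      and e2: "ee i * (p * ff j) - (p * ff j) * ee i = (ee i * p - p * ee i) * ff j + p * (ee i * ff j - ff j * ee i)"
      by (simp_all add: algebra_simps)
    show ?thesis unfolding e1 e2 using s1 s2 AB_add by blast
  qed
  then have "Ip \<beta> (ff j * p)" "Ip \<beta> (p * ff j)"
    unfolding Ip_iff[OF nz] using pos r1 r2 Wd_mult[OF fF pF] Wd_mult[OF pF fF] by blast+
  then show ?case unfolding \<beta>_def ..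
qed

text \<open>One form for both cases; the last clause records that a and b vanish or sit at a smaller
  height, as later inductions require.\<close>

lemma E_left:
  assumes I: "Ip \<alpha> y" and i: "i \<in> {1..N}"
  obtains \<beta> a b where "Ip \<beta> a" "Ip \<beta> b" "cg (ee i * y) (y * ee i + (a * kk (al i) + b * ll (al i)))"
    "\<beta> = \<alpha> - al i \<and> \<beta> \<in> ZPi_pos N \<or> a = 0 \<and> b = 0"
proof -
  have e: "ee i * y = y * ee i + (ee i * y - y * ee i)" by simp
  have r: "cg (y * ee i) (y * ee i)" by (intro cg_refl Wd_mult letters_Fr i Ip_Fr[OF I])
  show thesis
  proof (cases "\<alpha> - al i \<in> ZPi_pos N")
    case True
    obtain a b where ab: "Ip (\<alpha> - al i) a" "Ip (\<alpha> - al i) b" "cg (ee i * y - y * ee i) (a * kk (al i) + b * ll (al i))"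
      using comm_AB[OF I i True] unfolding AB_def by blast
    show thesis
      by (rule that[OF ab(1,2)], subst e, rule cg_add[OF r ab(3)]) (use True in blast)
  next
    case False
    have "cg (ee i * y) (y * ee i + (0 * kk (al i) + 0 * ll (al i)))"
      by (subst e, rule cg_add[OF r]) (use comm_zero[OF I i False] in simp)
    then show thesis using that[OF Ip_zero[OF ZPi_pos_0] Ip_zero[OF ZPi_pos_0]] by blast
  qed
qed

text \<open>The part U^0 U^+ of the triangular decomposition, on representatives; \<open>Jm\<close>
  below is the preimage of J^- (see \<open>Jt_minus_eq\<close>).\<close>

definition KE :: "(gen list \<Rightarrow>\<^sub>0 'k) set" where
  "KE = fa.span ({mon z * mon w | z w. z \<in> lists GKLs \<and> w \<in> lists GEs} \<union> rr)"

definition Jm :: "(gen list \<Rightarrow>\<^sub>0 'k) set" where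
  "Jm = fa.span {y * (mon z * mon w) | \<alpha> y z w. Ip \<alpha> y \<and> z \<in> lists GKLs \<and> w \<in> lists GEs}"

lemma Jm_subspace: "fa.subspace Jm" unfolding Jm_def by (rule fa.subspace_span)

lemma KE_subspace: "fa.subspace KE" unfolding KE_def by (rule fa.subspace_span)

lemma Jm_gen: "Ip \<alpha> y \<Longrightarrow> z \<in> lists GKLs \<Longrightarrow> w \<in> lists GEs \<Longrightarrow> y * (mon z * mon w) \<in> Jm"
  unfolding Jm_def by (rule fa.span_base) blast

lemma KE_gen: "z \<in> lists GKLs \<Longrightarrow> w \<in> lists GEs \<Longrightarrow> mon z * mon w \<in> KE"
  unfolding KE_def by (rule fa.span_base) blast

lemma rr_KE: "rr \<subseteq> KE" unfolding KE_def using fa.span_superset by blast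

lemma rr_Jm: "rr \<subseteq> Jm"
proof
  fix p assume "p \<in> rr"
  then have "Ip 0 p" by (simp add: Ip_zero_iff)
  from Jm_gen[OF this, of "[]" "[]"] show "p \<in> Jm" by (simp add: mon_Nil)
qed

lemma words_Fr: "z \<in> lists GKLs \<Longrightarrow> mon z \<in> Fr" "z \<in> lists GEs \<Longrightarrow> mon z \<in> Fr" "z \<in> lists GFs \<Longrightarrow> mon z \<in> Fr"
  using mon_Fr lists_mono[OF sub_gens(1)] lists_mono[OF sub_gens(2)] lists_mono[OF sub_gens(3)] by blast+

lemma Jm_Fr: "Jm \<subseteq> Fr"
  unfolding Jm_def
proof (rule fa.span_minimal[OF _ Wd_subspace], rule subsetI, unfold mem_Collect_eq, elim exE conjE)
  fix x \<alpha> y z w assume "x = y * (mon z * mon w)" "Ip \<alpha> y" "z \<in> lists GKLs" "w \<in> lists GEs"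
  then show "x \<in> Fr" by (simp only:) (intro Wd_mult Ip_Fr words_Fr)
qed

lemma cg_closed: "fa.subspace S \<Longrightarrow> rr \<subseteq> S \<Longrightarrow> cg x y \<Longrightarrow> y \<in> S \<Longrightarrow> x \<in> S"
proof -
  assume a: "fa.subspace S" "rr \<subseteq> S" "cg x y" "y \<in> S"
  have "(x - y) + y \<in> S" using a unfolding cg_def by (intro fa.subspace_add[OF a(1)]) auto
  then show ?thesis by simp
qed

lemmas cg_Jm = cg_closed[OF Jm_subspace rr_Jm] and cg_KE = cg_closed[OF KE_subspace rr_KE]

lemma Jm_induct:
  assumes "x \<in> Jm" "\<And>\<alpha> y z w. Ip \<alpha> y \<Longrightarrow> z \<in> lists GKLs \<Longrightarrow> w \<in> lists GEs \<Longrightarrow> P (y * (mon z * mon w))"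
    "P 0" "\<And>a b c. P a \<Longrightarrow> P b \<Longrightarrow> P (scp c a + b)"
  shows "P x"
proof -
  have "P x"
    using assms(1) unfolding Jm_def
  proof (induction rule: fa.span_induct_alt)
    case (step c x y)
    then show ?case using assms(2,4) by blast
  qed (rule assms(3))
  then show ?thesis .
qed

lemma KE_induct:
  assumes "x \<in> KE" "\<And>z w. z \<in> lists GKLs \<Longrightarrow> w \<in> lists GEs \<Longrightarrow> P (mon z * mon w)" "\<And>x. x \<in> rr \<Longrightarrow> P x"
    "\<And>a b c. P a \<Longrightarrow> P b \<Longrightarrow> P (scp c a + b)"
  shows "P x"
proof -
  have "P x"
    using assms(1) unfolding KE_def
  proof (induction rule: fa.span_induct_alt)
    case (step c x y)
    then show ?case using assms(2-4) by blast
  qed (rule assms(3)[OF fa.subspace_0[OF rr_subspace]])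
  then show ?thesis .
qed

lemma KE_span: "s \<in> Wd GKLs \<Longrightarrow> t \<in> Wd GEs \<Longrightarrow> s * t \<in> KE"
proof (induction s rule: Wd_induct)
  case (step c z s)
  have "mon z * t \<in> KE" using step.prems step(1)
  proof (induction t rule: Wd_induct)
    case (step d w t)
    then show ?case unfolding distrib_left scp_mult
      by (intro fa.subspace_add[OF KE_subspace] fa.subspace_scale[OF KE_subspace] KE_gen)
  qed (simp add: fa.subspace_0[OF KE_subspace])
  then show ?case unfolding distrib_right scp_mult
    by (intro fa.subspace_add[OF KE_subspace] fa.subspace_scale[OF KE_subspace] step)
qed (simp add: fa.subspace_0[OF KE_subspace])

lemma Jm_KE: "Ip \<alpha> y \<Longrightarrow> x \<in> KE \<Longrightarrow> y * x \<in> Jm"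
proof (erule KE_induct)
  assume I: "Ip \<alpha> y"
  show "x \<in> rr \<Longrightarrow> y * x \<in> Jm" for x using rr_closed(1)[OF _ Ip_Fr[OF I]] rr_Jm by blast
  show "y * a \<in> Jm \<Longrightarrow> y * b \<in> Jm \<Longrightarrow> y * (scp c a + b) \<in> Jm" for a b c
    unfolding distrib_left scp_mult by (intro fa.subspace_add[OF Jm_subspace] fa.subspace_scale[OF Jm_subspace])
qed (rule Jm_gen)

lemma KL_KE: "z \<in> lists GKLs \<Longrightarrow> x \<in> KE \<Longrightarrow> mon z * x \<in> KE"
proof (erule KE_induct)
  assume z: "z \<in> lists GKLs"
  show "x \<in> rr \<Longrightarrow> mon z * x \<in> KE" for x using rr_closed(1)[OF _ words_Fr(1)[OF z]] rr_KE by blast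
  show "mon z * a \<in> KE \<Longrightarrow> mon z * b \<in> KE \<Longrightarrow> mon z * (scp c a + b) \<in> KE" for a b c
    unfolding distrib_left scp_mult by (intro fa.subspace_add[OF KE_subspace] fa.subspace_scale[OF KE_subspace])
  fix z' w assume "z' \<in> lists GKLs" "w \<in> lists GEs"
  then have "mon (z @ z') * mon w \<in> KE" using z by (intro KE_gen) simp_all
  then show "mon z * (mon z' * mon w) \<in> KE" by (simp only: mon_mult[symmetric] mult.assoc)
qed

lemma E_KL:
  assumes i: "i \<in> {1..N}"
  shows "z \<in> lists GKLs \<Longrightarrow> \<exists>c. cg (ee i * mon z) (scp c (mon z * ee i))"
proof (induction z)
  case Nil
  have "cg (ee i * mon []) (scp 1 (mon [] * ee i))" using cg_refl[OF letters_Fr(3)[OF i]] by (simp add: mon_Nil)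
  then show ?case ..
next
  case (Cons g z)
  then have z: "z \<in> lists GKLs" and g: "g \<in> GKLs" by simp_all
  obtain c where c: "cg (ee i * mon z) (scp c (mon z * ee i))" using Cons.IH[OF z] by blast
  have gF: "letter g \<in> Fr" using g sub_gens(3) by (blast intro: Wd_letter)
  note eF = letters_Fr(3)[OF i]
  have "\<exists>d. d \<noteq> 0 \<and> cg (letter g * ee i) (scp d (ee i * letter g))"
    using g
  proof
    assume "g \<in> GK ` ZPi N"
    then obtain \<beta> where b: "\<beta> \<in> ZPi N" "g = GK \<beta>" by blast
    show ?thesis unfolding b(2) using cg_rels(6)[OF b(1) i] chi_nz[OF b(1) al_ZPi[OF i]] by blast
  next
    assume "g \<in> GL ` ZPi N"
    then obtain \<beta> where b: "\<beta> \<in> ZPi N" "g = GL \<beta>" by blast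
    show ?thesis unfolding b(2) using cg_rels(7)[OF b(1) i] chi_nz[OF ZPi_closed(3)[OF al_ZPi[OF i]] b(1)] by blast
  qed
  then obtain d where d: "d \<noteq> 0" "cg (letter g * ee i) (scp d (ee i * letter g))" by blast
  have "cg (scp (inverse d) (letter g * ee i)) (scp (inverse d) (scp d (ee i * letter g)))"
    by (rule cg_scp[OF d(2)])
  then have "cg (ee i * letter g) (scp (inverse d) (letter g * ee i))" using d(1) cg_sym by simp
  then have "cg (ee i * letter g * mon z) (scp (inverse d) (letter g * ee i) * mon z)"
    by (rule cg_right[OF words_Fr(1)[OF z]])
  also have "\<dots> = scp (inverse d) (letter g * (ee i * mon z))" by (simp only: scp_mult mult.assoc)
  also have "cg (scp (inverse d) (letter g * (ee i * mon z))) (scp (inverse d) (letter g * scp c (mon z * ee i)))"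
    by (rule cg_scp[OF cg_left[OF gF c]])
  also have "\<dots> = scp (inverse d * c) (mon (g # z) * ee i)" by (simp only: mon_Cons scp_mult fa.scale_scale mult.assoc)
  finally show ?case by (simp only: mon_Cons mult.assoc) blast
qed

lemma E_KE: "i \<in> {1..N} \<Longrightarrow> x \<in> KE \<Longrightarrow> ee i * x \<in> KE"
proof (erule KE_induct)
  assume i: "i \<in> {1..N}"
  note eF = letters_Fr(3)[OF i]
  show "x \<in> rr \<Longrightarrow> ee i * x \<in> KE" for x using rr_closed(1)[OF _ eF] rr_KE by blast
  show "ee i * a \<in> KE \<Longrightarrow> ee i * b \<in> KE \<Longrightarrow> ee i * (scp c a + b) \<in> KE" for a b c
    unfolding distrib_left scp_mult by (intro fa.subspace_add[OF KE_subspace] fa.subspace_scale[OF KE_subspace])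
  fix z w assume z: "z \<in> lists GKLs" and w: "w \<in> lists GEs"
  obtain c where "cg (ee i * mon z) (scp c (mon z * ee i))" using E_KL[OF i z] by blast
  then have "cg (ee i * mon z * mon w) (scp c (mon z * ee i) * mon w)" by (rule cg_right[OF words_Fr(2)[OF w]])
  also have "\<dots> = scp c (mon z * mon (GE i # w))" by (simp only: scp_mult mon_Cons mult.assoc)
  finally have "cg (ee i * (mon z * mon w)) (scp c (mon z * mon (GE i # w)))" by (simp only: mult.assoc)
  then show "ee i * (mon z * mon w) \<in> KE"
    by (rule cg_KE) (use z w i in \<open>auto intro!: fa.subspace_scale[OF KE_subspace] KE_gen\<close>)
qed

text \<open>Commuting F_j through a word of E's replaces one E_i by K_i and L_i, and these can be
  brought to the front.\<close>

lemma E_F_word: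
  assumes j: "j \<in> {1..N}"
  shows "w \<in> lists GEs \<Longrightarrow> mon w * ff j - ff j * mon w \<in> KE"
proof (induction w)
  case Nil
  show ?case by (simp add: mon_Nil fa.subspace_0[OF KE_subspace])
next
  case (Cons g w)
  then obtain i where i: "g = GE i" "i \<in> {1..N}" by (auto simp only: Cons_in_lists_iff image_iff)
  have w: "w \<in> lists GEs" using Cons.prems by simp
  note Z = al_ZPi[OF i(2)]
  have e: "mon (g # w) * ff j - ff j * mon (g # w) = ee i * (mon w * ff j - ff j * mon w) + (ee i * ff j - ff j * ee i) * mon w"
    by (simp add: mon_Cons i(1) algebra_simps)
  have "(ee i * ff j - ff j * ee i) * mon w \<in> KE"
  proof (rule cg_KE[OF cg_right[OF words_Fr(2)[OF w] cg_rels(10)[OF i(2) j]]])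
    have m: "mon [g] * mon w \<in> KE" if "g \<in> GKLs" for g by (rule KE_gen) (use that w in auto)
    have "GK (al i) \<in> GKLs" "GL (al i) \<in> GKLs" using Z by blast+
    note m = m[OF this(1)] m[OF this(2)]
    have "(- kk (al i) + ll (al i)) * mon w = - (mon [GK (al i)] * mon w) + mon [GL (al i)] * mon w"
      by (simp add: letter_mon algebra_simps)
    also have "\<dots> \<in> KE"
      by (intro fa.subspace_add[OF KE_subspace] fa.subspace_neg[OF KE_subspace] m)
    finally show "(if i = j then - kk (al i) + ll (al i) else 0) * mon w \<in> KE"
      using fa.subspace_0[OF KE_subspace] by (cases "i = j") (simp_all only: simp_thms if_True if_False mult_zero_left)
  qed
  then show ?case unfolding e using E_KE[OF i(2) Cons.IH[OF w]] by (rule fa.subspace_add[OF KE_subspace, rotated])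
qed

lemma KL_commute_Ip:
  assumes I: "Ip \<alpha> y" and g: "g \<in> GKLs"
  shows "\<exists>c. cg (letter g * y) (scp c (y * letter g))"
  using g
proof
  assume "g \<in> GK ` ZPi N"
  then obtain \<beta> where b: "\<beta> \<in> ZPi N" "g = GK \<beta>" by blast
  show ?thesis unfolding b(2) using Ip_commute_kk[OF I b(1)] by blast
next
  assume "g \<in> GL ` ZPi N"
  then obtain \<beta> where b: "\<beta> \<in> ZPi N" "g = GL \<beta>" by blast
  show ?thesis unfolding b(2) using Ip_commute_ll[OF I b(1)] by blast
qed

lemma KL_commute_word:
  assumes g: "g \<in> GKLs" and w: "w \<in> lists (gens N)"
  shows "\<exists>c. c \<noteq> 0 \<and> cg (letter g * mon w) (scp c (mon w * letter g))"
  using g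
proof
  assume "g \<in> GK ` ZPi N"
  then obtain \<beta> where b: "\<beta> \<in> ZPi N" "g = GK \<beta>" by blast
  show ?thesis unfolding b(2) using kk_word[OF b(1) w] chi_nz[OF b(1) wdeg_ZPi[OF w]] by blast
next
  assume "g \<in> GL ` ZPi N"
  then obtain \<beta> where b: "\<beta> \<in> ZPi N" "g = GL \<beta>" by blast
  show ?thesis unfolding b(2) using ll_word[OF b(1) w] chi_nz[OF ZPi_closed(3)[OF wdeg_ZPi[OF w]] b(1)] by blast
qed

lemma KL_commute_word':
  assumes g: "g \<in> GKLs" and w: "w \<in> lists (gens N)"
  shows "\<exists>c. cg (mon w * letter g) (scp c (letter g * mon w))"
proof -
  obtain c where c: "c \<noteq> 0" "cg (letter g * mon w) (scp c (mon w * letter g))" using KL_commute_word[OF assms] by blast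
  have "cg (scp (inverse c) (scp c (mon w * letter g))) (scp (inverse c) (letter g * mon w))"
    by (rule cg_scp[OF cg_sym[OF c(2)]])
  then show ?thesis using c(1) by auto
qed

lemma KL_word_letter:
  assumes g: "g \<in> gens N"
  shows "z \<in> lists GKLs \<Longrightarrow> \<exists>c. cg (mon z * letter g) (scp c (letter g * mon z))"
proof (induction z)
  case Nil
  have "cg (mon [] * letter g) (scp 1 (letter g * mon []))" using cg_refl[OF Wd_letter[OF g]] by (simp add: mon_Nil)
  then show ?case ..
next
  case (Cons h z)
  then have z: "z \<in> lists GKLs" and h: "h \<in> GKLs" by simp_all
  obtain c where c: "cg (mon z * letter g) (scp c (letter g * mon z))" using Cons.IH[OF z] by blast
  have hF: "letter h \<in> Fr" using h sub_gens(3) by (blast intro: Wd_letter)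
  have "[g] \<in> lists (gens N)" using g by simp
  then obtain d where d: "cg (letter h * letter g) (scp d (letter g * letter h))"
    using KL_commute_word[OF h] unfolding letter_mon by blast
  have "cg (letter h * (mon z * letter g)) (letter h * scp c (letter g * mon z))" by (rule cg_left[OF hF c])
  also have "\<dots> = scp c ((letter h * letter g) * mon z)" by (simp only: scp_mult mult.assoc)
  also have "cg (scp c ((letter h * letter g) * mon z)) (scp c (scp d (letter g * letter h) * mon z))"
    by (rule cg_scp[OF cg_right[OF words_Fr(1)[OF z] d]])
  also have "\<dots> = scp (c * d) (letter g * mon (h # z))" by (simp only: mon_Cons scp_mult fa.scale_scale mult.assoc)
  finally show ?case by (simp only: mon_Cons mult.assoc) blast
qed

text \<open>A letter K or L passes y up to a scalar, F_j is absorbed by y through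
  \<open>Ip_F\<close>, and E_i passes y at the cost of elements of I^- followed by K_i or
  L_i.\<close>

lemma Jm_left:
  assumes g: "g \<in> gens N" and x: "x \<in> Jm"
  shows "letter g * x \<in> Jm"
  using x
proof (rule Jm_induct)
  show "letter g * 0 \<in> Jm" by (simp add: fa.subspace_0[OF Jm_subspace])
  show "letter g * a \<in> Jm \<Longrightarrow> letter g * b \<in> Jm \<Longrightarrow> letter g * (scp c a + b) \<in> Jm" for a b c
    unfolding distrib_left scp_mult by (intro fa.subspace_add[OF Jm_subspace] fa.subspace_scale[OF Jm_subspace])
  fix \<alpha> y z w assume I: "Ip \<alpha> y" and z: "z \<in> lists GKLs" and w: "w \<in> lists GEs"
  have mF: "mon z * mon w \<in> Fr" by (rule Wd_mult[OF words_Fr(1)[OF z] words_Fr(2)[OF w]])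
  consider "g \<in> GKLs" | i where "i \<in> {1..N}" "g = GE i" | j where "j \<in> {1..N}" "g = GF j"
    using g unfolding gens_def by blast
  then show "letter g * (y * (mon z * mon w)) \<in> Jm"
  proof cases
    case 1
    obtain c where "cg (letter g * y) (scp c (y * letter g))" using KL_commute_Ip[OF I 1] by blast
    then have "cg (letter g * y * (mon z * mon w)) (scp c (y * letter g) * (mon z * mon w))" by (rule cg_right[OF mF])
    also have "\<dots> = scp c (y * (mon (g # z) * mon w))" by (simp only: scp_mult mon_Cons mult.assoc)
    finally have "cg (letter g * (y * (mon z * mon w))) (scp c (y * (mon (g # z) * mon w)))" by (simp only: mult.assoc)
    then show ?thesis
      by (rule cg_Jm) (rule fa.subspace_scale[OF Jm_subspace Jm_gen[OF I _ w]], use 1 z in simp)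
  next
    case (2 i)
    obtain \<beta> a b where ab: "Ip \<beta> a" "Ip \<beta> b" "cg (ee i * y) (y * ee i + (a * kk (al i) + b * ll (al i)))"
      by (rule E_left[OF I 2(1)])
    have "GK (al i) \<in> GKLs" "GL (al i) \<in> GKLs" using al_ZPi[OF 2(1)] by blast+
    then have zz: "GK (al i) # z \<in> lists GKLs" "GL (al i) # z \<in> lists GKLs" using z by simp_all
    have "cg (ee i * y * (mon z * mon w)) ((y * ee i + (a * kk (al i) + b * ll (al i))) * (mon z * mon w))"
      by (rule cg_right[OF mF ab(3)])
    also have "\<dots> = y * (ee i * (mon z * mon w)) + (a * (mon (GK (al i) # z) * mon w) + b * (mon (GL (al i) # z) * mon w))"
      by (simp only: distrib_right mon_Cons mult.assoc)
    finally have "cg (letter g * (y * (mon z * mon w)))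
      (y * (ee i * (mon z * mon w)) + (a * (mon (GK (al i) # z) * mon w) + b * (mon (GL (al i) # z) * mon w)))"
      by (simp only: 2(2) mult.assoc)
    then show ?thesis
      by (rule cg_Jm) (intro fa.subspace_add[OF Jm_subspace] Jm_KE[OF I E_KE[OF 2(1) KE_gen[OF z w]]]
        Jm_gen[OF ab(1) zz(1) w] Jm_gen[OF ab(2) zz(2) w])
  next
    case (3 j)
    show ?thesis using Jm_gen[OF conjunct1[OF Ip_F[OF I 3(1)]] z w] by (simp only: 3(2) mult.assoc)
  qed
qed

text \<open>The case F_j: it passes the E-word up to an element of \<open>KE\<close> and the K,
  L-word up to a scalar, and is then absorbed by y from the right.\<close>

lemma Jm_right:
  assumes g: "g \<in> gens N" and x: "x \<in> Jm"
  shows "x * letter g \<in> Jm"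
  using x
proof (rule Jm_induct)
  show "0 * letter g \<in> Jm" by (simp add: fa.subspace_0[OF Jm_subspace])
  show "a * letter g \<in> Jm \<Longrightarrow> b * letter g \<in> Jm \<Longrightarrow> (scp c a + b) * letter g \<in> Jm" for a b c
    unfolding distrib_right scp_mult by (intro fa.subspace_add[OF Jm_subspace] fa.subspace_scale[OF Jm_subspace])
  fix \<alpha> y z w assume I: "Ip \<alpha> y" and z: "z \<in> lists GKLs" and w: "w \<in> lists GEs"
  have wg: "w \<in> lists (gens N)" using w lists_mono[OF sub_gens(2)] by blast
  have zF: "mon z \<in> Fr" by (rule words_Fr(1)[OF z])
  have yF: "y \<in> Fr" by (rule Ip_Fr[OF I])
  have yzF: "y * mon z \<in> Fr" by (rule Wd_mult[OF yF zF])
  consider "g \<in> GKLs" | i where "i \<in> {1..N}" "g = GE i" | j where "j \<in> {1..N}" "g = GF j"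
    using g unfolding gens_def by blast
  then show "y * (mon z * mon w) * letter g \<in> Jm"
  proof cases
    case 1
    obtain c where "cg (mon w * letter g) (scp c (letter g * mon w))" using KL_commute_word'[OF 1 wg] by blast
    then have "cg ((y * mon z) * (mon w * letter g)) ((y * mon z) * scp c (letter g * mon w))" by (rule cg_left[OF yzF])
    also have "\<dots> = scp c (y * (mon (z @ [g]) * mon w))" by (simp only: scp_mult mon_mult[symmetric] letter_mon mult.assoc)
    finally have "cg (y * (mon z * mon w) * letter g) (scp c (y * (mon (z @ [g]) * mon w)))" by (simp only: mult.assoc)
    then show ?thesis
      by (rule cg_Jm) (rule fa.subspace_scale[OF Jm_subspace Jm_gen[OF I _ w]], use 1 z in simp)
  next
    case (2 i)
    have "w @ [g] \<in> lists GEs" using w 2 by simp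
    from Jm_gen[OF I z this] show ?thesis by (simp only: mon_mult[symmetric] letter_mon mult.assoc)
  next
    case (3 j)
    obtain c where c: "cg (mon z * letter g) (scp c (letter g * mon z))" using KL_word_letter[OF g z] by blast
    have "y * (mon z * (ff j * mon w)) \<in> Jm"
    proof (rule cg_Jm)
      have "cg (y * (mon z * letter g) * mon w) (y * scp c (letter g * mon z) * mon w)"
        by (rule cg_right[OF words_Fr(2)[OF w] cg_left[OF yF c]])
      then show "cg (y * (mon z * (ff j * mon w))) (scp c (y * ff j * (mon z * mon w)))"
        by (simp only: 3(2) mult.assoc scp_mult)
      show "scp c (y * ff j * (mon z * mon w)) \<in> Jm"
        by (rule fa.subspace_scale[OF Jm_subspace Jm_gen[OF conjunct2[OF Ip_F[OF I 3(1)]] z w]])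
    qed
    moreover have "y * (mon z * (mon w * ff j - ff j * mon w)) \<in> Jm"
    proof (rule Jm_KE[OF I])
      show "mon z * (mon w * ff j - ff j * mon w) \<in> KE" by (rule KL_KE[OF z E_F_word[OF 3(1) w]])
    qed
    ultimately have "y * (mon z * (ff j * mon w)) + y * (mon z * (mon w * ff j - ff j * mon w)) \<in> Jm"
      by (rule fa.subspace_add[OF Jm_subspace])
    moreover have "y * (mon z * (ff j * mon w)) + y * (mon z * (mon w * ff j - ff j * mon w)) = y * (mon z * mon w) * letter g"
      by (simp add: 3(2) algebra_simps)
    ultimately show ?thesis by simp
  qed
qed

lemma Jm_mult: "x \<in> Jm \<Longrightarrow> p \<in> Fr \<Longrightarrow> p * x \<in> Jm" "x \<in> Jm \<Longrightarrow> p \<in> Fr \<Longrightarrow> x * p \<in> Jm"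
  using closed_by_mult[of p "gens N" Jm x] closed_right_mult[OF Jm_subspace Jm_right, of "gens N" p x] Jm_subspace Jm_left
  unfolding closed_by_def by blast+

end

section \<open>The automorphism Omega and the ideal defining U(\<chi>)\<close>

context gqg
begin

abbreviation Om :: "(gen list \<Rightarrow>\<^sub>0 'k) \<Rightarrow> (gen list \<Rightarrow>\<^sub>0 'k)" where "Om \<equiv> free_subst Omega_gen"

lemma Om_diff: "Om (p - q) = Om p - Om q"
proof -
  have "Om ((p - q) + q) = Om (p - q) + Om q" by (rule free_subst_add)
  then show ?thesis by simp
qed

lemma Om_neg: "Om (- p) = - Om p" using Om_diff[of 0 p] by (simp add: free_subst_zero)

lemma Om_one: "Om 1 = 1" using free_subst_mon[of Omega_gen "[]"] by (simp add: mon_Nil)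

lemmas Om_simps = free_subst_add Om_diff Om_neg Om_one free_subst_mult free_subst_scp free_subst_letter
  free_subst_zero Omega_gen.simps

lemma Omega_gen_Fr: "g \<in> gens N \<Longrightarrow> Omega_gen g \<in> Fr"
proof (cases g)
  case (GK \<alpha>)
  assume "g \<in> gens N"
  then have "- \<alpha> \<in> ZPi N" using GK gens_iff ZPi_closed(3) by blast
  then show ?thesis unfolding GK Omega_gen.simps by (rule letters_Fr)
next
  case (GL \<alpha>)
  assume "g \<in> gens N"
  then have "- \<alpha> \<in> ZPi N" using GL gens_iff ZPi_closed(3) by blast
  then show ?thesis unfolding GL Omega_gen.simps by (rule letters_Fr)
next
  case (GE i)
  assume "g \<in> gens N"
  then have i: "i \<in> {1..N}" using GE gens_iff by blast
  show ?thesis unfolding GE Omega_gen.simps by (intro Wd_mult letters_Fr ZPi_closed(3) al_ZPi i)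
next
  case (GF i)
  assume "g \<in> gens N"
  then have i: "i \<in> {1..N}" using GF gens_iff by blast
  show ?thesis unfolding GF Omega_gen.simps by (intro Wd_mult letters_Fr ZPi_closed(3) al_ZPi i)
qed

lemma Om_Fr: "p \<in> Fr \<Longrightarrow> Om p \<in> Fr"
  by (rule free_subst_Wd[OF _ Omega_gen_Fr])

lemma word_eqs:
  "mon [GF i, GL \<beta>] = (ff i * ll \<beta> :: gen list \<Rightarrow>\<^sub>0 'k)"
  "mon [GK \<beta>, GE i] = (kk \<beta> * ee i :: gen list \<Rightarrow>\<^sub>0 'k)"
  by (simp_all add: mon_Cons mon_Nil)

lemma chi_minus_minus: "\<alpha> \<in> ZPi N \<Longrightarrow> \<beta> \<in> ZPi N \<Longrightarrow> \<chi> (- \<alpha>) (- \<beta>) = \<chi> \<alpha> \<beta>"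
  using chi_neg(1)[of "- \<alpha>" \<beta>] chi_neg(2)[of \<alpha> \<beta>] ZPi_closed(3)[of \<alpha> N] by (simp del: carrier_free_Abelian_group_iff)

text \<open>The images of E_i and F_j are F_i L^{-1} and K^{-1} E_j. Collecting K^{-1} in front and
  L^{-1} behind gives two scalars that cancel, which leaves K^{-1} (F_i E_j - E_j F_i)
  L^{-1}.\<close>

lemma Om_EF:
  assumes i: "i \<in> {1..N}" and j: "j \<in> {1..N}"
  shows "cg (ff i * ll (- al i) * (kk (- al j) * ee j) - kk (- al j) * ee j * (ff i * ll (- al i)))
    (if i = j then - kk (- al i) + ll (- al i) else 0)"
proof -
  have Z: "- al i \<in> ZPi N" "- al j \<in> ZPi N" "al i \<in> ZPi N" "al j \<in> ZPi N"
    by (intro ZPi_closed(3) al_ZPi i j)+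
  note F = letters_Fr(1)[OF Z(1)] letters_Fr(1)[OF Z(2)] letters_Fr(2)[OF Z(1)] letters_Fr(2)[OF Z(2)]
    letters_Fr(3)[OF i] letters_Fr(3)[OF j] letters_Fr(4)[OF i] letters_Fr(4)[OF j]
  define c where "c = \<chi> (al j) (al i)"
  have c1: "cg (ll (- al i) * ee j) (scp c (ee j * ll (- al i)))"
    using cg_rels(7)[OF Z(1) j] chi_minus_minus[OF Z(4,3)] by (simp add: c_def)
  have c2: "cg (kk (- al j) * ff i) (scp c (ff i * kk (- al j)))"
    using cg_rels(8)[OF Z(2) i] chi_minus_minus[OF Z(4,3)] by (simp add: c_def)
  have "cg (ff i * (ll (- al i) * kk (- al j)) * ee j) (ff i * (kk (- al j) * ll (- al i)) * ee j)"
    by (rule cg_right[OF F(6) cg_left[OF F(7) cg_sym[OF cg_rels(5)[OF Z(2,1)]]]])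
  also have "\<dots> = (ff i * kk (- al j)) * (ll (- al i) * ee j)" by (simp only: mult.assoc)
  also have "cg ((ff i * kk (- al j)) * (ll (- al i) * ee j)) ((ff i * kk (- al j)) * scp c (ee j * ll (- al i)))"
    by (rule cg_left[OF Wd_mult[OF F(7,2)] c1])
  also have "\<dots> = scp c (ff i * kk (- al j)) * (ee j * ll (- al i))" by (simp only: scp_mult)
  also have "cg (scp c (ff i * kk (- al j)) * (ee j * ll (- al i))) ((kk (- al j) * ff i) * (ee j * ll (- al i)))"
    by (rule cg_right[OF Wd_mult[OF F(6,3)] cg_sym[OF c2]])
  finally have X: "cg (ff i * ll (- al i) * (kk (- al j) * ee j)) (kk (- al j) * (ff i * ee j) * ll (- al i))"
    by (simp only: mult.assoc)
  have r: "cg (kk (- al j) * ee j * (ff i * ll (- al i))) (kk (- al j) * ee j * (ff i * ll (- al i)))"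
    by (intro cg_refl Wd_mult F)
  have "cg (ff i * ll (- al i) * (kk (- al j) * ee j) - kk (- al j) * ee j * (ff i * ll (- al i)))
     (kk (- al j) * (ff i * ee j) * ll (- al i) - kk (- al j) * ee j * (ff i * ll (- al i)))"
    by (rule cg_diff[OF X r])
  also have "\<dots> = kk (- al j) * (- (ee j * ff i - ff i * ee j)) * ll (- al i)" by (simp add: algebra_simps)
  also have "cg \<dots> (kk (- al j) * (- (if j = i then - kk (al j) + ll (al j) else 0)) * ll (- al i))"
    by (rule cg_right[OF F(3) cg_left[OF F(2) cg_neg[OF cg_rels(10)[OF j i]]]])
  also have "cg \<dots> (if i = j then - kk (- al i) + ll (- al i) else 0)"
  proof (cases "i = j")
    case False
    then show ?thesis using cg_refl[OF Wd_closed(8)] by simp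
  next
    case True
    have k: "cg (kk (- al i) * kk (al i)) 1"
      using cg_trans[OF cg_rels(3)[OF Z(1,3)]] cg_rels(1) by simp
    have l: "cg (ll (al i) * ll (- al i)) 1"
      using cg_trans[OF cg_rels(4)[OF Z(3,1)]] cg_rels(2) by simp
    have "kk (- al i) * (- (- kk (al i) + ll (al i))) * ll (- al i)
      = kk (- al i) * kk (al i) * ll (- al i) - kk (- al i) * (ll (al i) * ll (- al i))" by (simp add: algebra_simps)
    also have "cg \<dots> (1 * ll (- al i) - kk (- al i) * 1)"
      by (rule cg_diff[OF cg_right[OF F(3) k] cg_left[OF F(1) l]])
    finally show ?thesis using True by simp
  qed
  finally show ?thesis .
qed

lemma cg_rr: "cg p 0 \<Longrightarrow> p \<in> rr" by (simp add: cg_def)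

lemma cg_rr': "cg p q \<Longrightarrow> p - q \<in> rr" by (simp add: cg_def)

lemma Om_relators: "p \<in> relators N \<chi> \<Longrightarrow> Om p \<in> rr"
proof -
  assume p: "p \<in> relators N \<chi>"
  have i8: "ll \<alpha> * (ff i * ll (- al i)) - scp (\<chi> (al i) \<alpha>) (ff i * ll (- al i) * ll \<alpha>) \<in> rr"
    and i7: "kk \<alpha> * (ff i * ll (- al i)) - scp (\<chi> \<alpha> (- al i)) (ff i * ll (- al i) * kk \<alpha>) \<in> rr"
    and i6: "ll \<alpha> * (kk (- al i) * ee i) - scp (\<chi> (- al i) \<alpha>) (kk (- al i) * ee i * ll \<alpha>) \<in> rr"
    and i5: "kk \<alpha> * (kk (- al i) * ee i) - scp (\<chi> \<alpha> (al i)) (kk (- al i) * ee i * kk \<alpha>) \<in> rr"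
    if a: "\<alpha> \<in> ZPi N" and i: "i \<in> {1..N}" for \<alpha> i
  proof -
    have "- al i \<in> ZPi N" by (intro ZPi_closed(3) al_ZPi i)
    then have w: "[GF i, GL (- al i)] \<in> lists (gens N)" "[GK (- al i), GE i] \<in> lists (gens N)"
      using i gens_iff by simp_all
    note W = kk_word[OF a w(1)] ll_word[OF a w(1)] kk_word[OF a w(2)] ll_word[OF a w(2)]
    note W' = W[THEN cg_rr', unfolded word_eqs wdeg_simps gen_deg.simps add_0_right add_0_left minus_minus]
    show "ll \<alpha> * (ff i * ll (- al i)) - scp (\<chi> (al i) \<alpha>) (ff i * ll (- al i) * ll \<alpha>) \<in> rr"
      "kk \<alpha> * (ff i * ll (- al i)) - scp (\<chi> \<alpha> (- al i)) (ff i * ll (- al i) * kk \<alpha>) \<in> rr"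
      "ll \<alpha> * (kk (- al i) * ee i) - scp (\<chi> (- al i) \<alpha>) (kk (- al i) * ee i * ll \<alpha>) \<in> rr"
      "kk \<alpha> * (kk (- al i) * ee i) - scp (\<chi> \<alpha> (al i)) (kk (- al i) * ee i * kk \<alpha>) \<in> rr"
      by (rule W'(2), rule W'(1), rule W'(4), rule W'(3))
  qed
  have neg: "- \<alpha> \<in> ZPi N" if "\<alpha> \<in> ZPi N" for \<alpha> by (rule ZPi_closed(3)[OF that])
  from p show ?thesis
    unfolding relators_def Un_iff scp_def[symmetric] mult.assoc[symmetric]
  proof (elim disjE)
    assume "p \<in> {kk 0 - 1, ll 0 - 1}"
    then show ?thesis using cg_rr'[OF cg_rels(1)] cg_rr'[OF cg_rels(2)] by (auto simp: Om_simps)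
  next
    assume "p \<in> {kk \<alpha> * kk \<beta> - kk (\<alpha> + \<beta>) |\<alpha> \<beta>. \<alpha> \<in> ZPi N \<and> \<beta> \<in> ZPi N}"
    then obtain \<alpha> \<beta> where a: "\<alpha> \<in> ZPi N" "\<beta> \<in> ZPi N" "p = kk \<alpha> * kk \<beta> - kk (\<alpha> + \<beta>)" by blast
    show ?thesis using cg_rr'[OF cg_rels(3)[OF neg[OF a(1)] neg[OF a(2)]]] unfolding a(3) Om_simps minus_add_distrib .
  next
    assume "p \<in> {ll \<alpha> * ll \<beta> - ll (\<alpha> + \<beta>) |\<alpha> \<beta>. \<alpha> \<in> ZPi N \<and> \<beta> \<in> ZPi N}"
    then obtain \<alpha> \<beta> where a: "\<alpha> \<in> ZPi N" "\<beta> \<in> ZPi N" "p = ll \<alpha> * ll \<beta> - ll (\<alpha> + \<beta>)" by blast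
    show ?thesis using cg_rr'[OF cg_rels(4)[OF neg[OF a(1)] neg[OF a(2)]]] unfolding a(3) Om_simps minus_add_distrib .
  next
    assume "p \<in> {kk \<alpha> * ll \<beta> - ll \<beta> * kk \<alpha> |\<alpha> \<beta>. \<alpha> \<in> ZPi N \<and> \<beta> \<in> ZPi N}"
    then obtain \<alpha> \<beta> where a: "\<alpha> \<in> ZPi N" "\<beta> \<in> ZPi N" "p = kk \<alpha> * ll \<beta> - ll \<beta> * kk \<alpha>" by blast
    show ?thesis using cg_rr'[OF cg_rels(5)[OF neg[OF a(1)] neg[OF a(2)]]] unfolding a(3) Om_simps .
  next
    assume "p \<in> {kk \<alpha> * ee i - scp (\<chi> \<alpha> (al i)) (ee i) * kk \<alpha> |\<alpha> i. \<alpha> \<in> ZPi N \<and> i \<in> {1..N}}"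
    then obtain \<alpha> i where a: "\<alpha> \<in> ZPi N" "i \<in> {1..N}" "p = kk \<alpha> * ee i - scp (\<chi> \<alpha> (al i)) (ee i) * kk \<alpha>" by blast
    show ?thesis using i7[OF neg[OF a(1)] a(2)] chi_minus_minus[OF a(1) al_ZPi[OF a(2)]] unfolding a(3) Om_simps scp_mult by simp
  next
    assume "p \<in> {ll \<alpha> * ee i - scp (\<chi> (- al i) \<alpha>) (ee i) * ll \<alpha> |\<alpha> i. \<alpha> \<in> ZPi N \<and> i \<in> {1..N}}"
    then obtain \<alpha> i where a: "\<alpha> \<in> ZPi N" "i \<in> {1..N}" "p = ll \<alpha> * ee i - scp (\<chi> (- al i) \<alpha>) (ee i) * ll \<alpha>" by blast
    have "\<chi> (al i) (- \<alpha>) = \<chi> (- al i) \<alpha>" using chi_neg[OF al_ZPi[OF a(2)] a(1)] by simp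
    then show ?thesis using i8[OF neg[OF a(1)] a(2)] unfolding a(3) Om_simps scp_mult by simp
  next
    assume "p \<in> {kk \<alpha> * ff i - scp (\<chi> \<alpha> (- al i)) (ff i) * kk \<alpha> |\<alpha> i. \<alpha> \<in> ZPi N \<and> i \<in> {1..N}}"
    then obtain \<alpha> i where a: "\<alpha> \<in> ZPi N" "i \<in> {1..N}" "p = kk \<alpha> * ff i - scp (\<chi> \<alpha> (- al i)) (ff i) * kk \<alpha>" by blast
    have "\<chi> (- \<alpha>) (al i) = \<chi> \<alpha> (- al i)" using chi_neg[OF a(1) al_ZPi[OF a(2)]] by simp
    then show ?thesis using i5[OF neg[OF a(1)] a(2)] unfolding a(3) Om_simps scp_mult by simp
  next
    assume "p \<in> {ll \<alpha> * ff i - scp (\<chi> (al i) \<alpha>) (ff i) * ll \<alpha> |\<alpha> i. \<alpha> \<in> ZPi N \<and> i \<in> {1..N}}"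
    then obtain \<alpha> i where a: "\<alpha> \<in> ZPi N" "i \<in> {1..N}" "p = ll \<alpha> * ff i - scp (\<chi> (al i) \<alpha>) (ff i) * ll \<alpha>" by blast
    show ?thesis using i6[OF neg[OF a(1)] a(2)] chi_minus_minus[OF al_ZPi[OF a(2)] a(1)] unfolding a(3) Om_simps scp_mult by simp
  next
    assume "p \<in> {ee i * ff j - ff j * ee i - (if i = j then - kk (al i) + ll (al i) else 0) |i j. i \<in> {1..N} \<and> j \<in> {1..N}}"
    then obtain i j where a: "i \<in> {1..N}" "j \<in> {1..N}"
      "p = ee i * ff j - ff j * ee i - (if i = j then - kk (al i) + ll (al i) else 0)" by blast
    have "Om (if i = j then - kk (al i) + ll (al i) else 0) = (if i = j then - kk (- al i) + ll (- al i) else 0)"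
      by (cases "i = j") (simp_all only: if_True if_False simp_thms Om_simps)
    then show ?thesis using cg_rr'[OF Om_EF[OF a(1,2)]] unfolding a(3) Om_diff free_subst_mult free_subst_letter Omega_gen.simps by simp
  qed
qed

lemma Om_rr: "p \<in> rr \<Longrightarrow> Om p \<in> rr"
proof -
  have "rr \<subseteq> {p \<in> Fr. Om p \<in> rr}"
  proof (rule rr_minimal)
    show "fa.subspace {p \<in> Fr. Om p \<in> rr}"
      by (rule fa.subspaceI) (auto simp: Om_simps Wd_closed fa.subspace_0[OF rr_subspace]
          fa.subspace_add[OF rr_subspace] fa.subspace_scale[OF rr_subspace])
    show "relators N \<chi> \<subseteq> {p \<in> Fr. Om p \<in> rr}" using Om_relators relators_Fr by blast
    show "g \<in> gens N \<Longrightarrow> p \<in> {p \<in> Fr. Om p \<in> rr} \<Longrightarrow> letter g * p \<in> {p \<in> Fr. Om p \<in> rr}" for g p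
      using rr_closed(1)[of "Om p" "Omega_gen g"] Omega_gen_Fr[of g] by (simp add: Om_simps Wd_closed)
    show "g \<in> gens N \<Longrightarrow> p \<in> {p \<in> Fr. Om p \<in> rr} \<Longrightarrow> p * letter g \<in> {p \<in> Fr. Om p \<in> rr}" for g p
      using rr_closed(2)[of "Om p" "Omega_gen g"] Omega_gen_Fr[of g] by (simp add: Om_simps Wd_closed)
  qed auto
  then show "p \<in> rr \<Longrightarrow> Om p \<in> rr" by blast
qed

lemma Om_cg: "cg p q \<Longrightarrow> cg (Om p) (Om q)"
  using Om_rr[of "p - q"] by (simp add: cg_def Om_Fr Om_diff)

lemma F_Om: "i \<in> {1..N} \<Longrightarrow> cg (ff i) (Om (ee i * ll (- al i)))"
proof -
  assume i: "i \<in> {1..N}"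
  have Z: "- al i \<in> ZPi N" "al i \<in> ZPi N" by (intro ZPi_closed(3) al_ZPi i)+
  have l: "cg (ll (- al i) * ll (al i)) 1"
    using cg_trans[OF cg_rels(4)[OF Z]] cg_rels(2) by simp
  have "cg (ff i * (ll (- al i) * ll (al i))) (ff i * 1)" by (rule cg_left[OF letters_Fr(4)[OF i] l])
  from cg_sym[OF this] show ?thesis by (simp add: Om_simps mult.assoc)
qed

lemma E_Om: "i \<in> {1..N} \<Longrightarrow> cg (ee i) (Om (kk (- al i) * ff i))"
proof -
  assume i: "i \<in> {1..N}"
  have Z: "- al i \<in> ZPi N" "al i \<in> ZPi N" by (intro ZPi_closed(3) al_ZPi i)+
  have l: "cg (kk (al i) * kk (- al i)) 1"
    using cg_trans[OF cg_rels(3)[OF Z(2,1)]] cg_rels(1) by simp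
  have "cg ((kk (al i) * kk (- al i)) * ee i) (1 * ee i)" by (rule cg_right[OF letters_Fr(3)[OF i] l])
  from cg_sym[OF this] show ?thesis by (simp add: Om_simps mult.assoc)
qed

text \<open>Surjectivity of Omega on generators. It makes the Omega-image of a two-sided ideal
  stable under multiplication by letters.\<close>

lemma letter_Om: "g \<in> gens N \<Longrightarrow> \<exists>p\<in>Fr. cg (letter g) (Om p)"
proof (cases g)
  case (GK \<alpha>)
  assume "g \<in> gens N"
  then have a: "\<alpha> \<in> ZPi N" using GK gens_iff by blast
  have "cg (letter g) (Om (kk (- \<alpha>)))" using cg_refl[OF letters_Fr(1)[OF a]] by (simp add: GK Om_simps)
  then show ?thesis using letters_Fr(1)[OF ZPi_closed(3)[OF a]] by blast
next
  case (GL \<alpha>)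
  assume "g \<in> gens N"
  then have a: "\<alpha> \<in> ZPi N" using GL gens_iff by blast
  have "cg (letter g) (Om (ll (- \<alpha>)))" using cg_refl[OF letters_Fr(2)[OF a]] by (simp add: GL Om_simps)
  then show ?thesis using letters_Fr(2)[OF ZPi_closed(3)[OF a]] by blast
next
  case (GE i)
  assume "g \<in> gens N"
  then have i: "i \<in> {1..N}" using GE gens_iff by blast
  have "kk (- al i) * ff i \<in> Fr" by (intro Wd_mult letters_Fr ZPi_closed(3) al_ZPi i)
  then show ?thesis using E_Om[OF i] GE by blast
next
  case (GF i)
  assume "g \<in> gens N"
  then have i: "i \<in> {1..N}" using GF gens_iff by blast
  have "ee i * ll (- al i) \<in> Fr" by (intro Wd_mult letters_Fr ZPi_closed(3) al_ZPi i)
  then show ?thesis using F_Om[OF i] GF by blast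
qed

text \<open>The preimage in the free algebra of the ideal that defines U(\<chi>) (see
  \<open>U_ideal_eq\<close>).\<close>

definition J2 :: "(gen list \<Rightarrow>\<^sub>0 'k) set" where
  "J2 = {a + Om b | a b. a \<in> Jm \<and> b \<in> Jm}"

lemma J2_I: "a \<in> Jm \<Longrightarrow> b \<in> Jm \<Longrightarrow> a + Om b \<in> J2" unfolding J2_def by blast

lemma J2_subspace: "fa.subspace J2"
proof (rule fa.subspaceI)
  note S = fa.subspace_0[OF Jm_subspace] fa.subspace_add[OF Jm_subspace] fa.subspace_scale[OF Jm_subspace]
  show "0 \<in> J2" using J2_I[OF S(1) S(1)] by (simp add: Om_simps)
  fix x y assume "x \<in> J2" "y \<in> J2"
  then obtain a b a' b' where ab: "a \<in> Jm" "b \<in> Jm" "x = a + Om b" "a' \<in> Jm" "b' \<in> Jm" "y = a' + Om b'"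
    unfolding J2_def by blast
  have "x + y = (a + a') + Om (b + b')" unfolding ab(3,6) Om_simps by (simp add: algebra_simps)
  then show "x + y \<in> J2" using J2_I[OF S(2)[OF ab(1,4)] S(2)[OF ab(2,5)]] by simp
next
  note S = fa.subspace_0[OF Jm_subspace] fa.subspace_add[OF Jm_subspace] fa.subspace_scale[OF Jm_subspace]
  fix c x assume "x \<in> J2"
  then obtain a b where ab: "a \<in> Jm" "b \<in> Jm" "x = a + Om b" unfolding J2_def by blast
  have "scp c x = scp c a + Om (scp c b)" unfolding ab(3) Om_simps fa.scale_right_distrib ..
  then show "scp c x \<in> J2" using J2_I[OF S(3)[OF ab(1)] S(3)[OF ab(2)]] by simp
qed

lemma Jm_J2: "Jm \<subseteq> J2"
  using J2_I[OF _ fa.subspace_0[OF Jm_subspace]] by (auto simp: Om_simps)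

lemma rr_J2: "rr \<subseteq> J2" using rr_Jm Jm_J2 by blast

lemma J2_Fr: "J2 \<subseteq> Fr"
  unfolding J2_def using Jm_Fr Om_Fr fa.subspace_add[OF Wd_subspace] by blast

lemma J2_letter:
  assumes g: "g \<in> gens N" and x: "x \<in> J2"
  shows "letter g * x \<in> J2" "x * letter g \<in> J2"
proof -
  obtain a b where ab: "a \<in> Jm" "b \<in> Jm" "x = a + Om b" using x unfolding J2_def by blast
  obtain p where p: "p \<in> Fr" "cg (letter g) (Om p)" using letter_Om[OF g] by blast
  have OF: "Om b \<in> Fr" using ab(2) Jm_Fr Om_Fr by blast
  note add = fa.subspace_add[OF J2_subspace]
  have "letter g * x = (letter g * a + Om (p * b)) + (letter g - Om p) * Om b"
    unfolding ab(3) Om_simps by (simp add: algebra_simps)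
  moreover have "(letter g - Om p) * Om b \<in> J2" using rr_closed(2)[OF cg_rr'[OF p(2)] OF] rr_J2 by blast
  moreover have "letter g * a + Om (p * b) \<in> J2" by (rule J2_I[OF Jm_left[OF g ab(1)] Jm_mult(1)[OF ab(2) p(1)]])
  ultimately show "letter g * x \<in> J2" using add by simp
  have "x * letter g = (a * letter g + Om (b * p)) + Om b * (letter g - Om p)"
    unfolding ab(3) Om_simps by (simp add: algebra_simps)
  moreover have "Om b * (letter g - Om p) \<in> J2" using rr_closed(1)[OF cg_rr'[OF p(2)] OF] rr_J2 by blast
  moreover have "a * letter g + Om (b * p) \<in> J2" by (rule J2_I[OF Jm_right[OF g ab(1)] Jm_mult(2)[OF ab(2) p(1)]])
  ultimately show "x * letter g \<in> J2" using add by simp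
qed

lemma J2_mult: "x \<in> J2 \<Longrightarrow> p \<in> Fr \<Longrightarrow> p * x \<in> J2" "x \<in> J2 \<Longrightarrow> p \<in> Fr \<Longrightarrow> x * p \<in> J2"
  using closed_by_mult[of p "gens N" J2 x] closed_right_mult[OF J2_subspace J2_letter(2), of "gens N" p x] J2_subspace J2_letter(1)
  unfolding closed_by_def by blast+

end

section \<open>U(\<chi>) as a quotient of the free algebra\<close>

context gqg
begin

lemma pj_coset: "p \<in> Fr \<Longrightarrow> pj p = {q. cg q p}"
proof -
  assume p: "p \<in> Fr"
  have "pj p = {j + p | j. j \<in> rr}" by (auto simp: projt_def a_r_coset_def' free_algebra_simps)
  also have "\<dots> = {q. cg q p}"
  proof (intro equalityI subsetI)
    fix x assume "x \<in> {j + p | j. j \<in> rr}"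
    then obtain j where j: "j \<in> rr" "x = j + p" by blast
    have "j + p \<in> Fr" using j(1) rr_Fr p fa.subspace_add[OF Wd_subspace] by blast
    then show "x \<in> {q. cg q p}" using j p by (simp add: cg_def)
  next
    fix x assume "x \<in> {q. cg q p}"
    then have "x - p \<in> rr" "x = (x - p) + p" by (simp_all add: cg_def)
    then show "x \<in> {j + p | j. j \<in> rr}" by blast
  qed
  finally show ?thesis .
qed

lemma Omegat_pj: "p \<in> Fr \<Longrightarrow> Omegat N \<chi> (pj p) = pj (Om p)"
proof -
  assume p: "p \<in> Fr"
  have "pj (Om q) = pj (Om p)" if "q \<in> pj p" for q
  proof -
    have "cg q p" using that pj_coset[OF p] by blast
    then have "cg (Om q) (Om p)" by (rule Om_cg)
    then show ?thesis using pj_eq cg_Fr by blast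
  qed
  moreover have "p \<in> pj p" using pj_coset[OF p] cg_refl[OF p] by blast
  ultimately show ?thesis unfolding Omegat_def by blast
qed

lemma It_minus_eq: "It_minus N \<chi> = pj ` fa.span {p. \<exists>\<alpha>. Ip \<alpha> p}"
proof -
  have e: "T.pull {Y. \<exists>\<alpha>\<in>ZPi_pos N. It N \<chi> \<alpha> Y} = {p. \<exists>\<alpha>. Ip \<alpha> p}"
    unfolding T.pull_def Ip_def using It_pos by blast
  have c: "{Y. \<exists>\<alpha>\<in>ZPi_pos N. It N \<chi> \<alpha> Y} \<subseteq> carrier UT"
    unfolding T.carr using It_rep Hs_GF_Fr(1) by blast
  show ?thesis unfolding It_minus_def
    using lin_span_image[OF T.presentation_axioms Wd_subspace pj_smult c] unfolding e .
qed

lemma Ip_span_mult: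
  assumes y: "y \<in> fa.span {p. \<exists>\<alpha>. Ip \<alpha> p}" and x: "x \<in> KE" shows "y * x \<in> Jm"
  using y
proof (induction rule: fa.span_induct_alt)
  case base
  then show ?case by (simp add: fa.subspace_0[OF Jm_subspace])
next
  case (step c a b)
  then have "a * x \<in> Jm" using Jm_KE[OF _ x] by blast
  then show ?case using step(2) unfolding distrib_right scp_mult
    by (intro fa.subspace_add[OF Jm_subspace] fa.subspace_scale[OF Jm_subspace])
qed

lemma Jt_minus_eq: "Jt_minus N \<chi> = pj ` Jm"
proof -
  define S where "S = {Y \<otimes>\<^bsub>UT\<^esub> Z \<otimes>\<^bsub>UT\<^esub> W | Y Z W. Y \<in> It_minus N \<chi> \<and> Z \<in> Ut_zero N \<chi> \<and> W \<in> Ut_plus N \<chi>}"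
  have IF: "fa.span {p. \<exists>\<alpha>. Ip \<alpha> p} \<subseteq> Fr"
    by (rule fa.span_minimal[OF _ Wd_subspace]) (use Ip_Fr in blast)
  have form: "\<exists>y s t. y \<in> fa.span {p. \<exists>\<alpha>. Ip \<alpha> p} \<and> s \<in> Wd GKLs \<and> t \<in> Wd GEs \<and> Y = pj (y * (s * t)) \<and> y * (s * t) \<in> Fr"
    if Y: "Y \<in> S" for Y
  proof -
    obtain y s t where y: "y \<in> fa.span {p. \<exists>\<alpha>. Ip \<alpha> p}" "s \<in> Wd GKLs" "t \<in> Wd GEs" "Y = pj y \<otimes>\<^bsub>UT\<^esub> pj s \<otimes>\<^bsub>UT\<^esub> pj t"
      using Y unfolding S_def It_minus_eq Ut_zero_eq Ut_plus_eq by blast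
    have F: "y \<in> Fr" "s \<in> Fr" "t \<in> Fr" using y IF Wd_mono[OF sub_gens(2)] Wd_mono[OF sub_gens(3)] by blast+
    have "Y = pj (y * (s * t))" unfolding y(4) pj_mult[OF F(1,2)] pj_mult[OF Wd_mult[OF F(1,2)] F(3)] by (simp only: mult.assoc)
    then show ?thesis using y F Wd_mult by blast
  qed
  have c: "S \<subseteq> carrier UT" unfolding T.carr using form by blast
  have "fa.span (T.pull S) = Jm"
  proof
    show "fa.span (T.pull S) \<subseteq> Jm"
    proof (rule fa.span_minimal[OF _ Jm_subspace], rule subsetI)
      fix p assume p: "p \<in> T.pull S"
      then have "pj p \<in> S" by (simp add: T.pull_def)
      then obtain y s t where y: "y \<in> fa.span {p. \<exists>\<alpha>. Ip \<alpha> p}" "s \<in> Wd GKLs" "t \<in> Wd GEs" "pj p = pj (y * (s * t))" "y * (s * t) \<in> Fr"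
        using form by blast
      have "cg p (y * (s * t))" using y(4,5) p pj_eq by (simp add: T.pull_def)
      then show "p \<in> Jm" using cg_Jm Ip_span_mult[OF y(1) KE_span[OF y(2,3)]] by blast
    qed
    show "Jm \<subseteq> fa.span (T.pull S)"
      unfolding Jm_def
    proof (rule fa.span_mono, rule subsetI, unfold mem_Collect_eq, elim exE conjE)
      fix x \<alpha> y z w assume a: "x = y * (mon z * mon w)" "Ip \<alpha> y" "z \<in> lists GKLs" "w \<in> lists GEs"
      have F: "y \<in> Fr" "mon z \<in> Fr" "mon w \<in> Fr" by (rule Ip_Fr[OF a(2)], rule words_Fr(1)[OF a(3)], rule words_Fr(2)[OF a(4)])
      have "pj x = pj y \<otimes>\<^bsub>UT\<^esub> pj (mon z) \<otimes>\<^bsub>UT\<^esub> pj (mon w)"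
        unfolding a(1) pj_mult[OF F(1,2)] pj_mult[OF Wd_mult[OF F(1,2)] F(3)] by (simp only: mult.assoc)
      moreover have "pj y \<in> It_minus N \<chi>" unfolding It_minus_eq using a(2) by (intro imageI fa.span_base) blast
      moreover have "pj (mon z) \<in> Ut_zero N \<chi>" unfolding Ut_zero_eq by (intro imageI Wd_mon a)
      moreover have "pj (mon w) \<in> Ut_plus N \<chi>" unfolding Ut_plus_eq by (intro imageI Wd_mon a)
      moreover have "x \<in> Fr" unfolding a(1) by (intro Wd_mult F)
      ultimately show "x \<in> T.pull S" unfolding T.pull_def S_def by blast
    qed
  qed
  then show ?thesis unfolding Jt_minus_def S_def[symmetric]
    using lin_span_image[OF T.presentation_axioms Wd_subspace pj_smult c] by simp
qed

lemma U_ideal_eq: "U_ideal N \<chi> = pj ` J2"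
proof -
  have "Omegat N \<chi> ` Jt_minus N \<chi> = (\<lambda>p. pj (Om p)) ` Jm"
    unfolding Jt_minus_eq image_image using Omegat_pj Jm_Fr by (intro image_cong refl) blast
  then have U: "U_ideal N \<chi> = (\<Union>x\<in>pj ` Jm. \<Union>y\<in>(\<lambda>p. pj (Om p)) ` Jm. {x \<oplus>\<^bsub>UT\<^esub> y})"
    unfolding U_ideal_def Jt_minus_eq set_add_def' by (simp only:)
  have e: "pj a \<oplus>\<^bsub>UT\<^esub> pj (Om b) = pj (a + Om b)" if "a \<in> Jm" "b \<in> Jm" for a b
    by (rule T.add[OF subsetD[OF Jm_Fr that(1)] Om_Fr[OF subsetD[OF Jm_Fr that(2)]]])
  show ?thesis
  proof (intro equalityI subsetI)
    fix x assume "x \<in> U_ideal N \<chi>"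
    then obtain a b where ab: "a \<in> Jm" "b \<in> Jm" "x = pj a \<oplus>\<^bsub>UT\<^esub> pj (Om b)"
      unfolding U by (elim UN_E imageE singletonE) simp
    show "x \<in> pj ` J2" unfolding ab(3) e[OF ab(1,2)] by (rule imageI[OF J2_I[OF ab(1,2)]])
  next
    fix x assume "x \<in> pj ` J2"
    then obtain a b where ab: "a \<in> Jm" "b \<in> Jm" "x = pj (a + Om b)" unfolding J2_def by (elim imageE CollectE exE conjE) simp
    show "x \<in> U_ideal N \<chi>" unfolding U ab(3) e[OF ab(1,2), symmetric]
      by (rule UN_I, rule imageI[OF ab(1)], rule UN_I, rule imageI[OF ab(2)], rule singletonI)
  qed
qed

abbreviation "UU \<equiv> Uq N \<chi>"

definition p2 :: "(gen list \<Rightarrow>\<^sub>0 'k) \<Rightarrow> (gen list \<Rightarrow>\<^sub>0 'k) set set" where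
  "p2 p = proj N \<chi> (pj p)"

interpretation Q: pres_quot UT pj Fr rr J2
  by unfold_locales (use subspace_asub[OF J2_subspace] rr_J2 J2_Fr in auto)

lemma Q_pi: "Q.\<pi>' = p2"
  by (rule ext) (simp add: Q.\<pi>'_def p2_def proj_def U_ideal_eq)

lemma Uq_eq: "UU = quot UT (pj ` J2)" by (simp add: Uq_def U_ideal_eq)

sublocale U: presentation UU p2 Fr J2
  using Q.quot_presentation by (simp add: Q_pi Uq_eq)

lemma p2_mult: "p \<in> Fr \<Longrightarrow> q \<in> Fr \<Longrightarrow> p2 p \<otimes>\<^bsub>UU\<^esub> p2 q = p2 (p * q)"
proof -
  assume pq: "p \<in> Fr" "q \<in> Fr"
  have "a * b - p * q \<in> J2" if "p \<in> Fr" "q \<in> Fr" "a \<in> Fr" "b \<in> Fr" "a - p \<in> J2" "b - q \<in> J2" for a b p q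
  proof -
    have "a * b - p * q = (a - p) * b + p * (b - q)" by (simp add: algebra_simps)
    also have "\<dots> \<in> J2" by (intro fa.subspace_add[OF J2_subspace] J2_mult that)
    finally show ?thesis .
  qed
  from Q.quot_mult[of "(*)", OF _ this pq] show ?thesis
    by (simp add: Q_pi Uq_eq pj_mult Wd_mult)
qed

lemma p2_smult: "p \<in> Fr \<Longrightarrow> c \<odot>\<^bsub>UU\<^esub> p2 p = p2 (scp c p)"
proof -
  assume p: "p \<in> Fr"
  have "scp c a - scp c p \<in> J2" if "a - p \<in> J2" for a p
    using fa.subspace_scale[OF J2_subspace that, of c] by (simp add: fa.scale_right_diff_distrib)
  from Q.quot_smult[of c "scp c", OF _ this p] show ?thesis
    by (simp add: Q_pi Uq_eq pj_smult Wd_closed)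
qed

lemma p2_one: "\<one>\<^bsub>UU\<^esub> = p2 1"
  using Q.quot_one[OF pj_one] by (simp add: Q_pi Uq_eq)

lemma p2_gens: "Kgen N \<chi> \<alpha> = p2 (kk \<alpha>)" "Lgen N \<chi> \<alpha> = p2 (ll \<alpha>)" "Egen N \<chi> i = p2 (ee i)"
  by (simp_all add: Kgen_def Lgen_def Egen_def p2_def)

lemma U_zero_eq: "U_zero N \<chi> = p2 ` Wd GKLs"
  by (simp add: U_zero_def Ut_zero_eq image_image p2_def)

lemma U_minus_eq: "U_minus N \<chi> = p2 ` Wd GFs"
  by (simp add: U_minus_def Ut_minus_eq image_image p2_def)

lemma U_deg_eq: "U_deg N \<chi> \<beta> = p2 ` Hs (gens N) \<beta>"
  by (simp add: U_deg_def Ut_deg_eq image_image p2_def)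

end

section \<open>Characters of U^0\<close>

locale gqg_char = gqg N \<chi> for N and \<chi> :: "lattice \<Rightarrow> lattice \<Rightarrow> 'k::field_char_0" +
  fixes \<Lambda> :: "(gen list \<Rightarrow>\<^sub>0 'k) set set \<Rightarrow> 'k"
  assumes ch: "\<Lambda> \<in> characters N \<chi>"
begin

definition lam :: "(gen list \<Rightarrow>\<^sub>0 'k) \<Rightarrow> 'k" where "lam p = \<Lambda> (p2 p)"

lemma KL_Fr: "s \<in> Wd GKLs \<Longrightarrow> s \<in> Fr" using Wd_mono[OF sub_gens(3)] by blast

lemma lam_one: "lam 1 = 1"
  using ch by (simp add: characters_def lam_def p2_one)

lemma lam_mult: "s \<in> Wd GKLs \<Longrightarrow> t \<in> Wd GKLs \<Longrightarrow> lam (s * t) = lam s * lam t"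
  and lam_add: "s \<in> Wd GKLs \<Longrightarrow> t \<in> Wd GKLs \<Longrightarrow> lam (s + t) = lam s + lam t"
  and lam_scp: "s \<in> Wd GKLs \<Longrightarrow> lam (scp c s) = c * lam s"
proof -
  have c: "\<forall>x\<in>U_zero N \<chi>. \<forall>y\<in>U_zero N \<chi>. \<Lambda> (x \<otimes>\<^bsub>UU\<^esub> y) = \<Lambda> x * \<Lambda> y \<and> \<Lambda> (x \<oplus>\<^bsub>UU\<^esub> y) = \<Lambda> x + \<Lambda> y"
    "\<forall>c. \<forall>x\<in>U_zero N \<chi>. \<Lambda> (c \<odot>\<^bsub>UU\<^esub> x) = c * \<Lambda> x"
    using ch unfolding characters_def by blast+
  show "s \<in> Wd GKLs \<Longrightarrow> lam (scp c s) = c * lam s"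
    using c(2) p2_smult[OF KL_Fr] unfolding U_zero_eq lam_def by (metis imageI)
  assume st: "s \<in> Wd GKLs" "t \<in> Wd GKLs"
  have "\<Lambda> (p2 s \<otimes>\<^bsub>UU\<^esub> p2 t) = \<Lambda> (p2 s) * \<Lambda> (p2 t)" "\<Lambda> (p2 s \<oplus>\<^bsub>UU\<^esub> p2 t) = \<Lambda> (p2 s) + \<Lambda> (p2 t)"
    using c(1) st unfolding U_zero_eq by blast+
  then show "lam (s * t) = lam s * lam t" "lam (s + t) = lam s + lam t"
    unfolding lam_def p2_mult[OF KL_Fr[OF st(1)] KL_Fr[OF st(2)]] U.add[OF KL_Fr[OF st(1)] KL_Fr[OF st(2)]] .
qed

lemma lam_cg: "cg p q \<Longrightarrow> lam p = lam q"
proof -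
  assume c: "cg p q"
  have "p2 p = p2 q" using U.eq[OF cg_Fr(1)[OF c] cg_Fr(2)[OF c]] cg_rr'[OF c] rr_J2 by blast
  then show "lam p = lam q" by (simp only: lam_def)
qed

lemma KL_letters: "\<alpha> \<in> ZPi N \<Longrightarrow> kk \<alpha> \<in> Wd GKLs" "\<alpha> \<in> ZPi N \<Longrightarrow> ll \<alpha> \<in> Wd GKLs"
  by (intro Wd_letter UnI1 imageI, assumption, intro Wd_letter UnI2 imageI, assumption)

definition lK :: "lattice \<Rightarrow> 'k" where "lK \<alpha> = lam (kk \<alpha>)"
definition lL :: "lattice \<Rightarrow> 'k" where "lL \<alpha> = lam (ll \<alpha>)"

lemma lK_add: "\<alpha> \<in> ZPi N \<Longrightarrow> \<beta> \<in> ZPi N \<Longrightarrow> lK (\<alpha> + \<beta>) = lK \<alpha> * lK \<beta>"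
  using lam_cg[OF cg_rels(3)] lam_mult[OF KL_letters(1) KL_letters(1)] by (simp add: lK_def del: carrier_free_Abelian_group_iff)

lemma lL_add: "\<alpha> \<in> ZPi N \<Longrightarrow> \<beta> \<in> ZPi N \<Longrightarrow> lL (\<alpha> + \<beta>) = lL \<alpha> * lL \<beta>"
  using lam_cg[OF cg_rels(4)] lam_mult[OF KL_letters(2) KL_letters(2)] by (simp add: lL_def del: carrier_free_Abelian_group_iff)

lemma lKL_0: "lK 0 = 1" "lL 0 = 1"
  using lam_cg[OF cg_rels(1)] lam_cg[OF cg_rels(2)] lam_one by (simp_all add: lK_def lL_def)

lemma lL_neg: "\<alpha> \<in> ZPi N \<Longrightarrow> lL \<alpha> * lL (- \<alpha>) = 1"
  using lL_add[of \<alpha> "- \<alpha>"] ZPi_closed(3)[of \<alpha> N] lKL_0(2) by (simp del: carrier_free_Abelian_group_iff)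

end

section \<open>The action of the generators on functions on words\<close>

text \<open>Covers K_\<alpha> and L_\<alpha> for every \<alpha>, whereas \<open>Kop\<close> and
  \<open>Lop\<close> exist for the simple \<alpha>_j.\<close>

definition diag :: "'k::field \<Rightarrow> (nat \<Rightarrow> 'k) \<Rightarrow> 'k vec \<Rightarrow> 'k vec" where
  "diag c a f = Vec (\<lambda>u. c * (\<Prod>x\<leftarrow>u. a x) * coef f u)"

lemma coef_diag: "coef (diag c a f) u = c * (\<Prod>x\<leftarrow>u. a x) * coef f u" by (simp add: diag_def)

lemma diag_linear: "diag c a (f + g) = diag c a f + diag c a g" "diag c a (scl d f) = scl d (diag c a f)" "diag c a 0 = 0"
  by (auto intro!: vec_eqI simp: coef_diag algebra_simps)

lemma diag_diag: "diag c a (diag d b f) = diag (c * d) (\<lambda>x. a x * b x) f"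
proof (rule vec_eqI)
  fix u
  have "(\<Prod>x\<leftarrow>u. a x * b x) = (\<Prod>x\<leftarrow>u. a x) * (\<Prod>x\<leftarrow>u. b x)" by (induction u) (simp_all add: mult_ac)
  then show "coef (diag c a (diag d b f)) u = coef (diag (c * d) (\<lambda>x. a x * b x) f) u" by (simp add: coef_diag)
qed

lemma diag_one: "diag 1 (\<lambda>_. 1) f = f"
proof (rule vec_eqI)
  fix u :: "nat list"
  have "(\<Prod>x\<leftarrow>u. 1 :: 'a) = 1" by (induction u) simp_all
  then show "coef (diag 1 (\<lambda>_. 1) f) u = coef f u" by (simp add: coef_diag)
qed

lemma Eop_diag: "Eop i (diag c a f) = scl (a i) (diag c a (Eop i f))"
  by (rule vec_eqI) (simp add: coef_Eop coef_diag)

lemma diag_vac: "diag c a vac = scl c vac"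
  by (rule vec_eqI) (simp add: coef_diag vac_def)

context shuffle
begin

lemma Kop_diag: "Kop j f = diag (k j) (\<lambda>x. inverse (q j x)) f" by (simp add: Kop_def diag_def)
lemma Lop_diag: "Lop j f = diag (l j) (\<lambda>x. q x j) f" by (simp add: Lop_def diag_def)

lemma diag_comm: "diag c a (diag d b f) = diag d b (diag c a f)" by (simp add: diag_diag mult.commute)

lemma diag_Fop: "diag c a (Fop i f) = scl (a i) (Fop i (diag c a f))"
proof (rule vec_eqI)
  fix u show "coef (diag c a (Fop i f)) u = coef (scl (a i) (Fop i (diag c a f))) u"
  proof (induction u arbitrary: f)
    case (Cons n u)
    have d: "diag c a (f - g) = diag c a f - diag c a g" for f g by (rule vec_eqI) (simp add: coef_diag algebra_simps)
    have c: "diag c a (Kop i f) = Kop i (diag c a f)" "diag c a (Lop i f) = Lop i (diag c a f)"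
      unfolding Kop_diag Lop_diag by (rule diag_comm)+
    have "coef (diag c a (Fop i f)) (n # u) = a n * coef (diag c a (Eop n (Fop i f))) u"
      by (simp add: coef_diag coef_Eop)
    also have "Eop n (Fop i f) = Fop i (Eop n f) + (if n = i then Lop i f - Kop i f else 0)" by (rule Eop_Fop)
    also have "a n * coef (diag c a \<dots>) u = a n * (a i * coef (Fop i (diag c a (Eop n f))) u
       + (if n = i then coef (Lop i (diag c a f) - Kop i (diag c a f)) u else 0))"
      by (cases "n = i") (simp_all add: diag_linear Cons d c)
    also have "\<dots> = coef (scl (a i) (Eop n (Fop i (diag c a f)))) u"
      by (simp add: Eop_Fop Eop_diag)
    finally show ?case by (simp add: coef_Eop)
  qed (simp add: coef_diag)
qed

lemma Lspan_diag: "f \<in> Lspan N \<Longrightarrow> diag c a f \<in> Lspan N"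
  unfolding Lspan_def
proof (induction rule: vec.span_induct_alt)
  case base
  then show ?case by (simp add: diag_linear vec.span_zero)
next
  case (step d x y)
  then obtain w where w: "w \<in> lists {1..N}" "x = Fword w vac" by blast
  have "diag c a (Fword w vac) = scl (c * (\<Prod>i\<leftarrow>w. a i)) (Fword w vac)"
  proof (induction w)
    case (Cons i w)
    then show ?case by (simp add: diag_Fop mult_ac)
  qed (simp add: diag_vac)
  then have "diag c a x \<in> vec.span ((\<lambda>w. Fword w vac) ` lists {1..N})"
    using vec.span_scale[OF vec.span_base[OF imageI[OF w(1)]]] w(2) by simp
  then show ?case using step(2) unfolding diag_linear by (intro vec.span_add vec.span_scale)
qed

lemma Lspan_subspace: "vec.subspace (Lspan N)" unfolding Lspan_def by (rule vec.subspace_span)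

end

context gqg_char
begin

text \<open>Padded by 1 outside the index set, since the shuffle locales ask for nonzero entries at
  all natural numbers.\<close>

definition qm :: "nat \<Rightarrow> nat \<Rightarrow> 'k" where
  "qm i j = (if i \<in> {1..N} \<and> j \<in> {1..N} then \<chi> (al i) (al j) else 1)"

definition km :: "nat \<Rightarrow> 'k" where "km i = lK (al i)"
definition lm :: "nat \<Rightarrow> 'k" where "lm i = (if i \<in> {1..N} then lL (al i) else 1)"

lemma qm_in: "i \<in> {1..N} \<Longrightarrow> j \<in> {1..N} \<Longrightarrow> qm i j = \<chi> (al i) (al j)"
  by (simp only: qm_def simp_thms if_True)

lemma qm_out: "i \<notin> {1..N} \<or> j \<notin> {1..N} \<Longrightarrow> qm i j = 1"
  by (simp only: qm_def de_Morgan_conj[symmetric] if_False)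

lemma qm_nz: "qm i j \<noteq> 0"
proof (cases "i \<in> {1..N} \<and> j \<in> {1..N}")
  case True
  then show ?thesis using chi_nz[OF al_ZPi[of i] al_ZPi[of j]] qm_in[of i j] by metis
next
  case False
  then have "qm i j = 1" using qm_out[of i j] by metis
  then show ?thesis by simp
qed

lemma lm_nz: "lm i \<noteq> 0"
proof (cases "i \<in> {1..N}")
  case True
  then have "lm i = lL (al i)" by (simp only: lm_def if_True)
  then show ?thesis using lL_neg[OF al_ZPi[OF True]] by auto
next
  case False
  then have "lm i = 1" by (simp only: lm_def if_False)
  then show ?thesis by simp
qed

sublocale S: shuffle_on qm km lm N
  by (unfold_locales; rule qm_nz qm_out lm_nz)

definition ka :: "lattice \<Rightarrow> nat \<Rightarrow> 'k" where "ka \<alpha> x = (if x \<in> {1..N} then inverse (\<chi> \<alpha> (al x)) else 1)"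
definition la :: "lattice \<Rightarrow> nat \<Rightarrow> 'k" where "la \<alpha> x = (if x \<in> {1..N} then \<chi> (al x) \<alpha> else 1)"

primrec gact :: "gen \<Rightarrow> 'k vec \<Rightarrow> 'k vec" where
  "gact (GK \<alpha>) f = diag (lK \<alpha>) (ka \<alpha>) f"
| "gact (GL \<alpha>) f = diag (lL \<alpha>) (la \<alpha>) f"
| "gact (GE i) f = Eop i f"
| "gact (GF i) f = S.Fop i f"

text \<open>A representation of the free algebra; by \<open>act_rr\<close> it factors through
  U-tilde.\<close>

definition act :: "(gen list \<Rightarrow>\<^sub>0 'k) \<Rightarrow> 'k vec \<Rightarrow> 'k vec" where
  "act p f = lext scl (\<lambda>w. foldr gact w f) p"

lemma gact_linear: "gact g (f + h) = gact g f + gact g h" "gact g (scl c f) = scl c (gact g f)" "gact g 0 = 0"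
  by (cases g; simp add: diag_linear)+

lemma act_add: "act (p + q) f = act p f + act q f"
  by (simp add: act_def lext_add[OF vec.vector_space_axioms])

lemma act_0 [simp]: "act 0 f = 0" by (simp add: act_def)

lemma act_scp_mon: "act (scp c (mon w)) f = scl c (foldr gact w f)"
  by (simp add: act_def scp_mon lext_single[OF vec.vector_space_axioms])

lemma act_scp: "act (scp c p) f = scl c (act p f)"
  by (induction p rule: poly_induct) (simp_all add: fa.scale_right_distrib act_add act_scp_mon vec.scale_right_distrib)

lemma act_mon: "act (mon w) f = foldr gact w f"
  using act_scp_mon[of 1 w f] by simp

lemma act_diff: "act (p - q) f = act p f - act q f"
proof -
  have "act ((p - q) + q) f = act (p - q) f + act q f" by (rule act_add)
  then show ?thesis by simp
qed

lemma act_neg: "act (- p) f = - act p f" using act_diff[of 0 p f] by simp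

lemma foldr_gact_linear: "foldr gact w (f + h) = foldr gact w f + foldr gact w h"
  "foldr gact w (scl c f) = scl c (foldr gact w f)" "foldr gact w 0 = 0"
  by (induction w) (simp_all add: gact_linear)

lemma act_linear: "act p (f + h) = act p f + act p h" "act p (scl c f) = scl c (act p f)" "act p 0 = 0"
proof -
  show "act p (f + h) = act p f + act p h"
    by (induction p rule: poly_induct) (simp_all add: act_add act_scp_mon foldr_gact_linear vec.scale_right_distrib algebra_simps)
  show "act p (scl c f) = scl c (act p f)"
    by (induction p rule: poly_induct) (simp_all add: act_add act_scp_mon foldr_gact_linear vec.scale_right_distrib mult.commute)
  show "act p 0 = 0"
    by (induction p rule: poly_induct) (simp_all add: act_add act_scp_mon foldr_gact_linear)
qed

lemma act_mult: "act (p * p') f = act p (act p' f)"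
proof (induction p rule: poly_induct)
  case (step c w p)
  have "act (mon w * p') f = act (mon w) (act p' f)"
  proof (induction p' rule: poly_induct)
    case zero
    then show ?case by (simp add: act_linear)
  next
    case (step d v p')
    then show ?case
      by (simp add: distrib_left scp_mult mon_mult act_add act_linear act_scp act_mon)
  qed
  then show ?case using step by (simp add: distrib_right scp_mult act_add act_scp)
qed simp

lemma act_letter: "act (letter g) f = gact g f" by (simp add: letter_mon act_mon)

lemma act_one: "act 1 f = f" using act_mon[of "[]" f] by (simp add: mon_Nil)

lemmas act_simps = act_add act_diff act_neg act_scp act_mult act_letter act_one act_0 gact.simps

lemma ka_add: "\<alpha> \<in> ZPi N \<Longrightarrow> \<beta> \<in> ZPi N \<Longrightarrow> ka (\<alpha> + \<beta>) = (\<lambda>x. ka \<alpha> x * ka \<beta> x)"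
  using chi_add(2)[of \<alpha> \<beta>] al_ZPi by (auto simp: ka_def fun_eq_iff simp del: carrier_free_Abelian_group_iff atLeastAtMost_iff)

lemma la_add: "\<alpha> \<in> ZPi N \<Longrightarrow> \<beta> \<in> ZPi N \<Longrightarrow> la (\<alpha> + \<beta>) = (\<lambda>x. la \<alpha> x * la \<beta> x)"
  using chi_add(1)[of _ \<alpha> \<beta>] al_ZPi by (auto simp: la_def fun_eq_iff simp del: carrier_free_Abelian_group_iff atLeastAtMost_iff)

lemma kla_0: "ka 0 = (\<lambda>_. 1)" "la 0 = (\<lambda>_. 1)"
  using chi_0 al_ZPi by (auto simp: ka_def la_def fun_eq_iff simp del: carrier_free_Abelian_group_iff atLeastAtMost_iff)

lemma gact_al:
  assumes "i \<in> {1..N}"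
  shows "gact (GK (al i)) f = S.Kop i f" "gact (GL (al i)) f = S.Lop i f"
proof -
  have "ka (al i) = (\<lambda>x. inverse (qm i x))" "la (al i) = (\<lambda>x. qm x i)"
    using assms by (auto simp: ka_def la_def qm_def fun_eq_iff simp del: atLeastAtMost_iff)
  moreover have "km i = lK (al i)" "lm i = lL (al i)" unfolding km_def lm_def using assms by (simp_all only: if_True)
  ultimately show "gact (GK (al i)) f = S.Kop i f" "gact (GL (al i)) f = S.Lop i f"
    by (simp_all add: S.Kop_diag S.Lop_diag)
qed

lemma act_relators:
  assumes p: "p \<in> relators N \<chi>" shows "act p f = 0"
proof -
  have kx: "diag (lK \<alpha>) (ka \<alpha>) (Eop i f) = scl (\<chi> \<alpha> (al i)) (Eop i (diag (lK \<alpha>) (ka \<alpha>) f))"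
    "diag (lL \<alpha>) (la \<alpha>) (Eop i f) = scl (\<chi> (- al i) \<alpha>) (Eop i (diag (lL \<alpha>) (la \<alpha>) f))"
    "diag (lK \<alpha>) (ka \<alpha>) (S.Fop i f) = scl (\<chi> \<alpha> (- al i)) (S.Fop i (diag (lK \<alpha>) (ka \<alpha>) f))"
    "diag (lL \<alpha>) (la \<alpha>) (S.Fop i f) = scl (\<chi> (al i) \<alpha>) (S.Fop i (diag (lL \<alpha>) (la \<alpha>) f))"
    if a: "\<alpha> \<in> ZPi N" "i \<in> {1..N}" for \<alpha> i f
  proof -
    have k: "ka \<alpha> i = inverse (\<chi> \<alpha> (al i))" "la \<alpha> i = \<chi> (al i) \<alpha>" unfolding ka_def la_def using a(2) by (simp_all only: if_True)
    note nz = chi_nz[OF a(1) al_ZPi[OF a(2)]] chi_nz[OF al_ZPi[OF a(2)] a(1)]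
    show "diag (lK \<alpha>) (ka \<alpha>) (Eop i f) = scl (\<chi> \<alpha> (al i)) (Eop i (diag (lK \<alpha>) (ka \<alpha>) f))"
      using nz by (simp add: Eop_diag k)
    show "diag (lL \<alpha>) (la \<alpha>) (Eop i f) = scl (\<chi> (- al i) \<alpha>) (Eop i (diag (lL \<alpha>) (la \<alpha>) f))"
      using nz chi_neg(2)[OF al_ZPi[OF a(2)] a(1)] by (simp add: Eop_diag k)
    show "diag (lK \<alpha>) (ka \<alpha>) (S.Fop i f) = scl (\<chi> \<alpha> (- al i)) (S.Fop i (diag (lK \<alpha>) (ka \<alpha>) f))"
      using chi_neg(1)[OF a(1) al_ZPi[OF a(2)]] by (simp add: S.diag_Fop k)
    show "diag (lL \<alpha>) (la \<alpha>) (S.Fop i f) = scl (\<chi> (al i) \<alpha>) (S.Fop i (diag (lL \<alpha>) (la \<alpha>) f))"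
      by (simp add: S.diag_Fop k)
  qed
  from p show ?thesis
    unfolding relators_def Un_iff scp_def[symmetric]
  proof (elim disjE)
    assume "p \<in> {kk 0 - 1, ll 0 - 1}"
    then show ?thesis using diag_one by (auto simp: act_simps kla_0 lKL_0)
  next
    assume "p \<in> {kk \<alpha> * kk \<beta> - kk (\<alpha> + \<beta>) |\<alpha> \<beta>. \<alpha> \<in> ZPi N \<and> \<beta> \<in> ZPi N}"
    then obtain \<alpha> \<beta> where a: "\<alpha> \<in> ZPi N" "\<beta> \<in> ZPi N" "p = kk \<alpha> * kk \<beta> - kk (\<alpha> + \<beta>)" by blast
    show ?thesis by (simp add: a(3) act_simps diag_diag ka_add[OF a(1,2)] lK_add[OF a(1,2)])
  next
    assume "p \<in> {ll \<alpha> * ll \<beta> - ll (\<alpha> + \<beta>) |\<alpha> \<beta>. \<alpha> \<in> ZPi N \<and> \<beta> \<in> ZPi N}"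
    then obtain \<alpha> \<beta> where a: "\<alpha> \<in> ZPi N" "\<beta> \<in> ZPi N" "p = ll \<alpha> * ll \<beta> - ll (\<alpha> + \<beta>)" by blast
    show ?thesis by (simp add: a(3) act_simps diag_diag la_add[OF a(1,2)] lL_add[OF a(1,2)])
  next
    assume "p \<in> {kk \<alpha> * ll \<beta> - ll \<beta> * kk \<alpha> |\<alpha> \<beta>. \<alpha> \<in> ZPi N \<and> \<beta> \<in> ZPi N}"
    then obtain \<alpha> \<beta> where a: "p = kk \<alpha> * ll \<beta> - ll \<beta> * kk \<alpha>" by blast
    show ?thesis using S.diag_comm[of "lK \<alpha>" "ka \<alpha>" "lL \<beta>" "la \<beta>" f] by (simp add: a act_simps)
  next
    assume "p \<in> {kk \<alpha> * ee i - scp (\<chi> \<alpha> (al i)) (ee i) * kk \<alpha> |\<alpha> i. \<alpha> \<in> ZPi N \<and> i \<in> {1..N}}"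
    then obtain \<alpha> i where a: "\<alpha> \<in> ZPi N" "i \<in> {1..N}" "p = kk \<alpha> * ee i - scp (\<chi> \<alpha> (al i)) (ee i) * kk \<alpha>" by blast
    show ?thesis by (simp add: a(3) act_simps kx(1)[OF a(1,2)])
  next
    assume "p \<in> {ll \<alpha> * ee i - scp (\<chi> (- al i) \<alpha>) (ee i) * ll \<alpha> |\<alpha> i. \<alpha> \<in> ZPi N \<and> i \<in> {1..N}}"
    then obtain \<alpha> i where a: "\<alpha> \<in> ZPi N" "i \<in> {1..N}" "p = ll \<alpha> * ee i - scp (\<chi> (- al i) \<alpha>) (ee i) * ll \<alpha>" by blast
    show ?thesis by (simp add: a(3) act_simps kx(2)[OF a(1,2)])
  next
    assume "p \<in> {kk \<alpha> * ff i - scp (\<chi> \<alpha> (- al i)) (ff i) * kk \<alpha> |\<alpha> i. \<alpha> \<in> ZPi N \<and> i \<in> {1..N}}"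
    then obtain \<alpha> i where a: "\<alpha> \<in> ZPi N" "i \<in> {1..N}" "p = kk \<alpha> * ff i - scp (\<chi> \<alpha> (- al i)) (ff i) * kk \<alpha>" by blast
    show ?thesis by (simp add: a(3) act_simps kx(3)[OF a(1,2)])
  next
    assume "p \<in> {ll \<alpha> * ff i - scp (\<chi> (al i) \<alpha>) (ff i) * ll \<alpha> |\<alpha> i. \<alpha> \<in> ZPi N \<and> i \<in> {1..N}}"
    then obtain \<alpha> i where a: "\<alpha> \<in> ZPi N" "i \<in> {1..N}" "p = ll \<alpha> * ff i - scp (\<chi> (al i) \<alpha>) (ff i) * ll \<alpha>" by blast
    show ?thesis by (simp add: a(3) act_simps kx(4)[OF a(1,2)])
  next
    assume "p \<in> {ee i * ff j - ff j * ee i - (if i = j then - kk (al i) + ll (al i) else 0) |i j. i \<in> {1..N} \<and> j \<in> {1..N}}"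
    then obtain i j where a: "i \<in> {1..N}" "j \<in> {1..N}"
      "p = ee i * ff j - ff j * ee i - (if i = j then - kk (al i) + ll (al i) else 0)" by blast
    have "act (if i = j then - kk (al i) + ll (al i) else 0) f = (if i = j then S.Lop j f - S.Kop j f else 0)"
      using gact_al[OF a(1)] by (cases "i = j") (simp_all add: act_add act_diff act_letter del: gact.simps)
    then show ?thesis unfolding a(3) act_diff act_mult act_letter gact.simps S.Eop_Fop by simp
  qed
qed

lemma act_rr: "p \<in> rr \<Longrightarrow> act p f = 0"
proof -
  have "rr \<subseteq> {p \<in> Fr. \<forall>f. act p f = 0}"
  proof (rule rr_minimal)
    show "fa.subspace {p \<in> Fr. \<forall>f. act p f = 0}"
      by (rule fa.subspaceI) (auto simp: act_simps Wd_closed)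
    show "relators N \<chi> \<subseteq> {p \<in> Fr. \<forall>f. act p f = 0}" using act_relators relators_Fr by blast
  qed (auto simp: act_mult act_linear Wd_closed)
  then show "p \<in> rr \<Longrightarrow> act p f = 0" by blast
qed

lemma act_cg: "cg p p' \<Longrightarrow> act p f = act p' f"
  using act_rr[of "p - p'" f] by (simp add: cg_def act_diff)

lemma gact_Lspan: "g \<in> gens N \<Longrightarrow> f \<in> S.Lspan N \<Longrightarrow> gact g f \<in> S.Lspan N"
  by (cases g) (simp_all only: gact.simps gens_iff S.Lspan_diag S.Lspan_Eop S.Lspan_Fop)

lemma act_Lspan: "p \<in> Fr \<Longrightarrow> f \<in> S.Lspan N \<Longrightarrow> act p f \<in> S.Lspan N"
proof (induction p rule: Wd_induct)
  case zero
  then show ?case using vec.subspace_0[OF S.Lspan_subspace] by simp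
next
  case (step c w p)
  have "foldr gact w f \<in> S.Lspan N" using step(1) by (induction w) (simp_all add: step.prems gact_Lspan)
  then show ?case using step
    by (auto simp: act_add act_scp act_mon intro!: vec.subspace_add[OF S.Lspan_subspace] vec.subspace_scale[OF S.Lspan_subspace])
qed

lemma vac_Lspan: "vac \<in> S.Lspan N" using S.Fword_in_Lspan[of "[]" N] by simp

end

section \<open>The defining ideal of U(\<chi>) annihilates the vacuum\<close>

context gqg_char
begin

lemma F_word_coef: "w \<in> lists GFs \<Longrightarrow> w \<noteq> [] \<Longrightarrow> coef (act (mon w) h) [] = 0"
  by (cases w) (auto simp: act_mon)

lemma F_coef:
  assumes "\<beta> \<noteq> 0" "p \<in> Hs GFs \<beta>" shows "coef (act p h) [] = 0"
  using assms(2)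
proof (induction p rule: Hs_induct)
  case (step c w p)
  then have "w \<noteq> []" using assms(1) by auto
  then show ?case using F_word_coef[OF step(1)] step(4) by (simp add: act_add act_scp)
qed simp

lemma Ip_coef: "Ip \<alpha> y \<Longrightarrow> coef (act y h) [] = 0"
proof -
  assume I: "Ip \<alpha> y"
  show ?thesis
  proof (cases "\<alpha> = 0")
    case True
    then show ?thesis using I Ip_zero_iff act_rr by (metis coef_simps(1))
  next
    case False
    obtain p where p: "p \<in> Hs GFs (- \<alpha>)" "cg y p" using Ip_rep[OF I] by blast
    have "- \<alpha> \<noteq> 0" using False by simp
    then show ?thesis using F_coef[OF _ p(1)] act_cg[OF p(2)] by metis
  qed
qed

lemma Jm_coef: "x \<in> Jm \<Longrightarrow> coef (act x h) [] = 0"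
  by (erule Jm_induct) (simp_all add: act_mult act_add act_scp Ip_coef)

text \<open>Omega sends the last F_i to K^{-1} E_i, and E_i acts first and kills
  \<open>vac\<close>.\<close>

lemma Om_F_word_vac: "w \<in> lists GFs \<Longrightarrow> w \<noteq> [] \<Longrightarrow> act (Om (mon w)) vac = 0"
proof -
  assume w: "w \<in> lists GFs" "w \<noteq> []"
  then obtain v g where v: "w = v @ [g]" by (metis rev_exhaust)
  then obtain i where g: "g = GF i" using w by auto
  have "Om (mon w) = Om (mon v) * (kk (- al i) * ee i)"
    by (simp add: v g mon_mult[symmetric] letter_mon[symmetric] Om_simps)
  then show ?thesis by (simp add: act_simps act_linear diag_linear)
qed

text \<open>Induction on the height of \<alpha>. On \<open>vac\<close> the element Omega(y) acts by
  0. On F_j h', the F_j is moved to the left of Omega(y): there it leaves no constant coefficient,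
  and the commutator lies in I^- K + I^- L at a smaller height. The restriction to
  \<open>Lspan\<close> is what allows h to be built from such F's.\<close>

lemma Om_Ip_coef:
  assumes "Ip \<alpha> y" "h \<in> S.Lspan N" shows "coef (act (Om y) h) [] = 0"
  using assms
proof (induction "ht N \<alpha>" arbitrary: \<alpha> y h rule: less_induct)
  case less
  note I = less.prems(1)
  show ?case
  proof (cases "\<alpha> = 0")
    case True
    then have "y \<in> rr" using I Ip_zero_iff by blast
    then show ?thesis using act_rr[OF Om_rr] by simp
  next
    case False
    obtain p where p: "p \<in> Hs GFs (- \<alpha>)" "cg y p" using Ip_rep[OF I] by blast
    have nz: "- \<alpha> \<noteq> 0" using False by simp
    have "act (Om p) vac = 0"
      using p(1)
    proof (induction p rule: Hs_induct)
      case (step c w p)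
      then have "w \<noteq> []" using nz by auto
      then show ?case using Om_F_word_vac[OF step(1)] step(4) by (simp add: act_add act_scp Om_simps)
    qed (simp add: Om_simps)
    then have vac0: "act (Om y) vac = 0" using act_cg[OF Om_cg[OF p(2)]] by simp
    have gen: "coef (act (Om y) (S.Fword w vac)) [] = 0" if w: "w \<in> lists {1..N}" for w
    proof (cases w)
      case Nil
      then show ?thesis using vac0 by simp
    next
      case (Cons j v)
      then have j: "j \<in> {1..N}" and v: "v \<in> lists {1..N}" using w by simp_all
      define h' where "h' = S.Fword v vac"
      have h': "h' \<in> S.Lspan N" unfolding h'_def by (rule S.Fword_in_Lspan[OF v])
      have Z: "- al j \<in> ZPi N" "al j \<in> ZPi N" by (intro ZPi_closed(3) al_ZPi j)+
      obtain \<beta> a b where ab: "Ip \<beta> a" "Ip \<beta> b" "cg (ee j * y) (y * ee j + (a * kk (al j) + b * ll (al j)))"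
        "\<beta> = \<alpha> - al j \<and> \<beta> \<in> ZPi_pos N \<or> a = 0 \<and> b = 0"
        by (rule E_left[OF I j])
      have "coef (act (Om x) h'') [] = 0" if x: "x \<in> {a, b}" and h'': "h'' \<in> S.Lspan N" for x h''
      proof (cases "x = 0")
        case True
        then show ?thesis by (simp add: Om_simps)
      next
        case False
        then have "\<beta> = \<alpha> - al j" "\<beta> \<in> ZPi_pos N" using ab(4) x by blast+
        then have "ht N \<beta> < ht N \<alpha>" using ht_minus[OF Ip_pos[OF I] j] by blast
        then show ?thesis using less.hyps[OF _ _ h''] ab(1,2) x by blast
      qed
      note IH = this
      \<comment> \<open>The first F_j is written as the Omega-image of E_j L^{-1}, so that it can be
        commuted with y inside Omega.\<close>
      have "S.Fword w vac = act (ff j) h'" by (simp add: Cons h'_def act_simps)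
      also have "\<dots> = act (Om (ee j * ll (- al j))) h'" by (rule act_cg[OF F_Om[OF j]])
      finally have "act (Om y) (S.Fword w vac) = act (Om (y * ee j)) (act (ll (al j)) h')"
        by (simp add: Om_simps act_mult)
      moreover have "cg (y * ee j) (ee j * y - (a * kk (al j) + b * ll (al j)))"
      proof -
        have "cg (ee j * y - (a * kk (al j) + b * ll (al j))) (y * ee j + (a * kk (al j) + b * ll (al j)) - (a * kk (al j) + b * ll (al j)))"
          by (rule cg_diff[OF ab(3) cg_refl])
            (intro fa.subspace_add[OF Wd_subspace] Wd_mult letters_Fr Z Ip_Fr[OF ab(1)] Ip_Fr[OF ab(2)])
        from cg_sym[OF this] show ?thesis by (simp only: add_diff_cancel_right')
      qed
      then have "act (Om (y * ee j)) f = act (Om (ee j * y - (a * kk (al j) + b * ll (al j)))) f" for f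
        by (rule act_cg[OF Om_cg])
      ultimately have e: "act (Om y) (S.Fword w vac) = act (Om (ee j)) (act (Om y) (act (ll (al j)) h'))
         - (act (Om a) (act (Om (kk (al j))) (act (ll (al j)) h')) + act (Om b) (act (Om (ll (al j))) (act (ll (al j)) h')))"
        by (simp only: free_subst_add Om_diff free_subst_mult act_add act_diff act_mult)
      have L: "act (ll (al j)) h' \<in> S.Lspan N" by (rule act_Lspan[OF letters_Fr(2)[OF Z(2)] h'])
      have L2: "act (Om (kk (al j))) (act (ll (al j)) h') \<in> S.Lspan N" "act (Om (ll (al j))) (act (ll (al j)) h') \<in> S.Lspan N"
        by (rule act_Lspan[OF Om_Fr[OF letters_Fr(1)[OF Z(2)]] L], rule act_Lspan[OF Om_Fr[OF letters_Fr(2)[OF Z(2)]] L])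
      \<comment> \<open>Omega(E_j) is F_j L^{-1}, and F_j has no constant coefficient in its
        image.\<close>
      have "coef (act (Om (ee j)) f) [] = 0" for f by (simp add: Om_simps act_mult act_letter)
      then show ?thesis unfolding e using IH[OF _ L2(1), of a] IH[OF _ L2(2), of b] by simp
    qed
    from less.prems(2) show ?thesis unfolding S.Lspan_def
    proof (induction rule: vec.span_induct_alt)
      case base
      then show ?case by (simp add: act_linear)
    next
      case (step c x z)
      then show ?case using gen by (auto simp: act_linear)
    qed
  qed
qed

lemma Om_Jm_coef: "x \<in> Jm \<Longrightarrow> h \<in> S.Lspan N \<Longrightarrow> coef (act (Om x) h) [] = 0"
proof (erule Jm_induct)
  fix \<alpha> y z w assume h: "h \<in> S.Lspan N" and I: "Ip \<alpha> y" and z: "z \<in> lists GKLs" and w: "w \<in> lists GEs"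
  have "act (Om (mon z * mon w)) h \<in> S.Lspan N"
    by (rule act_Lspan[OF Om_Fr[OF Wd_mult[OF words_Fr(1)[OF z] words_Fr(2)[OF w]]] h])
  then show "coef (act (Om (y * (mon z * mon w))) h) [] = 0"
    using Om_Ip_coef[OF I] by (simp add: free_subst_mult[of _ y] act_mult[of "Om y"])
qed (simp_all add: Om_simps act_add act_scp)

lemma J2_coef: "x \<in> J2 \<Longrightarrow> h \<in> S.Lspan N \<Longrightarrow> coef (act x h) [] = 0"
  unfolding J2_def using Jm_coef Om_Jm_coef by (auto simp: act_add)

text \<open>The annihilator of the vacuum; \<open>Fr\<close> modulo \<open>J4\<close> is
  \<open>Lspan\<close> (see \<open>Lspan_act\<close>).\<close>

definition J4 :: "(gen list \<Rightarrow>\<^sub>0 'k) set" where "J4 = {p \<in> Fr. act p vac = 0}"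

lemma J4_subspace: "fa.subspace J4"
  unfolding J4_def by (rule fa.subspaceI) (auto simp: act_simps Wd_closed)

lemma J4_Fr: "J4 \<subseteq> Fr" by (auto simp: J4_def)

lemma J4_left: "p \<in> Fr \<Longrightarrow> x \<in> J4 \<Longrightarrow> p * x \<in> J4"
  by (simp add: J4_def act_mult act_linear Wd_mult)

text \<open>Reversed because the rightmost letter acts first: the E's then strip the letters of u in
  order, and the constant coefficient of the result is the coefficient at u.\<close>

abbreviation ew :: "nat list \<Rightarrow> gen list \<Rightarrow>\<^sub>0 'k" where "ew u \<equiv> mon (map GE (rev u))"

lemma ew_Fr: "u \<in> lists {1..N} \<Longrightarrow> ew u \<in> Fr"
  by (rule words_Fr(2)) auto

lemma ew_coef: "coef (act (ew u) f) [] = coef f u"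
proof -
  have "coef (foldr Eop (rev u) f) [] = coef f u"
  proof (induction u arbitrary: f)
    case (Cons i u)
    then show ?case by (simp add: coef_Eop)
  qed simp
  moreover have "foldr gact (map GE v) f = foldr Eop v f" for v by (induction v) simp_all
  ultimately show ?thesis by (simp add: act_mon)
qed

lemma notin_J4:
  assumes "p \<in> Fr" "p \<notin> J4" shows "\<exists>u\<in>lists {1..N}. coef (act (ew u * p) vac) [] \<noteq> 0"
proof -
  have "act p vac \<noteq> 0" using assms by (simp add: J4_def)
  then obtain u where u: "coef (act p vac) u \<noteq> 0" using nonzero_coef by blast
  then have "u \<in> lists {1..N}" using S.Lspan_weights[OF act_Lspan[OF assms(1) vac_Lspan]] by blast
  then show ?thesis using u ew_coef by (metis act_mult)
qed

text \<open>Only constant coefficients were computed, but J2 is an ideal: multiplying x by E-words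
  from the left reads off every coefficient of x applied to \<open>vac\<close>.\<close>

lemma J2_J4: "J2 \<subseteq> J4"
proof
  fix x assume x: "x \<in> J2"
  have "coef (act (ew u * x) vac) [] = 0" if "u \<in> lists {1..N}" for u
    by (rule J2_coef[OF J2_mult(1)[OF x ew_Fr[OF that]] vac_Lspan])
  then show "x \<in> J4" using notin_J4[of x] x J2_Fr by blast
qed

lemma one_J4: "1 \<notin> J4"
proof
  assume "1 \<in> J4"
  then have "coef (vac :: 'k vec) [] = 0" by (simp add: J4_def act_one)
  then show False by (simp add: vac_def)
qed

text \<open>Degree in the algebra and content of words are opposite. Hence components of a
  polynomial are seen on coefficients (\<open>coef_comp\<close>), which makes \<open>J4\<close>
  graded.\<close>

lemma has_wt_word: "has_wt (foldr gact w vac) (\<lambda>j. - Poly_Mapping.lookup (wdeg w) j)"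
proof (induction w)
  case Nil
  then show ?case using has_wt_vac by simp
next
  case (Cons g w)
  let ?b = "\<lambda>j. - Poly_Mapping.lookup (wdeg w) j"
  let ?f = "foldr gact w vac"
  have d: "has_wt (diag c a ?f) ?b" for c a
    using Cons unfolding has_wt_def by (auto simp: coef_diag)
  show ?case
  proof (cases g)
    case (GE i)
    have "?b(i := ?b i - 1) = (\<lambda>j. - Poly_Mapping.lookup (wdeg (g # w)) j)"
      by (rule ext) (simp add: GE lookup_add lookup_frag_of)
    then show ?thesis using has_wt_Eop[OF Cons, of i] by (simp add: GE)
  next
    case (GF i)
    have "?b(i := ?b i + 1) = (\<lambda>j. - Poly_Mapping.lookup (wdeg (g # w)) j)"
      by (rule ext) (simp add: GF lookup_add lookup_minus lookup_uminus lookup_frag_of)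
    then show ?thesis using S.has_wt_Fop[OF Cons, of i] by (simp only: GF foldr.simps o_apply gact.simps)
  qed (use d in simp_all)
qed

lemma coef_comp:
  "coef (act (comp \<beta> p) vac) u = (if cnt u = (\<lambda>j. - Poly_Mapping.lookup \<beta> j) then coef (act p vac) u else 0)"
proof (induction p rule: poly_induct)
  case (step c w p)
  have "coef (act (comp \<beta> (scp c (mon w))) vac) u
     = (if cnt u = (\<lambda>j. - Poly_Mapping.lookup \<beta> j) then coef (act (scp c (mon w)) vac) u else 0)"
  proof (cases "coef (foldr gact w vac) u = 0")
    case True
    then show ?thesis by (simp add: comp_scp_mon act_scp act_mon)
  next
    case False
    then have c: "cnt u = (\<lambda>j. - Poly_Mapping.lookup (wdeg w) j)" using has_wt_word[of w] unfolding has_wt_def by blast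
    have "(wdeg w = \<beta>) = (cnt u = (\<lambda>j. - Poly_Mapping.lookup \<beta> j))"
      unfolding c fun_eq_iff neg_equal_iff_equal by (metis poly_mapping_eqI)
    then show ?thesis by (simp add: comp_scp_mon act_scp act_mon)
  qed
  then show ?case using step by (simp add: comp_add act_add)
qed simp

lemma comp_J4: "p \<in> J4 \<Longrightarrow> comp \<beta> p \<in> J4"
proof -
  assume p: "p \<in> J4"
  have "act (comp \<beta> p) vac = 0"
    by (rule vec_eqI) (use p in \<open>simp add: coef_comp J4_def\<close>)
  moreover have "comp \<beta> p \<in> Fr" using comp_in_Hs[of p "gens N" \<beta>] Hs_Wd p J4_Fr by blast
  ultimately show ?thesis by (simp add: J4_def)
qed

lemma lam_vac: "s \<in> Wd GKLs \<Longrightarrow> act s vac = scl (lam s) vac"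
proof (induction s rule: Wd_induct)
  case zero
  have "lam 0 = 0" using lam_scp[OF Wd_closed(8), of 0] by simp
  then show ?case by simp
next
  case (step c w p)
  have "w \<in> lists GKLs \<Longrightarrow> act (mon w) vac = scl (lam (mon w)) vac" for w
  proof (induction w)
    case Nil
    then show ?case by (simp add: mon_Nil act_one lam_one)
  next
    case (Cons g w)
    then have g: "g \<in> GKLs" and w: "w \<in> lists GKLs" by simp_all
    have "gact g vac = scl (lam (letter g)) vac"
      using g by (auto simp: diag_vac lK_def lL_def)
    moreover have "lam (mon (g # w)) = lam (letter g) * lam (mon w)"
      unfolding mon_Cons by (rule lam_mult[OF Wd_letter[OF g] Wd_mon[OF w]])
    ultimately show ?case using Cons.IH[OF w]
      by (simp add: mon_Cons act_mult act_letter gact_linear mult.commute)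
  qed
  from this[OF step(1)] show ?case
    using step lam_add[OF Wd_closed(9)[OF Wd_mon[OF step(1)]] step(2), of c] lam_scp[OF Wd_mon[OF step(1)], of c]
    by (simp add: act_add act_scp vec.scale_left_distrib)
qed

end

section \<open>U(\<chi>)-modules presented by left ideals of the free algebra\<close>

context gqg
begin

definition left_sub :: "(gen list \<Rightarrow>\<^sub>0 'k) set \<Rightarrow> bool" where
  "left_sub J \<longleftrightarrow> fa.subspace J \<and> J \<subseteq> Fr \<and> (\<forall>p\<in>Fr. \<forall>x\<in>J. p * x \<in> J)"

text \<open>M is \<open>Fr\<close> modulo the left ideal J, with U(\<chi>) acting through left
  multiplication. The submodules of M then correspond to the left ideals above J, and quotients of M
  are again of this form.\<close>

definition gmodule where
  "gmodule M \<pi> J \<longleftrightarrow> presentation M \<pi> Fr J \<and> left_sub J \<and> (\<forall>p\<in>Fr. \<forall>x\<in>Fr. p2 p \<odot>\<^bsub>M\<^esub> \<pi> x = \<pi> (p * x))"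

lemma gmodule_pres: "gmodule M \<pi> J \<Longrightarrow> presentation M \<pi> Fr J"
  and gmodule_smult: "gmodule M \<pi> J \<Longrightarrow> p \<in> Fr \<Longrightarrow> x \<in> Fr \<Longrightarrow> p2 p \<odot>\<^bsub>M\<^esub> \<pi> x = \<pi> (p * x)"
  by (simp_all add: gmodule_def)

lemma left_subI: "fa.subspace J \<Longrightarrow> J \<subseteq> Fr \<Longrightarrow> (\<And>p x. p \<in> Fr \<Longrightarrow> x \<in> J \<Longrightarrow> p * x \<in> J) \<Longrightarrow> left_sub J"
  by (simp add: left_sub_def)

lemma left_subD: "left_sub J \<Longrightarrow> fa.subspace J" "left_sub J \<Longrightarrow> J \<subseteq> Fr" "left_sub J \<Longrightarrow> p \<in> Fr \<Longrightarrow> x \<in> J \<Longrightarrow> p * x \<in> J"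
  by (simp_all add: left_sub_def)

lemma J2_left_sub: "left_sub J2"
  by (rule left_subI[OF J2_subspace J2_Fr J2_mult(1)])

lemma submodule_image:
  assumes g: "gmodule M \<pi> K" and P: "left_sub P" shows "submodule (\<pi> ` P) UU M"
proof -
  interpret M: presentation M \<pi> Fr K by (rule gmodule_pres[OF g])
  show ?thesis unfolding submodule_iff
  proof (intro conjI ballI)
    show "subgroup (\<pi> ` P) (add_monoid M)"
      by (rule M.subgroup_image[OF subspace_asub[OF left_subD(1)[OF P]] left_subD(2)[OF P]])
    fix a x assume "a \<in> carrier UU" "x \<in> \<pi> ` P"
    then obtain p y where p: "p \<in> Fr" "a = p2 p" and y: "y \<in> P" "x = \<pi> y" unfolding U.carr by (elim imageE) simp
    have "y \<in> Fr" using y(1) left_subD(2)[OF P] by blast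
    then show "a \<odot>\<^bsub>M\<^esub> x \<in> \<pi> ` P"
      unfolding p(2) y(2) gmodule_smult[OF g p(1) \<open>y \<in> Fr\<close>] by (intro imageI left_subD(3)[OF P p(1) y(1)])
  qed
qed

lemma submodule_pull:
  assumes g: "gmodule M \<pi> K" and H: "submodule H UU M"
  shows "left_sub (presentation.pull \<pi> Fr H)" "K \<subseteq> presentation.pull \<pi> Fr H" "\<pi> ` presentation.pull \<pi> Fr H = H"
proof -
  interpret M: presentation M \<pi> Fr K by (rule gmodule_pres[OF g])
  have sub: "subgroup H (add_monoid M)" and cl: "\<And>a x. a \<in> carrier UU \<Longrightarrow> x \<in> H \<Longrightarrow> a \<odot>\<^bsub>M\<^esub> x \<in> H"
    using H by (auto simp: submodule_iff)
  note pl = M.pull_subgroup[OF sub]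
  show "K \<subseteq> M.pull H" "\<pi> ` M.pull H = H" by (rule pl)+
  have left: "p * x \<in> M.pull H" if p: "p \<in> Fr" and x: "x \<in> M.pull H" for p x
  proof -
    have x': "x \<in> Fr" "\<pi> x \<in> H" using x by (auto simp: M.pull_def)
    have "p2 p \<in> carrier UU" unfolding U.carr by (rule imageI[OF p])
    from cl[OF this x'(2)] show ?thesis
      using gmodule_smult[OF g p x'(1)] Wd_mult[OF p x'(1)] by (simp add: M.pull_def)
  qed
  show "left_sub (M.pull H)"
  proof (rule left_subI[OF _ _ left])
    show "fa.subspace (M.pull H)"
    proof (rule fa.subspaceI)
      show "x \<in> M.pull H \<Longrightarrow> scp c x \<in> M.pull H" for c x
        unfolding scp_def by (rule left[OF Wd_fconst])
    qed (use pl(1) in \<open>auto simp: asub_def\<close>)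
    show "M.pull H \<subseteq> Fr" by (auto simp: M.pull_def)
  qed
qed

lemma quot_gmodule:
  assumes g: "gmodule M \<pi> K" and P: "left_sub P" and KP: "K \<subseteq> P"
  shows "gmodule (quot M (\<pi> ` P)) (\<lambda>p. \<pi> ` P +>\<^bsub>M\<^esub> \<pi> p) P"
proof -
  interpret M: presentation M \<pi> Fr K by (rule gmodule_pres[OF g])
  interpret Q: pres_quot M \<pi> Fr K P
    by unfold_locales (rule subspace_asub[OF left_subD(1)[OF P]], rule KP, rule left_subD(2)[OF P])
  have e: "Q.\<pi>' = (\<lambda>p. \<pi> ` P +>\<^bsub>M\<^esub> \<pi> p)" by (rule ext) (rule Q.\<pi>'_def)
  have "p2 p \<odot>\<^bsub>quot M (\<pi> ` P)\<^esub> Q.\<pi>' x = Q.\<pi>' (p * x)" if p: "p \<in> Fr" and x: "x \<in> Fr" for p x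
  proof (rule Q.quot_smult[OF _ _ x])
    show "p2 p \<odot>\<^bsub>M\<^esub> \<pi> y = \<pi> (p * y) \<and> p * y \<in> Fr" if "y \<in> Fr" for y
      using gmodule_smult[OF g p that] Wd_mult[OF p that] by blast
    show "p * a - p * y \<in> P" if "a - y \<in> P" for a y
      using left_subD(3)[OF P p that] by (simp add: right_diff_distrib)
  qed
  then show ?thesis unfolding gmodule_def e[symmetric] using Q.quot_presentation P by blast
qed

lemma scalars_pres:
  assumes g: "gmodule M \<pi> K"
  shows "presentation (scalars UU M) \<pi> Fr K" "p \<in> Fr \<Longrightarrow> c \<odot>\<^bsub>scalars UU M\<^esub> \<pi> p = \<pi> (scp c p)"
proof -
  interpret M: presentation M \<pi> Fr K by (rule gmodule_pres[OF g])
  show "presentation (scalars UU M) \<pi> Fr K"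
    by unfold_locales (use M.P M.J M.JP M.carr M.add M.zero M.eq in \<open>auto simp: scalars_def\<close>)
  assume p: "p \<in> Fr"
  have "c \<odot>\<^bsub>scalars UU M\<^esub> \<pi> p = (c \<odot>\<^bsub>UU\<^esub> \<one>\<^bsub>UU\<^esub>) \<odot>\<^bsub>M\<^esub> \<pi> p" by (simp add: scalars_def)
  also have "\<dots> = p2 (fconst c) \<odot>\<^bsub>M\<^esub> \<pi> p" by (simp add: p2_one p2_smult[OF Wd_one] scp_one)
  also have "\<dots> = \<pi> (scp c p)" unfolding scp_def by (rule gmodule_smult[OF g Wd_fconst p])
  finally show "c \<odot>\<^bsub>scalars UU M\<^esub> \<pi> p = \<pi> (scp c p)" .
qed

lemma scalars_lin_span:
  assumes g: "gmodule M \<pi> K" and S: "S \<subseteq> carrier M"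
  shows "lin_span (scalars UU M) S = \<pi> ` fa.span (presentation.pull \<pi> Fr S)"
proof -
  have c: "S \<subseteq> carrier (scalars UU M)" using S by (simp add: scalars_def)
  show ?thesis by (rule lin_span_image[OF scalars_pres(1)[OF g] Wd_subspace scalars_pres(2)[OF g] c])
qed

lemma regular_gmodule: "gmodule (regular_module UU) p2 J2"
proof -
  have "presentation (regular_module UU) p2 Fr J2"
    by unfold_locales (use U.P U.J U.JP U.carr U.add U.zero U.eq in \<open>auto simp: regular_module_def\<close>)
  then show ?thesis unfolding gmodule_def using J2_left_sub p2_mult by (auto simp: regular_module_def)
qed

end

section \<open>The Verma module\<close>

context gqg_char
begin

lemma J4_left_sub: "left_sub J4"
  by (rule left_subI[OF J4_subspace J4_Fr J4_left])

definition Vrel :: "(gen list \<Rightarrow>\<^sub>0 'k) set" where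
  "Vrel = {s - fconst (lam s) | s. s \<in> Wd GKLs} \<union> ee ` {1..N}"

text \<open>The preimage of the left ideal that presents the Verma module (see
  \<open>VI_eq\<close>).\<close>

definition J3 :: "(gen list \<Rightarrow>\<^sub>0 'k) set" where
  "J3 = \<Inter>{P. left_sub P \<and> J2 \<subseteq> P \<and> Vrel \<subseteq> P}"

lemma Vrel_Fr: "Vrel \<subseteq> Fr"
  unfolding Vrel_def using KL_Fr letters_Fr(3) Wd_fconst fa.subspace_diff[OF Wd_subspace] by blast

lemma Fr_left_sub: "left_sub Fr"
  by (rule left_subI[OF Wd_subspace subset_refl Wd_mult])

lemma J3_left_sub: "left_sub J3"
proof (rule left_subI)
  show "fa.subspace J3"
    unfolding J3_def by (rule fa.subspace_Inter) (auto dest: left_subD(1))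
  show "J3 \<subseteq> Fr" unfolding J3_def using Fr_left_sub J2_Fr Vrel_Fr by blast
  show "p \<in> Fr \<Longrightarrow> x \<in> J3 \<Longrightarrow> p * x \<in> J3" for p x
    unfolding J3_def using left_subD(3) by blast
qed

lemma J2_J3: "J2 \<subseteq> J3" and Vrel_J3: "Vrel \<subseteq> J3"
  unfolding J3_def by blast+

lemma J3_J4: "J3 \<subseteq> J4"
proof -
  have "Vrel \<subseteq> J4"
  proof
    fix x assume x: "x \<in> Vrel"
    then have F: "x \<in> Fr" using Vrel_Fr by blast
    from x consider s where "s \<in> Wd GKLs" "x = s - fconst (lam s)" | i where "x = ee i"
      unfolding Vrel_def by blast
    then have "act x vac = 0"
    proof cases
      case (1 s)
      have "act (fconst (lam s)) vac = scl (lam s) vac" using act_scp[of "lam s" 1 vac] by (simp add: scp_one act_one)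
      then show ?thesis using lam_vac[OF 1(1)] by (simp add: 1(2) act_diff)
    next
      case (2 i)
      then show ?thesis by (simp add: act_letter)
    qed
    then show "x \<in> J4" using F by (simp add: J4_def)
  qed
  then show ?thesis unfolding J3_def using J4_left_sub J2_J4 by blast
qed

abbreviation "VI \<equiv> verma_ideal N \<chi> \<Lambda>"

lemma VI_eq: "VI = p2 ` J3"
proof -
  define G where "G = {Z \<ominus>\<^bsub>UU\<^esub> (\<Lambda> Z \<odot>\<^bsub>UU\<^esub> \<one>\<^bsub>UU\<^esub>) | Z. Z \<in> U_zero N \<chi>} \<union> Egen N \<chi> ` {1..N}"
  have s: "p2 s \<ominus>\<^bsub>UU\<^esub> (\<Lambda> (p2 s) \<odot>\<^bsub>UU\<^esub> \<one>\<^bsub>UU\<^esub>) = p2 (s - fconst (lam s))" if "s \<in> Wd GKLs" for s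
    using U.diff[OF KL_Fr[OF that] Wd_fconst] by (simp add: p2_one p2_smult[OF Wd_one] scp_one lam_def)
  have "{Z \<ominus>\<^bsub>UU\<^esub> (\<Lambda> Z \<odot>\<^bsub>UU\<^esub> \<one>\<^bsub>UU\<^esub>) | Z. Z \<in> U_zero N \<chi>} = p2 ` {s - fconst (lam s) | s. s \<in> Wd GKLs}"
  proof (intro equalityI subsetI)
    fix x assume "x \<in> {Z \<ominus>\<^bsub>UU\<^esub> (\<Lambda> Z \<odot>\<^bsub>UU\<^esub> \<one>\<^bsub>UU\<^esub>) | Z. Z \<in> U_zero N \<chi>}"
    then obtain t where t: "t \<in> Wd GKLs" "x = p2 t \<ominus>\<^bsub>UU\<^esub> (\<Lambda> (p2 t) \<odot>\<^bsub>UU\<^esub> \<one>\<^bsub>UU\<^esub>)"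
      unfolding U_zero_eq by blast
    show "x \<in> p2 ` {s - fconst (lam s) | s. s \<in> Wd GKLs}" unfolding t(2) s[OF t(1)] using t(1) by blast
  next
    fix x assume "x \<in> p2 ` {s - fconst (lam s) | s. s \<in> Wd GKLs}"
    then obtain t where t: "t \<in> Wd GKLs" "x = p2 (t - fconst (lam t))" by blast
    show "x \<in> {Z \<ominus>\<^bsub>UU\<^esub> (\<Lambda> Z \<odot>\<^bsub>UU\<^esub> \<one>\<^bsub>UU\<^esub>) | Z. Z \<in> U_zero N \<chi>}"
      unfolding t(2) s[OF t(1), symmetric] U_zero_eq using t(1) by blast
  qed
  then have G: "G = p2 ` Vrel" unfolding G_def Vrel_def image_Un by (simp add: p2_gens image_image)
  have VI: "VI = \<Inter>{H. submodule H UU (regular_module UU) \<and> G \<subseteq> H}"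
    unfolding verma_ideal_def left_ideal_gen_def G_def ..
  show ?thesis
  proof
    show "VI \<subseteq> p2 ` J3"
      unfolding VI using submodule_image[OF regular_gmodule J3_left_sub] G Vrel_J3 by (intro Inter_lower) blast
    show "p2 ` J3 \<subseteq> VI"
      unfolding VI
    proof (rule Inter_greatest)
      fix H assume "H \<in> {H. submodule H UU (regular_module UU) \<and> G \<subseteq> H}"
      then have H: "submodule H UU (regular_module UU)" "G \<subseteq> H" by blast+
      note pl = submodule_pull[OF regular_gmodule H(1)]
      have "Vrel \<subseteq> U.pull H" using H(2) Vrel_Fr unfolding G U.pull_def by blast
      then have "J3 \<subseteq> U.pull H" unfolding J3_def using pl(1,2) by blast
      then show "p2 ` J3 \<subseteq> H" using pl(3) by blast
    qed
  qed
qed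

abbreviation "VV \<equiv> verma N \<chi> \<Lambda>"

definition p3 :: "(gen list \<Rightarrow>\<^sub>0 'k) \<Rightarrow> (gen list \<Rightarrow>\<^sub>0 'k) set set set" where
  "p3 p = p2 ` J3 +>\<^bsub>regular_module UU\<^esub> p2 p"

lemma verma_gmodule: "gmodule VV p3 J3"
  using quot_gmodule[OF regular_gmodule J3_left_sub J2_J3] unfolding verma_def VI_eq p3_def[abs_def] .

sublocale V: presentation VV p3 Fr J3 by (rule gmodule_pres[OF verma_gmodule])

lemma verma_vec_eq: "verma_vec N \<chi> \<Lambda> = p3 1"
  by (simp add: verma_vec_def p3_def VI_eq p2_one)

lemma J3_subspace: "fa.subspace J3" by (rule left_subD(1)[OF J3_left_sub])

lemma rr_J3: "rr \<subseteq> J3" using rr_J2 J2_J3 by blast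

lemma KL_mod:
  assumes g: "g \<in> GKLs" and p: "p \<in> Hs GFs \<beta>"
  shows "\<exists>f\<in>Hs GFs \<beta>. letter g * p - f \<in> J3"
  using p
proof (induction p rule: Hs_induct)
  case zero
  show ?case using fa.subspace_0[OF J3_subspace] by (intro bexI[of _ 0]) (simp_all add: fa.subspace_0[OF Hs_subspace])
next
  case (step d w p)
  obtain f where f: "f \<in> Hs GFs \<beta>" "letter g * p - f \<in> J3" using step(4) by blast
  have wg: "w \<in> lists (gens N)" using step(1) lists_mono[OF sub_gens(1)] by blast
  obtain c where c: "cg (letter g * mon w) (scp c (mon w * letter g))" using KL_commute_word[OF g wg] by blast
  have "letter g - fconst (lam (letter g)) \<in> J3" using Vrel_J3 Wd_letter[OF g] unfolding Vrel_def by blast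
  then have "scp c (mon w * (letter g - fconst (lam (letter g)))) \<in> J3"
    by (intro fa.subspace_scale[OF J3_subspace] left_subD(3)[OF J3_left_sub mon_Fr[OF wg]])
  moreover have "letter g * mon w - scp c (mon w * letter g) \<in> J3" using cg_rr'[OF c] rr_J3 by blast
  ultimately have "(letter g * mon w - scp c (mon w * letter g)) + scp c (mon w * (letter g - fconst (lam (letter g)))) \<in> J3"
    by (intro fa.subspace_add[OF J3_subspace])
  then have s: "letter g * mon w - scp (c * lam (letter g)) (mon w) \<in> J3"
    using fconst_commute[of "lam (letter g)" "mon w"]
    by (simp add: right_diff_distrib fa.scale_right_diff_distrib fa.scale_scale[symmetric] scp_def[of "lam (letter g)"])
  have "scp d (letter g * mon w - scp (c * lam (letter g)) (mon w)) + (letter g * p - f) \<in> J3"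
    by (intro fa.subspace_add[OF J3_subspace] fa.subspace_scale[OF J3_subspace] s f(2))
  then have "letter g * (scp d (mon w) + p) - (scp d (scp (c * lam (letter g)) (mon w)) + f) \<in> J3"
    by (simp add: distrib_left scp_mult fa.scale_right_diff_distrib algebra_simps)
  moreover have "scp d (scp (c * lam (letter g)) (mon w)) + f \<in> Hs GFs \<beta>"
    by (intro fa.subspace_add[OF Hs_subspace] fa.subspace_scale[OF Hs_subspace] Hs_mon step(1,2) f(1))
  ultimately show ?case by blast
qed

lemma F_Hs: "j \<in> {1..N} \<Longrightarrow> f \<in> Hs GFs \<beta> \<Longrightarrow> ff j * f \<in> (Hs GFs (- al j + \<beta>) :: (gen list \<Rightarrow>\<^sub>0 'k) set)"
proof (rule Hs_mult)
  assume "j \<in> {1..N}"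
  then show "ff j \<in> (Hs GFs (- al j) :: (gen list \<Rightarrow>\<^sub>0 'k) set)" unfolding letter_mon by (intro Hs_mon) auto
qed

lemma E_word_mod:
  assumes i: "i \<in> {1..N}"
  shows "w \<in> lists GFs \<Longrightarrow> \<exists>f\<in>Hs GFs (al i + wdeg w). ee i * mon w - f \<in> J3"
proof (induction w)
  case Nil
  have "ee i \<in> J3" using Vrel_J3 i unfolding Vrel_def by blast
  then show ?case by (intro bexI[of _ 0]) (simp_all add: mon_Nil fa.subspace_0[OF Hs_subspace])
next
  case (Cons g w)
  then obtain j where j: "g = GF j" "j \<in> {1..N}" by (auto simp only: Cons_in_lists_iff image_iff)
  have w: "w \<in> lists GFs" using Cons.prems by simp
  have wF: "mon w \<in> Fr" by (rule words_Fr(3)[OF w])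
  note Z = al_ZPi[OF i]
  obtain f where f: "f \<in> Hs GFs (al i + wdeg w)" "ee i * mon w - f \<in> J3" using Cons.IH[OF w] by blast
  have h: "\<exists>h\<in>Hs GFs (al i - al j + wdeg w). (ee i * ff j - ff j * ee i) * mon w - h \<in> J3"
  proof (cases "i = j")
    case False
    have "(ee i * ff j - ff j * ee i) * mon w \<in> rr"
      by (rule rr_closed(2)[OF cg_rr[OF cg_EF(1)[OF i j(2) False]] wF])
    then show ?thesis using rr_J3 by (intro bexI[of _ 0]) (auto simp: fa.subspace_0[OF Hs_subspace])
  next
    case True
    have m: "mon w \<in> Hs GFs (wdeg w)" by (rule Hs_mon[OF w refl])
    have "GK (al i) \<in> GKLs" "GL (al i) \<in> GKLs" using Z by blast+
    from KL_mod[OF this(1) m] KL_mod[OF this(2) m]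
    obtain a b where a: "a \<in> Hs GFs (wdeg w)" "kk (al i) * mon w - a \<in> J3"
      and b: "b \<in> Hs GFs (wdeg w)" "ll (al i) * mon w - b \<in> J3" by blast
    have "((ee i * ff j - ff j * ee i) - (- kk (al i) + ll (al i))) * mon w \<in> J3"
      using rr_closed(2)[OF cg_rr'[OF cg_EF(2)[OF i j(2) True]] wF] rr_J3 by blast
    then have "((ee i * ff j - ff j * ee i) - (- kk (al i) + ll (al i))) * mon w + ((ll (al i) * mon w - b) - (kk (al i) * mon w - a)) \<in> J3"
      by (intro fa.subspace_add[OF J3_subspace] fa.subspace_diff[OF J3_subspace] a b)
    then have "(ee i * ff j - ff j * ee i) * mon w - (b - a) \<in> J3" by (simp add: algebra_simps)
    moreover have "b - a \<in> Hs GFs (al i - al j + wdeg w)" unfolding True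
      using fa.subspace_diff[OF Hs_subspace b(1) a(1)] by simp
    ultimately show ?thesis by blast
  qed
  then obtain h where h: "h \<in> Hs GFs (al i - al j + wdeg w)" "(ee i * ff j - ff j * ee i) * mon w - h \<in> J3" by blast
  have "ff j * (ee i * mon w - f) + ((ee i * ff j - ff j * ee i) * mon w - h) \<in> J3"
    by (intro fa.subspace_add[OF J3_subspace] left_subD(3)[OF J3_left_sub letters_Fr(4)[OF j(2)]] f h)
  moreover have "ff j * (ee i * mon w - f) + ((ee i * ff j - ff j * ee i) * mon w - h) = ee i * mon (g # w) - (ff j * f + h)"
    by (simp add: mon_Cons j(1) algebra_simps)
  ultimately have r: "ee i * mon (g # w) - (ff j * f + h) \<in> J3" by simp
  have d: "- al j + (al i + wdeg w) = al i + wdeg (g # w)" "al i - al j + wdeg w = al i + wdeg (g # w)"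
    by (simp_all add: j(1) algebra_simps)
  have "ff j * f + h \<in> Hs GFs (al i + wdeg (g # w))"
    using F_Hs[OF j(2) f(1)] h(1) unfolding d by (rule fa.subspace_add[OF Hs_subspace])
  then show ?case using r by blast
qed

lemma E_mod:
  assumes i: "i \<in> {1..N}" and p: "p \<in> Hs GFs \<beta>"
  shows "\<exists>f\<in>Hs GFs (al i + \<beta>). ee i * p - f \<in> J3"
  using p
proof (induction p rule: Hs_induct)
  case zero
  show ?case using fa.subspace_0[OF J3_subspace] by (intro bexI[of _ 0]) (simp_all add: fa.subspace_0[OF Hs_subspace])
next
  case (step d w p)
  obtain f where f: "f \<in> Hs GFs (al i + \<beta>)" "ee i * p - f \<in> J3" using step(4) by blast
  obtain h where h: "h \<in> Hs GFs (al i + \<beta>)" "ee i * mon w - h \<in> J3" using E_word_mod[OF i step(1)] step(2) by blast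
  have "scp d (ee i * mon w - h) + (ee i * p - f) \<in> J3"
    by (intro fa.subspace_add[OF J3_subspace] fa.subspace_scale[OF J3_subspace] h f)
  then have "ee i * (scp d (mon w) + p) - (scp d h + f) \<in> J3"
    by (simp add: distrib_left scp_mult fa.scale_right_diff_distrib algebra_simps)
  moreover have "scp d h + f \<in> Hs GFs (al i + \<beta>)"
    by (intro fa.subspace_add[OF Hs_subspace] fa.subspace_scale[OF Hs_subspace] h f)
  ultimately show ?case by blast
qed

lemma letter_mod:
  assumes g: "g \<in> gens N" and p: "p \<in> Hs GFs \<beta>"
  shows "\<exists>f\<in>Hs GFs (gen_deg g + \<beta>). letter g * p - f \<in> J3"
proof -
  consider "g \<in> GKLs" | i where "i \<in> {1..N}" "g = GE i" | j where "j \<in> {1..N}" "g = GF j"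
    using g unfolding gens_def by blast
  then show ?thesis
  proof cases
    case 1
    then have "gen_deg g = 0" by auto
    then show ?thesis using KL_mod[OF 1 p] by simp
  next
    case (2 i)
    then show ?thesis using E_mod[OF 2(1) p] by simp
  next
    case (3 j)
    then show ?thesis using F_Hs[OF 3(1) p] fa.subspace_0[OF J3_subspace] by (intro bexI[of _ "ff j * p"]) simp_all
  qed
qed

text \<open>The spanning half of the triangular decomposition, with degrees: K and L act by scalars
  on F-words, and each E is commuted to the right until it dies.\<close>

lemma word_mod: "w \<in> lists (gens N) \<Longrightarrow> \<exists>f\<in>Hs GFs (wdeg w). mon w - f \<in> J3"
proof (induction w)
  case Nil
  have "1 \<in> (Hs GFs 0 :: (gen list \<Rightarrow>\<^sub>0 'k) set)" using Hs_mon[of "[]" GFs 0] by (simp add: mon_Nil)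
  then show ?case using fa.subspace_0[OF J3_subspace] by (intro bexI[of _ 1]) (simp_all add: mon_Nil)
next
  case (Cons g w)
  then have g: "g \<in> gens N" and w: "w \<in> lists (gens N)" by simp_all
  obtain f where f: "f \<in> Hs GFs (wdeg w)" "mon w - f \<in> J3" using Cons.IH[OF w] by blast
  obtain h where h: "h \<in> Hs GFs (gen_deg g + wdeg w)" "letter g * f - h \<in> J3" using letter_mod[OF g f(1)] by blast
  have "letter g * (mon w - f) + (letter g * f - h) \<in> J3"
    by (intro fa.subspace_add[OF J3_subspace] left_subD(3)[OF J3_left_sub Wd_letter[OF g]] f h)
  then have "mon (g # w) - h \<in> J3" by (simp add: mon_Cons algebra_simps)
  then show ?case using h(1) unfolding wdeg_simps by blast
qed

lemma Hs_mod: "p \<in> Hs (gens N) \<beta> \<Longrightarrow> \<exists>f\<in>Hs GFs \<beta>. p - f \<in> J3"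
proof (induction p rule: Hs_induct)
  case zero
  show ?case using fa.subspace_0[OF J3_subspace] by (intro bexI[of _ 0]) (simp_all add: fa.subspace_0[OF Hs_subspace])
next
  case (step d w p)
  obtain f where f: "f \<in> Hs GFs \<beta>" "p - f \<in> J3" using step(4) by blast
  obtain h where h: "h \<in> Hs GFs \<beta>" "mon w - h \<in> J3" using word_mod[OF step(1)] step(2) by blast
  have "scp d (mon w - h) + (p - f) \<in> J3"
    by (intro fa.subspace_add[OF J3_subspace] fa.subspace_scale[OF J3_subspace] h f)
  then have "(scp d (mon w) + p) - (scp d h + f) \<in> J3"
    by (simp add: fa.scale_right_diff_distrib algebra_simps)
  moreover have "scp d h + f \<in> Hs GFs \<beta>"
    by (intro fa.subspace_add[OF Hs_subspace] fa.subspace_scale[OF Hs_subspace] h f)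
  ultimately show ?case by blast
qed

text \<open>The graded pieces are defined through U^- alone. By \<open>Hs_mod\<close> they are also
  the images of all homogeneous polynomials, which fits the left ideals used here.\<close>

lemma verma_deg_eq: "verma_deg N \<chi> \<Lambda> \<beta> = p3 ` Hs (gens N) \<beta>"
proof (intro equalityI subsetI)
  have act1: "p2 p \<odot>\<^bsub>VV\<^esub> verma_vec N \<chi> \<Lambda> = p3 p" if "p \<in> Fr" for p
    using gmodule_smult[OF verma_gmodule that Wd_one] by (simp add: verma_vec_eq)
  { fix x assume "x \<in> verma_deg N \<chi> \<Lambda> \<beta>"
    then obtain p where "x = p2 p \<odot>\<^bsub>VV\<^esub> verma_vec N \<chi> \<Lambda>" "p \<in> Hs (gens N) \<beta>"
      unfolding verma_deg_def U_deg_eq by blast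
    then show "x \<in> p3 ` Hs (gens N) \<beta>" using act1 Hs_Wd by blast }
  { fix x assume "x \<in> p3 ` Hs (gens N) \<beta>"
    then obtain p where p: "p \<in> Hs (gens N) \<beta>" "x = p3 p" by blast
    obtain f where f: "f \<in> Hs GFs \<beta>" "p - f \<in> J3" using Hs_mod[OF p(1)] by blast
    have F: "p \<in> Fr" "f \<in> Fr" using p(1) f(1) Hs_Wd Hs_GF_Fr by blast+
    have "x = p2 f \<odot>\<^bsub>VV\<^esub> verma_vec N \<chi> \<Lambda>" unfolding act1[OF F(2)] p(2) using V.eq[OF F] f(2) by blast
    moreover have "p2 f \<in> U_minus N \<chi> \<inter> U_deg N \<chi> \<beta>"
      unfolding U_minus_eq U_deg_eq using f(1) Hs_Wd Hs_GF_Fr(2) by blast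
    ultimately show "x \<in> verma_deg N \<chi> \<Lambda> \<beta>" unfolding verma_deg_def by blast }
qed

end

section \<open>The maximal graded submodule and its quotient\<close>

lemma lookup_comp: "Poly_Mapping.lookup (comp \<beta> p) w = (if wdeg w = \<beta> then Poly_Mapping.lookup p w else 0)"
proof (induction p rule: poly_induct)
  case (step c v p)
  have "Poly_Mapping.lookup (comp \<beta> (scp c (mon v))) w = (if wdeg w = \<beta> then Poly_Mapping.lookup (scp c (mon v)) w else 0)"
    unfolding comp_scp_mon by (simp add: scp_mon lookup_single when_def)
  then show ?case using step by (simp add: comp_add lookup_add)
qed simp

lemma comp_sum:
  assumes "finite B" "wdeg ` Poly_Mapping.keys p \<subseteq> B" shows "(\<Sum>\<beta>\<in>B. comp \<beta> p) = p"
proof (rule poly_mapping_eqI)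
  fix w
  have "Poly_Mapping.lookup (\<Sum>\<beta>\<in>B. comp \<beta> p) w = (\<Sum>\<beta>\<in>B. Poly_Mapping.lookup (comp \<beta> p) w)" by (rule lookup_sum)
  also have "\<dots> = (\<Sum>\<beta>\<in>B. if wdeg w = \<beta> then Poly_Mapping.lookup p w else 0)" by (simp only: lookup_comp)
  also have "\<dots> = (if wdeg w \<in> B then Poly_Mapping.lookup p w else 0)" using assms(1) by simp
  also have "\<dots> = Poly_Mapping.lookup p w" using assms(2) by (cases "w \<in> Poly_Mapping.keys p") (auto simp: in_keys_iff)
  finally show "Poly_Mapping.lookup (\<Sum>\<beta>\<in>B. comp \<beta> p) w = Poly_Mapping.lookup p w" .
qed

context gqg_char
begin

lemma graded_pull:
  assumes H: "submodule H UU VV"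
  shows "lin_span (scalars UU VV) (\<Union>\<alpha>\<in>ZPi N. H \<inter> verma_deg N \<chi> \<Lambda> \<alpha>)
    = p3 ` fa.span {p \<in> Fr. p3 p \<in> H \<and> (\<exists>\<alpha>\<in>ZPi N. p3 p \<in> p3 ` Hs (gens N) \<alpha>)}"
proof -
  have "H \<subseteq> carrier VV" using H subgroup.subset[of H "add_monoid VV"] by (simp add: submodule_iff)
  then have c: "(\<Union>\<alpha>\<in>ZPi N. H \<inter> verma_deg N \<chi> \<Lambda> \<alpha>) \<subseteq> carrier VV" by blast
  have "V.pull (\<Union>\<alpha>\<in>ZPi N. H \<inter> verma_deg N \<chi> \<Lambda> \<alpha>) = {p \<in> Fr. p3 p \<in> H \<and> (\<exists>\<alpha>\<in>ZPi N. p3 p \<in> p3 ` Hs (gens N) \<alpha>)}"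
    unfolding V.pull_def verma_deg_eq by blast
  then show ?thesis using scalars_lin_span[OF verma_gmodule c] by simp
qed

lemma pull_J4: "p \<in> Fr \<Longrightarrow> p3 p \<in> p3 ` J4 \<longleftrightarrow> p \<in> J4"
  using V.pull_image[OF J3_J4 J4_Fr subspace_asub[OF J4_subspace]] by (auto simp: V.pull_def)

lemma J4_graded: "graded_submodule N \<chi> \<Lambda> (p3 ` J4)"
proof -
  have s: "submodule (p3 ` J4) UU VV" by (rule submodule_image[OF verma_gmodule J4_left_sub])
  define D where "D = {p \<in> Fr. p3 p \<in> p3 ` J4 \<and> (\<exists>\<alpha>\<in>ZPi N. p3 p \<in> p3 ` Hs (gens N) \<alpha>)}"
  have "fa.span D = J4"
  proof
    show "fa.span D \<subseteq> J4" by (rule fa.span_minimal[OF _ J4_subspace]) (use pull_J4 in \<open>auto simp: D_def\<close>)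
    show "J4 \<subseteq> fa.span D"
    proof
      fix p assume p: "p \<in> J4"
      then have F: "p \<in> Fr" using J4_Fr by blast
      have "comp \<beta> p \<in> D" if "\<beta> \<in> wdeg ` Poly_Mapping.keys p" for \<beta>
      proof -
        have "Poly_Mapping.keys p \<subseteq> lists (gens N)" using F by (simp add: Wd_def)
        then have Z: "\<beta> \<in> ZPi N" using that wdeg_ZPi by blast
        have "comp \<beta> p \<in> Hs (gens N) \<beta>" by (rule comp_in_Hs[OF F])
        moreover have "comp \<beta> p \<in> J4" by (rule comp_J4[OF p])
        ultimately show ?thesis using Z J4_Fr unfolding D_def by blast
      qed
      then have "(\<Sum>\<beta>\<in>wdeg ` Poly_Mapping.keys p. comp \<beta> p) \<in> fa.span D"
        by (intro fa.span_sum fa.span_base)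
      then show "p \<in> fa.span D" by (simp add: comp_sum)
    qed
  qed
  then show ?thesis unfolding graded_submodule_def graded_pull[OF s] D_def using s by simp
qed

lemma F_words_deg_0: "w \<in> lists GFs \<Longrightarrow> wdeg w = 0 \<Longrightarrow> w = []"
proof (cases w)
  case (Cons g v)
  assume w: "w \<in> lists GFs" "wdeg w = 0"
  then obtain j where "g = GF j" using Cons by auto
  then show ?thesis using wdeg_F_words[OF w(1), of j] w(2) Cons by simp
qed simp

lemma Hs_F_0: "f \<in> Hs GFs 0 \<Longrightarrow> \<exists>c. f = scp c 1"
proof (induction f rule: Hs_induct)
  case zero
  show ?case by (rule exI[of _ 0]) simp
next
  case (step d w p)
  obtain c where c: "p = scp c 1" using step(4) by blast
  have "w = []" by (rule F_words_deg_0[OF step(1,2)])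
  then have "scp d (mon w) + p = scp (d + c) 1" by (simp add: c mon_Nil fa.scale_left_distrib)
  then show ?case ..
qed

text \<open>A proper graded submodule contains no vector with a nonzero vacuum coefficient. Being
  stable under E-words, it then consists of vectors all of whose coefficients vanish on the side of
  \<open>Lspan\<close>.\<close>

lemma max_graded_upper:
  assumes g: "graded_submodule N \<chi> \<Lambda> H" and ne: "H \<noteq> carrier VV"
  shows "H \<subseteq> p3 ` J4"
proof -
  have s: "submodule H UU VV" and gr: "H = lin_span (scalars UU VV) (\<Union>\<alpha>\<in>ZPi N. H \<inter> verma_deg N \<chi> \<Lambda> \<alpha>)"
    using g unfolding graded_submodule_def by blast+
  define D where "D = {p \<in> Fr. p3 p \<in> H \<and> (\<exists>\<alpha>\<in>ZPi N. p3 p \<in> p3 ` Hs (gens N) \<alpha>)}"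
  have HD: "H = p3 ` fa.span D" unfolding D_def using gr graded_pull[OF s] by metis
  note pl = submodule_pull[OF verma_gmodule s]
  note PS = left_subD(1)[OF pl(1)]
  have DF: "fa.span D \<subseteq> Fr" by (rule fa.span_minimal[OF _ Wd_subspace]) (auto simp: D_def)
  have J3_coef: "coef (act p vac) [] = coef (act p' vac) []" if "p - p' \<in> J3" for p p'
    using that J3_J4 act_diff[of p p' vac] unfolding J4_def by auto
  \<comment> \<open>A homogeneous element with nonzero vacuum coefficient has degree 0, hence is a
    nonzero multiple of the generator modulo J3, and the submodule would be everything.\<close>
  have D0: "coef (act p vac) [] = 0" if p: "p \<in> D" for p
  proof (rule ccontr)
    assume nz: "coef (act p vac) [] \<noteq> 0"
    obtain \<alpha> h where h: "h \<in> Hs (gens N) \<alpha>" "p3 p = p3 h" and pF: "p \<in> Fr" and pH: "p3 p \<in> H"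
      using p unfolding D_def by blast
    obtain f where f: "f \<in> Hs GFs \<alpha>" "h - f \<in> J3" using Hs_mod[OF h(1)] by blast
    have F: "h \<in> Fr" "f \<in> Fr" using h(1) f(1) Hs_Wd Hs_GF_Fr by blast+
    have eq: "p3 h = p3 f" "p - h \<in> J3" using V.eq[OF F] f(2) V.eq[OF pF F(1)] h(2) by blast+
    have nzf: "coef (act f vac) [] \<noteq> 0" using nz J3_coef[OF eq(2)] J3_coef[OF f(2)] by simp
    have "\<alpha> = 0" using F_coef[OF _ f(1)] nzf by blast
    then obtain c where c: "f = scp c 1" using Hs_F_0 f(1) by blast
    have "c \<noteq> 0" using nzf c by auto
    have "f \<in> V.pull H" using pH h(2) eq(1) F(2) by (simp add: V.pull_def)
    then have "scp (inverse c) f \<in> V.pull H" by (rule fa.subspace_scale[OF PS])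
    then have one: "1 \<in> V.pull H" using \<open>c \<noteq> 0\<close> by (simp add: c)
    have "Fr \<subseteq> V.pull H" using left_subD(3)[OF pl(1) _ one] by (auto simp: mult_1_right)
    then have "carrier VV \<subseteq> H" unfolding V.carr using pl(3) by blast
    moreover have "H \<subseteq> carrier VV" unfolding V.carr using HD DF by blast
    ultimately show False using ne by blast
  qed
  have span0: "coef (act p vac) [] = 0" if "p \<in> fa.span D" for p
    using that by (induction rule: fa.span_induct_alt) (simp_all add: act_add act_scp D0)
  have pull0: "coef (act p vac) [] = 0" if p: "p \<in> V.pull H" for p
  proof -
    have pF: "p \<in> Fr" and "p3 p \<in> p3 ` fa.span D" using p HD by (auto simp: V.pull_def)
    then obtain s where s: "s \<in> fa.span D" "p3 p = p3 s" by blast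
    have "p - s \<in> J3" using V.eq[OF pF subsetD[OF DF s(1)]] s(2) by blast
    then show ?thesis using J3_coef span0[OF s(1)] by metis
  qed
  \<comment> \<open>The left ideal contains \<open>ew u * p\<close> together with p, so all
    coefficients of p applied to \<open>vac\<close> vanish.\<close>
  have "V.pull H \<subseteq> J4"
  proof
    fix p assume p: "p \<in> V.pull H"
    then have "p \<in> Fr" by (simp add: V.pull_def)
    moreover have "coef (act (ew u * p) vac) [] = 0" if "u \<in> lists {1..N}" for u
      by (rule pull0[OF left_subD(3)[OF pl(1) ew_Fr[OF that] p]])
    ultimately show "p \<in> J4" using notin_J4 by blast
  qed
  then show ?thesis using pl(3) by blast
qed

lemma max_graded_eq: "max_graded_submodule N \<chi> \<Lambda> = p3 ` J4"
  unfolding max_graded_submodule_def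
proof (rule Greatest_equality)
  have "p3 1 \<notin> p3 ` J4" using pull_J4[OF Wd_one] one_J4 by blast
  moreover have "p3 1 \<in> carrier VV" unfolding V.carr by (rule imageI[OF Wd_one])
  ultimately show "graded_submodule N \<chi> \<Lambda> (p3 ` J4) \<and> p3 ` J4 \<noteq> carrier VV" using J4_graded by blast
qed (use max_graded_upper in blast)

lemma simple_gmodule: "gmodule (simple_module N \<chi> \<Lambda>) (\<lambda>p. p3 ` J4 +>\<^bsub>VV\<^esub> p3 p) J4"
  using quot_gmodule[OF verma_gmodule J4_left_sub J3_J4] unfolding simple_module_def max_graded_eq .

lemma Lspan_act: "S.Lspan N = (\<lambda>p. act p vac) ` Fr"
proof
  show "(\<lambda>p. act p vac) ` Fr \<subseteq> S.Lspan N" using act_Lspan[OF _ vac_Lspan] by blast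
  show "S.Lspan N \<subseteq> (\<lambda>p. act p vac) ` Fr"
    unfolding S.Lspan_def
  proof (rule vec.span_minimal)
    show "vec.subspace ((\<lambda>p. act p vac) ` Fr)"
    proof (rule vec.subspaceI)
      show "0 \<in> (\<lambda>p. act p vac) ` Fr" by (rule image_eqI[of _ _ 0]) (simp_all add: Wd_closed)
      fix x assume "x \<in> (\<lambda>p. act p vac) ` Fr"
      then obtain p where p: "p \<in> Fr" "x = act p vac" by blast
      show "scl c x \<in> (\<lambda>p. act p vac) ` Fr" for c
        by (rule image_eqI[of _ _ "scp c p"]) (simp_all add: p act_scp Wd_closed)
      fix y assume "y \<in> (\<lambda>p. act p vac) ` Fr"
      then obtain p' where p': "p' \<in> Fr" "y = act p' vac" by blast
      show "x + y \<in> (\<lambda>p. act p vac) ` Fr"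
        by (rule image_eqI[of _ _ "p + p'"]) (simp_all add: p p' act_add Wd_closed)
    qed
    show "(\<lambda>w. S.Fword w vac) ` lists {1..N} \<subseteq> (\<lambda>p. act p vac) ` Fr"
    proof (rule image_subsetI)
      fix w assume w: "w \<in> lists {1..N}"
      have "foldr gact (map GF w) f = S.Fword w f" for f by (induction w) simp_all
      moreover have "mon (map GF w) \<in> Fr" by (rule words_Fr(3)) (use w in auto)
      ultimately show "S.Fword w vac \<in> (\<lambda>p. act p vac) ` Fr"
        by (intro image_eqI[of _ _ "mon (map GF w)"]) (simp_all add: act_mon)
    qed
  qed
qed

section \<open>Finite dimension of the simple module, and the theorem\<close>

lemma fin_dim_iff:
  assumes g: "gmodule M \<pi> J4"
  shows "fin_dim (scalars UU M) \<longleftrightarrow> S.fin_dim_Lspan"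
proof -
  interpret M: presentation M \<pi> Fr J4 by (rule gmodule_pres[OF g])
  have carr: "carrier (scalars UU M) = \<pi> ` Fr" by (simp add: scalars_def M.carr)
  have sp: "lin_span (scalars UU M) (\<pi> ` C) = \<pi> ` fa.span (M.pull (\<pi> ` C))" if "C \<subseteq> Fr" for C
    by (rule scalars_lin_span[OF g]) (use that M.carr in blast)
  \<comment> \<open>The isomorphism of M with \<open>Lspan\<close>, stated on representatives.
    Finite spanning sets are carried across it in both directions.\<close>
  have eq: "act p vac = act p' vac \<longleftrightarrow> \<pi> p = \<pi> p'" if "p \<in> Fr" "p' \<in> Fr" for p p'
    using M.eq[OF that] that by (simp add: J4_def act_diff Wd_closed)
  show ?thesis
  proof
    assume "fin_dim (scalars UU M)"
    then obtain B where B: "finite B" "B \<subseteq> \<pi> ` Fr" "lin_span (scalars UU M) B = \<pi> ` Fr"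
      unfolding fin_dim_def carr by blast
    obtain C where C: "C \<subseteq> Fr" "finite C" "B = \<pi> ` C" using finite_subset_image[OF B(1,2)] by blast
    define A where "A = (\<lambda>p. act p vac) ` C"
    have "S.Lspan N \<subseteq> vec.span A"
      unfolding Lspan_act
    proof (rule image_subsetI)
      fix p assume p: "p \<in> Fr"
      then have "\<pi> p \<in> \<pi> ` fa.span (M.pull (\<pi> ` C))" using B(3) unfolding C(3) sp[OF C(1)] by blast
      then obtain s where s: "s \<in> fa.span (M.pull (\<pi> ` C))" "\<pi> p = \<pi> s" by blast
      have "s \<in> Fr \<and> act s vac \<in> vec.span A"
        using s(1)
      proof (induction rule: fa.span_induct_alt)
        case base
        then show ?case by (simp add: Wd_closed vec.span_zero)
      next
        case (step c x y)
        then obtain d where d: "x \<in> Fr" "d \<in> C" "\<pi> x = \<pi> d" by (auto simp: M.pull_def)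
        then have "act x vac = act d vac" using eq C(1) by blast
        then have "act x vac \<in> vec.span A" using d(2) unfolding A_def by (intro vec.span_base) blast
        then show ?case using step(2) d(1)
          by (simp add: act_add act_scp Wd_closed vec.span_add vec.span_scale)
      qed
      then show "act p vac \<in> vec.span A" using eq[OF p] s(2) by metis
    qed
    moreover have "finite A" "A \<subseteq> S.Lspan N" unfolding A_def Lspan_act using C by blast+
    ultimately show S.fin_dim_Lspan unfolding S.fin_dim_Lspan_def by blast
  next
    assume S.fin_dim_Lspan
    then obtain B where B: "finite B" "B \<subseteq> (\<lambda>p. act p vac) ` Fr" "S.Lspan N \<subseteq> vec.span B"
      unfolding S.fin_dim_Lspan_def Lspan_act by blast
    obtain C where C: "C \<subseteq> Fr" "finite C" "B = (\<lambda>p. act p vac) ` C" using finite_subset_image[OF B(1,2)] by blast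
    have CF: "fa.span C \<subseteq> Fr" by (rule fa.span_minimal[OF C(1) Wd_subspace])
    have lift: "\<exists>s\<in>fa.span C. act s vac = f" if "f \<in> vec.span B" for f
      using that unfolding C(3)
    proof (induction rule: vec.span_induct_alt)
      case base
      show ?case by (intro bexI[of _ 0]) (simp_all add: fa.span_zero)
    next
      case (step c x y)
      then obtain d s where d: "d \<in> C" "x = act d vac" "s \<in> fa.span C" "act s vac = y" by blast
      then show ?case
        by (intro bexI[of _ "scp c d + s"]) (simp_all add: act_add act_scp fa.span_add fa.span_scale fa.span_base)
    qed
    have "\<pi> ` Fr \<subseteq> \<pi> ` fa.span (M.pull (\<pi> ` C))"
    proof (rule image_subsetI)
      fix p assume p: "p \<in> Fr"
      then have "act p vac \<in> vec.span B" using B(3) Lspan_act by blast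
      then obtain s where s: "s \<in> fa.span C" "act s vac = act p vac" using lift by blast
      have "\<pi> p = \<pi> s" using eq[OF subsetD[OF CF s(1)] p] s(2) by simp
      moreover have "s \<in> fa.span (M.pull (\<pi> ` C))"
        using s(1) fa.span_mono[of C "M.pull (\<pi> ` C)"] C(1) unfolding M.pull_def by blast
      ultimately show "\<pi> p \<in> \<pi> ` fa.span (M.pull (\<pi> ` C))" by blast
    qed
    moreover have "fa.span (M.pull (\<pi> ` C)) \<subseteq> Fr"
      by (rule fa.span_minimal[OF _ Wd_subspace]) (auto simp: M.pull_def)
    ultimately have "lin_span (scalars UU M) (\<pi> ` C) = \<pi> ` Fr" unfolding sp[OF C(1)] by blast
    then show "fin_dim (scalars UU M)" unfolding fin_dim_def carr using C(1,2) by blast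
  qed
qed

lemma simple_fin_dim_iff: "simple_fin_dim N \<chi> \<Lambda> \<longleftrightarrow> S.fin_dim_Lspan"
  unfolding simple_fin_dim_def by (rule fin_dim_iff[OF simple_gmodule])

lemma in_S_iff:
  assumes i: "i \<in> {1..N}"
  shows "in_S N \<chi> \<Lambda> i \<longleftrightarrow> (\<exists>r. km i = lm i * qm i i ^ r)"
proof -
  have Z: "al i \<in> ZPi N" "- al i \<in> ZPi N" by (intro ZPi_closed(3) al_ZPi i)+
  have "\<Lambda> (Kgen N \<chi> (al i) \<otimes>\<^bsub>UU\<^esub> Lgen N \<chi> (- al i)) = lam (kk (al i) * ll (- al i))"
    unfolding p2_gens p2_mult[OF letters_Fr(1)[OF Z(1)] letters_Fr(2)[OF Z(2)]] lam_def ..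
  also have "\<dots> = lK (al i) * lL (- al i)"
    unfolding lK_def lL_def by (rule lam_mult[OF KL_letters(1)[OF Z(1)] KL_letters(2)[OF Z(2)]])
  finally have L: "\<Lambda> (Kgen N \<chi> (al i) \<otimes>\<^bsub>UU\<^esub> Lgen N \<chi> (- al i)) = lK (al i) * lL (- al i)" .
  have n: "lL (al i) * lL (- al i) = 1" by (rule lL_neg[OF Z(1)])
  then have nz: "lL (al i) \<noteq> 0" by auto
  have inv: "lL (- al i) = inverse (lL (al i))" by (rule inverse_unique[OF n, symmetric])
  have m: "lm i = lL (al i)" unfolding lm_def using i by (simp only: if_True)
  have "(lK (al i) * inverse (lL (al i)) = x) = (lK (al i) = lL (al i) * x)" for x
    using nz by (auto simp: field_simps)
  then show ?thesis unfolding in_S_def L inv km_def m qm_in[OF i i] by simp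
qed

end

theorem theorem7p3:
  fixes N :: nat
    and \<chi> :: "lattice \<Rightarrow> lattice \<Rightarrow> 'k::field_char_0"
    and \<Lambda> :: "(gen list \<Rightarrow>\<^sub>0 'k) set set \<Rightarrow> 'k"
    and q :: "nat \<Rightarrow> nat \<Rightarrow> 'k"
  assumes "N \<ge> 1"
    and "bihom N \<chi>"
    and "\<Lambda> \<in> characters N \<chi>"
    and q_def: "\<And>i j. q i j = \<chi> (frag_of i) (frag_of j)"
  shows
    "(\<forall>m qh. N \<ge> 2 \<longrightarrow> m \<in> {1..N} \<longrightarrow> not_root_of_unity qh \<longrightarrow>
        (\<forall>i\<in>{1..N}. i < m \<longrightarrow> q i i = qh powi 2) \<longrightarrow>
        q m m = - 1 \<longrightarrow>
        (\<forall>i\<in>{1..N}. m < i \<longrightarrow> q i i = qh powi (- 2)) \<longrightarrow>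
        (\<forall>i\<in>{1..N-1}. q i (i+1) * q (i+1) i = (if i + 1 \<le> m then qh powi (- 2) else qh powi 2)) \<longrightarrow>
        (\<forall>i\<in>{1..N}. \<forall>j\<in>{1..N}. \<bar>int i - int j\<bar> \<ge> 2 \<longrightarrow> q i j * q j i = 1) \<longrightarrow>
        (simple_fin_dim N \<chi> \<Lambda> \<longleftrightarrow> (\<forall>i\<in>{1..N} - {m}. in_S N \<chi> \<Lambda> i)))
     \<and>
     (\<forall>qh. N \<ge> 3 \<longrightarrow> not_root_of_unity qh \<longrightarrow>
        q 1 1 = - 1 \<longrightarrow>
        (\<forall>i\<in>{2..N-1}. q i i = qh powi 2) \<longrightarrow>
        q N N = qh powi 4 \<longrightarrow>
        (\<forall>i\<in>{1..N-2}. q i (i+1) * q (i+1) i = qh powi (- 2)) \<longrightarrow>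
        q (N-1) N * q N (N-1) = qh powi (- 4) \<longrightarrow>
        (\<forall>i\<in>{1..N}. \<forall>j\<in>{1..N}. \<bar>int i - int j\<bar> \<ge> 2 \<longrightarrow> q i j * q j i = 1) \<longrightarrow>
        (simple_fin_dim N \<chi> \<Lambda> \<longleftrightarrow> (\<forall>i\<in>{1..N} - {1}. in_S N \<chi> \<Lambda> i)))"
proof -
  interpret gqg_char N \<chi> \<Lambda> by unfold_locales (use assms in blast)+
  have e: "qm i j = q i j" if "i \<in> {1..N}" "j \<in> {1..N}" for i j
    unfolding q_def by (rule qm_in[OF that])
  have S: "(\<forall>i\<in>{1..N} - {m}. in_S N \<chi> \<Lambda> i) \<longleftrightarrow> (\<forall>i\<in>{1..N} - {m}. \<exists>r. km i = lm i * qm i i ^ r)" for m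
    using in_S_iff by blast
  show ?thesis
  proof (intro conjI allI impI)
    fix m and qh :: 'k
    assume m: "m \<in> {1..N}" and qh: "not_root_of_unity qh"
      and d: "\<forall>i\<in>{1..N}. i < m \<longrightarrow> q i i = qh powi 2" "q m m = - 1"
        "\<forall>i\<in>{1..N}. m < i \<longrightarrow> q i i = qh powi (- 2)"
      and n: "\<forall>i\<in>{1..N-1}. q i (i+1) * q (i+1) i = (if i + 1 \<le> m then qh powi (- 2) else qh powi 2)"
      and f: "\<forall>i\<in>{1..N}. \<forall>j\<in>{1..N}. \<bar>int i - int j\<bar> \<ge> 2 \<longrightarrow> q i j * q j i = 1"
    show "simple_fin_dim N \<chi> \<Lambda> \<longleftrightarrow> (\<forall>i\<in>{1..N} - {m}. in_S N \<chi> \<Lambda> i)"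
      unfolding simple_fin_dim_iff S
    proof (rule S.type_A_iff[OF m qh])
      show "qm i i = qh powi 2" if "i \<in> {1..N}" "i < m" for i using d(1) that e[OF that(1,1)] by simp
      show "qm m m = - 1" using d(2) e[OF m m] by simp
      show "qm i i = qh powi (- 2)" if "i \<in> {1..N}" "m < i" for i using d(3) that e[OF that(1,1)] by simp
      show "qm i (i + 1) * qm (i + 1) i = (if i + 1 \<le> m then qh powi (- 2) else qh powi 2)" if "i \<in> {1..N-1}" for i
      proof -
        have "i \<in> {1..N}" "i + 1 \<in> {1..N}" using that by auto
        then show ?thesis using n that e by metis
      qed
      show "qm i j * qm j i = 1" if "i \<in> {1..N}" "j \<in> {1..N}" "\<bar>int i - int j\<bar> \<ge> 2" for i j
        using f that e[OF that(1,2)] e[OF that(2,1)] by simp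
    qed
  next
    fix qh :: 'k
    assume N: "N \<ge> 3" and qh: "not_root_of_unity qh"
      and d: "q 1 1 = - 1" "\<forall>i\<in>{2..N-1}. q i i = qh powi 2" "q N N = qh powi 4"
      and n: "\<forall>i\<in>{1..N-2}. q i (i+1) * q (i+1) i = qh powi (- 2)" "q (N-1) N * q N (N-1) = qh powi (- 4)"
      and f: "\<forall>i\<in>{1..N}. \<forall>j\<in>{1..N}. \<bar>int i - int j\<bar> \<ge> 2 \<longrightarrow> q i j * q j i = 1"
    have I: "1 \<in> {1..N}" "N \<in> {1..N}" "N - 1 \<in> {1..N}" using N by auto
    show "simple_fin_dim N \<chi> \<Lambda> \<longleftrightarrow> (\<forall>i\<in>{1..N} - {1}. in_S N \<chi> \<Lambda> i)"
      unfolding simple_fin_dim_iff S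
    proof (rule S.type_C_iff[OF N qh])
      show "qm 1 1 = - 1" unfolding e[OF I(1,1)] by (rule d(1))
      show "qm N N = qh powi 4" unfolding e[OF I(2,2)] by (rule d(3))
      show "qm (N - 1) N * qm N (N - 1) = qh powi (- 4)" unfolding e[OF I(3,2)] e[OF I(2,3)] by (rule n(2))
      show "qm i i = qh powi 2" if "i \<in> {2..N-1}" for i
      proof -
        have "i \<in> {1..N}" using that by auto
        then show ?thesis using d(2) that e by metis
      qed
      show "qm i (i + 1) * qm (i + 1) i = qh powi (- 2)" if "i \<in> {1..N-2}" for i
      proof -
        have "i \<in> {1..N}" "i + 1 \<in> {1..N}" using that N by auto
        then show ?thesis using n(1) that e by metis
      qed
      show "qm i j * qm j i = 1" if "i \<in> {1..N}" "j \<in> {1..N}" "\<bar>int i - int j\<bar> \<ge> 2" for i j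
        using f that e[OF that(1,2)] e[OF that(2,1)] by simp
    qed
  qed
qed

end
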